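(* Let $\Omega\subset\mathbb{R}^2$ be an open bounded convex polygonal set with Lipschitz boundary, and let $\mathcal{V}=(\mathcal{M},\mathcal{E})$ be an admissible finite-volume Voronoi tessellation of $\Omega$ satisfying the boundary property (boundary) and the regularity property (reg) with parameter $\Theta_{\mathcal{V}}\in(0,1]$, both defined in the context. Let $T>0$, $\gamma>0$, and let $V\in\mathcal{C}^1([0,T],H^3(\Omega))$ be a real-valued potential such that $V$ is bounded from below and $\partial_t V$ is bounded from above. Let $u_0\in H^5\cap H^1_0(\Omega)$, and assume that there exists a unique solution $u\in\mathcal{C}([0,T];H^5\cap H^1_0(\Omega))$ of the Gross-Pitaevskii equation $$ i\partial_t u+\Delta u=\gamma|u|^2u+V(t,x)u\quad\text{in }(0,T)\times\Omega,\qquad u(t,x)=0\ \text{ for }(t,x)\in[0,T]\times\partial\Omega,\qquad u(0)=u_0 .$$ Let $u_{\mathcal{M}}=(u_K)_{K\in\mathcal{M}}:[0,T]\to X_{\mathcal{V},0}$ be the unique solution of the semi-discrete system $$ i u_{\mathcal{M}}'+A_{\mathcal{V}}u_{\mathcal{M}}=\gamma|u_{\mathcal{M}}|^2u_{\mathcal{M}}+(P_{\mathcal{M}}V)u_{\mathcal{M}},\qquad u_{\mathcal{M}}(0)=P_{\mathcal{M}}u_0 ,$$ where products are taken cellwise. Then for any $\varepsilon>0$, $$ \sup_{t\in[0,T]}\|P_{\mathcal{M}}u(t)-u_{\mathcal{M}}(t)\|_{0,2}\le C\,h_{\mathcal{M}}^{\frac12-\varepsilon}, $$ where $C=C\big(T,\Omega,\|u\|_{L^\infty_TH^5(\Omega)},\|V\|_{L^\infty_TH^3(\Omega)},\Theta_{\mathcal{V}},\varepsilon\big)>0$;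 in particular $C$ depends on the mesh only through $\Theta_{\mathcal{V}}$.
   Context: The coupling $\gamma$ and the potential $V$ are fixed data of the equation. $\|f\|_{L^\infty_TH^s(\Omega)}=\sup_{t\in[0,T]}\|f(t)\|_{H^s(\Omega)}$. Mesh. An admissible finite-volume discretization $\mathcal{V}=(\mathcal{M},\mathcal{E})$ of $\Omega$ consists of a finite family $\mathcal{M}$ of open convex polygonal subsets $K\subset\Omega$ (control volumes), pairwise disjoint, with $\overline\Omega=\bigcup_{K\in\mathcal{M}}\overline K$, and of the set $\mathcal{E}$ of edges $\sigma$ partitioning the skeleton $\bigcup_K\partial K$. For $K\ne L$, either $\overline K\cap\overline L$ has zero 1-dimensional Lebesgue measure or it is an edge of the mesh, denoted $\sigma=K|L$. To each $K$ is associated a center $x_K\in\overline K$ such that, for neighbours $K,L$, the line through $x_K$ and $x_L$ is orthogonal to $\sigma=K|L$. $\mathcal{E}_{\mathrm{int}}$ is the set of edges not contained in $\partial\Omega$, $\mathcal{E}_{\mathrm{ext}}$ the set of edges contained in $\partial\Omega$, and $\mathcal{E}_K$ the set of edges of $K$. $\mathcal{M}_{\mathrm{int}}$ is the set of $K$ having no edge contained in $\partial\Omega$, and $\mathcal{M}_{\mathrm{ext}}=\mathcal{M}\setminus\mathcal{M}_{\mathrm{int}}$. $|K|$ is the area of $K$, $|\sigma|$ the length of $\sigma$, $h_K=\mathrm{diam}(K)$, $h_{\mathcal{M}}=\sup_Kh_K$, $d_{K|L}=|x_K-x_L|$, and $d_{K,\sigma}$ is the distance from $x_K$ to $\sigma$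 measured orthogonally to $\sigma$. The discretization is a Voronoi tessellation if $K=\{x\in\Omega:|x-x_K|<|x-x_L|\text{ for all centers }x_L\ne x_K\}$ for every $K\in\mathcal{M}$. (boundary): if $\mathcal{E}_K\cap\mathcal{E}_{\mathrm{ext}}\neq\emptyset$ then $x_K\in\partial\Omega$. Dual triangulation. Connecting the centers of neighbouring cells gives the dual Delaunay triangulation $\mathcal{T}$, a conforming triangulation of $\Omega$ with acute triangles and $\overline\Omega=\bigcup_{T\in\mathcal{T}}\overline T$. For $T\in\mathcal{T}$, $x_T$ is its circumcenter; for $\sigma=K|L$, $x_\sigma$ is the midpoint of $[x_K,x_L]$. If $\sigma=K|L$ and $[x_K,x_L]$ is shared by triangles $T,T'$, then $\overline\sigma=[x_T,x_{T'}]=\overline{\sigma^T}\cup\overline{\sigma^{T'}}$ with $\sigma^T=(x_T,x_\sigma)$, $\sigma^{T'}=(x_{T'},x_\sigma)$; if $[x_K,x_L]\subset\partial\Omega$, only one triangle $T$ is involved and $\sigma=\sigma^T$. (reg): there is $0<\Theta_{\mathcal{V}}\le1$ independent of $h_{\mathcal{M}}$ such that, for all $K\in\mathcal{M}$ and $\sigma\in\mathcal{E}_K\cap\mathcal{E}_{\mathrm{int}}$, $\Theta_{\mathcal{V}}h_K\le d_{K,\sigma}\le h_K$ and $\Theta_{\mathcal{V}}h_K\le|\overline{\sigma^T}|\le h_K$, $\Theta_{\mathcal{V}}h_K\le|\overline{\sigma^{T'}}|\le h_K$ (each condition imposed when the corresponding piece exists). Discrete objects. $X_{\mathcal{V},0}$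 is the set of functions $v_{\mathcal{M}}=(v_K)_{K\in\mathcal{M}}:\Omega\to\mathbb{C}$ constant equal to $v_K$ on each $K$, with $v_K=0$ for $K\in\mathcal{M}_{\mathrm{ext}}$ (homogeneous Dirichlet condition). $\|v_{\mathcal{M}}\|_{0,2}^2=\sum_{K\in\mathcal{M}}|K||v_K|^2$. For $f$ continuous on $\overline\Omega$, $P_{\mathcal{M}}f$ is the piecewise constant function with $P_{\mathcal{M}}f|_K=f(x_K)$ for all $K\in\mathcal{M}$; $(P_{\mathcal{M}}V)(t)|_K=V(t,x_K)$. The discrete Laplacian is $(A_{\mathcal{V}}v_{\mathcal{M}})|_K=\frac1{|K|}\sum_{\sigma=K|L\in\mathcal{E}_K}\frac{|\sigma|}{d_{K|L}}(v_L-v_K)$ if $K\in\mathcal{M}_{\mathrm{int}}$, and $0$ if $K\in\mathcal{M}_{\mathrm{ext}}$. *)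

theory Defs
  imports "HOL-Analysis.Analysis"
begin

type_synonym plane = "real^2"


section \<open>Sobolev spaces on a planar domain\<close>

definition partial_derivative ::
    "2 \<Rightarrow> (plane \<Rightarrow> 'a::real_normed_vector) \<Rightarrow> plane \<Rightarrow> 'a" where
  "partial_derivative i f x = frechet_derivative f (at x) (axis i 1)"

fun iterated_partial ::
    "2 list \<Rightarrow> (plane \<Rightarrow> 'a::real_normed_vector) \<Rightarrow> plane \<Rightarrow> 'a" where
  "iterated_partial [] f = f"
| "iterated_partial (i # is) f = partial_derivative i (iterated_partial is f)"

definition smooth :: "(plane \<Rightarrow> 'a::real_normed_vector) \<Rightarrow> bool" where
  "smooth f \<longleftrightarrow> (\<forall>is x. iterated_partial is f differentiable (at x))"

definition test_function :: "plane set \<Rightarrow> (plane \<Rightarrow> 'a::real_normed_vector) \<Rightarrow> bool" where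
  "test_function \<Omega> \<phi> \<longleftrightarrow>
     smooth \<phi> \<and> compact (closure {x. \<phi> x \<noteq> 0}) \<and> closure {x. \<phi> x \<noteq> 0} \<subseteq> \<Omega>"

definition locally_integrable :: "plane set \<Rightarrow> (plane \<Rightarrow> 'a::euclidean_space) \<Rightarrow> bool" where
  "locally_integrable \<Omega> f \<longleftrightarrow> (\<forall>K. compact K \<and> K \<subseteq> \<Omega> \<longrightarrow> set_integrable lebesgue K f)"

definition square_integrable :: "plane set \<Rightarrow> (plane \<Rightarrow> 'a::euclidean_space) \<Rightarrow> bool" where
  "square_integrable \<Omega> f \<longleftrightarrow>
     set_borel_measurable lebesgue \<Omega> f \<and> set_integrable lebesgue \<Omega> (\<lambda>x. (norm (f x))\<^sup>2)"

text \<open>A multi-index is a pair \<open>(a, b)\<close>, standing for \<open>a\<close> derivatives in the first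
  and \<open>b\<close> derivatives in the second coordinate direction.\<close>

definition has_weak_derivative ::
    "plane set \<Rightarrow> nat \<times> nat \<Rightarrow> (plane \<Rightarrow> 'a::euclidean_space) \<Rightarrow> (plane \<Rightarrow> 'a) \<Rightarrow> bool" where
  "has_weak_derivative \<Omega> \<alpha> f g \<longleftrightarrow>
     locally_integrable \<Omega> f \<and> locally_integrable \<Omega> g \<and>
     (\<forall>\<phi> :: plane \<Rightarrow> real. test_function \<Omega> \<phi> \<longrightarrow>
        (LINT x:\<Omega>|lebesgue.
           iterated_partial (replicate (fst \<alpha>) 1 @ replicate (snd \<alpha>) 2) \<phi> x *\<^sub>R f x) =
        (-1) ^ (fst \<alpha> + snd \<alpha>) *\<^sub>R (LINT x:\<Omega>|lebesgue. \<phi> x *\<^sub>R g x))"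

text \<open>Weak derivatives are unique up to null sets, so the choice below does not affect
  the norms.\<close>

definition weak_derivative ::
    "plane set \<Rightarrow> nat \<times> nat \<Rightarrow> (plane \<Rightarrow> 'a::euclidean_space) \<Rightarrow> plane \<Rightarrow> 'a" where
  "weak_derivative \<Omega> \<alpha> f = (SOME g. has_weak_derivative \<Omega> \<alpha> f g)"

definition sobolev :: "nat \<Rightarrow> plane set \<Rightarrow> (plane \<Rightarrow> 'a::euclidean_space) set" where
  "sobolev m \<Omega> =
     {f. \<forall>\<alpha>. fst \<alpha> + snd \<alpha> \<le> m \<longrightarrow>
           (\<exists>g. has_weak_derivative \<Omega> \<alpha> f g \<and> square_integrable \<Omega> g)}"

definition sobolev_norm :: "nat \<Rightarrow> plane set \<Rightarrow> (plane \<Rightarrow> 'a::euclidean_space) \<Rightarrow> real" where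
  "sobolev_norm m \<Omega> f =
     sqrt (\<Sum>\<alpha> | fst \<alpha> + snd \<alpha> \<le> m. LINT x:\<Omega>|lebesgue. (norm (weak_derivative \<Omega> \<alpha> f x))\<^sup>2)"

definition sobolev_H10 :: "plane set \<Rightarrow> (plane \<Rightarrow> 'a::euclidean_space) set" where
  "sobolev_H10 \<Omega> =
     {f \<in> sobolev 1 \<Omega>.
        \<forall>e>0. \<exists>\<phi>. test_function \<Omega> \<phi> \<and> sobolev_norm 1 \<Omega> (\<lambda>x. f x - \<phi> x) < e}"

definition sobolev_continuous ::
    "nat \<Rightarrow> plane set \<Rightarrow> real \<Rightarrow> (real \<Rightarrow> plane \<Rightarrow> 'a::euclidean_space) \<Rightarrow> bool" where
  "sobolev_continuous m \<Omega> T f \<longleftrightarrow>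
     (\<forall>t\<in>{0..T}. f t \<in> sobolev m \<Omega> \<and>
        ((\<lambda>s. sobolev_norm m \<Omega> (\<lambda>x. f s x - f t x)) \<longlongrightarrow> 0) (at t within {0..T}))"

definition sobolev_sup_norm ::
    "nat \<Rightarrow> plane set \<Rightarrow> real \<Rightarrow> (real \<Rightarrow> plane \<Rightarrow> 'a::euclidean_space) \<Rightarrow> real" where
  "sobolev_sup_norm m \<Omega> T f = (SUP t\<in>{0..T}. sobolev_norm m \<Omega> (f t))"

text \<open>For \<open>m = 0\<close> this is differentiability in \<open>L\<^sup>2(\<Omega>)\<close>.\<close>

definition has_sobolev_time_derivative ::
    "nat \<Rightarrow> plane set \<Rightarrow> real \<Rightarrow> (real \<Rightarrow> plane \<Rightarrow> 'a::euclidean_space) \<Rightarrow> real \<Rightarrow>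
       (plane \<Rightarrow> 'a) \<Rightarrow> bool" where
  "has_sobolev_time_derivative m \<Omega> T f t g \<longleftrightarrow>
     (\<forall>s\<in>{0..T}. f s \<in> sobolev m \<Omega>) \<and> g \<in> sobolev m \<Omega> \<and>
     ((\<lambda>s. sobolev_norm m \<Omega> (\<lambda>x. (f s x - f t x) /\<^sub>R (s - t) - g x)) \<longlongrightarrow> 0)
       (at t within {0..T})"


section \<open>The domain, the potential and the Gross--Pitaevskii equation\<close>

definition lipschitz_boundary :: "plane set \<Rightarrow> bool" where
  "lipschitz_boundary \<Omega> \<longleftrightarrow>
     (\<forall>p\<in>frontier \<Omega>. \<exists>r>0. \<exists>(Q :: plane \<Rightarrow> plane) (g :: real \<Rightarrow> real) L.
        orthogonal_transformation Q \<and> L-lipschitz_on UNIV g \<and>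
        (\<forall>x\<in>ball p r. x \<in> \<Omega> \<longleftrightarrow> g (Q (x - p) $ 1) < Q (x - p) $ 2))"

definition polygonal_domain :: "plane set \<Rightarrow> bool" where
  "polygonal_domain \<Omega> \<longleftrightarrow>
     \<Omega> \<noteq> {} \<and> open \<Omega> \<and> bounded \<Omega> \<and> convex \<Omega> \<and> polytope (closure \<Omega>) \<and> lipschitz_boundary \<Omega>"

text \<open>Elements of \<open>H\<^sup>m(\<Omega>)\<close>, \<open>m \<ge> 2\<close>, are evaluated at points of \<open>closure \<Omega>\<close>; we
  therefore work with their representatives that are continuous on \<open>closure \<Omega>\<close>.
  No such choice is needed for the time derivative \<open>Vt\<close>.\<close>

definition admissible_potential ::
    "plane set \<Rightarrow> real \<Rightarrow> (real \<Rightarrow> plane \<Rightarrow> real) \<Rightarrow> bool" where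
  "admissible_potential \<Omega> T V \<longleftrightarrow>
     sobolev_continuous 3 \<Omega> T V \<and>
     (\<forall>t\<in>{0..T}. continuous_on (closure \<Omega>) (V t)) \<and>
     (\<exists>m. \<forall>t\<in>{0..T}. \<forall>x\<in>\<Omega>. m \<le> V t x) \<and>
     (\<exists>Vt. sobolev_continuous 3 \<Omega> T Vt \<and>
        (\<forall>t\<in>{0..T}. has_sobolev_time_derivative 3 \<Omega> T V t (Vt t)) \<and>
        (\<exists>B. \<forall>t\<in>{0..T}. AE x in lebesgue. x \<in> \<Omega> \<longrightarrow> Vt t x \<le> B))"

text \<open>The equation holds almost everywhere in \<open>\<Omega>\<close> at every \<open>t \<in> (0,T)\<close>, with the time
  derivative taken in \<open>L\<^sup>2(\<Omega>)\<close> and the Laplacian as the sum of weak second derivatives.\<close>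

definition gp_solution ::
    "plane set \<Rightarrow> real \<Rightarrow> real \<Rightarrow> (real \<Rightarrow> plane \<Rightarrow> real) \<Rightarrow> (plane \<Rightarrow> complex) \<Rightarrow>
       (real \<Rightarrow> plane \<Rightarrow> complex) \<Rightarrow> bool" where
  "gp_solution \<Omega> T \<gamma> V u0 u \<longleftrightarrow>
     sobolev_continuous 5 \<Omega> T u \<and>
     (\<forall>t\<in>{0..T}. u t \<in> sobolev_H10 \<Omega> \<and> continuous_on (closure \<Omega>) (u t)) \<and>
     (\<forall>t\<in>{0<..<T}. \<exists>ut uxx uyy.
        has_sobolev_time_derivative 0 \<Omega> T u t ut \<and>
        has_weak_derivative \<Omega> (2, 0) (u t) uxx \<and>
        has_weak_derivative \<Omega> (0, 2) (u t) uyy \<and>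
        (AE x in lebesgue. x \<in> \<Omega> \<longrightarrow>
           \<i> * ut x + (uxx x + uyy x) =
             of_real (\<gamma> * (norm (u t x))\<^sup>2) * u t x + of_real (V t x) * u t x)) \<and>
     (\<forall>t\<in>{0..T}. \<forall>x\<in>frontier \<Omega>. u t x = 0) \<and>
     (\<forall>x\<in>closure \<Omega>. u 0 x = u0 x)"


section \<open>Finite-volume meshes\<close>

record mesh =
  cells :: "plane set set"
  edges :: "plane set set"
  center :: "plane set \<Rightarrow> plane"

definition interface :: "plane set \<Rightarrow> plane set \<Rightarrow> plane set" where
  "interface K L = closure K \<inter> closure L"

definition cell_edges :: "mesh \<Rightarrow> plane set \<Rightarrow> plane set set" where
  "cell_edges \<V> K = {\<sigma> \<in> edges \<V>. \<sigma> \<subseteq> frontier K}"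

definition ext_edges :: "plane set \<Rightarrow> mesh \<Rightarrow> plane set set" where
  "ext_edges \<Omega> \<V> = {\<sigma> \<in> edges \<V>. \<sigma> \<subseteq> frontier \<Omega>}"

definition int_edges :: "plane set \<Rightarrow> mesh \<Rightarrow> plane set set" where
  "int_edges \<Omega> \<V> = edges \<V> - ext_edges \<Omega> \<V>"

definition int_cells :: "plane set \<Rightarrow> mesh \<Rightarrow> plane set set" where
  "int_cells \<Omega> \<V> = {K \<in> cells \<V>. cell_edges \<V> K \<inter> ext_edges \<Omega> \<V> = {}}"

definition ext_cells :: "plane set \<Rightarrow> mesh \<Rightarrow> plane set set" where
  "ext_cells \<Omega> \<V> = cells \<V> - int_cells \<Omega> \<V>"

definition neighbours :: "mesh \<Rightarrow> plane set \<Rightarrow> plane set \<Rightarrow> bool" where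
  "neighbours \<V> K L \<longleftrightarrow>
     K \<in> cells \<V> \<and> L \<in> cells \<V> \<and> K \<noteq> L \<and> interface K L \<in> edges \<V>"

definition area :: "plane set \<Rightarrow> real" where
  "area K = measure lebesgue K"

text \<open>Only applied to convex subsets of a line (edges, and intersections of the closures of
  disjoint open convex cells), whose one-dimensional Lebesgue measure is their diameter.\<close>

definition edge_length :: "plane set \<Rightarrow> real" where
  "edge_length \<sigma> = diameter \<sigma>"

definition mesh_size :: "mesh \<Rightarrow> real" where
  "mesh_size \<V> = (SUP K\<in>cells \<V>. diameter K)"

text \<open>Edges are closed segments; two distinct edges may share end points, and they
  partition the skeleton up to these.\<close>

definition admissible_mesh :: "plane set \<Rightarrow> mesh \<Rightarrow> bool" where
  "admissible_mesh \<Omega> \<V> \<longleftrightarrow>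
     finite (cells \<V>) \<and>
     (\<forall>K\<in>cells \<V>. K \<noteq> {} \<and> open K \<and> convex K \<and> polytope (closure K) \<and> K \<subseteq> \<Omega>) \<and>
     (\<forall>K\<in>cells \<V>. \<forall>L\<in>cells \<V>. K \<noteq> L \<longrightarrow> K \<inter> L = {}) \<and>
     closure \<Omega> = (\<Union>K\<in>cells \<V>. closure K) \<and>
     finite (edges \<V>) \<and>
     (\<forall>\<sigma>\<in>edges \<V>. \<exists>a b. a \<noteq> b \<and> \<sigma> = closed_segment a b) \<and>
     (\<forall>\<sigma>\<in>edges \<V>. \<forall>\<tau>\<in>edges \<V>. \<sigma> \<noteq> \<tau> \<longrightarrow> rel_interior \<sigma> \<inter> rel_interior \<tau> = {}) \<and>
     \<Union>(edges \<V>) = (\<Union>K\<in>cells \<V>. frontier K) \<and>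
     (\<forall>K\<in>cells \<V>. frontier K = \<Union>(cell_edges \<V> K)) \<and>
     (\<forall>K\<in>cells \<V>. \<forall>L\<in>cells \<V>. K \<noteq> L \<longrightarrow>
        edge_length (interface K L) = 0 \<or> interface K L \<in> edges \<V>) \<and>
     (\<forall>K\<in>cells \<V>. center \<V> K \<in> closure K) \<and>
     (\<forall>K L. neighbours \<V> K L \<longrightarrow>
        center \<V> K \<noteq> center \<V> L \<and>
        (\<forall>p\<in>interface K L. \<forall>q\<in>interface K L. orthogonal (center \<V> L - center \<V> K) (q - p)))"

definition voronoi :: "plane set \<Rightarrow> mesh \<Rightarrow> bool" where
  "voronoi \<Omega> \<V> \<longleftrightarrow>
     (\<forall>K\<in>cells \<V>. K = {x \<in> \<Omega>. \<forall>L\<in>cells \<V>. center \<V> L \<noteq> center \<V> K \<longrightarrow>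
        dist x (center \<V> K) < dist x (center \<V> L)})"

definition boundary_property :: "plane set \<Rightarrow> mesh \<Rightarrow> bool" where
  "boundary_property \<Omega> \<V> \<longleftrightarrow>
     (\<forall>K\<in>cells \<V>. cell_edges \<V> K \<inter> ext_edges \<Omega> \<V> \<noteq> {} \<longrightarrow> center \<V> K \<in> frontier \<Omega>)"

text \<open>A triangle is represented by the set of its three vertices. The angle at \<open>a\<close> between
  \<open>b - a\<close> and \<open>c - a\<close> is acute iff their inner product is positive.\<close>

definition acute_triangle :: "plane set \<Rightarrow> bool" where
  "acute_triangle S \<longleftrightarrow>
     card S = 3 \<and> \<not> affine_dependent S \<and>
     (\<forall>a\<in>S. \<forall>b\<in>S - {a}. \<forall>c\<in>S - {a}. 0 < (b - a) \<bullet> (c - a))"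

definition circumcenter :: "plane set \<Rightarrow> plane" where
  "circumcenter S = (THE p. \<forall>v\<in>S. \<forall>w\<in>S. dist p v = dist p w)"

text \<open>A conforming acute triangulation of \<open>\<Omega>\<close> whose vertices are the centers and whose edges
  are the segments joining the centers of neighbouring cells. These conditions determine it.\<close>

definition dual_triangulation :: "plane set \<Rightarrow> mesh \<Rightarrow> plane set set \<Rightarrow> bool" where
  "dual_triangulation \<Omega> \<V> \<T> \<longleftrightarrow>
     (\<forall>S\<in>\<T>. acute_triangle S) \<and>
     \<Union>\<T> = center \<V> ` cells \<V> \<and>
     (\<forall>K\<in>cells \<V>. \<forall>L\<in>cells \<V>. K \<noteq> L \<longrightarrow>
        (neighbours \<V> K L \<longleftrightarrow> (\<exists>S\<in>\<T>. {center \<V> K, center \<V> L} \<subseteq> S))) \<and>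
     (\<forall>S\<in>\<T>. \<forall>S'\<in>\<T>. convex hull S \<inter> convex hull S' = convex hull (S \<inter> S')) \<and>
     closure \<Omega> = (\<Union>S\<in>\<T>. convex hull S)"

text \<open>The distance \<open>d\<^bsub>K,\<sigma>\<^esub>\<close> is measured to the line carrying \<open>\<sigma>\<close>. For \<open>\<sigma> = K|L\<close> and a
  triangle \<open>S\<close> having \<open>[x\<^sub>K, x\<^sub>L]\<close> as an edge, the piece \<open>\<sigma>\<^sup>S\<close> joins the circumcenter of \<open>S\<close>
  to the midpoint of \<open>[x\<^sub>K, x\<^sub>L]\<close>.\<close>

definition regular_mesh :: "plane set \<Rightarrow> mesh \<Rightarrow> plane set set \<Rightarrow> real \<Rightarrow> bool" where
  "regular_mesh \<Omega> \<V> \<T> \<Theta> \<longleftrightarrow>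
     0 < \<Theta> \<and> \<Theta> \<le> 1 \<and>
     (\<forall>K\<in>cells \<V>. \<forall>\<sigma>\<in>cell_edges \<V> K \<inter> int_edges \<Omega> \<V>.
        infdist (center \<V> K) (affine hull \<sigma>) \<in> {\<Theta> * diameter K .. diameter K} \<and>
        (\<forall>L S. neighbours \<V> K L \<and> \<sigma> = interface K L \<and> S \<in> \<T> \<and> {center \<V> K, center \<V> L} \<subseteq> S \<longrightarrow>
           dist (circumcenter S) (midpoint (center \<V> K) (center \<V> L))
             \<in> {\<Theta> * diameter K .. diameter K}))"


section \<open>The semi-discrete scheme\<close>

text \<open>A function that is constant on each cell is identified with the family of its values;
  only the values at the cells of the mesh matter.\<close>

definition discrete_space :: "plane set \<Rightarrow> mesh \<Rightarrow> (plane set \<Rightarrow> complex) set" where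
  "discrete_space \<Omega> \<V> = {v. \<forall>K\<in>ext_cells \<Omega> \<V>. v K = 0}"

definition discrete_norm :: "mesh \<Rightarrow> (plane set \<Rightarrow> complex) \<Rightarrow> real" where
  "discrete_norm \<V> v = sqrt (\<Sum>K\<in>cells \<V>. area K * (norm (v K))\<^sup>2)"

definition cell_projection :: "mesh \<Rightarrow> (plane \<Rightarrow> 'a) \<Rightarrow> plane set \<Rightarrow> 'a" where
  "cell_projection \<V> f K = f (center \<V> K)"

text \<open>The edges \<open>\<sigma> = K|L\<close> of \<open>K\<close> correspond bijectively to the neighbours \<open>L\<close>.\<close>

definition discrete_laplacian ::
    "plane set \<Rightarrow> mesh \<Rightarrow> (plane set \<Rightarrow> complex) \<Rightarrow> plane set \<Rightarrow> complex" where
  "discrete_laplacian \<Omega> \<V> v K =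
     (if K \<in> int_cells \<Omega> \<V>
      then (1 / area K) *\<^sub>R
        (\<Sum>L | neighbours \<V> K L.
           (edge_length (interface K L) / dist (center \<V> K) (center \<V> L)) *\<^sub>R (v L - v K))
      else 0)"

definition semidiscrete_solution ::
    "plane set \<Rightarrow> mesh \<Rightarrow> real \<Rightarrow> real \<Rightarrow> (real \<Rightarrow> plane \<Rightarrow> real) \<Rightarrow> (plane \<Rightarrow> complex) \<Rightarrow>
       (real \<Rightarrow> plane set \<Rightarrow> complex) \<Rightarrow> bool" where
  "semidiscrete_solution \<Omega> \<V> T \<gamma> V u0 w \<longleftrightarrow>
     (\<forall>t\<in>{0..T}. w t \<in> discrete_space \<Omega> \<V>) \<and>
     (\<forall>t\<in>{0..T}. \<forall>K\<in>cells \<V>. \<exists>w'.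
        ((\<lambda>s. w s K) has_vector_derivative w') (at t within {0..T}) \<and>
        \<i> * w' + discrete_laplacian \<Omega> \<V> (w t) K =
          of_real (\<gamma> * (norm (w t K))\<^sup>2) * w t K +
          of_real (cell_projection \<V> (V t) K) * w t K) \<and>
     (\<forall>K\<in>cells \<V>. w 0 K = cell_projection \<V> u0 K)"

end

theory Submission
  imports Defs "HOL-Computational_Algebra.Polynomial"
begin

text \<open>The error \<open>e = P u - u\<^sub>M\<close> satisfies a discrete Schroedinger equation whose source is the
  consistency error of the two-point flux. On a Voronoi mesh this flux is exact on affine functions;
  on quadratic polynomials it is exact up to an edge flux of size \<open>h\<close>, which is antisymmetric up
  to \<open>h\<^sup>2\<close> because second derivatives of \<open>u\<close> are Lipschitz. Tested with \<open>i e\<close>, the edge flux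
  pairs with the differences of \<open>e\<close> across the edges and therefore costs only \<open>h\<close> times the
  discrete \<open>H\<^sup>1\<close> seminorm of \<open>e\<close>, which is bounded by conservation of mass and an energy
  estimate for the scheme. The nonlinearity produces the cube of the discrete \<open>L\<^sup>3\<close> norm of \<open>e\<close>,
  absorbed by a discrete Gagliardo--Nirenberg inequality. Gronwall's lemma gives
  \<open>\<parallel>e\<parallel>\<^sup>2 \<le> C h\<close>, and \<open>h\<close> is at most the diameter of the domain. Since \<open>H\<^sup>5\<close> functions
  are only given by weak derivatives, \<open>u\<close> is replaced near the finitely many centers by a mollification,
  whose derivatives are bounded by a Sobolev inequality on parallelograms inside the domain.\<close>


section \<open>Smooth bump functions\<close>

text \<open>The midpoint of an edge need not lie on the segment joining the two centers. On
  shape-regular meshes the edge flux, summed over a cell and divided by its area, is therefore of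
  order one, and a cellwise truncation estimate gives no rate; antisymmetry is the only gain. Its
  price, the discrete gradient of e, cannot be absorbed, as a Schroedinger flow has no dissipation.
  The gradient is bounded but not small, so a source proportional to h acts on the squared norm, and
  this is the origin of the exponent 1/2. The test function i e is chosen because the real inner
  product then removes the discrete Laplacian of e and all real multiples of e, in particular the
  potential. The mesh is fixed before the mollification: its accuracy \<eta> may depend on all
  distances, areas and weights of the mesh and leaves no trace in the constants. Exterior centers
  lie on the boundary, where the mollified u is not controlled; there u is zero, and expansions are
  made at interior centers only.\<close>

definition deriv_seq :: "(nat \<Rightarrow> real \<Rightarrow> real) \<Rightarrow> bool" where
  "deriv_seq A \<longleftrightarrow> (\<forall>n x. (A n has_real_derivative A (Suc n) x) (at x))"

lemma deriv_seq_affine: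
  assumes "deriv_seq A"
  shows "deriv_seq (\<lambda>n x. c ^ n * A n (c * x + d))"
  unfolding deriv_seq_def
proof (intro allI)
  fix n x
  have "(A n has_real_derivative A (Suc n) (c * x + d)) (at (c * x + d))"
    using assms by (simp add: deriv_seq_def)
  moreover have "((\<lambda>x. c * x + d) has_real_derivative c) (at x)"
    by (auto intro!: derivative_eq_intros)
  ultimately have "((\<lambda>x. A n (c * x + d)) has_real_derivative A (Suc n) (c * x + d) * c) (at x)"
    by (rule DERIV_chain2)
  then show "((\<lambda>x. c ^ n * A n (c * x + d)) has_real_derivative
      c ^ Suc n * A (Suc n) (c * x + d)) (at x)"
    by (auto intro!: derivative_eq_intros simp: algebra_simps)
qed

text \<open>Leibniz' rule. Pascal's identity merges the two shifted sums that come from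
  differentiating the factors.\<close>

lemma deriv_seq_mult:
  assumes A: "deriv_seq A" and B: "deriv_seq B"
  shows "deriv_seq (\<lambda>n x. \<Sum>k\<le>n. real (n choose k) * (A k x * B (n - k) x))"
  unfolding deriv_seq_def
proof (intro allI)
  fix n x
  have dA: "(A k has_real_derivative A (Suc k) x) (at x)" for k
    using A by (simp add: deriv_seq_def)
  have dB: "(B k has_real_derivative B (Suc k) x) (at x)" for k
    using B by (simp add: deriv_seq_def)
  define X where "X i j = A i x * B j x" for i j
  have "((\<lambda>x. \<Sum>k\<le>n. real (n choose k) * (A k x * B (n - k) x)) has_real_derivative
      (\<Sum>k\<le>n. real (n choose k) * (A (Suc k) x * B (n - k) x + B (Suc (n - k)) x * A k x))) (at x)"
    by (intro DERIV_sum DERIV_cmult DERIV_mult dA dB)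
  also have "(\<Sum>k\<le>n. real (n choose k) * (A (Suc k) x * B (n - k) x + B (Suc (n - k)) x * A k x))
      = (\<Sum>k\<le>n. real (n choose k) * X (Suc k) (n - k)) + (\<Sum>k\<le>n. real (n choose k) * X k (Suc (n - k)))"
    by (simp add: X_def sum.distrib algebra_simps)
  also have "(\<Sum>k\<le>n. real (n choose k) * X k (Suc (n - k)))
      = (\<Sum>k\<le>Suc n. real (n choose k) * X k (Suc n - k))"
    by (simp add: Suc_diff_le)
  also have "(\<Sum>k\<le>Suc n. real (n choose k) * X k (Suc n - k))
     = X 0 (Suc n) + (\<Sum>k\<le>n. real (n choose Suc k) * X (Suc k) (n - k))"
    by (subst sum.atMost_Suc_shift) simp
  also have "(\<Sum>k\<le>n. real (n choose k) * X (Suc k) (n - k)) +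
      (X 0 (Suc n) + (\<Sum>k\<le>n. real (n choose Suc k) * X (Suc k) (n - k)))
      = X 0 (Suc n) + (\<Sum>k\<le>n. real (Suc n choose Suc k) * X (Suc k) (n - k))"
    by (simp add: sum.distrib[symmetric] algebra_simps)
  also have "\<dots> = (\<Sum>k\<le>Suc n. real (Suc n choose k) * X k (Suc n - k))"
    by (simp only: sum.atMost_Suc_shift) simp
  finally show "((\<lambda>x. \<Sum>k\<le>n. real (n choose k) * (A k x * B (n - k) x)) has_real_derivative
      (\<Sum>k\<le>Suc n. real (Suc n choose k) * (A k x * B (Suc n - k) x))) (at x)"
    by (simp add: X_def)
qed

text \<open>If \<open>s = 1 / t\<close>, then \<open>p(s) exp (- s)\<close> has the derivative \<open>s\<^sup>2 (p(s) - p'(s)) exp (- s)\<close>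
  with respect to \<open>t\<close>.\<close>

primrec flat_poly :: "nat \<Rightarrow> real poly" where
  "flat_poly 0 = 1"
| "flat_poly (Suc n) = [:0, 0, 1:] * (flat_poly n - pderiv (flat_poly n))"

definition flat_deriv :: "nat \<Rightarrow> real \<Rightarrow> real" where
  "flat_deriv n t = (if t \<le> 0 then 0 else poly (flat_poly n) (1 / t) * exp (- (1 / t)))"

definition flat :: "real \<Rightarrow> real" where
  "flat t = (if t \<le> 0 then 0 else exp (- (1 / t)))"

lemma flat_deriv_0: "flat_deriv 0 = flat"
  by (auto simp: flat_deriv_def flat_def)

text \<open>The fact behind the flatness at 0: with s = 1/t every derivative of exp (-1/t) has the
  form p(s) exp (-s).\<close>

lemma poly_exp_tendsto_0:
  fixes p :: "real poly"
  shows "((\<lambda>s. poly p s * exp (- s)) \<longlongrightarrow> 0) at_top"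
proof -
  have "((\<lambda>s. \<Sum>i\<le>degree p. coeff p i * (s ^ i / exp s)) \<longlongrightarrow> (\<Sum>i\<le>degree p. coeff p i * 0)) at_top"
    by (intro tendsto_sum tendsto_mult tendsto_const tendsto_power_div_exp_0)
  moreover have "(\<lambda>s. \<Sum>i\<le>degree p. coeff p i * (s ^ i / exp s)) = (\<lambda>s. poly p s * exp (- s))"
    by (auto simp: poly_altdef exp_minus sum_distrib_right sum_divide_distrib field_simps intro!: sum.cong)
  ultimately show ?thesis by simp
qed

lemma deriv_seq_flat: "deriv_seq flat_deriv"
  unfolding deriv_seq_def
proof (intro allI)
  fix n and x :: real
  consider "x < 0" | "x = 0" | "x > 0" by linarith
  then show "(flat_deriv n has_real_derivative flat_deriv (Suc n) x) (at x)"
  proof cases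
    case 1
    have ev: "eventually (\<lambda>t. t < 0) (nhds x)"
      using 1 by (rule order_tendstoD(2)[OF filterlim_ident])
    have "((\<lambda>t. 0) has_real_derivative 0) (at x)" by simp
    moreover have "eventually (\<lambda>t. flat_deriv n t = 0) (nhds x)"
      using ev by eventually_elim (simp add: flat_deriv_def)
    ultimately show ?thesis using 1
      by (subst DERIV_cong_ev[OF refl _ refl, where g = "\<lambda>t. 0"]) (auto simp: flat_deriv_def)
  next
    case 3
    have ev: "eventually (\<lambda>t. t > 0) (nhds x)"
      using 3 by (rule order_tendstoD(1)[OF filterlim_ident])
    have "((\<lambda>t. poly (flat_poly n) (1 / t) * exp (- (1 / t))) has_real_derivative
       flat_deriv (Suc n) x) (at x)"
      using 3 by (auto intro!: derivative_eq_intros DERIV_chain2[OF poly_DERIV]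
          simp: flat_deriv_def field_simps power2_eq_square)
    moreover have "eventually (\<lambda>t. flat_deriv n t = poly (flat_poly n) (1 / t) * exp (- (1 / t))) (nhds x)"
      using ev by eventually_elim (simp add: flat_deriv_def)
    ultimately show ?thesis
      by (subst DERIV_cong_ev[OF refl _ refl])
  next
    case 2
    \<comment> \<open>The right difference quotient at 0 contributes one more factor 1/h, hence the
      multiplication of the polynomial by its variable.\<close>
    have "((\<lambda>h. poly ([:0,1:] * flat_poly n) (inverse h) * exp (- inverse h)) \<longlongrightarrow> 0) (at_right 0)"
      by (rule filterlim_compose[OF poly_exp_tendsto_0 filterlim_inverse_at_top_right])
    then have r: "((\<lambda>h. (flat_deriv n (0 + h) - flat_deriv n 0) / h) \<longlongrightarrow> 0) (at_right 0)"
      by (rule Lim_transform_eventually)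
        (auto simp: eventually_at_filter flat_deriv_def field_simps)
    have "((\<lambda>h. 0) \<longlongrightarrow> (0::real)) (at_left 0)" by simp
    then have l: "((\<lambda>h. (flat_deriv n (0 + h) - flat_deriv n 0) / h) \<longlongrightarrow> 0) (at_left (0::real))"
      by (rule Lim_transform_eventually)
        (auto simp: eventually_at_filter flat_deriv_def)
    from l r have "((\<lambda>h. (flat_deriv n (0 + h) - flat_deriv n 0) / h) \<longlongrightarrow> 0) (at 0)"
      by (simp add: filterlim_at_split)
    then show ?thesis using 2 by (simp add: DERIV_def flat_deriv_def)
  qed
qed

lemma flat_bounds: "0 \<le> flat t" "flat t \<le> 1"
  by (auto simp: flat_def)

lemma flat_pos_iff: "0 < flat t \<longleftrightarrow> 0 < t"
  by (auto simp: flat_def)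

lemma flat_tendsto_1:
  assumes "t > 0"
  shows "(\<lambda>n. flat (real n * t)) \<longlonglongrightarrow> 1"
proof -
  have "(\<lambda>n. exp (- (inverse (real n) * inverse t))) \<longlonglongrightarrow> exp (- (0 * inverse t))"
    by (intro tendsto_intros lim_inverse_n)
  then have "(\<lambda>n. exp (- (inverse (real n) * inverse t))) \<longlonglongrightarrow> 1" by simp
  then show ?thesis
  proof (rule Lim_transform_eventually)
    show "eventually (\<lambda>n. exp (- (inverse (real n) * inverse t)) = flat (real n * t)) sequentially"
      using eventually_gt_at_top[of 0]
      by eventually_elim (use assms in \<open>auto simp: flat_def divide_simps mult_le_0_iff\<close>)
  qed
qed

text \<open>The factor c sets the steepness. As c grows, the bump tends pointwise to the indicator
  of the open interval, so integrals against bumps pass to integrals over intervals.\<close>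

definition bump :: "real \<Rightarrow> real \<Rightarrow> real \<Rightarrow> real \<Rightarrow> real" where
  "bump c a b t = flat (c * (t - a)) * flat (c * (b - t))"

lemma bump_deriv_seq: "\<exists>A. deriv_seq A \<and> A 0 = bump c a b"
proof -
  have 1: "deriv_seq (\<lambda>n x. c ^ n * flat_deriv n (c * x + (- c * a)))"
    by (rule deriv_seq_affine[OF deriv_seq_flat])
  have 2: "deriv_seq (\<lambda>n x. (- c) ^ n * flat_deriv n ((- c) * x + c * b))"
    by (rule deriv_seq_affine[OF deriv_seq_flat])
  show ?thesis
    by (rule exI, rule conjI, rule deriv_seq_mult[OF 1 2])
      (auto simp: bump_def fun_eq_iff flat_deriv_0 algebra_simps)
qed

lemma bump_bounds: "0 \<le> bump c a b t" "bump c a b t \<le> 1"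
  by (auto simp: bump_def flat_bounds intro!: mult_le_one)

lemma bump_pos_iff: "c > 0 \<Longrightarrow> 0 < bump c a b t \<longleftrightarrow> a < t \<and> t < b"
  using flat_bounds(1)[of "c * (t - a)"] flat_bounds(1)[of "c * (b - t)"]
  by (auto simp: bump_def flat_pos_iff zero_less_mult_iff)

lemma bump_eq_0: "c \<ge> 0 \<Longrightarrow> t \<le> a \<or> b \<le> t \<Longrightarrow> bump c a b t = 0"
  by (auto simp: bump_def flat_def mult_nonneg_nonpos zero_less_mult_iff)

lemma bump_tendsto: "(\<lambda>n. bump (real n) a b t) \<longlonglongrightarrow> indicator {a<..<b} t"
proof (cases "a < t \<and> t < b")
  case True
  then have "(\<lambda>n. flat (real n * (t - a)) * flat (real n * (b - t))) \<longlonglongrightarrow> 1 * 1"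
    by (intro tendsto_mult flat_tendsto_1) auto
  then show ?thesis using True by (simp add: bump_def)
next
  case False
  then show ?thesis by (auto simp: bump_eq_0 not_less)
qed

section \<open>Smooth functions of two variables, represented with all their partial
  derivatives\<close>

definition jet :: "(nat \<Rightarrow> nat \<Rightarrow> plane \<Rightarrow> real) \<Rightarrow> bool" where
  "jet \<Phi> \<longleftrightarrow> (\<forall>k l x. (\<Phi> k l has_derivative (\<lambda>h. h$1 * \<Phi> (Suc k) l x + h$2 * \<Phi> k (Suc l) x)) (at x))"

lemma jetD: "jet \<Phi> \<Longrightarrow> (\<Phi> k l has_derivative (\<lambda>h. h$1 * \<Phi> (Suc k) l x + h$2 * \<Phi> k (Suc l) x)) (at x)"
  by (simp add: jet_def)

lemma jet_continuous_on: "jet \<Phi> \<Longrightarrow> continuous_on S (\<Phi> k l)"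
  by (meson jetD has_derivative_continuous continuous_at_imp_continuous_on)

text \<open>A \<open>jet\<close> indexes derivatives by a pair of orders. Symmetry of mixed partials
  is thus built in, and an iterated partial depends only on how often each direction occurs in the
  list.\<close>

lemma iterated_partial_jet:
  assumes "jet \<Phi>"
  shows "iterated_partial is (\<Phi> k l) = \<Phi> (k + count_list is 1) (l + count_list is 2)"
proof (induction "is")
  case (Cons i js)
  have *: "frechet_derivative (\<Phi> k l) (at x) = (\<lambda>h. h$1 * \<Phi> (Suc k) l x + h$2 * \<Phi> k (Suc l) x)" for k l x
    by (rule frechet_derivative_at[symmetric, OF jetD[OF assms]])
  have "i = 1 \<or> i = 2" by (rule exhaust_2)
  then show ?case
    unfolding iterated_partial.simps Cons.IH by (auto simp: partial_derivative_def * axis_def fun_eq_iff)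
qed auto

lemma jet_smooth: "jet \<Phi> \<Longrightarrow> smooth (\<Phi> k l)"
  unfolding smooth_def
  by (simp only: iterated_partial_jet differentiable_def) (blast intro: jetD)

lemma jet_test_function:
  assumes "jet \<Phi>" "\<And>x. x \<notin> cbox a b \<Longrightarrow> \<Phi> 0 0 x = 0" "cbox a b \<subseteq> \<Omega>"
  shows "test_function \<Omega> (\<Phi> 0 0)"
proof -
  have "{x. \<Phi> 0 0 x \<noteq> 0} \<subseteq> cbox a b" using assms(2) by blast
  then have "closure {x. \<Phi> 0 0 x \<noteq> 0} \<subseteq> cbox a b"
    by (rule closure_minimal[OF _ closed_cbox])
  moreover from this have "compact (closure {x. \<Phi> 0 0 x \<noteq> 0})"
    by (metis compact_cbox closed_closure compact_Int_closed inf.absorb2)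
  ultimately show ?thesis
    using assms jet_smooth unfolding test_function_def by blast
qed

lemma jet_product:
  assumes A: "deriv_seq A" and B: "deriv_seq B"
  shows "jet (\<lambda>k l x. A k (x$1) * B l (x$2))"
  unfolding jet_def
proof (intro allI)
  fix k l and x :: plane
  have a: "((\<lambda>x::plane. A k (x$1)) has_derivative (\<lambda>h. A (Suc k) (x$1) * h$1)) (at x)"
    using A unfolding deriv_seq_def has_field_derivative_def
    by (intro has_derivative_compose[OF bounded_linear_imp_has_derivative[OF bounded_linear_vec_nth]]) blast
  have b: "((\<lambda>x::plane. B l (x$2)) has_derivative (\<lambda>h. B (Suc l) (x$2) * h$2)) (at x)"
    using B unfolding deriv_seq_def has_field_derivative_def
    by (intro has_derivative_compose[OF bounded_linear_imp_has_derivative[OF bounded_linear_vec_nth]]) blast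
  show "((\<lambda>x. A k (x $ 1) * B l (x $ 2)) has_derivative
      (\<lambda>h. h $ 1 * (A (Suc k) (x $ 1) * B l (x $ 2)) + h $ 2 * (A k (x $ 1) * B (Suc l) (x $ 2)))) (at x)"
    by (rule has_derivative_eq_rhs[OF has_derivative_mult[OF a b]]) (auto simp: algebra_simps)
qed

lemma jet_cmult: "jet \<Phi> \<Longrightarrow> jet (\<lambda>k l x. c * \<Phi> k l x)"
  unfolding jet_def
  by (intro allI, rule has_derivative_eq_rhs[OF has_derivative_mult_right])
    (auto simp: algebra_simps)

text \<open>Supplies the kernel of a convolution as a test function in the integration variable y.
  The chain rule produces the same sign as integration by parts does.\<close>

lemma jet_reflect:
  assumes "jet \<Phi>"
  shows "jet (\<lambda>k l y. (-1) ^ (k + l) * \<Phi> k l (x - y))"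
  unfolding jet_def
proof (intro allI)
  fix k l and y :: plane
  have d: "((\<lambda>y. x - y) has_derivative (\<lambda>h. - h)) (at y)"
    by (auto intro!: derivative_eq_intros)
  have "((\<lambda>y. \<Phi> k l (x - y)) has_derivative
      (\<lambda>h. (- h)$1 * \<Phi> (Suc k) l (x - y) + (- h)$2 * \<Phi> k (Suc l) (x - y))) (at y)"
    by (rule has_derivative_compose[OF d]) (use jetD[OF assms] in simp)
  from has_derivative_mult_right[OF this, of "(-1) ^ (k + l)"]
  show "((\<lambda>y. (-1) ^ (k + l) * \<Phi> k l (x - y)) has_derivative
    (\<lambda>h. h $ 1 * ((-1) ^ (Suc k + l) * \<Phi> (Suc k) l (x - y)) +
         h $ 2 * ((-1) ^ (k + Suc l) * \<Phi> k (Suc l) (x - y)))) (at y)"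
    by (rule has_derivative_eq_rhs) (auto simp: algebra_simps fun_eq_iff)
qed

definition pbump :: "real \<Rightarrow> plane \<Rightarrow> plane \<Rightarrow> plane \<Rightarrow> real" where
  "pbump c a b x = bump c (a$1) (b$1) (x$1) * bump c (a$2) (b$2) (x$2)"

lemma pbump_jet: obtains \<Phi> where "jet \<Phi>" "\<Phi> 0 0 = pbump c a b"
proof -
  obtain A where A: "deriv_seq A" "A 0 = bump c (a$1) (b$1)" using bump_deriv_seq by blast
  obtain B where B: "deriv_seq B" "B 0 = bump c (a$2) (b$2)" using bump_deriv_seq by blast
  show ?thesis
    by (rule that[OF jet_product[OF A(1) B(1)]]) (simp add: A B fun_eq_iff pbump_def)
qed

lemma pbump_bounds: "0 \<le> pbump c a b x" "pbump c a b x \<le> 1"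
  by (auto simp: pbump_def bump_bounds intro!: mult_le_one)

lemma mem_box_plane: "x \<in> box a (b::plane) \<longleftrightarrow> a$1 < x$1 \<and> x$1 < b$1 \<and> a$2 < x$2 \<and> x$2 < b$2"
  by (auto simp: mem_box_cart forall_2)

lemma mem_cbox_plane: "x \<in> cbox a (b::plane) \<longleftrightarrow> a$1 \<le> x$1 \<and> x$1 \<le> b$1 \<and> a$2 \<le> x$2 \<and> x$2 \<le> b$2"
  by (auto simp: mem_box_cart forall_2)

lemma pbump_pos_iff: "c > 0 \<Longrightarrow> 0 < pbump c a b x \<longleftrightarrow> x \<in> box a b"
  using bump_bounds(1)[of c "a$1" "b$1" "x$1"] bump_bounds(1)[of c "a$2" "b$2" "x$2"]
  by (auto simp: pbump_def mem_box_plane bump_pos_iff zero_less_mult_iff)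

lemma pbump_eq_0: "c \<ge> 0 \<Longrightarrow> x \<notin> box a b \<Longrightarrow> pbump c a b x = 0"
  by (auto simp: pbump_def mem_box_plane bump_eq_0 not_less)

lemma pbump_tendsto: "(\<lambda>n. pbump (real n) a b x) \<longlonglongrightarrow> indicator (box a b) x"
proof -
  have "(\<lambda>n. pbump (real n) a b x) \<longlonglongrightarrow>
      indicator {a$1<..<b$1} (x$1) * indicator {a$2<..<b$2} (x$2)"
    unfolding pbump_def by (intro tendsto_mult bump_tendsto)
  moreover have "indicator {a$1<..<b$1} (x$1) * indicator {a$2<..<b$2} (x$2) = (indicator (box a b) x :: real)"
    by (simp add: indicator_def mem_box_plane)
  ultimately show ?thesis by simp 
qed

lemma pbump_continuous_on: "continuous_on S (pbump c a b)"
  by (metis pbump_jet jet_continuous_on)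

lemma pbump_measurable [measurable]: "pbump c a b \<in> borel_measurable borel"
  by (intro borel_measurable_continuous_onI pbump_continuous_on)

lemma pbump_test_function:
  assumes "c \<ge> 0" "cbox a b \<subseteq> \<Omega>"
  shows "test_function \<Omega> (pbump c a b)"
proof -
  obtain \<Phi> where \<Phi>: "jet \<Phi>" "\<Phi> 0 0 = pbump c a b" by (rule pbump_jet)
  show ?thesis
    using jet_test_function[OF \<Phi>(1) _ assms(2)] pbump_eq_0[OF assms(1)] box_subset_cbox
    unfolding \<Phi>(2) by blast
qed

section \<open>Uniqueness of weak derivatives\<close>

text \<open>Boxes are stable under intersection and generate the Borel sets, so by the Dynkin
  argument h integrates to zero over every Borel set; {h > 0} and {h < 0} then finish. The support
  condition reduces the whole plane, needed for complements, to a box.\<close>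

lemma AE_zero_of_integral_boxes_zero:
  fixes h :: "plane \<Rightarrow> real"
  assumes int: "integrable lborel h"
    and supp: "\<And>x. x \<notin> box a b \<Longrightarrow> h x = 0"
    and box: "\<And>c d. (LINT x:box c d|lborel. h x) = 0"
  shows "AE x in lborel. h x = 0"
proof -
  have si: "set_integrable lborel A h" if "A \<in> sets borel" for A
    using integrable_mult_indicator[OF _ int, of A] that by (simp add: set_integrable_def)
  have univ: "(LINT x:UNIV|lborel. h x) = 0"
  proof -
    have "(LINT x:UNIV|lborel. h x) = (LINT x:box a b|lborel. h x)"
      unfolding set_lebesgue_integral_def
      by (rule Bochner_Integration.integral_cong) (auto simp: indicator_def supp)
    then show ?thesis by (simp add: box)
  qed
  have zero: "(LINT x:A|lborel. h x) = 0" if "A \<in> sets borel" for A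
  proof -
    let ?G = "range (\<lambda>(a, b). box a b :: plane set)"
    have A: "A \<in> sigma_sets UNIV ?G"
      using that by (simp add: borel_eq_box sets_measure_of_conv)
    have sb: "sigma_sets UNIV ?G = sets borel"
      by (simp add: borel_eq_box sets_measure_of_conv)
    have stable: "Int_stable ?G"
      unfolding Int_stable_def
    proof (intro ballI)
      fix X Y assume "X \<in> ?G" "Y \<in> ?G"
      then obtain a b c d where "X = box a b" "Y = box c d" by auto
      then show "X \<inter> Y \<in> ?G" by (simp only: box_Int_box) blast
    qed
    have "?G \<subseteq> Pow UNIV" by simp
    with stable show ?thesis using A
    proof (induction rule: sigma_sets_induct_disjoint)
      case (basic A) then show ?case using box by auto
    next
      case empty show ?case by (simp add: set_lebesgue_integral_def)
    next
      case (compl A)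
      then have m: "A \<in> sets borel" by (simp add: sb)
      have "(LINT x:UNIV|lborel. h x) = (LINT x:A \<union> (UNIV - A)|lborel. h x)" by simp
      also have "\<dots> = (LINT x:A|lborel. h x) + (LINT x:UNIV - A|lborel. h x)"
        by (rule set_integral_Un) (use m in \<open>auto intro!: si\<close>)
      finally show ?case using compl univ by simp
    next
      case (union A)
      then have "\<And>i. A i \<in> sets borel" using sb by auto
      moreover from this have "(\<Union>i. A i) \<in> sets borel" by auto
      ultimately have "(LINT x:(\<Union>i. A i)|lborel. h x) = (\<Sum>i. (LINT x:(A i)|lborel. h x))"
        using union by (intro lebesgue_integral_countable_add si) (auto simp: disjoint_family_on_def)
      then show ?case using union by simp
    qed
  qed
  have [measurable]: "h \<in> borel_measurable borel" using int by auto
  have mp: "{x. h x > 0} \<in> sets borel" and mn: "{x. h x < 0} \<in> sets borel" by measurable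
  have "(LINT x|lborel. indicator {x. h x > 0} x *\<^sub>R h x) = 0"
    using zero[OF mp] by (simp add: set_lebesgue_integral_def)
  then have "AE x in lborel. indicator {x. h x > 0} x *\<^sub>R h x = 0"
    by (subst (asm) integral_nonneg_eq_0_iff_AE)
      (use si[OF mp] in \<open>auto simp: set_integrable_def indicator_def\<close>)
  moreover have "(LINT x|lborel. - (indicator {x. h x < 0} x *\<^sub>R h x)) = 0"
    using zero[OF mn] by (simp add: set_lebesgue_integral_def)
  then have "AE x in lborel. - (indicator {x. h x < 0} x *\<^sub>R h x) = 0"
    by (subst (asm) integral_nonneg_eq_0_iff_AE)
      (use si[OF mn] in \<open>auto simp: set_integrable_def indicator_def\<close>)
  ultimately show ?thesis
    by eventually_elim (auto simp: indicator_def split: if_splits)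
qed

text \<open>Inside a box, steep bumps approximate the indicators of smaller boxes, and dominated
  convergence shows that h integrates to zero over each of them. Countably many boxes exhaust the
  open set.\<close>

lemma fundamental_lemma_real:
  fixes h :: "plane \<Rightarrow> real"
  assumes op: "open \<Omega>" and li: "locally_integrable \<Omega> h"
    and z: "\<And>\<phi>. test_function \<Omega> \<phi> \<Longrightarrow> (LINT x:\<Omega>|lebesgue. \<phi> x * h x) = 0"
  shows "AE x in lebesgue. x \<in> \<Omega> \<longrightarrow> h x = 0"
proof -
  have local: "AE x in lebesgue. x \<in> box a b \<longrightarrow> h x = 0" if ab: "cbox a b \<subseteq> \<Omega>" for a b
  proof -
    define h1 where "h1 x = indicator (cbox a b) x *\<^sub>R h x" for x
    have h1: "integrable lebesgue h1"
      using li[unfolded locally_integrable_def set_integrable_def, rule_format, of "cbox a b"] ab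
      by (simp add: h1_def[abs_def])
    then have "h1 \<in> borel_measurable (completion lborel)" by auto
    \<comment> \<open>The argument with generators lives on Borel sets, so the Lebesgue measurable
      function is exchanged for a Borel one that agrees with it almost everywhere.\<close>
    then obtain h2 where h2m: "h2 \<in> borel_measurable lborel" and h2: "AE x in lborel. h1 x = h2 x"
      using completion_ex_borel_measurable_real by blast
    have h2c: "h2 \<in> borel_measurable lebesgue" by (rule measurable_completion[OF h2m])
    have h2i: "integrable lebesgue h2"
      by (rule integrable_cong_AE_imp[OF h1 h2c]) (use AE_completion[OF h2] in \<open>eventually_elim, simp\<close>)
    then have h2l: "integrable lborel h2"
      using integrable_completion[OF h2m] by blast
    define h3 where "h3 x = indicator (box a b) x *\<^sub>R h2 x" for x
    have h3l: "integrable lborel h3"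
      unfolding h3_def by (intro integrable_mult_indicator h2l) auto
    have "(LINT x:box c d|lborel. h3 x) = 0" for c d
    proof -
      obtain e f where ef: "box c d \<inter> box a b = box e f" using box_Int_box[of c d a b] by blast
      show ?thesis
      proof (cases "box e f = {}")
        case True
        then have "indicator (box c d) x *\<^sub>R h3 x = 0" for x
          using ef unfolding h3_def by (auto simp: indicator_def)
        then show ?thesis unfolding set_lebesgue_integral_def by (simp only: Bochner_Integration.integral_zero)
      next
        case False
        have sub: "cbox e f \<subseteq> cbox a b"
        proof -
          have "box e f \<subseteq> cbox a b" using ef box_subset_cbox[of a b] by blast
          then have "closure (box e f) \<subseteq> cbox a b" by (rule closure_minimal[OF _ closed_cbox])
          then show ?thesis by (simp add: closure_box[OF False])
        qed
        have lim: "(\<lambda>n. LINT x|lebesgue. pbump (real n) e f x * h1 x) \<longlonglongrightarrow>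
            (LINT x|lebesgue. indicator (box e f) x * h1 x)"
        proof (rule integral_dominated_convergence[where w = "\<lambda>x. norm (h1 x)"])
          show "AE x in lebesgue. (\<lambda>n. pbump (real n) e f x * h1 x) \<longlonglongrightarrow> indicator (box e f) x * h1 x"
            by (auto intro!: tendsto_mult pbump_tendsto)
          show "AE x in lebesgue. norm (pbump (real n) e f x * h1 x) \<le> norm (h1 x)" for n
            using pbump_bounds[of "real n" e f] by (auto simp: abs_mult mult_left_le_one_le)
          have [measurable]: "h1 \<in> borel_measurable lebesgue" using h1 by auto
          have [measurable]: "pbump c e f \<in> borel_measurable lebesgue" for c
            by (intro measurable_completion) simp
          show "(\<lambda>x. pbump (real n) e f x * h1 x) \<in> borel_measurable lebesgue" for n
            by measurable
          have [measurable]: "indicator (box e f) \<in> borel_measurable lebesgue"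
            by (intro measurable_completion) simp
          show "(\<lambda>x. indicator (box e f) x * h1 x) \<in> borel_measurable lebesgue"
            by measurable
        qed (use h1 in auto)
        have "(LINT x|lebesgue. pbump (real n) e f x * h1 x) = 0" for n
        proof -
          have "(LINT x|lebesgue. pbump (real n) e f x * h1 x) = (LINT x:\<Omega>|lebesgue. pbump (real n) e f x * h x)"
            unfolding set_lebesgue_integral_def h1_def
          proof (rule Bochner_Integration.integral_cong)
            fix x
            have "x \<notin> cbox e f \<Longrightarrow> pbump (real n) e f x = 0"
              using pbump_eq_0[of "real n" x e f] box_subset_cbox by auto
            then show "pbump (real n) e f x * (indicator (cbox a b) x *\<^sub>R h x) = indicator \<Omega> x *\<^sub>R (pbump (real n) e f x * h x)"
              using sub ab by (cases "x \<in> cbox e f") (auto simp: indicator_def)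
          qed simp
          then show ?thesis using z[OF pbump_test_function[of "real n" e f]] sub ab by auto
        qed
        with lim have "(LINT x|lebesgue. indicator (box e f) x * h1 x) = 0"
          by (simp add: LIMSEQ_const_iff)
        also have "(LINT x|lebesgue. indicator (box e f) x * h1 x) = (LINT x|lebesgue. indicator (box e f) x * h2 x)"
        proof (rule integral_cong_AE)
          have [measurable]: "indicator (box e f) \<in> borel_measurable lebesgue"
            by (intro measurable_completion) simp
          have [measurable]: "h1 \<in> borel_measurable lebesgue" "h2 \<in> borel_measurable lebesgue" 
            using h1 h2i by auto
          show "(\<lambda>x. indicator (box e f) x * h1 x) \<in> borel_measurable lebesgue"
            "(\<lambda>x. indicator (box e f) x * h2 x) \<in> borel_measurable lebesgue"
            by measurable
          show "AE x in lebesgue. indicator (box e f) x * h1 x = indicator (box e f) x * h2 x"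
            using AE_completion[OF h2] by auto
        qed
        also have "\<dots> = (LINT x|lborel. indicator (box e f) x * h2 x)"
          by (rule integral_completion) (use h2m in measurable)
        also have "\<dots> = (LINT x:box c d|lborel. h3 x)"
          unfolding set_lebesgue_integral_def h3_def
          by (rule Bochner_Integration.integral_cong) (auto simp: indicator_def ef[symmetric])
        finally show ?thesis by simp
      qed
    qed
    then have "AE x in lborel. h3 x = 0"
      by (intro AE_zero_of_integral_boxes_zero[of h3 a b]) (use h3l in \<open>auto simp: h3_def\<close>)
    then have "AE x in lebesgue. h3 x = 0" by (rule AE_completion)
    with AE_completion[OF h2] show ?thesis
      by eventually_elim (use box_subset_cbox[of a b] in \<open>auto simp: h3_def h1_def indicator_def split: if_splits\<close>)
  qed
  \<comment> \<open>The countable exhaustion of an open set is by closed boxes, and the boundary of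
    a box is a null set.\<close>
  have local': "AE x in lebesgue. x \<in> cbox a b \<longrightarrow> h x = 0" if "cbox a b \<subseteq> \<Omega>" for a b
  proof -
    have "AE x in lebesgue. x \<notin> cbox a b - box a b"
      using negligible_frontier_interval[of a b] by (intro AE_not_in) (simp add: negligible_iff_null_sets)
    with local[OF that] show ?thesis by eventually_elim auto
  qed
  obtain D where D: "countable D" "D \<subseteq> Pow \<Omega>" "\<And>X. X \<in> D \<Longrightarrow> \<exists>a b. X = cbox a b" "\<Union>D = \<Omega>"
    using open_countable_Union_open_cbox[OF op] by blast
  have "AE x in lebesgue. \<forall>X\<in>D. x \<in> X \<longrightarrow> h x = 0"
  proof (rule AE_ball_countable'[OF _ D(1)])
    fix X assume X: "X \<in> D"
    then obtain a b where "X = cbox a b" using D(3) by blast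
    moreover have "X \<subseteq> \<Omega>" using X D(2) by blast
    ultimately show "AE x in lebesgue. x \<in> X \<longrightarrow> h x = 0" using local' by blast
  qed
  then show ?thesis
    by eventually_elim (use D(4) in auto)
qed

lemma test_function_continuous_bounded:
  fixes \<phi> :: "plane \<Rightarrow> real"
  assumes "test_function \<Omega> \<phi>"
  obtains K B where "compact K" "K \<subseteq> \<Omega>" "continuous_on UNIV \<phi>" "\<And>x. x \<notin> K \<Longrightarrow> \<phi> x = 0" "\<And>x. \<bar>\<phi> x\<bar> \<le> B"
proof -
  have "\<forall>x. iterated_partial [] \<phi> differentiable (at x)"
    using assms unfolding test_function_def smooth_def by blast
  then have c: "continuous_on UNIV \<phi>"
    by (simp add: continuous_at_imp_continuous_on differentiable_imp_continuous_within)
  let ?K = "closure {x. \<phi> x \<noteq> 0}"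
  have K: "compact ?K" "?K \<subseteq> \<Omega>" using assms unfolding test_function_def by auto
  have "bounded (\<phi> ` ?K)"
    by (rule compact_imp_bounded[OF compact_continuous_image[OF continuous_on_subset[OF c] K(1)]]) simp
  then obtain B where B: "\<forall>y\<in>\<phi> ` ?K. norm y \<le> B" unfolding bounded_iff by blast
  have out: "x \<notin> ?K \<Longrightarrow> \<phi> x = 0" for x using closure_subset[of "{x. \<phi> x \<noteq> 0}"] by blast
  have bd: "\<bar>\<phi> x\<bar> \<le> max B 0" for x
  proof (cases "x \<in> ?K")
    case True
    then have "norm (\<phi> x) \<le> B" using B by blast
    then show ?thesis by simp
  next
    case False
    then have "\<phi> x = 0" by (rule out)
    then show ?thesis by simp
  qed
  show ?thesis
  proof (rule that[of ?K "max B 0"])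
    show "compact ?K" "?K \<subseteq> \<Omega>" by (fact K)+
    show "continuous_on UNIV \<phi>" by (fact c)
    show "\<phi> x = 0" if "x \<notin> ?K" for x using that by (rule out)
    show "\<bar>\<phi> x\<bar> \<le> max B 0" for x by (rule bd)
  qed
qed

lemma test_function_integrable:
  fixes \<phi> :: "plane \<Rightarrow> real" and g :: "plane \<Rightarrow> 'a::euclidean_space"
  assumes "test_function \<Omega> \<phi>" "locally_integrable \<Omega> g"
  shows "set_integrable lebesgue \<Omega> (\<lambda>x. \<phi> x *\<^sub>R g x)"
proof -
  obtain K B where K: "compact K" "K \<subseteq> \<Omega>" "continuous_on UNIV \<phi>" "\<And>x. x \<notin> K \<Longrightarrow> \<phi> x = 0" "\<And>x. \<bar>\<phi> x\<bar> \<le> B"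
    using test_function_continuous_bounded[OF assms(1)] by blast
  have i: "integrable lebesgue (\<lambda>x. indicator K x *\<^sub>R g x)"
    using assms(2) K unfolding locally_integrable_def set_integrable_def by blast
  have "\<phi> \<in> borel_measurable borel" using K(3) by (rule borel_measurable_continuous_onI)
  then have [measurable]: "\<phi> \<in> borel_measurable lebesgue" by (intro measurable_completion) simp
  have [measurable]: "(\<lambda>x. indicator K x *\<^sub>R g x) \<in> borel_measurable lebesgue" using i by auto
  have eq: "(\<lambda>x. indicator \<Omega> x *\<^sub>R (\<phi> x *\<^sub>R g x)) = (\<lambda>x. \<phi> x *\<^sub>R (indicator K x *\<^sub>R g x))"
    using K(2,4) by (auto simp: indicator_def fun_eq_iff)
  have "integrable lebesgue (\<lambda>x. \<phi> x *\<^sub>R (indicator K x *\<^sub>R g x))"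
  proof (rule Bochner_Integration.integrable_bound)
    show "integrable lebesgue (\<lambda>x. B *\<^sub>R (indicator K x *\<^sub>R g x))" by (rule integrable_scaleR_right[OF i])
    show "(\<lambda>x. \<phi> x *\<^sub>R (indicator K x *\<^sub>R g x)) \<in> borel_measurable lebesgue" by measurable
    show "AE x in lebesgue. norm (\<phi> x *\<^sub>R (indicator K x *\<^sub>R g x)) \<le> norm (B *\<^sub>R (indicator K x *\<^sub>R g x))"
    proof (rule AE_I2)
      fix x
      have "\<bar>\<phi> x\<bar> \<le> \<bar>B\<bar>" using K(5)[of x] by linarith
      then show "norm (\<phi> x *\<^sub>R (indicator K x *\<^sub>R g x)) \<le> norm (B *\<^sub>R (indicator K x *\<^sub>R g x))"
        by (simp only: norm_scaleR) (intro mult_right_mono; simp)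
    qed
  qed
  then show ?thesis unfolding set_integrable_def eq .
qed

text \<open>The fundamental lemma concerns real functions, so it is applied to every coordinate of g
  - g'.\<close>

lemma weak_derivative_unique:
  fixes f g g' :: "plane \<Rightarrow> 'a::euclidean_space"
  assumes op: "open \<Omega>" and g: "has_weak_derivative \<Omega> \<alpha> f g" and g': "has_weak_derivative \<Omega> \<alpha> f g'"
  shows "AE x in lebesgue. x \<in> \<Omega> \<longrightarrow> g x = g' x"
proof -
  have li: "locally_integrable \<Omega> g" "locally_integrable \<Omega> g'"
    using g g' by (auto simp: has_weak_derivative_def)
  have "AE x in lebesgue. x \<in> \<Omega> \<longrightarrow> (g x - g' x) \<bullet> b = 0" for b
  proof (rule fundamental_lemma_real[OF op])
    show "locally_integrable \<Omega> (\<lambda>x. (g x - g' x) \<bullet> b)"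
      unfolding locally_integrable_def set_integrable_def
    proof (intro allI impI)
      fix K assume "compact K \<and> K \<subseteq> \<Omega>"
      then have "integrable lebesgue (\<lambda>x. (indicator K x *\<^sub>R g x - indicator K x *\<^sub>R g' x) \<bullet> b)"
        using li[unfolded locally_integrable_def set_integrable_def, rule_format, of K]
        by (intro integrable_inner_left Bochner_Integration.integrable_diff) auto
      then show "integrable lebesgue (\<lambda>x. indicator K x *\<^sub>R ((g x - g' x) \<bullet> b))"
        by (simp add: algebra_simps inner_diff_left)
    qed
    fix \<phi> :: "plane \<Rightarrow> real" assume \<phi>: "test_function \<Omega> \<phi>"
    have i: "set_integrable lebesgue \<Omega> (\<lambda>x. \<phi> x *\<^sub>R g x)" "set_integrable lebesgue \<Omega> (\<lambda>x. \<phi> x *\<^sub>R g' x)"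
      using test_function_integrable[OF \<phi>] li by auto
    have "(-1) ^ (fst \<alpha> + snd \<alpha>) *\<^sub>R (LINT x:\<Omega>|lebesgue. \<phi> x *\<^sub>R g x)
        = (-1) ^ (fst \<alpha> + snd \<alpha>) *\<^sub>R (LINT x:\<Omega>|lebesgue. \<phi> x *\<^sub>R g' x)"
    proof (rule trans[OF sym])
      let ?L = "LINT x:\<Omega>|lebesgue.
        iterated_partial (replicate (fst \<alpha>) 1 @ replicate (snd \<alpha>) 2) \<phi> x *\<^sub>R f x"
      show "?L = (-1) ^ (fst \<alpha> + snd \<alpha>) *\<^sub>R (LINT x:\<Omega>|lebesgue. \<phi> x *\<^sub>R g x)"
        using g \<phi> unfolding has_weak_derivative_def by blast
      show "?L = (-1) ^ (fst \<alpha> + snd \<alpha>) *\<^sub>R (LINT x:\<Omega>|lebesgue. \<phi> x *\<^sub>R g' x)"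
        using g' \<phi> unfolding has_weak_derivative_def by blast
    qed
    then have "(LINT x:\<Omega>|lebesgue. \<phi> x *\<^sub>R g x) - (LINT x:\<Omega>|lebesgue. \<phi> x *\<^sub>R g' x) = 0"
      by simp
    then have "(LINT x:\<Omega>|lebesgue. \<phi> x *\<^sub>R g x - \<phi> x *\<^sub>R g' x) = 0"
      using i by simp
    then have "(LINT x|lebesgue. (indicator \<Omega> x *\<^sub>R (\<phi> x *\<^sub>R g x - \<phi> x *\<^sub>R g' x)) \<bullet> b) = 0"
      using i unfolding set_lebesgue_integral_def set_integrable_def
      by (subst integral_inner_left) (auto simp: scaleR_diff_right)
    moreover have "(\<lambda>x. (indicator \<Omega> x *\<^sub>R (\<phi> x *\<^sub>R g x - \<phi> x *\<^sub>R g' x)) \<bullet> b)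
       = (\<lambda>x. indicator \<Omega> x *\<^sub>R (\<phi> x * ((g x - g' x) \<bullet> b)))"
      by (auto simp: algebra_simps inner_diff_left fun_eq_iff)
    ultimately show "(LINT x:\<Omega>|lebesgue. \<phi> x * ((g x - g' x) \<bullet> b)) = 0"
      by (simp add: set_lebesgue_integral_def)
  qed
  then have "AE x in lebesgue. \<forall>b\<in>Basis. x \<in> \<Omega> \<longrightarrow> (g x - g' x) \<bullet> b = 0"
    by (subst AE_finite_all) auto
  then show ?thesis
    by eventually_elim (simp add: euclidean_all_zero_iff)
qed

section \<open>Sobolev norms\<close>

text \<open>\<open>weak_derivative\<close> is an arbitrary choice, so statements about norms must be
  transferable between functions that agree almost everywhere on \<Omega>.\<close>

lemma square_integrable_cong_AE:
  fixes g w :: "plane \<Rightarrow> 'a::euclidean_space"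
  assumes g: "square_integrable \<Omega> g" and ae: "AE x in lebesgue. x \<in> \<Omega> \<longrightarrow> g x = w x"
  shows "square_integrable \<Omega> w"
    and "(LINT x:\<Omega>|lebesgue. (norm (g x))\<^sup>2) = (LINT x:\<Omega>|lebesgue. (norm (w x))\<^sup>2)"
proof -
  have m: "(\<lambda>x. indicator \<Omega> x *\<^sub>R g x) \<in> borel_measurable lebesgue"
    using g by (simp add: square_integrable_def set_borel_measurable_def)
  have "AE x in lebesgue. indicator \<Omega> x *\<^sub>R g x = indicator \<Omega> x *\<^sub>R w x"
    using ae by eventually_elim (auto simp: indicator_def)
  then have mw: "(\<lambda>x. indicator \<Omega> x *\<^sub>R w x) \<in> borel_measurable lebesgue"
    by (rule borel_measurable_AE[OF m])
  have eq: "(\<lambda>x. indicator \<Omega> x *\<^sub>R (norm (v x))\<^sup>2) = (\<lambda>x. (norm (indicator \<Omega> x *\<^sub>R v x))\<^sup>2)"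
    for v :: "plane \<Rightarrow> 'a"
    by (auto simp: indicator_def fun_eq_iff)
  have ae2: "AE x in lebesgue. (norm (indicator \<Omega> x *\<^sub>R g x))\<^sup>2 = (norm (indicator \<Omega> x *\<^sub>R w x))\<^sup>2"
    using ae by eventually_elim (auto simp: indicator_def)
  have m2: "(\<lambda>x. (norm (indicator \<Omega> x *\<^sub>R g x))\<^sup>2) \<in> borel_measurable lebesgue"
    "(\<lambda>x. (norm (indicator \<Omega> x *\<^sub>R w x))\<^sup>2) \<in> borel_measurable lebesgue"
    using measurable_compose[OF m, of "\<lambda>v. (norm v)\<^sup>2" borel] measurable_compose[OF mw, of "\<lambda>v. (norm v)\<^sup>2" borel]
    by simp_all
  show "square_integrable \<Omega> w"
    using g mw integrable_cong_AE[OF m2 ae2]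
    unfolding square_integrable_def set_borel_measurable_def set_integrable_def eq by blast
  show "(LINT x:\<Omega>|lebesgue. (norm (g x))\<^sup>2) = (LINT x:\<Omega>|lebesgue. (norm (w x))\<^sup>2)"
    unfolding set_lebesgue_integral_def eq by (rule integral_cong_AE[OF m2 ae2])
qed

text \<open>Membership provides some square integrable weak derivative; the chosen one agrees with
  it almost everywhere and inherits the property.\<close>

lemma sobolev_weak_derivative:
  fixes f :: "plane \<Rightarrow> 'a::euclidean_space"
  assumes "open \<Omega>" "f \<in> sobolev m \<Omega>" "fst \<alpha> + snd \<alpha> \<le> m"
  shows "has_weak_derivative \<Omega> \<alpha> f (weak_derivative \<Omega> \<alpha> f)"
    and "square_integrable \<Omega> (weak_derivative \<Omega> \<alpha> f)"
proof -
  obtain g where g: "has_weak_derivative \<Omega> \<alpha> f g" "square_integrable \<Omega> g"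
    using assms unfolding sobolev_def by blast
  show w: "has_weak_derivative \<Omega> \<alpha> f (weak_derivative \<Omega> \<alpha> f)"
    unfolding weak_derivative_def by (rule someI[of "has_weak_derivative \<Omega> \<alpha> f", OF g(1)])
  show "square_integrable \<Omega> (weak_derivative \<Omega> \<alpha> f)"
    by (rule square_integrable_cong_AE(1)[OF g(2) weak_derivative_unique[OF assms(1) g(1) w]])
qed

lemma finite_multi_indices: "finite {\<alpha> :: nat \<times> nat. fst \<alpha> + snd \<alpha> \<le> m}"
  by (rule finite_subset[of _ "{..m} \<times> {..m}"]) auto

lemma set_integral_nonneg_fun:
  fixes f :: "_ \<Rightarrow> real"
  assumes "\<And>x. x \<in> S \<Longrightarrow> 0 \<le> f x"
  shows "0 \<le> (LINT x:S|M. f x)"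
  unfolding set_lebesgue_integral_def
  by (rule Bochner_Integration.integral_nonneg) (use assms in \<open>auto simp: indicator_def\<close>)

lemma sobolev_norm_nonneg: "0 \<le> sobolev_norm m \<Omega> f"
  unfolding sobolev_norm_def by (intro real_sqrt_ge_zero sum_nonneg set_integral_nonneg_fun) simp

lemma sobolev_norm_power2:
  "(sobolev_norm m \<Omega> f)\<^sup>2 =
     (\<Sum>\<alpha> | fst \<alpha> + snd \<alpha> \<le> m. LINT x:\<Omega>|lebesgue. (norm (weak_derivative \<Omega> \<alpha> f x))\<^sup>2)"
  unfolding sobolev_norm_def by (intro real_sqrt_pow2 sum_nonneg set_integral_nonneg_fun) simp

lemma weak_derivative_L2_le:
  assumes "fst \<alpha> + snd \<alpha> \<le> m"
  shows "(LINT x:\<Omega>|lebesgue. (norm (weak_derivative \<Omega> \<alpha> f x))\<^sup>2) \<le> (sobolev_norm m \<Omega> f)\<^sup>2"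
  unfolding sobolev_norm_power2
  by (rule member_le_sum[where f = "\<lambda>\<alpha>. LINT x:\<Omega>|lebesgue. (norm (weak_derivative \<Omega> \<alpha> f x))\<^sup>2"])
    (auto intro!: set_integral_nonneg_fun simp: assms finite_multi_indices)

text \<open>Young's inequality |g| \<le> s/2 + |g|^2/(2s) plays the role of Cauchy-Schwarz. Taking s
  > N instead of s = N avoids division by zero, and s tends to N at the end. The generous factor,
  measure plus 1, is always positive and free of roots.\<close>

lemma square_integrable_imp_L1:
  fixes g :: "plane \<Rightarrow> 'a::euclidean_space"
  assumes O: "open \<Omega>" "bounded \<Omega>" and g: "square_integrable \<Omega> g"
    and N: "(LINT x:\<Omega>|lebesgue. (norm (g x))\<^sup>2) \<le> N\<^sup>2" "N \<ge> 0"
  shows "set_integrable lebesgue \<Omega> g"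
    and "(LINT x:\<Omega>|lebesgue. norm (g x)) \<le> (measure lebesgue \<Omega> + 1) * N"
proof -
  have L: "\<Omega> \<in> lmeasurable" using O by (simp add: lmeasurable_open)
  have m: "set_borel_measurable lebesgue \<Omega> g"
    and i2: "set_integrable lebesgue \<Omega> (\<lambda>x. (norm (g x))\<^sup>2)"
    using g by (auto simp: square_integrable_def)
  have ci: "set_integrable lebesgue \<Omega> (\<lambda>x. c)" for c :: real
    using L by (rule absolutely_integrable_on_const)
  have young: "norm (g x) \<le> s / 2 + (norm (g x))\<^sup>2 / (2 * s)" if "s > 0" for s x
  proof -
    have "0 \<le> (norm (g x) - s)\<^sup>2 / (2 * s)" using that by simp
    also have "\<dots> = (norm (g x))\<^sup>2 / (2 * s) - norm (g x) + s / 2"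
      using that by (simp add: power2_diff field_simps power2_eq_square)
    finally show ?thesis by simp
  qed
  have bi: "set_integrable lebesgue \<Omega> (\<lambda>x. s / 2 + (norm (g x))\<^sup>2 / (2 * s))" for s
    by (intro set_integral_add ci set_integrable_divide i2)
  show gi: "set_integrable lebesgue \<Omega> g"
    by (rule set_integrable_bound[OF bi[of 1] m]) (use young[of 1] in \<open>auto intro: order_trans[OF _ abs_ge_self]\<close>)
  have h: "(LINT x:\<Omega>|lebesgue. norm (g x)) \<le> (measure lebesgue \<Omega> + 1) / 2 * s" if s: "s > N" for s
  proof -
    have s0: "s > 0" using s N by simp
    have "(LINT x:\<Omega>|lebesgue. norm (g x)) \<le> (LINT x:\<Omega>|lebesgue. s / 2 + (norm (g x))\<^sup>2 / (2 * s))"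
      by (rule set_integral_mono[OF set_integrable_norm[OF gi] bi young[OF s0]])
    also have "\<dots> = (LINT x:\<Omega>|lebesgue. s / 2) + (LINT x:\<Omega>|lebesgue. (norm (g x))\<^sup>2 / (2 * s))"
      by (intro set_integral_add ci set_integrable_divide i2)
    also have "(LINT x:\<Omega>|lebesgue. s / 2) = measure lebesgue \<Omega> * (s / 2)"
      unfolding set_lebesgue_integral_def using L by simp
    also have "(LINT x:\<Omega>|lebesgue. (norm (g x))\<^sup>2 / (2 * s)) = (LINT x:\<Omega>|lebesgue. (norm (g x))\<^sup>2) / (2 * s)"
      by simp
    also have "\<dots> \<le> s\<^sup>2 / (2 * s)"
      by (intro divide_right_mono order_trans[OF N(1)] power_mono) (use s N s0 in auto)
    also have "\<dots> = s / 2" using s0 by (simp add: power2_eq_square)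
    finally show ?thesis by (simp add: algebra_simps add_divide_distrib)
  qed
  have *: "(LINT x:\<Omega>|lebesgue. norm (g x)) \<le> (measure lebesgue \<Omega> + 1) / 2 * N"
  proof (rule field_le_epsilon)
    fix e :: real assume e: "e > 0"
    have p: "measure lebesgue \<Omega> + 1 > 0" by (rule add_nonneg_pos) auto
    let ?s = "N + e / (measure lebesgue \<Omega> + 1)"
    have "(LINT x:\<Omega>|lebesgue. norm (g x)) \<le> (measure lebesgue \<Omega> + 1) / 2 * ?s"
      by (rule h) (use e p in simp)
    also have "\<dots> = (measure lebesgue \<Omega> + 1) / 2 * N + e / 2"
      using p by (simp add: field_simps)
    finally show "(LINT x:\<Omega>|lebesgue. norm (g x)) \<le> (measure lebesgue \<Omega> + 1) / 2 * N + e"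
      using e by simp
  qed
  have "(measure lebesgue \<Omega> + 1) / 2 * N \<le> (measure lebesgue \<Omega> + 1) * N"
  proof (rule mult_right_mono[OF _ N(2)])
    have "(x + 1) / 2 \<le> x + 1" if "0 \<le> x" for x :: real using that by simp
    from this[OF measure_nonneg] show "(measure lebesgue \<Omega> + 1) / 2 \<le> measure lebesgue \<Omega> + 1" .
  qed
  with * show "(LINT x:\<Omega>|lebesgue. norm (g x)) \<le> (measure lebesgue \<Omega> + 1) * N" by linarith
qed

lemma iterated_partial_append: "iterated_partial (js @ is) f = iterated_partial js (iterated_partial is f)"
  by (induction js) auto

text \<open>The complement of the closed support is open and the function vanishes on it, hence so
  does every derivative.\<close>

lemma iterated_partial_support:
  assumes "x \<notin> closure {x. \<phi> x \<noteq> 0}"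
  shows "iterated_partial is \<phi> x = 0"
  using assms
proof (induction "is" arbitrary: x)
  case Nil then show ?case using closure_subset[of "{x. \<phi> x \<noteq> 0}"] by auto
next
  case (Cons i js)
  let ?U = "- closure {x. \<phi> x \<noteq> 0}"
  have "((\<lambda>x. 0) has_derivative (\<lambda>h. 0)) (at x)" by simp
  then have "(iterated_partial js \<phi> has_derivative (\<lambda>h. 0)) (at x)"
    by (rule has_derivative_transform_within_open[where s = ?U]) (use Cons in auto)
  then show ?case
    by (simp add: partial_derivative_def frechet_derivative_at[symmetric])
qed

text \<open>In the definition of weak derivatives a derivative of the test function multiplies f.
  Linearity of that integral needs this product to be integrable.\<close>

lemma test_function_iterated_partial:
  assumes "test_function \<Omega> \<phi>"
  shows "test_function \<Omega> (iterated_partial is \<phi>)"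
proof -
  have sub: "closure {x. iterated_partial is \<phi> x \<noteq> 0} \<subseteq> closure {x. \<phi> x \<noteq> 0}"
    by (rule closure_minimal) (use iterated_partial_support[of _ \<phi> "is"] in auto)
  have "smooth (iterated_partial is \<phi>)"
    using assms unfolding test_function_def smooth_def by (simp add: iterated_partial_append[symmetric])
  moreover have "compact (closure {x. iterated_partial is \<phi> x \<noteq> 0})"
    using assms compact_Int_closed[of "closure {x. \<phi> x \<noteq> 0}", OF _ closed_closure] sub
    unfolding test_function_def by (metis inf.absorb2)
  ultimately show ?thesis using assms sub unfolding test_function_def by blast
qed

lemma locally_integrable_diff:
  fixes f g :: "plane \<Rightarrow> 'a::euclidean_space"
  assumes "locally_integrable \<Omega> f" "locally_integrable \<Omega> g"
  shows "locally_integrable \<Omega> (\<lambda>x. f x - g x)"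
  using assms unfolding locally_integrable_def by (blast intro: set_integral_diff(1))

lemma has_weak_derivative_diff:
  fixes f g :: "plane \<Rightarrow> 'a::euclidean_space"
  assumes f: "has_weak_derivative \<Omega> \<alpha> f f'" and g: "has_weak_derivative \<Omega> \<alpha> g g'"
  shows "has_weak_derivative \<Omega> \<alpha> (\<lambda>x. f x - g x) (\<lambda>x. f' x - g' x)"
  unfolding has_weak_derivative_def
proof (intro conjI allI impI)
  have li: "locally_integrable \<Omega> f" "locally_integrable \<Omega> g" "locally_integrable \<Omega> f'" "locally_integrable \<Omega> g'"
    using f g by (auto simp: has_weak_derivative_def)
  then show "locally_integrable \<Omega> (\<lambda>x. f x - g x)" "locally_integrable \<Omega> (\<lambda>x. f' x - g' x)"
    by (auto intro: locally_integrable_diff)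
  fix \<phi> :: "plane \<Rightarrow> real" assume \<phi>: "test_function \<Omega> \<phi>"
  let ?D = "iterated_partial (replicate (fst \<alpha>) 1 @ replicate (snd \<alpha>) 2) \<phi>"
  have D: "test_function \<Omega> ?D" by (rule test_function_iterated_partial[OF \<phi>])
  have "(LINT x:\<Omega>|lebesgue. ?D x *\<^sub>R (f x - g x)) = (LINT x:\<Omega>|lebesgue. ?D x *\<^sub>R f x) - (LINT x:\<Omega>|lebesgue. ?D x *\<^sub>R g x)"
    unfolding scaleR_diff_right using test_function_integrable[OF D] li by (intro set_integral_diff) auto
  also have "(LINT x:\<Omega>|lebesgue. ?D x *\<^sub>R f x) = (-1) ^ (fst \<alpha> + snd \<alpha>) *\<^sub>R (LINT x:\<Omega>|lebesgue. \<phi> x *\<^sub>R f' x)"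
    using f \<phi> unfolding has_weak_derivative_def by blast
  also have "(LINT x:\<Omega>|lebesgue. ?D x *\<^sub>R g x) = (-1) ^ (fst \<alpha> + snd \<alpha>) *\<^sub>R (LINT x:\<Omega>|lebesgue. \<phi> x *\<^sub>R g' x)"
    using g \<phi> unfolding has_weak_derivative_def by blast
  also have "(-1) ^ (fst \<alpha> + snd \<alpha>) *\<^sub>R (LINT x:\<Omega>|lebesgue. \<phi> x *\<^sub>R f' x) - (-1) ^ (fst \<alpha> + snd \<alpha>) *\<^sub>R (LINT x:\<Omega>|lebesgue. \<phi> x *\<^sub>R g' x)
     = (-1) ^ (fst \<alpha> + snd \<alpha>) *\<^sub>R (LINT x:\<Omega>|lebesgue. \<phi> x *\<^sub>R (f' x - g' x))"
    unfolding scaleR_diff_right[symmetric] using test_function_integrable[OF \<phi>] li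
    by (subst set_integral_diff(2)[symmetric]) (auto simp: scaleR_diff_right)
  finally show "(LINT x:\<Omega>|lebesgue. ?D x *\<^sub>R (f x - g x)) = (-1) ^ (fst \<alpha> + snd \<alpha>) *\<^sub>R (LINT x:\<Omega>|lebesgue. \<phi> x *\<^sub>R (f' x - g' x))" .
qed

text \<open>A triangle inequality for squares, with factor 2, obtained for each weak derivative
  separately; it serves to bound the norm locally in time.\<close>

lemma sobolev_norm_le_diff:
  fixes f g :: "plane \<Rightarrow> 'a::euclidean_space"
  assumes O: "open \<Omega>" and f: "f \<in> sobolev m \<Omega>" and g: "g \<in> sobolev m \<Omega>"
  shows "(sobolev_norm m \<Omega> f)\<^sup>2 \<le> 2 * (sobolev_norm m \<Omega> (\<lambda>x. f x - g x))\<^sup>2 + 2 * (sobolev_norm m \<Omega> g)\<^sup>2"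
proof -
  let ?I = "\<lambda>f \<alpha>. LINT x:\<Omega>|lebesgue. (norm (weak_derivative \<Omega> \<alpha> f x))\<^sup>2"
  have "?I f \<alpha> \<le> 2 * ?I (\<lambda>x. f x - g x) \<alpha> + 2 * ?I g \<alpha>" if "fst \<alpha> + snd \<alpha> \<le> m" for \<alpha>
  proof -
    let ?f = "weak_derivative \<Omega> \<alpha> f" and ?g = "weak_derivative \<Omega> \<alpha> g" and ?d = "weak_derivative \<Omega> \<alpha> (\<lambda>x. f x - g x)"
    note F = sobolev_weak_derivative[OF O f that] and G = sobolev_weak_derivative[OF O g that]
    have d0: "has_weak_derivative \<Omega> \<alpha> (\<lambda>x. f x - g x) (\<lambda>x. ?f x - ?g x)"
      by (rule has_weak_derivative_diff[OF F(1) G(1)])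
    then have d: "has_weak_derivative \<Omega> \<alpha> (\<lambda>x. f x - g x) ?d"
      unfolding weak_derivative_def by (rule someI[of "has_weak_derivative \<Omega> \<alpha> (\<lambda>x. f x - g x)"])
    have ae: "AE x in lebesgue. x \<in> \<Omega> \<longrightarrow> ?f x - ?g x = ?d x"
      by (rule weak_derivative_unique[OF O d0 d])
    have ineq: "(norm (a::'a))\<^sup>2 \<le> 2 * (norm (a - b))\<^sup>2 + 2 * (norm b)\<^sup>2" for a b
    proof -
      have "(norm a)\<^sup>2 \<le> (norm (a - b) + norm b)\<^sup>2"
        using norm_triangle_ineq[of "a - b" b] by (intro power_mono) auto
      also have "\<dots> \<le> 2 * (norm (a - b))\<^sup>2 + 2 * (norm b)\<^sup>2"
        using sum_squares_bound[of "norm (a - b)" "norm b"] by (simp add: power2_sum)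
      finally show ?thesis .
    qed
    have fm: "set_borel_measurable lebesgue \<Omega> ?f" "set_borel_measurable lebesgue \<Omega> ?g"
      using F(2) G(2) by (auto simp: square_integrable_def)
    have fi: "set_integrable lebesgue \<Omega> (\<lambda>x. (norm (?f x))\<^sup>2)" "set_integrable lebesgue \<Omega> (\<lambda>x. (norm (?g x))\<^sup>2)"
      using F(2) G(2) by (auto simp: square_integrable_def)
    have dm: "set_borel_measurable lebesgue \<Omega> (\<lambda>x. ?f x - ?g x)"
      using fm unfolding set_borel_measurable_def scaleR_diff_right by (rule borel_measurable_diff)
    have dm2: "set_borel_measurable lebesgue \<Omega> (\<lambda>x. (norm (?f x - ?g x))\<^sup>2)"
    proof -
      have "(\<lambda>x. indicator \<Omega> x *\<^sub>R (norm (?f x - ?g x))\<^sup>2) = (\<lambda>x. (norm (indicator \<Omega> x *\<^sub>R (?f x - ?g x)))\<^sup>2)"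
        by (auto simp: indicator_def fun_eq_iff)
      then show ?thesis
        using dm measurable_compose[of "\<lambda>x. indicator \<Omega> x *\<^sub>R (?f x - ?g x)" lebesgue borel "\<lambda>v. (norm v)\<^sup>2" borel]
        unfolding set_borel_measurable_def by simp
    qed
    have di: "set_integrable lebesgue \<Omega> (\<lambda>x. (norm (?f x - ?g x))\<^sup>2)"
    proof (rule set_integrable_bound[OF _ dm2])
      show "set_integrable lebesgue \<Omega> (\<lambda>x. 2 * (norm (?f x))\<^sup>2 + 2 * (norm (?g x))\<^sup>2)"
        using fi by (intro set_integral_add set_integrable_mult_right) auto
      have "(norm (a - b))\<^sup>2 \<le> 2 * (norm a)\<^sup>2 + 2 * (norm b)\<^sup>2" for a b :: 'a
        using ineq[of "a - b" "- b"] by simp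
      then show "AE x in lebesgue. x \<in> \<Omega> \<longrightarrow> norm ((norm (?f x - ?g x))\<^sup>2) \<le> norm (2 * (norm (?f x))\<^sup>2 + 2 * (norm (?g x))\<^sup>2)"
        by (intro AE_I2) (simp add: order_trans[OF _ abs_ge_self])
    qed
    have dsq: "square_integrable \<Omega> (\<lambda>x. ?f x - ?g x)"
      using dm di by (simp add: square_integrable_def)
    have "?I f \<alpha> \<le> (LINT x:\<Omega>|lebesgue. 2 * (norm (?f x - ?g x))\<^sup>2 + 2 * (norm (?g x))\<^sup>2)"
      using di fi by (intro set_integral_mono set_integral_add(1) set_integrable_mult_right ineq) auto
    also have "\<dots> = 2 * (LINT x:\<Omega>|lebesgue. (norm (?f x - ?g x))\<^sup>2) + 2 * ?I g \<alpha>"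
      using di fi by (subst set_integral_add(2)) auto
    also have "(LINT x:\<Omega>|lebesgue. (norm (?f x - ?g x))\<^sup>2) = ?I (\<lambda>x. f x - g x) \<alpha>"
      by (rule square_integrable_cong_AE(2)[OF dsq ae])
    finally show ?thesis .
  qed
  then show ?thesis
    unfolding sobolev_norm_power2 sum_distrib_left sum.distrib[symmetric] by (intro sum_mono) auto
qed

text \<open>Without this bound the supremum in \<open>sobolev_sup_norm\<close> would carry no
  information. Continuity bounds the norm near each time, and finitely many such neighbourhoods
  cover [0,T].\<close>

lemma sobolev_continuous_bdd_above:
  fixes f :: "real \<Rightarrow> plane \<Rightarrow> 'a::euclidean_space"
  assumes O: "open \<Omega>" and f: "sobolev_continuous m \<Omega> T f"
  shows "bdd_above ((\<lambda>t. sobolev_norm m \<Omega> (f t)) ` {0..T})"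
proof -
  let ?N = "\<lambda>t. sobolev_norm m \<Omega> (f t)"
  have "\<exists>d>0. \<forall>s\<in>{0..T}. dist s t < d \<longrightarrow> (?N s)\<^sup>2 \<le> 2 + 2 * (?N t)\<^sup>2" if t: "t \<in> {0..T}" for t
  proof -
    let ?D = "\<lambda>s. sobolev_norm m \<Omega> (\<lambda>x. f s x - f t x)"
    have "(?D \<longlongrightarrow> 0) (at t within {0..T})" using f t by (simp add: sobolev_continuous_def)
    then have "eventually (\<lambda>s. dist (?D s) 0 < 1) (at t within {0..T})" by (rule tendstoD) simp
    then obtain d where d: "d > 0" "\<And>s. s \<in> {0..T} \<Longrightarrow> s \<noteq> t \<Longrightarrow> dist s t < d \<Longrightarrow> dist (?D s) 0 < 1"
      unfolding eventually_at by blast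
    have "(?N s)\<^sup>2 \<le> 2 + 2 * (?N t)\<^sup>2" if s: "s \<in> {0..T}" "dist s t < d" for s
    proof (cases "s = t")
      case True
      have "0 \<le> (?N t)\<^sup>2" by simp
      then show ?thesis unfolding True by linarith
    next
      case False
      then have "?D s < 1" "0 \<le> ?D s" using d(2)[OF s(1) False s(2)] sobolev_norm_nonneg[of m \<Omega> "\<lambda>x. f s x - f t x"] by (auto simp: dist_norm)
      then have "(?D s)\<^sup>2 \<le> 1" by (simp add: power_le_one)
      moreover have "(?N s)\<^sup>2 \<le> 2 * (?D s)\<^sup>2 + 2 * (?N t)\<^sup>2"
        by (rule sobolev_norm_le_diff[OF O]) (use f s t in \<open>auto simp: sobolev_continuous_def\<close>)
      ultimately show ?thesis by linarith
    qed
    with d(1) show ?thesis by blast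
  qed
  then obtain d where d: "\<And>t. t \<in> {0..T} \<Longrightarrow> d t > 0"
    "\<And>t s. t \<in> {0..T} \<Longrightarrow> s \<in> {0..T} \<Longrightarrow> dist s t < d t \<Longrightarrow> (?N s)\<^sup>2 \<le> 2 + 2 * (?N t)\<^sup>2"
    by metis
  have cov: "{0..T} \<subseteq> (\<Union>t\<in>{0..T}. ball t (d t))" using d(1) by force
  obtain C where C: "C \<subseteq> {0..T}" "finite C" "{0..T} \<subseteq> (\<Union>t\<in>C. ball t (d t))"
    by (rule compactE_image[OF compact_Icc _ cov]) auto
  have "?N s \<le> 2 + 2 * (\<Sum>t\<in>C. (?N t)\<^sup>2)" if s: "s \<in> {0..T}" for s
  proof -
    obtain t where t: "t \<in> C" "s \<in> ball t (d t)" using C(3) s by blast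
    have "(?N s)\<^sup>2 \<le> 2 + 2 * (?N t)\<^sup>2"
      by (rule d(2)) (use t C s in \<open>auto simp: dist_commute\<close>)
    moreover have "(?N t)\<^sup>2 \<le> (\<Sum>t\<in>C. (?N t)\<^sup>2)"
      by (rule member_le_sum[where f = "\<lambda>t. (?N t)\<^sup>2"]) (use t C in auto)
    ultimately have a: "(?N s)\<^sup>2 \<le> 2 + 2 * (\<Sum>t\<in>C. (?N t)\<^sup>2)" (is "_ \<le> ?B") by linarith
    have "0 \<le> (\<Sum>t\<in>C. (?N t)\<^sup>2)" by (intro sum_nonneg) simp
    then have "1 \<le> ?B" by linarith
    \<comment> \<open>The additive 2 makes the bound at least 1, so it may be replaced by its square
      and the squares removed.\<close>
    then have "?B \<le> ?B\<^sup>2" by (simp add: self_le_power)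
    with a have "(?N s)\<^sup>2 \<le> ?B\<^sup>2" by linarith
    then show ?thesis by (rule power2_le_imp_le) (use \<open>1 \<le> ?B\<close> in linarith)
  qed
  then show ?thesis by (rule bdd_aboveI2)
qed

lemma sobolev_sup_norm_upper:
  fixes f :: "real \<Rightarrow> plane \<Rightarrow> 'a::euclidean_space"
  assumes "open \<Omega>" "sobolev_continuous m \<Omega> T f" "t \<in> {0..T}"
  shows "sobolev_norm m \<Omega> (f t) \<le> sobolev_sup_norm m \<Omega> T f"
  unfolding sobolev_sup_norm_def
  by (rule cSUP_upper[OF assms(3) sobolev_continuous_bdd_above[OF assms(1,2)]])

section \<open>Mollification\<close>

definition diag :: "real \<Rightarrow> plane" where "diag r = (\<chi> i. r)"

lemma diag_nth [simp]: "diag r $ i = r"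
  by (simp add: diag_def)

lemma count_list_replicate: "count_list (replicate n x) y = (if x = y then n else 0)"
  by (induction n) auto

definition mollifier :: "real \<Rightarrow> plane \<Rightarrow> real" where
  "mollifier r y = pbump 1 (- diag r) (diag r) y / (LINT z|lborel. pbump 1 (- diag r) (diag r) z)"

text \<open>A jet above the mollifier is only known to exist, so one is fixed by choice. Its entries
  are determined nevertheless, being the partial derivatives of \<open>mollifier r\<close>.\<close>

definition mollifier_jet :: "real \<Rightarrow> nat \<Rightarrow> nat \<Rightarrow> plane \<Rightarrow> real" where
  "mollifier_jet r = (SOME \<Phi>. jet \<Phi> \<and> \<Phi> 0 0 = mollifier r)"

lemma mollifier_jet: "jet (mollifier_jet r)" "mollifier_jet r 0 0 = mollifier r"
proof -
  obtain \<Phi> where \<Phi>: "jet \<Phi>" "\<Phi> 0 0 = pbump 1 (- diag r) (diag r)" by (rule pbump_jet)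
  let ?c = "inverse (LINT z|lborel. pbump 1 (- diag r) (diag r) z)"
  have "jet (\<lambda>k l x. ?c * \<Phi> k l x) \<and> (\<lambda>k l x. ?c * \<Phi> k l x) 0 0 = mollifier r"
    using jet_cmult[OF \<Phi>(1), of ?c] by (simp add: \<Phi>(2) fun_eq_iff mollifier_def divide_inverse mult.commute)
  then have "jet (mollifier_jet r) \<and> mollifier_jet r 0 0 = mollifier r"
    unfolding mollifier_jet_def by (rule someI[of "\<lambda>\<Phi>. jet \<Phi> \<and> \<Phi> 0 0 = mollifier r"])
  then show "jet (mollifier_jet r)" "mollifier_jet r 0 0 = mollifier r" by auto
qed

lemma pbump_integrable: "integrable lborel (pbump c a b)" if "c \<ge> 0"
proof (rule Bochner_Integration.integrable_bound)
  show "integrable lborel (indicator (cbox a b) :: plane \<Rightarrow> real)"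
    by (rule integrable_real_indicator) (use emeasure_lborel_cbox_finite[of a b] in auto)
  have "norm (pbump c a b x) \<le> norm (indicator (cbox a b) x :: real)" for x
    using pbump_eq_0[OF that, of x a b] pbump_bounds[of c a b x] box_subset_cbox[of a b]
    by (cases "x \<in> cbox a b") auto
  then show "AE x in lborel. norm (pbump c a b x) \<le> norm (indicator (cbox a b) x :: real)" by simp
qed simp

text \<open>A nonnegative function with zero integral vanishes almost everywhere, but the bump is
  positive on a box of positive measure.\<close>

lemma mollifier_mass_pos:
  assumes "r > 0"
  shows "(LINT z|lborel. pbump 1 (- diag r) (diag r) z) > 0"
proof -
  let ?p = "pbump 1 (- diag r) (diag r)"
  have "(LINT z|lborel. ?p z) \<ge> 0" using pbump_bounds by (simp add: integral_nonneg)
  moreover have "(LINT z|lborel. ?p z) \<noteq> 0"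
  proof
    assume "(LINT z|lborel. ?p z) = 0"
    then have "AE z in lborel. ?p z = 0"
      using integral_nonneg_eq_0_iff_AE[OF pbump_integrable[of 1 "- diag r" "diag r"]] pbump_bounds(1) by simp
    then have "AE z in lborel. z \<notin> box (- diag r) (diag r)"
      by eventually_elim (metis less_irrefl pbump_pos_iff zero_less_one)
    then have "emeasure lborel (box (- diag r) (diag r)) = 0"
      by (subst (asm) AE_iff_measurable[of "box (- diag r) (diag r)"]) auto
    moreover have "emeasure lborel (box (- diag r) (diag r)) = ennreal (\<Prod>b\<in>Basis. (diag r - (- diag r)) \<bullet> b)"
      by (rule emeasure_lborel_box) (use assms in \<open>auto simp: Basis_vec_def inner_axis\<close>)
    moreover have "(\<Prod>b\<in>Basis. (diag r - (- diag r)) \<bullet> b) > 0"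
      by (rule prod_pos) (use assms in \<open>auto simp: Basis_vec_def inner_axis\<close>)
    ultimately show False by (simp only: ennreal_eq_0_iff)
  qed
  ultimately show ?thesis by linarith
qed

lemma mollifier_nonneg: "r > 0 \<Longrightarrow> 0 \<le> mollifier r y"
  unfolding mollifier_def by (intro divide_nonneg_pos pbump_bounds mollifier_mass_pos)

lemma mollifier_eq_0: "y \<notin> box (- diag r) (diag r) \<Longrightarrow> mollifier r y = 0"
  by (simp add: mollifier_def pbump_eq_0)

lemma mollifier_integrable: "integrable lborel (mollifier r)"
  unfolding mollifier_def by (simp add: pbump_integrable)

lemma mollifier_measurable [measurable]: "mollifier r \<in> borel_measurable borel"
  unfolding mollifier_def by simp

lemma mollifier_integral: "r > 0 \<Longrightarrow> (LINT y|lborel. mollifier r y) = 1"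
  using mollifier_mass_pos[of r] unfolding mollifier_def by simp

lemma mollifier_jet_eq_0:
  assumes "y \<notin> cbox (- diag r) (diag r)"
  shows "mollifier_jet r k l y = 0"
proof -
  have sub: "closure {x. mollifier r x \<noteq> 0} \<subseteq> cbox (- diag r) (diag r)"
    by (rule closure_minimal[OF _ closed_cbox]) (use mollifier_eq_0[of _ r] box_subset_cbox in blast)
  have "mollifier_jet r k l = iterated_partial (replicate k 1 @ replicate l 2) (mollifier_jet r 0 0)"
    unfolding iterated_partial_jet[OF mollifier_jet(1)] by (simp add: count_list_replicate)
  moreover have "iterated_partial (replicate k 1 @ replicate l 2) (mollifier_jet r 0 0) y = 0"
    unfolding mollifier_jet(2) by (rule iterated_partial_support) (use assms sub in blast)
  ultimately show ?thesis by metis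
qed

lemma mollifier_jet_continuous: "continuous_on S (mollifier_jet r k l)"
  by (rule jet_continuous_on[OF mollifier_jet(1)])

lemma mollifier_jet_bounded: "\<exists>M>0. \<forall>y. \<bar>mollifier_jet r k l y\<bar> \<le> M"
proof -
  have "bounded (mollifier_jet r k l ` cbox (- diag r) (diag r))"
    by (intro compact_imp_bounded compact_continuous_image mollifier_jet_continuous compact_cbox)
  then obtain B where B: "B > 0" "\<forall>z\<in>mollifier_jet r k l ` cbox (- diag r) (diag r). norm z \<le> B"
    unfolding bounded_pos by blast
  have "\<bar>mollifier_jet r k l y\<bar> \<le> B" for y
    using B mollifier_jet_eq_0[of y r k l] by (cases "y \<in> cbox (- diag r) (diag r)") auto
  with B(1) show ?thesis by blast
qed

lemma set_integrable_scaleR_continuous: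
  fixes f :: "plane \<Rightarrow> 'a::euclidean_space" and g :: "plane \<Rightarrow> real"
  assumes f: "set_integrable lebesgue \<Omega> f" and g: "continuous_on UNIV g" and B: "\<And>y. \<bar>g y\<bar> \<le> B"
  shows "set_integrable lebesgue \<Omega> (\<lambda>y. g y *\<^sub>R f y)"
proof -
  have i: "integrable lebesgue (\<lambda>x. indicator \<Omega> x *\<^sub>R f x)"
    using f by (simp add: set_integrable_def)
  have "g \<in> borel_measurable borel" using g by (rule borel_measurable_continuous_onI)
  then have [measurable]: "g \<in> borel_measurable lebesgue" by (intro measurable_completion) simp
  have [measurable]: "(\<lambda>x. indicator \<Omega> x *\<^sub>R f x) \<in> borel_measurable lebesgue" using i by auto
  have eq: "(\<lambda>x. indicator \<Omega> x *\<^sub>R (g x *\<^sub>R f x)) = (\<lambda>x. g x *\<^sub>R (indicator \<Omega> x *\<^sub>R f x))"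
    by (auto simp: indicator_def fun_eq_iff)
  have "integrable lebesgue (\<lambda>x. g x *\<^sub>R (indicator \<Omega> x *\<^sub>R f x))"
  proof (rule Bochner_Integration.integrable_bound)
    show "integrable lebesgue (\<lambda>x. B *\<^sub>R (indicator \<Omega> x *\<^sub>R f x))"
      by (rule integrable_scaleR_right[OF i])
    show "(\<lambda>x. g x *\<^sub>R (indicator \<Omega> x *\<^sub>R f x)) \<in> borel_measurable lebesgue" by measurable
    show "AE x in lebesgue. norm (g x *\<^sub>R (indicator \<Omega> x *\<^sub>R f x)) \<le> norm (B *\<^sub>R (indicator \<Omega> x *\<^sub>R f x))"
    proof (rule AE_I2)
      fix x
      have "\<bar>g x\<bar> \<le> \<bar>B\<bar>" using B[of x] by linarith
      then show "norm (g x *\<^sub>R (indicator \<Omega> x *\<^sub>R f x)) \<le> norm (B *\<^sub>R (indicator \<Omega> x *\<^sub>R f x))"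
        by (simp only: norm_scaleR) (intro mult_right_mono; simp)
    qed
  qed
  then show ?thesis unfolding set_integrable_def eq .
qed

text \<open>All derivatives sit on the kernel, so f need only be integrable. They can be moved to f
  only at points where the support of the kernel fits into \<Omega>.\<close>

definition mollify :: "real \<Rightarrow> nat \<Rightarrow> nat \<Rightarrow> plane set \<Rightarrow> (plane \<Rightarrow> 'a::euclidean_space) \<Rightarrow> plane \<Rightarrow> 'a" where
  "mollify r k l \<Omega> f x = (LINT y:\<Omega>|lebesgue. mollifier_jet r k l (x - y) *\<^sub>R f y)"

lemma mollify_integrable:
  fixes f :: "plane \<Rightarrow> 'a::euclidean_space"
  assumes "set_integrable lebesgue \<Omega> f"
  shows "set_integrable lebesgue \<Omega> (\<lambda>y. mollifier_jet r k l (x - y) *\<^sub>R f y)"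
proof -
  obtain M where M: "M > 0" "\<And>y. \<bar>mollifier_jet r k l y\<bar> \<le> M" using mollifier_jet_bounded[of r k l] by blast
  have "continuous_on UNIV (\<lambda>y. mollifier_jet r k l (x - y))"
    by (rule continuous_on_compose2[OF mollifier_jet_continuous[of UNIV]]) (auto intro!: continuous_intros)
  then show ?thesis by (rule set_integrable_scaleR_continuous[OF assms]) (rule M(2))
qed

text \<open>The reflected kernel is a test function as soon as its square lies in \<Omega>. The sign
  from the reflection and the sign in the definition of the weak derivative cancel.\<close>

lemma mollify_weak_derivative:
  fixes f :: "plane \<Rightarrow> 'a::euclidean_space"
  assumes f: "has_weak_derivative \<Omega> (k, l) f D" and sub: "cbox (x - diag r) (x + diag r) \<subseteq> \<Omega>"
  shows "mollify r k l \<Omega> f x = mollify r 0 0 \<Omega> D x"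
proof -
  define \<Psi> where "\<Psi> = (\<lambda>k l y. (-1) ^ (k + l) * mollifier_jet r k l (x - y))"
  have j: "jet \<Psi>" unfolding \<Psi>_def by (rule jet_reflect[OF mollifier_jet(1)])
  have "\<Psi> 0 0 y = 0" if "y \<notin> cbox (x - diag r) (x + diag r)" for y
  proof -
    have "x - y \<notin> cbox (- diag r) (diag r)" using that by (auto simp: mem_cbox_plane)
    then show ?thesis by (simp add: \<Psi>_def mollifier_jet_eq_0)
  qed
  then have t: "test_function \<Omega> (\<Psi> 0 0)" by (rule jet_test_function[OF j _ sub])
  have "iterated_partial (replicate k 1 @ replicate l 2) (\<Psi> 0 0) = \<Psi> k l"
    unfolding iterated_partial_jet[OF j] by (simp add: count_list_replicate)
  then have "(LINT y:\<Omega>|lebesgue. \<Psi> k l y *\<^sub>R f y) = (-1) ^ (k + l) *\<^sub>R (LINT y:\<Omega>|lebesgue. \<Psi> 0 0 y *\<^sub>R D y)"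
    using f t unfolding has_weak_derivative_def by auto
  then have "(-1) ^ (k + l) *\<^sub>R mollify r k l \<Omega> f x = (-1) ^ (k + l) *\<^sub>R mollify r 0 0 \<Omega> D x"
    unfolding mollify_def \<Psi>_def by (simp flip: scaleR_scaleR)
  then show ?thesis by simp
qed

text \<open>The remainder bound is uniform in the base point, so it can be integrated against |f|.
  Each of the two first derivatives is Lipschitz with constant 2 M, whence 4 M.\<close>

lemma jet_taylor1:
  assumes j: "jet \<Phi>" and M: "\<And>y. \<bar>\<Phi> (Suc (Suc k)) l y\<bar> \<le> M" "\<And>y. \<bar>\<Phi> (Suc k) (Suc l) y\<bar> \<le> M"
    "\<And>y. \<bar>\<Phi> k (Suc (Suc l)) y\<bar> \<le> M"
  shows "\<bar>\<Phi> k l (x + h) - \<Phi> k l x - (h$1 * \<Phi> (Suc k) l x + h$2 * \<Phi> k (Suc l) x)\<bar> \<le> 4 * M * (norm h)\<^sup>2"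
proof -
  have lin: "\<bar>h$1 * a + h$2 * b\<bar> \<le> (\<bar>a\<bar> + \<bar>b\<bar>) * norm h" for h :: plane and a b
  proof -
    have "\<bar>h$1 * a + h$2 * b\<bar> \<le> \<bar>h$1\<bar> * \<bar>a\<bar> + \<bar>h$2\<bar> * \<bar>b\<bar>"
      using abs_triangle_ineq[of "h$1 * a" "h$2 * b"] by (simp add: abs_mult)
    also have "\<dots> \<le> norm h * \<bar>a\<bar> + norm h * \<bar>b\<bar>"
      by (intro add_mono mult_right_mono component_le_norm_cart) auto
    finally show ?thesis by (simp add: algebra_simps)
  qed
  have Lip: "\<bar>\<Phi> m n y - \<Phi> m n x\<bar> \<le> 2 * M * norm (y - x)"
    if "\<And>y. \<bar>\<Phi> (Suc m) n y\<bar> \<le> M" "\<And>y. \<bar>\<Phi> m (Suc n) y\<bar> \<le> M" for m n y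
  proof -
    have "norm (\<Phi> m n y - \<Phi> m n x) \<le> 2 * M * norm (y - x)"
    proof (rule differentiable_bound[of UNIV _ "\<lambda>z (h::plane). h$1 * \<Phi> (Suc m) n z + h$2 * \<Phi> m (Suc n) z"])
      fix z
      show "(\<Phi> m n has_derivative (\<lambda>h. h$1 * \<Phi> (Suc m) n z + h$2 * \<Phi> m (Suc n) z)) (at z within UNIV)"
        using jetD[OF j] by simp
      have b: "norm (v$1 * \<Phi> (Suc m) n z + v$2 * \<Phi> m (Suc n) z) \<le> 2 * M * norm v" for v :: plane
      proof -
        have "\<bar>v$1 * \<Phi> (Suc m) n z + v$2 * \<Phi> m (Suc n) z\<bar> \<le> (\<bar>\<Phi> (Suc m) n z\<bar> + \<bar>\<Phi> m (Suc n) z\<bar>) * norm v"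
          by (rule lin)
        also have "\<dots> \<le> (2 * M) * norm v"
          using that(1)[of z] that(2)[of z] by (intro mult_right_mono) auto
        finally show ?thesis by simp
      qed
      show "onorm (\<lambda>h::plane. h$1 * \<Phi> (Suc m) n z + h$2 * \<Phi> m (Suc n) z) \<le> 2 * M"
        by (rule onorm_bound[OF _ b]) (use that(1)[of x] in linarith)
    qed auto
    then show ?thesis by simp
  qed
  define L where "L h = h$1 * \<Phi> (Suc k) l x + h$2 * \<Phi> k (Suc l) x" for h :: plane
  have "norm ((\<Phi> k l (x + h) - L (x + h)) - (\<Phi> k l x - L x)) \<le> (4 * M * norm h) * norm (x + h - x)"
  proof (rule differentiable_bound[of "cball x (norm h)" _ "\<lambda>z (v::plane). v$1 * (\<Phi> (Suc k) l z - \<Phi> (Suc k) l x) + v$2 * (\<Phi> k (Suc l) z - \<Phi> k (Suc l) x)"])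
    fix z assume z: "z \<in> cball x (norm h)"
    let ?D = "\<lambda>v::plane. v$1 * (\<Phi> (Suc k) l z - \<Phi> (Suc k) l x) + v$2 * (\<Phi> k (Suc l) z - \<Phi> k (Suc l) x)"
    have L: "(L has_derivative L) (at z within cball x (norm h))"
      unfolding L_def by (intro bounded_linear_imp_has_derivative bounded_linear_add
          bounded_linear_mult_left[THEN bounded_linear_compose] bounded_linear_vec_nth)
    show "((\<lambda>y. \<Phi> k l y - L y) has_derivative ?D) (at z within cball x (norm h))"
      by (rule has_derivative_eq_rhs[OF has_derivative_diff[OF has_derivative_at_withinI[OF jetD[OF j]] L]])
        (auto simp: L_def algebra_simps)
    have M0: "0 \<le> M" using M(1)[of x] by linarith
    have nz: "norm (z - x) \<le> norm h" using z by (simp add: dist_norm norm_minus_commute)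
    show "onorm ?D \<le> 4 * M * norm h"
    proof (rule onorm_bound)
      show "0 \<le> 4 * M * norm h" using M0 by simp
      fix v :: plane
      have "\<bar>?D v\<bar> \<le> (\<bar>\<Phi> (Suc k) l z - \<Phi> (Suc k) l x\<bar> + \<bar>\<Phi> k (Suc l) z - \<Phi> k (Suc l) x\<bar>) * norm v"
        by (rule lin)
      also have "\<dots> \<le> (2 * M * norm (z - x) + 2 * M * norm (z - x)) * norm v"
        by (intro mult_right_mono add_mono Lip M) simp
      also have "\<dots> \<le> (2 * M * norm h + 2 * M * norm h) * norm v"
        using nz M0 by (intro mult_right_mono add_mono mult_left_mono) auto
      finally show "norm (?D v) \<le> 4 * M * norm h * norm v" by (simp add: algebra_simps)
    qed
  qed (auto simp: dist_norm)
  moreover have "L (x + h) = L x + L h" by (simp add: L_def algebra_simps)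
  ultimately have "\<bar>\<Phi> k l (x + h) - \<Phi> k l x - L h\<bar> \<le> 4 * M * norm h * norm h"
    by (simp add: algebra_simps)
  then show ?thesis by (simp add: L_def power2_eq_square mult.assoc)
qed

text \<open>The uniform Taylor remainder of the kernel is integrated against |f|. This
  differentiates under the integral with an explicit quadratic error.\<close>

lemma mollify_has_derivative:
  fixes f :: "plane \<Rightarrow> 'a::euclidean_space"
  assumes f: "set_integrable lebesgue \<Omega> f"
  shows "(mollify r k l \<Omega> f has_derivative
      (\<lambda>h. h$1 *\<^sub>R mollify r (Suc k) l \<Omega> f x + h$2 *\<^sub>R mollify r k (Suc l) \<Omega> f x)) (at x)"
proof -
  obtain M1 where M1: "M1 > 0" "\<And>y. \<bar>mollifier_jet r (Suc (Suc k)) l y\<bar> \<le> M1" using mollifier_jet_bounded[of r "Suc (Suc k)" l] by blast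
  obtain M2 where M2: "M2 > 0" "\<And>y. \<bar>mollifier_jet r (Suc k) (Suc l) y\<bar> \<le> M2" using mollifier_jet_bounded[of r "Suc k" "Suc l"] by blast
  obtain M3 where M3: "M3 > 0" "\<And>y. \<bar>mollifier_jet r k (Suc (Suc l)) y\<bar> \<le> M3" using mollifier_jet_bounded[of r k "Suc (Suc l)"] by blast
  define M where "M = M1 + M2 + M3"
  have M: "\<bar>mollifier_jet r (Suc (Suc k)) l y\<bar> \<le> M" "\<bar>mollifier_jet r (Suc k) (Suc l) y\<bar> \<le> M" "\<bar>mollifier_jet r k (Suc (Suc l)) y\<bar> \<le> M" for y
    using M1(1) M2(1) M3(1) M1(2)[of y] M2(2)[of y] M3(2)[of y] unfolding M_def by linarith+
  define I where "I = (LINT y:\<Omega>|lebesgue. norm (f y))"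
  let ?D = "\<lambda>h. h$1 *\<^sub>R mollify r (Suc k) l \<Omega> f x + h$2 *\<^sub>R mollify r k (Suc l) \<Omega> f x"
  note i = mollify_integrable[OF f]
  have si: "set_integrable lebesgue \<Omega> (\<lambda>y. c *\<^sub>R (mollifier_jet r k l (x - y) *\<^sub>R f y))" for c r k l x
    by (intro set_integrable_scaleR_right i)
  have bd: "norm (mollify r k l \<Omega> f (x + h) - mollify r k l \<Omega> f x - ?D h) \<le> 4 * M * I * (norm h)\<^sup>2" for h
  proof -
    let ?e = "\<lambda>y. mollifier_jet r k l (x + h - y) - mollifier_jet r k l (x - y)
        - (h$1 * mollifier_jet r (Suc k) l (x - y) + h$2 * mollifier_jet r k (Suc l) (x - y))"
    have "mollify r k l \<Omega> f (x + h) - mollify r k l \<Omega> f x - ?D h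
      = (LINT y:\<Omega>|lebesgue. mollifier_jet r k l (x + h - y) *\<^sub>R f y - mollifier_jet r k l (x - y) *\<^sub>R f y
        - (h$1 *\<^sub>R (mollifier_jet r (Suc k) l (x - y) *\<^sub>R f y) + h$2 *\<^sub>R (mollifier_jet r k (Suc l) (x - y) *\<^sub>R f y)))"
      unfolding mollify_def
      by (simp only: set_integral_diff(2)[OF set_integral_diff(1)[OF i i] set_integral_add(1)[OF si si]]
          set_integral_diff(2)[OF i i] set_integral_add(2)[OF si si] set_integral_scaleR_right)
    also have "\<dots> = (LINT y:\<Omega>|lebesgue. ?e y *\<^sub>R f y)"
      by (simp add: algebra_simps)
    finally have eq: "mollify r k l \<Omega> f (x + h) - mollify r k l \<Omega> f x - ?D h = (LINT y:\<Omega>|lebesgue. ?e y *\<^sub>R f y)" .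
    have ei: "set_integrable lebesgue \<Omega> (\<lambda>y. ?e y *\<^sub>R f y)"
    proof -
      have "set_integrable lebesgue \<Omega> (\<lambda>y. mollifier_jet r k l (x + h - y) *\<^sub>R f y - mollifier_jet r k l (x - y) *\<^sub>R f y
        - (h$1 *\<^sub>R (mollifier_jet r (Suc k) l (x - y) *\<^sub>R f y) + h$2 *\<^sub>R (mollifier_jet r k (Suc l) (x - y) *\<^sub>R f y)))"
        by (intro set_integral_diff(1) set_integral_add(1) set_integrable_scaleR_right i)
      then show ?thesis by (simp add: algebra_simps)
    qed
    have "norm (LINT y:\<Omega>|lebesgue. ?e y *\<^sub>R f y) \<le> (LINT y:\<Omega>|lebesgue. norm (?e y *\<^sub>R f y))"
      by (rule set_integral_norm_bound[OF ei])
    also have "\<dots> \<le> (LINT y:\<Omega>|lebesgue. (4 * M * (norm h)\<^sup>2) * norm (f y))"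
    proof (rule set_integral_mono)
      show "set_integrable lebesgue \<Omega> (\<lambda>y. norm (?e y *\<^sub>R f y))" by (rule set_integrable_norm[OF ei])
      show "set_integrable lebesgue \<Omega> (\<lambda>y. (4 * M * (norm h)\<^sup>2) * norm (f y))"
        using set_integrable_norm[OF f] by (rule set_integrable_mult_right)
      fix y
      have "\<bar>?e y\<bar> \<le> 4 * M * (norm h)\<^sup>2"
        using jet_taylor1[OF mollifier_jet(1) M, of "x - y" h] by (simp add: algebra_simps)
      then show "norm (?e y *\<^sub>R f y) \<le> (4 * M * (norm h)\<^sup>2) * norm (f y)"
        unfolding norm_scaleR by (rule mult_right_mono) simp
    qed
    also have "\<dots> = 4 * M * I * (norm h)\<^sup>2" by (simp add: I_def)
    finally show ?thesis unfolding eq .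
  qed
  show ?thesis
    unfolding has_derivative_at
  proof
    show "bounded_linear ?D"
      by (intro bounded_linear_add bounded_linear_scaleR_left[THEN bounded_linear_compose] bounded_linear_vec_nth)
    show "(\<lambda>h. norm (mollify r k l \<Omega> f (x + h) - mollify r k l \<Omega> f x - ?D h) / norm h) \<midarrow>0\<rightarrow> 0"
    proof (rule tendsto_sandwich[OF _ _ tendsto_const])
      have "((\<lambda>h::plane. 4 * M * I * norm h) \<longlongrightarrow> 4 * M * I * norm (0::plane)) (at 0)"
        by (intro tendsto_intros)
      then show "((\<lambda>h::plane. 4 * M * I * norm h) \<longlongrightarrow> 0) (at 0)" by simp
      show "\<forall>\<^sub>F h in at 0. norm (mollify r k l \<Omega> f (x + h) - mollify r k l \<Omega> f x - ?D h) / norm h \<le> 4 * M * I * norm h"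
        unfolding eventually_at_filter
      proof (intro always_eventually allI impI)
        fix h :: plane assume "h \<noteq> 0"
        then show "norm (mollify r k l \<Omega> f (x + h) - mollify r k l \<Omega> f x - ?D h) / norm h \<le> 4 * M * I * norm h"
          using bd[of h] by (simp add: divide_le_eq power2_eq_square mult.assoc)
      qed
    qed auto
  qed
qed

text \<open>Lebesgue measure is invariant under the reflection y -> x - y.\<close>

lemma mollifier_reflect: "integrable lborel (\<lambda>y. mollifier r (x - y))" "(LINT y|lborel. mollifier r (x - y)) = (LINT y|lborel. mollifier r y)"
proof -
  have m: "(\<lambda>y::plane. x + (-1) *\<^sub>R y) \<in> borel_measurable borel" by measurable
  have "lborel = density (distr lborel borel (\<lambda>y::plane. x + (-1) *\<^sub>R y)) (\<lambda>_. \<bar>-1::real\<bar> ^ DIM(plane))"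
    by (rule lborel_affine) simp
  then have L: "distr lborel borel (\<lambda>y::plane. x + (-1) *\<^sub>R y) = lborel"
    by (simp add: density_1)
  have "integrable (distr lborel borel (\<lambda>y::plane. x + (-1) *\<^sub>R y)) (mollifier r)"
    unfolding L by (rule mollifier_integrable)
  then show "integrable lborel (\<lambda>y. mollifier r (x - y))"
    by (subst (asm) integrable_distr_eq) auto
  show "(LINT y|lborel. mollifier r (x - y)) = (LINT y|lborel. mollifier r y)"
    by (subst (2) L[symmetric], subst integral_distr) auto
qed

lemma mollifier_set_integral:
  assumes r: "r > 0" and sub: "cbox (x - diag r) (x + diag r) \<subseteq> \<Omega>"
  shows "set_integrable lebesgue \<Omega> (\<lambda>y. mollifier r (x - y))" "(LINT y:\<Omega>|lebesgue. mollifier r (x - y)) = 1"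
proof -
  have "mollifier r (x - y) = 0" if "y \<notin> \<Omega>" for y
  proof -
    have "x - y \<notin> cbox (- diag r) (diag r)" using that sub by (auto simp: mem_cbox_plane subset_iff)
    then show ?thesis using mollifier_eq_0 box_subset_cbox by blast
  qed
  then have eq: "(\<lambda>y. indicator \<Omega> y *\<^sub>R mollifier r (x - y)) = (\<lambda>y. mollifier r (x - y))"
    by (auto simp: indicator_def fun_eq_iff)
  have m: "(\<lambda>y. mollifier r (x - y)) \<in> lborel \<rightarrow>\<^sub>M borel" by measurable
  show "set_integrable lebesgue \<Omega> (\<lambda>y. mollifier r (x - y))"
    unfolding set_integrable_def eq integrable_completion[OF m] by (rule mollifier_reflect)
  show "(LINT y:\<Omega>|lebesgue. mollifier r (x - y)) = 1"
    unfolding set_lebesgue_integral_def eq integral_completion[OF m] mollifier_reflect(2)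
    by (rule mollifier_integral[OF r])
qed

text \<open>The kernel is a probability density on the small square, so the mollified value is an
  average of values of f there.\<close>

lemma mollify_approx:
  fixes f :: "plane \<Rightarrow> 'a::euclidean_space"
  assumes r: "r > 0" and sub: "cbox (x - diag r) (x + diag r) \<subseteq> \<Omega>"
    and f: "set_integrable lebesgue \<Omega> f"
    and e: "\<And>y. y \<in> cbox (x - diag r) (x + diag r) \<Longrightarrow> norm (f y - c) \<le> e"
  shows "norm (mollify r 0 0 \<Omega> f x - c) \<le> e"
proof -
  note k = mollifier_set_integral[OF r sub]
  have kc: "set_integrable lebesgue \<Omega> (\<lambda>y. mollifier r (x - y) *\<^sub>R c)"
    using k(1) integrable_scaleR_left[of c lebesgue "\<lambda>y. indicator \<Omega> y *\<^sub>R mollifier r (x - y)"]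
    by (simp add: set_integrable_def)
  have kv: "(LINT y:\<Omega>|lebesgue. mollifier r (x - y) *\<^sub>R c) = c"
    using k integral_scaleR_left[of c lebesgue "\<lambda>y. indicator \<Omega> y *\<^sub>R mollifier r (x - y)"]
    by (simp add: set_integrable_def set_lebesgue_integral_def)
  have fi: "set_integrable lebesgue \<Omega> (\<lambda>y. mollifier r (x - y) *\<^sub>R f y)"
    using mollify_integrable[OF f, of r 0 0 x] by (simp add: mollifier_jet)
  have di: "set_integrable lebesgue \<Omega> (\<lambda>y. mollifier r (x - y) *\<^sub>R (f y - c))"
    using set_integral_diff(1)[OF fi kc] by (simp add: scaleR_diff_right)
  have "mollify r 0 0 \<Omega> f x - c = (LINT y:\<Omega>|lebesgue. mollifier r (x - y) *\<^sub>R f y) - (LINT y:\<Omega>|lebesgue. mollifier r (x - y) *\<^sub>R c)"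
    by (simp add: mollify_def mollifier_jet kv)
  also have "\<dots> = (LINT y:\<Omega>|lebesgue. mollifier r (x - y) *\<^sub>R (f y - c))"
    using set_integral_diff(2)[OF fi kc] by (simp add: scaleR_diff_right)
  also have "norm \<dots> \<le> (LINT y:\<Omega>|lebesgue. norm (mollifier r (x - y) *\<^sub>R (f y - c)))"
    by (rule set_integral_norm_bound[OF di])
  also have "\<dots> \<le> (LINT y:\<Omega>|lebesgue. e * mollifier r (x - y))"
  proof (rule set_integral_mono[OF set_integrable_norm[OF di]])
    show "set_integrable lebesgue \<Omega> (\<lambda>y. e * mollifier r (x - y))" using k(1) by simp
    fix y
    show "norm (mollifier r (x - y) *\<^sub>R (f y - c)) \<le> e * mollifier r (x - y)"
    proof (cases "y \<in> cbox (x - diag r) (x + diag r)")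
      case True
      then show ?thesis using e[OF True] mollifier_nonneg[OF r, of "x - y"]
        by (simp add: mult.commute[of e] mult_left_mono)
    next
      case False
      then have "x - y \<notin> box (- diag r) (diag r)" by (auto simp: mem_cbox_plane mem_box_plane)
      then show ?thesis by (simp add: mollifier_eq_0)
    qed
  qed
  also have "\<dots> = e" using k(2) by simp
  finally show ?thesis .
qed

section \<open>A Sobolev inequality on convex sets\<close>

text \<open>Tonelli together with one-dimensional affine substitutions. For w2 nonzero the
  determinant factors as \<delta> w2; for w2 = 0 both v2 and w1 are nonzero and the coordinates are
  substituted in the other order.\<close>

lemma nn_integral_affine_2d:
  fixes K :: "real \<Rightarrow> real \<Rightarrow> ennreal"
  assumes K: "(\<lambda>p. K (fst p) (snd p)) \<in> borel_measurable (borel \<Otimes>\<^sub>M borel)" and det: "v1 * w2 - v2 * w1 \<noteq> 0"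
  shows "ennreal \<bar>v1 * w2 - v2 * w1\<bar> * (\<integral>\<^sup>+s. \<integral>\<^sup>+t. K (z1 + s * v1 + t * w1) (z2 + s * v2 + t * w2) \<partial>lborel \<partial>lborel)
     = (\<integral>\<^sup>+a. \<integral>\<^sup>+b. K a b \<partial>lborel \<partial>lborel)"
proof -
  have Km: "(\<lambda>x. K (f x) (g x)) \<in> borel_measurable M"
    if "f \<in> borel_measurable M" "g \<in> borel_measurable M" for f g and M :: "'b measure"
    using measurable_compose[OF measurable_Pair[OF that] K] by simp
  have swap: "(\<integral>\<^sup>+s. \<integral>\<^sup>+t. K (f s t) (g s t) \<partial>lborel \<partial>lborel) = (\<integral>\<^sup>+t. \<integral>\<^sup>+s. K (f s t) (g s t) \<partial>lborel \<partial>lborel)"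
    if "(\<lambda>p. f (fst p) (snd p)) \<in> borel_measurable (borel \<Otimes>\<^sub>M borel)" "(\<lambda>p. g (fst p) (snd p)) \<in> borel_measurable (borel \<Otimes>\<^sub>M borel)"
    for f g :: "real \<Rightarrow> real \<Rightarrow> real"
    by (rule lborel_pair.Fubini'[symmetric]) (use Km[OF that] in \<open>simp add: case_prod_beta'\<close>)
  have m: "(\<lambda>s. \<integral>\<^sup>+t. K (f s t) (g s t) \<partial>lborel) \<in> borel_measurable lborel"
    if "(\<lambda>p. f (fst p) (snd p)) \<in> borel_measurable (borel \<Otimes>\<^sub>M borel)" "(\<lambda>p. g (fst p) (snd p)) \<in> borel_measurable (borel \<Otimes>\<^sub>M borel)"
    for f g :: "real \<Rightarrow> real \<Rightarrow> real"
  proof -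
    have "case_prod (\<lambda>s t. K (f s t) (g s t)) \<in> borel_measurable (borel \<Otimes>\<^sub>M lborel)"
      using Km[OF that] by (simp add: case_prod_beta')
    from lborel.borel_measurable_nn_integral_fst[OF this] show ?thesis by simp
  qed
  show ?thesis
  proof (cases "w2 = 0")
    case False
    \<comment> \<open>Solving the second coordinate b for t and inserting the result into the first
      leaves a = z1 + (b - z2) w1 / w2 + \<delta> s.\<close>
    define \<delta> where "\<delta> = (v1 * w2 - v2 * w1) / w2"
    have \<delta>: "\<delta> \<noteq> 0" using det False by (simp add: \<delta>_def)
    have "(\<integral>\<^sup>+a. \<integral>\<^sup>+b. K a b \<partial>lborel \<partial>lborel) = (\<integral>\<^sup>+b. \<integral>\<^sup>+a. K a b \<partial>lborel \<partial>lborel)"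
      by (rule swap) measurable
    also have "\<dots> = (\<integral>\<^sup>+b. ennreal \<bar>\<delta>\<bar> * (\<integral>\<^sup>+s. K (z1 + (b - z2) * w1 / w2 + \<delta> * s) b \<partial>lborel) \<partial>lborel)"
      by (intro nn_integral_cong nn_integral_real_affine[OF Km \<delta>]) measurable
    also have "\<dots> = ennreal \<bar>\<delta>\<bar> * (\<integral>\<^sup>+b. \<integral>\<^sup>+s. K (z1 + (b - z2) * w1 / w2 + \<delta> * s) b \<partial>lborel \<partial>lborel)"
      by (rule nn_integral_cmult, rule m) measurable
    also have "(\<integral>\<^sup>+b. \<integral>\<^sup>+s. K (z1 + (b - z2) * w1 / w2 + \<delta> * s) b \<partial>lborel \<partial>lborel)
        = (\<integral>\<^sup>+s. \<integral>\<^sup>+b. K (z1 + (b - z2) * w1 / w2 + \<delta> * s) b \<partial>lborel \<partial>lborel)"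
      by (rule swap) measurable
    also have "\<dots> = (\<integral>\<^sup>+s. ennreal \<bar>w2\<bar> * (\<integral>\<^sup>+t. K (z1 + ((z2 + s * v2 + w2 * t) - z2) * w1 / w2 + \<delta> * s) (z2 + s * v2 + w2 * t) \<partial>lborel) \<partial>lborel)"
      by (intro nn_integral_cong nn_integral_real_affine[OF Km False]) measurable
    also have "\<dots> = ennreal \<bar>w2\<bar> * (\<integral>\<^sup>+s. \<integral>\<^sup>+t. K (z1 + ((z2 + s * v2 + w2 * t) - z2) * w1 / w2 + \<delta> * s) (z2 + s * v2 + w2 * t) \<partial>lborel \<partial>lborel)"
      by (rule nn_integral_cmult, rule m) measurable
    also have "(\<lambda>s. \<integral>\<^sup>+t. K (z1 + ((z2 + s * v2 + w2 * t) - z2) * w1 / w2 + \<delta> * s) (z2 + s * v2 + w2 * t) \<partial>lborel)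
      = (\<lambda>s. \<integral>\<^sup>+t. K (z1 + s * v1 + t * w1) (z2 + s * v2 + t * w2) \<partial>lborel)"
    proof (intro ext nn_integral_cong)
      fix s t
      have "z1 + ((z2 + s * v2 + w2 * t) - z2) * w1 / w2 + \<delta> * s = z1 + s * v1 + t * w1"
        using False by (simp add: \<delta>_def field_simps)
      then show "K (z1 + ((z2 + s * v2 + w2 * t) - z2) * w1 / w2 + \<delta> * s) (z2 + s * v2 + w2 * t)
        = K (z1 + s * v1 + t * w1) (z2 + s * v2 + t * w2)" by (simp only: mult.commute[of w2 t])
    qed
    finally have fin: "(\<integral>\<^sup>+a. \<integral>\<^sup>+b. K a b \<partial>lborel \<partial>lborel) = ennreal \<bar>\<delta>\<bar> * (ennreal \<bar>w2\<bar> *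
      (\<integral>\<^sup>+s. \<integral>\<^sup>+t. K (z1 + s * v1 + t * w1) (z2 + s * v2 + t * w2) \<partial>lborel \<partial>lborel))" .
    have "ennreal \<bar>v1 * w2 - v2 * w1\<bar> = ennreal (\<bar>\<delta>\<bar> * \<bar>w2\<bar>)"
      using False by (simp add: \<delta>_def abs_divide)
    also have "\<dots> = ennreal \<bar>\<delta>\<bar> * ennreal \<bar>w2\<bar>" by (rule ennreal_mult) auto
    finally show ?thesis unfolding fin by (simp only: mult.assoc)
  next
    case True
    then have w1: "w1 \<noteq> 0" and v2: "v2 \<noteq> 0" using det by auto
    have "(\<integral>\<^sup>+a. \<integral>\<^sup>+b. K a b \<partial>lborel \<partial>lborel) = (\<integral>\<^sup>+a. ennreal \<bar>v2\<bar> * (\<integral>\<^sup>+s. K a (z2 + v2 * s) \<partial>lborel) \<partial>lborel)"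
      by (intro nn_integral_cong nn_integral_real_affine[OF Km v2]) measurable
    also have "\<dots> = ennreal \<bar>v2\<bar> * (\<integral>\<^sup>+a. \<integral>\<^sup>+s. K a (z2 + v2 * s) \<partial>lborel \<partial>lborel)"
      by (rule nn_integral_cmult, rule m) measurable
    also have "(\<integral>\<^sup>+a. \<integral>\<^sup>+s. K a (z2 + v2 * s) \<partial>lborel \<partial>lborel) = (\<integral>\<^sup>+s. \<integral>\<^sup>+a. K a (z2 + v2 * s) \<partial>lborel \<partial>lborel)"
      by (rule swap) measurable
    also have "\<dots> = (\<integral>\<^sup>+s. ennreal \<bar>w1\<bar> * (\<integral>\<^sup>+t. K (z1 + s * v1 + w1 * t) (z2 + v2 * s) \<partial>lborel) \<partial>lborel)"
      by (intro nn_integral_cong nn_integral_real_affine[OF Km w1]) measurable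
    also have "\<dots> = ennreal \<bar>w1\<bar> * (\<integral>\<^sup>+s. \<integral>\<^sup>+t. K (z1 + s * v1 + w1 * t) (z2 + v2 * s) \<partial>lborel \<partial>lborel)"
      by (rule nn_integral_cmult, rule m) measurable
    finally have fin: "(\<integral>\<^sup>+a. \<integral>\<^sup>+b. K a b \<partial>lborel \<partial>lborel) = ennreal \<bar>v2\<bar> * (ennreal \<bar>w1\<bar> *
      (\<integral>\<^sup>+s. \<integral>\<^sup>+t. K (z1 + s * v1 + w1 * t) (z2 + v2 * s) \<partial>lborel \<partial>lborel))" .
    have "ennreal \<bar>v1 * w2 - v2 * w1\<bar> = ennreal (\<bar>v2\<bar> * \<bar>w1\<bar>)"
      using True by (simp add: abs_mult)
    also have "\<dots> = ennreal \<bar>v2\<bar> * ennreal \<bar>w1\<bar>" by (rule ennreal_mult) auto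
    finally have e: "ennreal \<bar>v1 * w2 - v2 * w1\<bar> = ennreal \<bar>v2\<bar> * ennreal \<bar>w1\<bar>" .
    have "K (z1 + s * v1 + w1 * t) (z2 + v2 * s) = K (z1 + s * v1 + t * w1) (z2 + s * v2 + t * w2)" for s t
      by (simp only: True mult_zero_right add_0_right mult.commute[of v2 s] mult.commute[of w1 t])
    then show ?thesis unfolding fin e by (simp only: mult.assoc)
  qed
qed

section \<open>Integrals over the plane and over parallelograms\<close>

definition pt :: "real \<Rightarrow> real \<Rightarrow> plane" where "pt a b = (\<chi> i. if i = 1 then a else b)"

lemma pt_nth [simp]: "pt a b $ 1 = a" "pt a b $ 2 = b"
  by (auto simp: pt_def)

lemma pt_eq_iff: "x = pt a b \<longleftrightarrow> x $ 1 = a \<and> x $ 2 = b"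
  by (auto simp: vec_eq_iff forall_2)

lemma pt_measurable [measurable]:
  assumes [measurable]: "f \<in> borel_measurable M" "g \<in> borel_measurable M"
  shows "(\<lambda>x. pt (f x) (g x)) \<in> borel_measurable M"
proof -
  have "(\<lambda>x. pt (f x) (g x)) = (\<lambda>x. f x *\<^sub>R axis 1 1 + g x *\<^sub>R axis 2 1)"
    by (auto simp: vec_eq_iff forall_2 axis_def fun_eq_iff)
  then show ?thesis by simp
qed

text \<open>Lebesgue measure on the plane is the image of the product measure, since both agree on
  boxes. This is the passage from plane integrals to iterated ones.\<close>

lemma nn_integral_plane:
  assumes k [measurable]: "k \<in> borel_measurable borel"
  shows "(\<integral>\<^sup>+x. k x \<partial>lborel) = (\<integral>\<^sup>+a. \<integral>\<^sup>+b. k (pt a b) \<partial>lborel \<partial>lborel)"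
proof -
  let ?M = "lborel \<Otimes>\<^sub>M (lborel :: real measure)"
  let ?f = "\<lambda>p. pt (fst p) (snd p)"
  have f [measurable]: "?f \<in> ?M \<rightarrow>\<^sub>M borel" by measurable
  have L: "lborel = distr ?M borel ?f"
  proof (rule lborel_eqI)
    fix l u :: plane assume lu: "\<And>b. b \<in> Basis \<Longrightarrow> l \<bullet> b \<le> u \<bullet> b"
    have le: "l $ i \<le> u $ i" for i using lu[of "axis i 1"] by (auto simp: Basis_vec_def inner_axis)
    have "?f -` box l u \<inter> space ?M = {l$1<..<u$1} \<times> {l$2<..<u$2}"
      by (auto simp: mem_box_plane space_pair_measure)
    then have "emeasure (distr ?M borel ?f) (box l u) = emeasure ?M ({l$1<..<u$1} \<times> {l$2<..<u$2})"
      by (simp add: emeasure_distr)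
    also have "\<dots> = ennreal (u$1 - l$1) * ennreal (u$2 - l$2)"
      using le[of 1] le[of 2] by (subst lborel.emeasure_pair_measure_Times) auto
    also have "\<dots> = ennreal (\<Prod>b\<in>Basis. (u - l) \<bullet> b)"
      using le[of 1] le[of 2]
      by (simp add: Basis_vec_def UNION_singleton_eq_range prod.reindex inj_on_def axis_eq_axis prod_2 inner_axis ennreal_mult UNIV_2 mult.commute)
    finally show "emeasure (distr ?M borel ?f) (box l u) = ennreal (\<Prod>b\<in>Basis. (u - l) \<bullet> b)" .
  qed simp
  have "(\<integral>\<^sup>+x. k x \<partial>lborel) = (\<integral>\<^sup>+x. k x \<partial>distr ?M borel ?f)" using L by simp
  also have "\<dots> = (\<integral>\<^sup>+p. k (?f p) \<partial>?M)" by (rule nn_integral_distr) measurable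
  also have "\<dots> = (\<integral>\<^sup>+a. \<integral>\<^sup>+b. k (pt a b) \<partial>lborel \<partial>lborel)"
    by (subst lborel.nn_integral_fst[symmetric]) (auto simp: )
  finally show ?thesis .
qed

text \<open>The affine parametrization has the constant Jacobian
  \<open>v$1 * w$2 - v$2 * w$1\<close>; restricting s and t to [0,1] only decreases the
  integral.\<close>

lemma nn_integral_parallelogram_le:
  fixes v w z :: plane
  assumes k: "k \<in> borel_measurable borel" and det: "v$1 * w$2 - v$2 * w$1 \<noteq> 0"
  shows "ennreal \<bar>v$1 * w$2 - v$2 * w$1\<bar> * (\<integral>\<^sup>+s\<in>{0..1}. (\<integral>\<^sup>+t\<in>{0..1}. k (z + s *\<^sub>R v + t *\<^sub>R w) \<partial>lborel) \<partial>lborel)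
      \<le> (\<integral>\<^sup>+x. k x \<partial>lborel)"
proof -
  have eq: "k (z + s *\<^sub>R v + t *\<^sub>R w) = k (pt (z$1 + s * v$1 + t * w$1) (z$2 + s * v$2 + t * w$2))" for s t
    by (rule arg_cong[where f = k]) (simp add: pt_eq_iff)
  have "(\<integral>\<^sup>+s\<in>{0..1}. (\<integral>\<^sup>+t\<in>{0..1}. k (z + s *\<^sub>R v + t *\<^sub>R w) \<partial>lborel) \<partial>lborel)
      \<le> (\<integral>\<^sup>+s. \<integral>\<^sup>+t. k (pt (z$1 + s * v$1 + t * w$1) (z$2 + s * v$2 + t * w$2)) \<partial>lborel \<partial>lborel)"
  proof (rule nn_integral_mono)
    fix s
    have "(\<integral>\<^sup>+t\<in>{0..1}. k (z + s *\<^sub>R v + t *\<^sub>R w) \<partial>lborel) \<le> (\<integral>\<^sup>+t. k (pt (z$1 + s * v$1 + t * w$1) (z$2 + s * v$2 + t * w$2)) \<partial>lborel)"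
      unfolding eq by (rule nn_integral_mono) (auto simp: indicator_def)
    then show "(\<integral>\<^sup>+t\<in>{0..1}. k (z + s *\<^sub>R v + t *\<^sub>R w) \<partial>lborel) * indicator {0..1} s
      \<le> (\<integral>\<^sup>+t. k (pt (z$1 + s * v$1 + t * w$1) (z$2 + s * v$2 + t * w$2)) \<partial>lborel)"
      by (auto simp: indicator_def)
  qed
  then have "ennreal \<bar>v$1 * w$2 - v$2 * w$1\<bar> * (\<integral>\<^sup>+s\<in>{0..1}. (\<integral>\<^sup>+t\<in>{0..1}. k (z + s *\<^sub>R v + t *\<^sub>R w) \<partial>lborel) \<partial>lborel)
     \<le> ennreal \<bar>v$1 * w$2 - v$2 * w$1\<bar> * (\<integral>\<^sup>+s. \<integral>\<^sup>+t. k (pt (z$1 + s * v$1 + t * w$1) (z$2 + s * v$2 + t * w$2)) \<partial>lborel \<partial>lborel)"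
    by (rule mult_left_mono) simp
  also have "\<dots> = (\<integral>\<^sup>+a. \<integral>\<^sup>+b. k (pt a b) \<partial>lborel \<partial>lborel)"
    by (rule nn_integral_affine_2d[where K = "\<lambda>a b. k (pt a b)", OF _ det])
      (rule measurable_compose[OF _ k], measurable)
  also have "\<dots> = (\<integral>\<^sup>+x. k x \<partial>lborel)" by (rule nn_integral_plane[OF k, symmetric])
  finally show ?thesis .
qed

text \<open>For each s, |G(0)| is at most |G(s)| plus the integral of |G'|; averaging over s gives
  the bound. It is the embedding of W^{1,1} into bounded functions in dimension one.\<close>

lemma norm_le_nn_integral_segment:
  fixes G :: "real \<Rightarrow> 'a::euclidean_space"
  assumes G: "\<And>s. (G has_vector_derivative G' s) (at s)" and G': "continuous_on UNIV G'"
  shows "ennreal (norm (G 0)) \<le> (\<integral>\<^sup>+s\<in>{0..1}. ennreal (norm (G s) + norm (G' s)) \<partial>lborel)"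
proof -
  have Gc: "continuous_on UNIV G"
    using G by (meson continuous_at_imp_continuous_on has_vector_derivative_continuous)
  have ci: "(\<lambda>s. norm (G' s)) integrable_on {a..b}" "G' integrable_on {a..b}" "(\<lambda>s. norm (G s)) integrable_on {a..b}" for a b
    by (intro integrable_continuous_real continuous_on_norm continuous_on_subset[OF G'] continuous_on_subset[OF Gc]; simp)+
  define J where "J = integral {0..1} (\<lambda>s. norm (G' s))"
  have pw: "norm (G 0) \<le> norm (G s) + J" if s: "s \<in> {0..1}" for s
  proof -
    have "(G' has_integral (G s - G 0)) {0..s}"
      by (rule fundamental_theorem_of_calculus) (use s G in \<open>auto intro: has_vector_derivative_at_within\<close>)
    then have "norm (G s - G 0) = norm (integral {0..s} G')" by (simp add: integral_unique)
    also have "\<dots> \<le> integral {0..s} (\<lambda>s. norm (G' s))"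
      by (rule integral_norm_bound_integral) (auto intro: ci)
    also have "\<dots> \<le> J" unfolding J_def
      by (rule integral_subset_le) (use s in \<open>auto intro: ci\<close>)
    finally show ?thesis using norm_triangle_ineq2[of "G 0" "G s"] by (simp add: norm_minus_commute)
  qed
  have "norm (G 0) = integral {0..1} (\<lambda>s::real. norm (G 0))" by simp
  also have "\<dots> \<le> integral {0..1} (\<lambda>s. norm (G s) + J)"
    by (rule integral_le) (use pw in \<open>auto intro!: integrable_add ci\<close>)
  also have "\<dots> = integral {0..1} (\<lambda>s. norm (G s)) + integral {0..1} (\<lambda>s::real. J)"
    by (rule integral_add) (auto intro: ci)
  also have "\<dots> = integral {0..1} (\<lambda>s. norm (G s)) + J" by simp
  also have "\<dots> = integral {0..1} (\<lambda>s. norm (G s) + norm (G' s))"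
    unfolding J_def by (rule integral_add[symmetric]) (auto intro: ci)
  finally have le: "norm (G 0) \<le> integral {0..1} (\<lambda>s. norm (G s) + norm (G' s))" .
  have "((\<lambda>s. norm (G s) + norm (G' s)) has_integral integral {0..1} (\<lambda>s. norm (G s) + norm (G' s))) {0..1}"
    by (intro integrable_integral integrable_add ci)
  then have "(\<integral>\<^sup>+s\<in>{0..1}. ennreal (norm (G s) + norm (G' s)) \<partial>lborel) = ennreal (integral {0..1} (\<lambda>s. norm (G s) + norm (G' s)))"
    by (intro nn_integral_has_integral_lebesgue') auto
  then show ?thesis using le by (simp add: ennreal_leI)
qed

text \<open>The one-dimensional inequality on the segment from x in direction v; the chain rule
  weights each partial derivative by a component of v, at most d.\<close>

lemma mollify_segment_bound:
  fixes f :: "plane \<Rightarrow> 'a::euclidean_space" and v x :: plane and r :: real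
  assumes f: "set_integrable lebesgue \<Omega> f" and d: "\<bar>v$1\<bar> \<le> d" "\<bar>v$2\<bar> \<le> d"
  defines "E \<equiv> \<lambda>k l. (\<integral>\<^sup>+s\<in>{0..1}. ennreal (norm (mollify r k l \<Omega> f (x + s *\<^sub>R v))) \<partial>lborel)"
  shows "ennreal (norm (mollify r k l \<Omega> f x)) \<le> E k l + ennreal d * E (Suc k) l + ennreal d * E k (Suc l)"
proof -
  let ?F = "\<lambda>k l y. mollify r k l \<Omega> f y"
  let ?G = "\<lambda>s. ?F k l (x + s *\<^sub>R v)"
  let ?G' = "\<lambda>s. v$1 *\<^sub>R ?F (Suc k) l (x + s *\<^sub>R v) + v$2 *\<^sub>R ?F k (Suc l) (x + s *\<^sub>R v)"
  have cont: "continuous_on UNIV (?F k l)" for k l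
    by (meson mollify_has_derivative[OF f] has_derivative_continuous continuous_at_imp_continuous_on)
  have contx: "continuous_on UNIV (\<lambda>s. ?F k l (x + s *\<^sub>R v))" for k l
    by (rule continuous_on_compose2[OF cont]) (auto intro!: continuous_intros)
  have der: "(?G has_vector_derivative ?G' s) (at s)" for s
  proof -
    have "((\<lambda>s. x + s *\<^sub>R v) has_derivative (\<lambda>h. h *\<^sub>R v)) (at s)"
      by (auto intro!: derivative_eq_intros)
    from has_derivative_compose[OF this mollify_has_derivative[OF f]]
    show ?thesis unfolding has_vector_derivative_def
      by (rule has_derivative_eq_rhs) (auto simp: fun_eq_iff algebra_simps)
  qed
  have d0: "d \<ge> 0" using d by linarith
  have m: "(\<lambda>s. ennreal (norm (?F k l (x + s *\<^sub>R v)))) \<in> borel_measurable borel" for k l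
    using borel_measurable_continuous_onI[OF contx[of k l]] by measurable
  have "ennreal (norm (?F k l x)) \<le> (\<integral>\<^sup>+s\<in>{0..1}. ennreal (norm (?G s) + norm (?G' s)) \<partial>lborel)"
    using norm_le_nn_integral_segment[of ?G ?G', OF der] contx by (simp add: continuous_intros)
  also have "\<dots> \<le> (\<integral>\<^sup>+s. ennreal (norm (?F k l (x + s *\<^sub>R v))) * indicator {0..1} s
      + ennreal d * (ennreal (norm (?F (Suc k) l (x + s *\<^sub>R v))) * indicator {0..1} s)
      + ennreal d * (ennreal (norm (?F k (Suc l) (x + s *\<^sub>R v))) * indicator {0..1} s) \<partial>lborel)"
  proof (rule nn_integral_mono)
    fix s :: real
    have "norm (?G' s) \<le> norm (v$1 *\<^sub>R ?F (Suc k) l (x + s *\<^sub>R v)) + norm (v$2 *\<^sub>R ?F k (Suc l) (x + s *\<^sub>R v))"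
      by (rule norm_triangle_ineq)
    also have "\<dots> \<le> d * norm (?F (Suc k) l (x + s *\<^sub>R v)) + d * norm (?F k (Suc l) (x + s *\<^sub>R v))"
      unfolding norm_scaleR using d by (intro add_mono mult_right_mono) auto
    finally have "ennreal (norm (?G s) + norm (?G' s)) \<le> ennreal (norm (?G s) + (d * norm (?F (Suc k) l (x + s *\<^sub>R v)) + d * norm (?F k (Suc l) (x + s *\<^sub>R v))))"
      by (intro ennreal_leI add_left_mono)
    also have "\<dots> = ennreal (norm (?G s)) + ennreal d * ennreal (norm (?F (Suc k) l (x + s *\<^sub>R v))) + ennreal d * ennreal (norm (?F k (Suc l) (x + s *\<^sub>R v)))"
      using d0 by (simp add: ennreal_mult add.assoc)
    finally show "ennreal (norm (?G s) + norm (?G' s)) * indicator {0..1} s \<le> ennreal (norm (?F k l (x + s *\<^sub>R v))) * indicator {0..1} s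
      + ennreal d * (ennreal (norm (?F (Suc k) l (x + s *\<^sub>R v))) * indicator {0..1} s)
      + ennreal d * (ennreal (norm (?F k (Suc l) (x + s *\<^sub>R v))) * indicator {0..1} s)"
      by (auto simp: indicator_def)
  qed
  also have "\<dots> = E k l + ennreal d * E (Suc k) l + ennreal d * E k (Suc l)"
    unfolding E_def using m by (simp add: nn_integral_add nn_integral_cmult)
  finally show ?thesis .
qed

text \<open>After exchanging the order of integration, the kernel with y fixed integrates over the
  parallelogram to at most 1/|det|, whatever r is. What remains is the L1 norm of D.\<close>

lemma mollify_parallelogram_L1:
  fixes D :: "plane \<Rightarrow> 'a::euclidean_space" and v w :: plane
  assumes D: "set_integrable lebesgue \<Omega> D" and N: "(LINT y:\<Omega>|lebesgue. norm (D y)) \<le> N"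
    and r: "r > 0" and det: "v$1 * w$2 - v$2 * w$1 \<noteq> 0"
  shows "(\<integral>\<^sup>+s\<in>{0..1}. (\<integral>\<^sup>+t\<in>{0..1}. ennreal (norm (mollify r 0 0 \<Omega> D (x + s *\<^sub>R v + t *\<^sub>R w))) \<partial>lborel) \<partial>lborel)
    \<le> ennreal (N / \<bar>v$1 * w$2 - v$2 * w$1\<bar>)"
proof -
  let ?\<delta> = "\<bar>v$1 * w$2 - v$2 * w$1\<bar>"
  have i: "integrable lebesgue (\<lambda>y. indicator \<Omega> y *\<^sub>R D y)" using D by (simp add: set_integrable_def)
  define h where "h y = ennreal (norm (indicator \<Omega> y *\<^sub>R D y))" for y
  have "h \<in> borel_measurable (completion lborel)" unfolding h_def using i by measurable
  \<comment> \<open>Tonelli is applied on \<open>lborel\<close>, hence a Borel representative of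
    |D|.\<close>
  then obtain h0 where h0 [measurable]: "h0 \<in> borel_measurable lborel" and ae: "AE y in lborel. h y = h0 y"
    using completion_ex_borel_measurable by blast
  have h0N: "(\<integral>\<^sup>+y. h0 y \<partial>lborel) \<le> ennreal N"
  proof -
    have "(\<integral>\<^sup>+y. h0 y \<partial>lborel) = (\<integral>\<^sup>+y. h y \<partial>lborel)"
      by (rule nn_integral_cong_AE) (use ae in \<open>eventually_elim, simp\<close>)
    also have "\<dots> = (\<integral>\<^sup>+y. h y \<partial>lebesgue)" by (simp add: nn_integral_completion)
    also have "\<dots> = ennreal (LINT y|lebesgue. norm (indicator \<Omega> y *\<^sub>R D y))"
      unfolding h_def by (rule nn_integral_eq_integral[OF integrable_norm[OF i]]) simp
    also have "(LINT y|lebesgue. norm (indicator \<Omega> y *\<^sub>R D y)) = (LINT y:\<Omega>|lebesgue. norm (D y))"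
      unfolding set_lebesgue_integral_def by (rule Bochner_Integration.integral_cong) auto
    finally show ?thesis using N by (simp add: ennreal_leI)
  qed
  define k where "k y = ennreal (mollifier r y)" for y
  have k [measurable]: "k \<in> borel_measurable borel" unfolding k_def by measurable
  have k1: "(\<integral>\<^sup>+y. k y \<partial>lborel) = 1"
    unfolding k_def using nn_integral_eq_integral[OF mollifier_integrable, of r] mollifier_nonneg[OF r] mollifier_integral[OF r] by simp
  have pw: "ennreal (norm (mollify r 0 0 \<Omega> D z)) \<le> (\<integral>\<^sup>+y. k (z - y) * h0 y \<partial>lborel)" for z
  proof -
    have "ennreal (norm (mollify r 0 0 \<Omega> D z)) \<le> (\<integral>\<^sup>+y. ennreal (norm (indicator \<Omega> y *\<^sub>R (mollifier_jet r 0 0 (z - y) *\<^sub>R D y))) \<partial>lebesgue)"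
      unfolding mollify_def set_lebesgue_integral_def
      by (rule integral_norm_bound_ennreal) (use mollify_integrable[OF D, of r 0 0 z] in \<open>simp add: set_integrable_def\<close>)
    also have "\<dots> = (\<integral>\<^sup>+y. k (z - y) * h y \<partial>lebesgue)"
      using mollifier_nonneg[OF r] by (intro nn_integral_cong) (simp add: k_def h_def mollifier_jet ennreal_mult' [symmetric] abs_mult mult_ac)
    also have "\<dots> = (\<integral>\<^sup>+y. k (z - y) * h y \<partial>lborel)" by (simp add: nn_integral_completion)
    also have "\<dots> = (\<integral>\<^sup>+y. k (z - y) * h0 y \<partial>lborel)"
      by (rule nn_integral_cong_AE) (use ae in \<open>eventually_elim, simp\<close>)
    finally show ?thesis .
  qed
  let ?z = "\<lambda>s t. x + s *\<^sub>R v + t *\<^sub>R w"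
  have "(\<integral>\<^sup>+s\<in>{0..1}. (\<integral>\<^sup>+t\<in>{0..1}. ennreal (norm (mollify r 0 0 \<Omega> D (?z s t))) \<partial>lborel) \<partial>lborel)
     \<le> (\<integral>\<^sup>+s\<in>{0..1}. (\<integral>\<^sup>+t\<in>{0..1}. (\<integral>\<^sup>+y. k (?z s t - y) * h0 y \<partial>lborel) \<partial>lborel) \<partial>lborel)"
    by (intro nn_integral_mono mult_right_mono pw) auto
  also have "\<dots> = (\<integral>\<^sup>+s. (\<integral>\<^sup>+t. (\<integral>\<^sup>+y. k (?z s t - y) * h0 y * indicator {0..1} t * indicator {0..1} s \<partial>lborel) \<partial>lborel) \<partial>lborel)"
    by (simp add: nn_integral_multc)
  also have "\<dots> = (\<integral>\<^sup>+s. (\<integral>\<^sup>+y. (\<integral>\<^sup>+t. k (?z s t - y) * h0 y * indicator {0..1} t * indicator {0..1} s \<partial>lborel) \<partial>lborel) \<partial>lborel)"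
    by (intro nn_integral_cong lborel_pair.Fubini') measurable
  also have "\<dots> = (\<integral>\<^sup>+y. (\<integral>\<^sup>+s. (\<integral>\<^sup>+t. k (?z s t - y) * h0 y * indicator {0..1} t * indicator {0..1} s \<partial>lborel) \<partial>lborel) \<partial>lborel)"
    by (intro lborel_pair.Fubini') measurable
  also have "\<dots> = (\<integral>\<^sup>+y. h0 y * (\<integral>\<^sup>+s\<in>{0..1}. (\<integral>\<^sup>+t\<in>{0..1}. k ((x - y) + s *\<^sub>R v + t *\<^sub>R w) \<partial>lborel) \<partial>lborel) \<partial>lborel)"
  proof (rule nn_integral_cong)
    fix y
    have "(\<integral>\<^sup>+s. (\<integral>\<^sup>+t. k (?z s t - y) * h0 y * indicator {0..1} t * indicator {0..1} s \<partial>lborel) \<partial>lborel)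
      = (\<integral>\<^sup>+s. (\<integral>\<^sup>+t. h0 y * (k ((x - y) + s *\<^sub>R v + t *\<^sub>R w) * indicator {0..1} t * indicator {0..1} s) \<partial>lborel) \<partial>lborel)"
      by (intro nn_integral_cong) (simp add: algebra_simps)
    also have "\<dots> = h0 y * (\<integral>\<^sup>+s. (\<integral>\<^sup>+t. k ((x - y) + s *\<^sub>R v + t *\<^sub>R w) * indicator {0..1} t * indicator {0..1} s \<partial>lborel) \<partial>lborel)"
      by (subst nn_integral_cmult, measurable, subst nn_integral_cmult, measurable)
    also have "\<dots> = h0 y * (\<integral>\<^sup>+s\<in>{0..1}. (\<integral>\<^sup>+t\<in>{0..1}. k ((x - y) + s *\<^sub>R v + t *\<^sub>R w) \<partial>lborel) \<partial>lborel)"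
      by (simp add: nn_integral_multc)
    finally show "(\<integral>\<^sup>+s. (\<integral>\<^sup>+t. k (?z s t - y) * h0 y * indicator {0..1} t * indicator {0..1} s \<partial>lborel) \<partial>lborel) = h0 y * (\<integral>\<^sup>+s\<in>{0..1}. (\<integral>\<^sup>+t\<in>{0..1}. k ((x - y) + s *\<^sub>R v + t *\<^sub>R w) \<partial>lborel) \<partial>lborel)" .
  qed
  also have "\<dots> \<le> (\<integral>\<^sup>+y. h0 y * ennreal (1 / ?\<delta>) \<partial>lborel)"
  proof (rule nn_integral_mono, rule mult_left_mono)
    fix y
    let ?Q = "\<integral>\<^sup>+s\<in>{0..1}. (\<integral>\<^sup>+t\<in>{0..1}. k ((x - y) + s *\<^sub>R v + t *\<^sub>R w) \<partial>lborel) \<partial>lborel"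
    have "ennreal ?\<delta> * ?Q \<le> 1" using nn_integral_parallelogram_le[OF k det, of "x - y"] k1 by simp
    then have "ennreal (1 / ?\<delta>) * (ennreal ?\<delta> * ?Q) \<le> ennreal (1 / ?\<delta>) * 1" by (rule mult_left_mono) simp
    moreover have "ennreal (1 / ?\<delta>) * ennreal ?\<delta> = 1" using det by (simp flip: ennreal_mult')
    ultimately show "?Q \<le> ennreal (1 / ?\<delta>)" by (simp flip: mult.assoc)
  qed simp
  also have "\<dots> = (\<integral>\<^sup>+y. h0 y \<partial>lborel) * ennreal (1 / ?\<delta>)" by (rule nn_integral_multc) simp
  also have "\<dots> \<le> ennreal N * ennreal (1 / ?\<delta>)" by (rule mult_right_mono[OF h0N]) simp
  also have "\<dots> = ennreal (N / ?\<delta>)" by (simp flip: ennreal_mult'')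
  finally show ?thesis .
qed

text \<open>The segment inequality is used once along v and once along w, so a point value costs two
  derivatives, and these only in L1. The bound is independent of r because on the whole
  parallelogram the derivatives can be moved from the kernel to f.\<close>

lemma mollify_sobolev_bound:
  fixes f :: "plane \<Rightarrow> 'a::euclidean_space" and v w :: plane
  assumes f: "set_integrable lebesgue \<Omega> f"
    and D: "\<And>i j. i + j \<le> k + l + 2 \<Longrightarrow> has_weak_derivative \<Omega> (i, j) f (D i j)"
    and Di: "\<And>i j. i + j \<le> k + l + 2 \<Longrightarrow> set_integrable lebesgue \<Omega> (D i j)"
    and DN: "\<And>i j. i + j \<le> k + l + 2 \<Longrightarrow> (LINT y:\<Omega>|lebesgue. norm (D i j y)) \<le> N"
    and r: "r > 0" and det: "v$1 * w$2 - v$2 * w$1 \<noteq> 0"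
    and d: "\<bar>v$1\<bar> \<le> d" "\<bar>v$2\<bar> \<le> d" "\<bar>w$1\<bar> \<le> d" "\<bar>w$2\<bar> \<le> d"
    and sub: "\<And>s t. s \<in> {0..1} \<Longrightarrow> t \<in> {0..1} \<Longrightarrow>
      cbox (x + s *\<^sub>R v + t *\<^sub>R w - diag r) (x + s *\<^sub>R v + t *\<^sub>R w + diag r) \<subseteq> \<Omega>"
  shows "norm (mollify r k l \<Omega> f x) \<le> (1 + 2 * d)\<^sup>2 * (N / \<bar>v$1 * w$2 - v$2 * w$1\<bar>)"
proof -
  let ?F = "\<lambda>k l y. mollify r k l \<Omega> f y"
  define Ew where "Ew i j y = (\<integral>\<^sup>+t\<in>{0..1}. ennreal (norm (?F i j (y + t *\<^sub>R w))) \<partial>lborel)" for i j y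
  define Q where "Q i j = (\<integral>\<^sup>+s\<in>{0..1}. Ew i j (x + s *\<^sub>R v) \<partial>lborel)" for i j
  define q where "q = N / \<bar>v$1 * w$2 - v$2 * w$1\<bar>"
  have d0: "d \<ge> 0" using d by linarith
  have N0: "0 \<le> N" using DN[of 0 0] set_integral_nonneg_fun[of \<Omega> "\<lambda>y. norm (D 0 0 y)" lebesgue] by simp
  have q0: "0 \<le> q" using N0 by (simp add: q_def)
  have Qb: "Q i j \<le> ennreal q" if "i + j \<le> k + l + 2" for i j
  proof -
    have "Q i j = (\<integral>\<^sup>+s\<in>{0..1}. (\<integral>\<^sup>+t\<in>{0..1}. ennreal (norm (mollify r 0 0 \<Omega> (D i j) (x + s *\<^sub>R v + t *\<^sub>R w))) \<partial>lborel) \<partial>lborel)"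
      unfolding Q_def Ew_def
    proof (rule nn_integral_cong)
      fix s
      show "(\<integral>\<^sup>+t\<in>{0..1}. ennreal (norm (?F i j (x + s *\<^sub>R v + t *\<^sub>R w))) \<partial>lborel) * indicator {0..1} s
        = (\<integral>\<^sup>+t\<in>{0..1}. ennreal (norm (mollify r 0 0 \<Omega> (D i j) (x + s *\<^sub>R v + t *\<^sub>R w))) \<partial>lborel) * indicator {0..1} s"
      proof (cases "s \<in> {0..1}")
        case True
        have "(\<integral>\<^sup>+t\<in>{0..1}. ennreal (norm (?F i j (x + s *\<^sub>R v + t *\<^sub>R w))) \<partial>lborel)
          = (\<integral>\<^sup>+t\<in>{0..1}. ennreal (norm (mollify r 0 0 \<Omega> (D i j) (x + s *\<^sub>R v + t *\<^sub>R w))) \<partial>lborel)"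
        proof (rule nn_integral_cong)
          fix t
          show "ennreal (norm (?F i j (x + s *\<^sub>R v + t *\<^sub>R w))) * indicator {0..1} t
            = ennreal (norm (mollify r 0 0 \<Omega> (D i j) (x + s *\<^sub>R v + t *\<^sub>R w))) * indicator {0..1} t"
            using mollify_weak_derivative[OF D[OF that] sub[OF True, of t]] by (cases "t \<in> {0..1}") auto
        qed
        then show ?thesis by simp
      qed simp
    qed
    also have "\<dots> \<le> ennreal q" unfolding q_def
      by (rule mollify_parallelogram_L1[OF Di[OF that] DN[OF that] r det])
    finally show ?thesis .
  qed
  have E2: "(\<integral>\<^sup>+s\<in>{0..1}. ennreal (norm (?F i j (x + s *\<^sub>R v))) \<partial>lborel) \<le> ennreal ((1 + 2 * d) * q)"
    if "i + j \<le> k + l + 1" for i j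
  proof -
    have m: "(\<lambda>s. Ew i j (x + s *\<^sub>R v) * indicator {0..1} s) \<in> borel_measurable lborel" for i j
    proof -
      have c: "continuous_on UNIV (?F i j)"
        by (meson mollify_has_derivative[OF f] has_derivative_continuous continuous_at_imp_continuous_on)
      have [measurable]: "?F i j \<in> borel_measurable borel" by (rule borel_measurable_continuous_onI[OF c])
      show ?thesis unfolding Ew_def by measurable
    qed
    have "(\<integral>\<^sup>+s\<in>{0..1}. ennreal (norm (?F i j (x + s *\<^sub>R v))) \<partial>lborel)
      \<le> (\<integral>\<^sup>+s\<in>{0..1}. (Ew i j (x + s *\<^sub>R v) + ennreal d * Ew (Suc i) j (x + s *\<^sub>R v) + ennreal d * Ew i (Suc j) (x + s *\<^sub>R v)) \<partial>lborel)"
      unfolding Ew_def by (intro nn_integral_mono mult_right_mono mollify_segment_bound[OF f d(3,4)]) auto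
    also have "\<dots> = (\<integral>\<^sup>+s. Ew i j (x + s *\<^sub>R v) * indicator {0..1} s + ennreal d * (Ew (Suc i) j (x + s *\<^sub>R v) * indicator {0..1} s)
        + ennreal d * (Ew i (Suc j) (x + s *\<^sub>R v) * indicator {0..1} s) \<partial>lborel)"
      by (intro nn_integral_cong) (auto simp: indicator_def)
    also have "\<dots> = Q i j + ennreal d * Q (Suc i) j + ennreal d * Q i (Suc j)"
      unfolding Q_def using m by (simp add: nn_integral_add nn_integral_cmult)
    also have "\<dots> \<le> ennreal q + ennreal d * ennreal q + ennreal d * ennreal q"
    proof -
      have "Q i j \<le> ennreal q" "Q (Suc i) j \<le> ennreal q" "Q i (Suc j) \<le> ennreal q"
        by (rule Qb, use that in linarith)+
      then show ?thesis by (intro add_mono mult_left_mono) auto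
    qed
    also have "\<dots> = ennreal ((1 + 2 * d) * q)"
      using d0 q0 by (simp add: algebra_simps flip: ennreal_mult ennreal_plus)
    finally show ?thesis .
  qed
  let ?p = "(1 + 2 * d) * q"
  have p0: "?p \<ge> 0" using d0 q0 by simp
  have "ennreal (norm (?F k l x)) \<le> ennreal ?p + ennreal d * ennreal ?p + ennreal d * ennreal ?p"
  proof (rule order_trans[OF mollify_segment_bound[OF f d(1,2)]])
    have "(\<integral>\<^sup>+s\<in>{0..1}. ennreal (norm (?F i j (x + s *\<^sub>R v))) \<partial>lborel) \<le> ennreal ?p"
      if "(i, j) \<in> {(k, l), (Suc k, l), (k, Suc l)}" for i j
      by (rule E2) (use that in auto)
    then show "(\<integral>\<^sup>+s\<in>{0..1}. ennreal (norm (?F k l (x + s *\<^sub>R v))) \<partial>lborel)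
      + ennreal d * (\<integral>\<^sup>+s\<in>{0..1}. ennreal (norm (?F (Suc k) l (x + s *\<^sub>R v))) \<partial>lborel)
      + ennreal d * (\<integral>\<^sup>+s\<in>{0..1}. ennreal (norm (?F k (Suc l) (x + s *\<^sub>R v))) \<partial>lborel)
      \<le> ennreal ?p + ennreal d * ennreal ?p + ennreal d * ennreal ?p"
      by (intro add_mono mult_left_mono) auto
  qed
  also have "\<dots> = ennreal (?p + d * ?p + d * ?p)"
    using d0 p0 by (simp flip: ennreal_mult ennreal_plus)
  also have "\<dots> = ennreal ((1 + 2 * d) * ?p)" by (rule arg_cong[where f = ennreal]) (simp add: algebra_simps)
  finally have "norm (?F k l x) \<le> (1 + 2 * d) * ?p"
    using d0 p0 by (subst (asm) ennreal_le_iff) (auto intro!: mult_nonneg_nonneg)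
  also have "\<dots> = (1 + 2 * d)\<^sup>2 * q" by (simp add: power2_eq_square algebra_simps)
  finally show ?thesis unfolding q_def .
qed

text \<open>Every point \<open>x\<close> of a bounded convex open set is the corner of a parallelogram of
  non-degenerate shape with respect to fixed bounds, and the parallelograms stay away from the
  boundary as long as \<open>x\<close> does.\<close>

definition parallelogram_condition :: "plane set \<Rightarrow> real \<Rightarrow> real \<Rightarrow> bool" where
  "parallelogram_condition \<Omega> d \<delta> \<longleftrightarrow> d > 0 \<and> \<delta> > 0 \<and>
    (\<forall>S. compact S \<and> S \<subseteq> \<Omega> \<longrightarrow> (\<exists>r0>0. \<forall>x\<in>S. \<exists>v w.
      \<bar>v$1\<bar> \<le> d \<and> \<bar>v$2\<bar> \<le> d \<and> \<bar>w$1\<bar> \<le> d \<and> \<bar>w$2\<bar> \<le> d \<and> \<delta> \<le> \<bar>v$1 * w$2 - v$2 * w$1\<bar> \<and>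
      (\<forall>s\<in>{0..1}. \<forall>t\<in>{0..1}. \<forall>r. r < r0 \<longrightarrow>
        cbox (x + s *\<^sub>R v + t *\<^sub>R w - diag r) (x + s *\<^sub>R v + t *\<^sub>R w + diag r) \<subseteq> \<Omega>)))"

lemma norm_plane_le: "norm (x::plane) \<le> \<bar>x$1\<bar> + \<bar>x$2\<bar>"
  using norm_le_l1_cart[of x] by (simp add: sum_2)

lemma cbox_diag_subset_cball: "cbox (x - diag r) (x + diag r) \<subseteq> cball x (2 * r)"
proof
  fix y assume y: "y \<in> cbox (x - diag r) (x + diag r)"
  then have "\<bar>(x - y)$1\<bar> \<le> r" "\<bar>(x - y)$2\<bar> \<le> r" by (auto simp: mem_cbox_plane)
  then show "y \<in> cball x (2 * r)" using norm_plane_le[of "x - y"] by (simp add: dist_norm)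
qed

lemma norm_pt: "norm (pt a b) = sqrt (a\<^sup>2 + b\<^sup>2)"
  by (simp add: norm_vec_def L2_set_def sum_2)

lemma convex_sum_3:
  assumes "convex S" "a \<in> S" "b \<in> S" "c \<in> S" "0 \<le> u" "0 \<le> v" "0 \<le> w" "u + v + w = (1::real)"
  shows "u *\<^sub>R a + v *\<^sub>R b + w *\<^sub>R c \<in> S"
proof -
  have "u *\<^sub>R a + v *\<^sub>R b + w *\<^sub>R c \<in> convex hull {a, b, c}"
    unfolding convex_hull_3 using assms by blast
  moreover have "convex hull {a, b, c} \<subseteq> S" by (rule hull_minimal) (use assms in auto)
  ultimately show ?thesis by blast
qed

text \<open>From x the construction looks towards the center c of a ball contained in \<Omega>. The
  triangle with corner x and two further corners in that ball contains a parallelogram with corner x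
  whose area is bounded below by the radius alone.\<close>

lemma parallelogram_condition_convex:
  assumes O: "open \<Omega>" "convex \<Omega>" "bounded \<Omega>" "\<Omega> \<noteq> {}"
  shows "\<exists>d \<delta>. parallelogram_condition \<Omega> d \<delta>"
proof -
  obtain c where c: "c \<in> \<Omega>" using O by blast
  obtain e where e: "e > 0" "cball c e \<subseteq> \<Omega>" using O(1) c open_contains_cball by blast
  define \<rho> where "\<rho> = e / 2"
  have \<rho>: "\<rho> > 0" "cball c (2 * \<rho>) \<subseteq> \<Omega>" using e by (auto simp: \<rho>_def)
  obtain D where D: "D > 0" "\<Omega> \<subseteq> cball c D"
  proof -
    obtain D where "0 < D" "\<Omega> \<subseteq> ball c D" using bounded_subset_ballD[OF O(3), of c] by blast
    then show ?thesis using that[of D] ball_subset_cball[of c D] by blast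
  qed
  have "\<exists>r0>0. \<forall>x\<in>S. \<exists>v w.
      \<bar>v$1\<bar> \<le> D + 2 * \<rho> \<and> \<bar>v$2\<bar> \<le> D + 2 * \<rho> \<and> \<bar>w$1\<bar> \<le> D + 2 * \<rho> \<and> \<bar>w$2\<bar> \<le> D + 2 * \<rho> \<and> \<rho>\<^sup>2 / 2 \<le> \<bar>v$1 * w$2 - v$2 * w$1\<bar> \<and>
      (\<forall>s\<in>{0..1}. \<forall>t\<in>{0..1}. \<forall>r. r < r0 \<longrightarrow>
        cbox (x + s *\<^sub>R v + t *\<^sub>R w - diag r) (x + s *\<^sub>R v + t *\<^sub>R w + diag r) \<subseteq> \<Omega>)"
    if S: "compact S" "S \<subseteq> \<Omega>" for S
  proof -
    \<comment> \<open>Everything happens in this compact hull. Its distance to the complement of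
      \<Omega> yields r0 and depends on S, whereas the bounds on the vectors do not.\<close>
    define H where "H = convex hull (S \<union> cball c (2 * \<rho>))"
    have "compact H" unfolding H_def by (intro compact_convex_hull compact_Un S compact_cball)
    moreover have HO: "H \<subseteq> \<Omega>" unfolding H_def by (rule hull_minimal) (use S \<rho> O in auto)
    ultimately obtain \<epsilon> where \<epsilon>: "\<epsilon> > 0" "(\<Union>x\<in>H. cball x \<epsilon>) \<subseteq> \<Omega>"
      using compact_subset_open_imp_cball_epsilon_subset[of H \<Omega>] O(1) by blast
    have conv: "convex H" by (simp add: H_def)
    show ?thesis
    proof (intro exI[of _ "\<epsilon> / 2"] conjI ballI)
      show "\<epsilon> / 2 > 0" using \<epsilon> by simp
      fix x assume x: "x \<in> S"
      define l where "l = norm (c - x)"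
      have l: "0 \<le> l" "l \<le> D" using D S x by (auto simp: l_def dist_norm)
      \<comment> \<open>The unit direction from x to c; if they coincide, any unit vector will
        do.\<close>
      obtain p :: plane where p: "(p$1)\<^sup>2 + (p$2)\<^sup>2 = 1" "c - x = l *\<^sub>R p"
      proof (cases "c = x")
        case True
        then show ?thesis by (intro that[of "pt 1 0"]) (auto simp: l_def)
      next
        case False
        then have n: "l > 0" by (simp add: l_def)
        have "l = sqrt (((c - x)$1)\<^sup>2 + ((c - x)$2)\<^sup>2)" by (simp add: l_def norm_vec_def L2_set_def sum_2)
        then have "l\<^sup>2 = ((c - x)$1)\<^sup>2 + ((c - x)$2)\<^sup>2" by simp
        then show ?thesis using n
          by (intro that[of "(1 / l) *\<^sub>R (c - x)"]) (auto simp: power_divide add_divide_distrib[symmetric])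
      qed
      \<comment> \<open>Relative to c, the points x + v0 and x + w0 are \<rho> times p plus or minus
        its normal, at distance \<open>sqrt 2 * \<rho>\<close>, so inside the ball of radius 2
        \<rho>. The surplus \<rho> in l + \<rho> keeps the determinant away from zero when x is
        close to c.\<close>
      define v0 where "v0 = pt ((l + \<rho>) * p$1 - \<rho> * p$2) ((l + \<rho>) * p$2 + \<rho> * p$1)"
      define w0 where "w0 = pt ((l + \<rho>) * p$1 + \<rho> * p$2) ((l + \<rho>) * p$2 - \<rho> * p$1)"
      have cx: "c$1 = x$1 + l * p$1" "c$2 = x$2 + l * p$2"
        using arg_cong[OF p(2), of "\<lambda>z. z$1"] arg_cong[OF p(2), of "\<lambda>z. z$2"] by auto
      have p1: "\<bar>p$1\<bar> \<le> 1" "\<bar>p$2\<bar> \<le> 1"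
        using p(1) by (simp_all flip: abs_square_le_1) (smt (verit) zero_le_power2)+
      have sq: "sqrt (2 * \<rho>\<^sup>2) \<le> 2 * \<rho>"
        using \<rho> by (intro real_le_lsqrt) (auto simp: power2_eq_square)
      have "x + v0 - c = pt (\<rho> * p$1 - \<rho> * p$2) (\<rho> * p$2 + \<rho> * p$1)"
        by (simp add: pt_eq_iff v0_def cx algebra_simps)
      then have "norm (x + v0 - c) = sqrt (2 * \<rho>\<^sup>2 * ((p$1)\<^sup>2 + (p$2)\<^sup>2))"
        by (simp add: norm_pt power2_eq_square algebra_simps)
      then have vH: "x + v0 \<in> H" using sq unfolding H_def p(1)
        by (intro hull_inc) (auto simp: dist_norm norm_minus_commute)
      have "x + w0 - c = pt (\<rho> * p$1 + \<rho> * p$2) (\<rho> * p$2 - \<rho> * p$1)"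
        by (simp add: pt_eq_iff w0_def cx algebra_simps)
      then have "norm (x + w0 - c) = sqrt (2 * \<rho>\<^sup>2 * ((p$1)\<^sup>2 + (p$2)\<^sup>2))"
        by (simp add: norm_pt power2_eq_square algebra_simps)
      then have wH: "x + w0 \<in> H" using sq unfolding H_def p(1)
        by (intro hull_inc) (auto simp: dist_norm norm_minus_commute)
      have xH: "x \<in> H" using x unfolding H_def by (intro hull_inc) auto
      \<comment> \<open>Halving puts the whole parallelogram into the triangle with corners x, x +
        v0 and x + w0.\<close>
      define v where "v = (1/2) *\<^sub>R v0"
      define w where "w = (1/2) *\<^sub>R w0"
      have le: "\<bar>a * b\<bar> \<le> a" if "\<bar>b\<bar> \<le> 1" "a \<ge> 0" for a b :: real
        using that by (simp add: abs_mult mult_left_le)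
      have b: "\<bar>(l + \<rho>) * p$1\<bar> \<le> D + \<rho>" "\<bar>(l + \<rho>) * p$2\<bar> \<le> D + \<rho>" "\<bar>\<rho> * p$1\<bar> \<le> \<rho>" "\<bar>\<rho> * p$2\<bar> \<le> \<rho>"
        using le[OF p1(1), of "l + \<rho>"] le[OF p1(2), of "l + \<rho>"] le[OF p1(1), of "\<rho>"] le[OF p1(2), of "\<rho>"] l \<rho> by auto
      have vb: "\<bar>v$1\<bar> \<le> D + 2 * \<rho>" "\<bar>v$2\<bar> \<le> D + 2 * \<rho>" "\<bar>w$1\<bar> \<le> D + 2 * \<rho>" "\<bar>w$2\<bar> \<le> D + 2 * \<rho>"
      proof -
        have h: "\<bar>(a - b) / 2\<bar> \<le> D + 2 * \<rho>" "\<bar>(a + b) / 2\<bar> \<le> D + 2 * \<rho>"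
          if "\<bar>a\<bar> \<le> D + \<rho>" "\<bar>b\<bar> \<le> \<rho>" for a b
          using that \<open>D > 0\<close> \<rho>(1) by (auto simp: abs_le_iff)
        have "v$1 = ((l + \<rho>) * p$1 - \<rho> * p$2) / 2" "v$2 = ((l + \<rho>) * p$2 + \<rho> * p$1) / 2"
          "w$1 = ((l + \<rho>) * p$1 + \<rho> * p$2) / 2" "w$2 = ((l + \<rho>) * p$2 - \<rho> * p$1) / 2"
          by (simp_all add: v_def w_def v0_def w0_def)
        then show "\<bar>v$1\<bar> \<le> D + 2 * \<rho>" "\<bar>v$2\<bar> \<le> D + 2 * \<rho>" "\<bar>w$1\<bar> \<le> D + 2 * \<rho>" "\<bar>w$2\<bar> \<le> D + 2 * \<rho>"
          using h b by (simp_all only:)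
      qed
      have "v$1 * w$2 - v$2 * w$1 = - (1/2) * (\<rho> * (l + \<rho>)) * ((p$1)\<^sup>2 + (p$2)\<^sup>2)"
        by (simp add: v_def w_def v0_def w0_def power2_eq_square field_simps)
      then have "v$1 * w$2 - v$2 * w$1 = - (\<rho> * (l + \<rho>) / 2)" unfolding p(1) by simp
      moreover have "\<rho> * \<rho> \<le> \<rho> * (l + \<rho>)" using l \<rho> by (intro mult_left_mono) auto
      ultimately have dv: "\<rho>\<^sup>2 / 2 \<le> \<bar>v$1 * w$2 - v$2 * w$1\<bar>" using \<rho> by (simp add: power2_eq_square abs_if)
      have sub: "cbox (x + s *\<^sub>R v + t *\<^sub>R w - diag r) (x + s *\<^sub>R v + t *\<^sub>R w + diag r) \<subseteq> \<Omega>"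
        if s: "s \<in> {0..1}" and t: "t \<in> {0..1}" and r: "r < \<epsilon> / 2" for s t r
      proof -
        let ?y = "x + s *\<^sub>R v + t *\<^sub>R w"
        have "((1 - (s + t) / 2) *\<^sub>R x + (s / 2) *\<^sub>R (x + v0)) + (t / 2) *\<^sub>R (x + w0) \<in> H"
          using s t by (intro convex_sum_3[OF conv xH vH wH]) auto
        moreover have "((1 - (s + t) / 2) *\<^sub>R x + (s / 2) *\<^sub>R (x + v0)) + (t / 2) *\<^sub>R (x + w0) = ?y"
          by (simp add: v_def w_def vec_eq_iff field_simps)
        ultimately have yH: "?y \<in> H" by simp
        have "cbox (?y - diag r) (?y + diag r) \<subseteq> cball ?y (2 * r)" by (rule cbox_diag_subset_cball)
        also have "\<dots> \<subseteq> cball ?y \<epsilon>" using r by auto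
        also have "\<dots> \<subseteq> \<Omega>" using \<epsilon>(2) yH by blast
        finally show ?thesis .
      qed
      show "\<exists>v w.
        \<bar>v$1\<bar> \<le> D + 2 * \<rho> \<and> \<bar>v$2\<bar> \<le> D + 2 * \<rho> \<and> \<bar>w$1\<bar> \<le> D + 2 * \<rho> \<and> \<bar>w$2\<bar> \<le> D + 2 * \<rho> \<and> \<rho>\<^sup>2 / 2 \<le> \<bar>v$1 * w$2 - v$2 * w$1\<bar> \<and>
        (\<forall>s\<in>{0..1}. \<forall>t\<in>{0..1}. \<forall>r. r < \<epsilon> / 2 \<longrightarrow>
          cbox (x + s *\<^sub>R v + t *\<^sub>R w - diag r) (x + s *\<^sub>R v + t *\<^sub>R w + diag r) \<subseteq> \<Omega>)"
        using vb dv sub by blast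
    qed
  qed
  moreover have "D + 2 * \<rho> > 0" "\<rho>\<^sup>2 / 2 > 0" using D \<rho> by auto
  ultimately have "parallelogram_condition \<Omega> (D + 2 * \<rho>) (\<rho>\<^sup>2 / 2)"
    unfolding parallelogram_condition_def by blast
  then show ?thesis by blast
qed

text \<open>The factors stem from the two uses of the segment inequality, the passage from L2 to L1,
  and the lower bound for the area of the parallelogram.\<close>

definition sobolev_const :: "plane set \<Rightarrow> real \<Rightarrow> real \<Rightarrow> real" where
  "sobolev_const \<Omega> d \<delta> = (1 + 2 * d)\<^sup>2 * ((measure lebesgue \<Omega> + 1) / \<delta>)"

lemma measure_plus_1_pos: "0 < measure M S + 1"
  by (rule add_nonneg_pos) auto

lemma sobolev_const_pos: "parallelogram_condition \<Omega> d \<delta> \<Longrightarrow> sobolev_const \<Omega> d \<delta> > 0"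
  unfolding sobolev_const_def parallelogram_condition_def
  by (intro mult_pos_pos divide_pos_pos measure_plus_1_pos zero_less_power) auto

section \<open>The Sobolev inequality for point values and Lipschitz constants\<close>

lemma sobolev_has_weak_derivative_self:
  fixes f :: "plane \<Rightarrow> 'a::euclidean_space"
  assumes "f \<in> sobolev m \<Omega>"
  shows "has_weak_derivative \<Omega> (0, 0) f f"
proof -
  have "fst (0::nat, 0::nat) + snd (0::nat, 0::nat) \<le> m" by simp
  then obtain g where "has_weak_derivative \<Omega> (0, 0) f g" using assms unfolding sobolev_def by blast
  then have "locally_integrable \<Omega> f" by (simp add: has_weak_derivative_def)
  then show ?thesis by (simp add: has_weak_derivative_def)
qed

lemma sobolev_imp_L2:
  fixes f :: "plane \<Rightarrow> 'a::euclidean_space"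
  assumes O: "open \<Omega>" and f: "f \<in> sobolev m \<Omega>"
  shows "square_integrable \<Omega> f" "(LINT x:\<Omega>|lebesgue. (norm (f x))\<^sup>2) \<le> (sobolev_norm m \<Omega> f)\<^sup>2"
proof -
  have z: "fst (0::nat, 0::nat) + snd (0::nat, 0::nat) \<le> m" by simp
  note w = sobolev_weak_derivative[OF O f z]
  note ae = weak_derivative_unique[OF O w(1) sobolev_has_weak_derivative_self[OF f]]
  show "square_integrable \<Omega> f" by (rule square_integrable_cong_AE(1)[OF w(2) ae])
  show "(LINT x:\<Omega>|lebesgue. (norm (f x))\<^sup>2) \<le> (sobolev_norm m \<Omega> f)\<^sup>2"
    using square_integrable_cong_AE(2)[OF w(2) ae] weak_derivative_L2_le[OF z, of \<Omega> f] by simp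
qed

lemma sobolev_imp_L1:
  fixes f :: "plane \<Rightarrow> 'a::euclidean_space"
  assumes O: "open \<Omega>" "bounded \<Omega>" and f: "f \<in> sobolev m \<Omega>"
  shows "set_integrable lebesgue \<Omega> f"
    and "(LINT x:\<Omega>|lebesgue. norm (f x)) \<le> (measure lebesgue \<Omega> + 1) * sobolev_norm m \<Omega> f"
  by (fact square_integrable_imp_L1[OF O sobolev_imp_L2[OF O(1) f] sobolev_norm_nonneg])+

lemma weak_derivative_L1:
  fixes f :: "plane \<Rightarrow> 'a::euclidean_space"
  assumes O: "open \<Omega>" "bounded \<Omega>" and f: "f \<in> sobolev m \<Omega>" and a: "fst \<alpha> + snd \<alpha> \<le> m"
  shows "set_integrable lebesgue \<Omega> (weak_derivative \<Omega> \<alpha> f)"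
    and "(LINT x:\<Omega>|lebesgue. norm (weak_derivative \<Omega> \<alpha> f x)) \<le> (measure lebesgue \<Omega> + 1) * sobolev_norm m \<Omega> f"
  by (fact square_integrable_imp_L1[OF O sobolev_weak_derivative(2)[OF O(1) f a] weak_derivative_L2_le[OF a] sobolev_norm_nonneg])+

text \<open>Only the threshold r0 depends on the compact set S. The constant does not, so the
  estimates persist when S exhausts \<Omega>.\<close>

lemma mollify_le_sobolev:
  assumes O: "open \<Omega>" "bounded \<Omega>" and pc: "parallelogram_condition \<Omega> d \<delta>" and S: "compact S" "S \<subseteq> \<Omega>"
  shows "\<exists>r0>0. \<forall>r x. 0 < r \<and> r < r0 \<and> x \<in> S \<longrightarrow> cbox (x - diag r) (x + diag r) \<subseteq> \<Omega> \<and>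
     (\<forall>m k l. \<forall>f :: plane \<Rightarrow> 'a::euclidean_space. f \<in> sobolev m \<Omega> \<and> k + l + 2 \<le> m \<longrightarrow>
       norm (mollify r k l \<Omega> f x) \<le> sobolev_const \<Omega> d \<delta> * sobolev_norm m \<Omega> f)"
proof -
  have dd: "d > 0" "\<delta> > 0" using pc by (auto simp: parallelogram_condition_def)
  from pc[unfolded parallelogram_condition_def, THEN conjunct2, THEN conjunct2, THEN spec, THEN mp, OF conjI[OF S]]
  obtain r0 where r0: "r0 > 0" "\<forall>x\<in>S. \<exists>v w.
      \<bar>v$1\<bar> \<le> d \<and> \<bar>v$2\<bar> \<le> d \<and> \<bar>w$1\<bar> \<le> d \<and> \<bar>w$2\<bar> \<le> d \<and> \<delta> \<le> \<bar>v$1 * w$2 - v$2 * w$1\<bar> \<and>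
      (\<forall>s\<in>{0..1}. \<forall>t\<in>{0..1}. \<forall>r. r < r0 \<longrightarrow>
        cbox (x + s *\<^sub>R v + t *\<^sub>R w - diag r) (x + s *\<^sub>R v + t *\<^sub>R w + diag r) \<subseteq> \<Omega>)"
    by blast
  show ?thesis
  proof (intro exI[of _ r0] conjI allI impI)
    fix r x assume rx: "0 < r \<and> r < r0 \<and> x \<in> S"
    from r0(2)[THEN bspec, of x] rx obtain v w where vw: "\<bar>v$1\<bar> \<le> d" "\<bar>v$2\<bar> \<le> d" "\<bar>w$1\<bar> \<le> d" "\<bar>w$2\<bar> \<le> d" "\<delta> \<le> \<bar>v$1 * w$2 - v$2 * w$1\<bar>"
      and vw': "\<forall>s\<in>{0..1}. \<forall>t\<in>{0..1}. \<forall>r. r < r0 \<longrightarrow>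
        cbox (x + s *\<^sub>R v + t *\<^sub>R w - diag r) (x + s *\<^sub>R v + t *\<^sub>R w + diag r) \<subseteq> \<Omega>"
      by auto
    have vw6: "cbox (x + s *\<^sub>R v + t *\<^sub>R w - diag r) (x + s *\<^sub>R v + t *\<^sub>R w + diag r) \<subseteq> \<Omega>"
      if "s \<in> {0..1}" "t \<in> {0..1}" for s t
      using vw'[THEN bspec, OF that(1), THEN bspec, OF that(2), THEN spec, of r] rx by blast
    show "cbox (x - diag r) (x + diag r) \<subseteq> \<Omega>" using vw6[of 0 0] by simp
    fix m k l and f :: "plane \<Rightarrow> 'a" assume "f \<in> sobolev m \<Omega> \<and> k + l + 2 \<le> m"
    then have f: "f \<in> sobolev m \<Omega>" and kl: "k + l + 2 \<le> m" by auto
    let ?N = "(measure lebesgue \<Omega> + 1) * sobolev_norm m \<Omega> f"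
    have N0: "0 \<le> ?N" by (intro mult_nonneg_nonneg sobolev_norm_nonneg less_imp_le measure_plus_1_pos)
    have "norm (mollify r k l \<Omega> f x) \<le> (1 + 2 * d)\<^sup>2 * (?N / \<bar>v$1 * w$2 - v$2 * w$1\<bar>)"
    proof (rule mollify_sobolev_bound[where D = "\<lambda>i j. weak_derivative \<Omega> (i, j) f"])
      show "set_integrable lebesgue \<Omega> f" by (rule sobolev_imp_L1(1)[OF O f])
      fix i j assume "i + j \<le> k + l + 2"
      then have ij: "fst (i, j) + snd (i, j) \<le> m" using kl by simp
      show "has_weak_derivative \<Omega> (i, j) f (weak_derivative \<Omega> (i, j) f)"
        by (rule sobolev_weak_derivative(1)[OF O(1) f ij])
      show "set_integrable lebesgue \<Omega> (weak_derivative \<Omega> (i, j) f)"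
        by (rule weak_derivative_L1(1)[OF O f ij])
      show "(LINT y:\<Omega>|lebesgue. norm (weak_derivative \<Omega> (i, j) f y)) \<le> ?N"
        by (rule weak_derivative_L1(2)[OF O f ij])
    qed (use vw rx dd vw6 in auto)
    also have "\<dots> \<le> (1 + 2 * d)\<^sup>2 * (?N / \<delta>)"
      using vw(5) dd N0 by (intro mult_left_mono divide_left_mono) auto
    also have "\<dots> = sobolev_const \<Omega> d \<delta> * sobolev_norm m \<Omega> f" by (simp add: sobolev_const_def)
    finally show "norm (mollify r k l \<Omega> f x) \<le> sobolev_const \<Omega> d \<delta> * sobolev_norm m \<Omega> f" .
  qed (rule r0(1))
qed

lemma mollify_tendsto_at:
  fixes f :: "plane \<Rightarrow> 'a::euclidean_space"
  assumes O: "open \<Omega>" and f: "set_integrable lebesgue \<Omega> f" and c: "continuous_on \<Omega> f" and x: "x \<in> \<Omega>" and e: "e > 0"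
  shows "\<exists>r1>0. \<forall>r. 0 < r \<and> r < r1 \<longrightarrow> norm (mollify r 0 0 \<Omega> f x - f x) \<le> e"
proof -
  obtain s where s: "s > 0" "cball x s \<subseteq> \<Omega>" using O x open_contains_cball by blast
  have "continuous (at x) f" using c O x by (simp add: continuous_on_eq_continuous_at)
  then obtain t where t: "t > 0" "\<And>y. dist y x < t \<Longrightarrow> dist (f y) (f x) < e"
    unfolding continuous_at_eps_delta using e by blast
  show ?thesis
  proof (intro exI[of _ "min (s / 2) (t / 2)"] conjI allI impI)
    show "0 < min (s / 2) (t / 2)" using s t by simp
    fix r assume r: "0 < r \<and> r < min (s / 2) (t / 2)"
    have sub: "cbox (x - diag r) (x + diag r) \<subseteq> cball x (2 * r)" by (rule cbox_diag_subset_cball)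
    show "norm (mollify r 0 0 \<Omega> f x - f x) \<le> e"
    proof (rule mollify_approx[OF _ _ f])
      show "0 < r" using r by simp
      have "cball x (2 * r) \<subseteq> cball x s" using r by auto
      then show "cbox (x - diag r) (x + diag r) \<subseteq> \<Omega>" using sub s by blast
      fix y assume "y \<in> cbox (x - diag r) (x + diag r)"
      then have "dist y x < t" using sub r by (auto simp: dist_commute)
      then show "norm (f y - f x) \<le> e" using t(2)[of y] by (simp add: dist_norm less_imp_le)
    qed
  qed
qed

text \<open>At an interior point the mollified values converge as r tends to 0; the closure is
  reached by continuity of f.\<close>

lemma sobolev_pointwise_bound:
  fixes f :: "plane \<Rightarrow> 'a::euclidean_space"
  assumes O: "open \<Omega>" "bounded \<Omega>" and pc: "parallelogram_condition \<Omega> d \<delta>"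
    and f: "f \<in> sobolev m \<Omega>" "2 \<le> m" and c: "continuous_on (closure \<Omega>) f" and x: "x \<in> closure \<Omega>"
  shows "norm (f x) \<le> sobolev_const \<Omega> d \<delta> * sobolev_norm m \<Omega> f"
proof (rule continuous_on_closure_norm_le[OF c _ x], intro ballI)
  fix y assume y: "y \<in> \<Omega>"
  show "norm (f y) \<le> sobolev_const \<Omega> d \<delta> * sobolev_norm m \<Omega> f"
  proof (rule field_le_epsilon)
    fix e :: real assume e: "e > 0"
    obtain r1 where r1: "r1 > 0" "\<And>r. 0 < r \<Longrightarrow> r < r1 \<Longrightarrow> norm (mollify r 0 0 \<Omega> f y - f y) \<le> e"
      using mollify_tendsto_at[OF O(1) sobolev_imp_L1(1)[OF O f(1)] continuous_on_subset[OF c closure_subset] y e] by blast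
    have yS: "compact {y}" "{y} \<subseteq> \<Omega>" using y by auto
    obtain r0 where r0: "r0 > 0" "\<And>r. 0 < r \<Longrightarrow> r < r0 \<Longrightarrow> norm (mollify r 0 0 \<Omega> f y) \<le> sobolev_const \<Omega> d \<delta> * sobolev_norm m \<Omega> f"
      using mollify_le_sobolev[OF O pc yS, where 'a = 'a] f by fastforce
    define r where "r = min r0 r1 / 2"
    have r: "0 < r" "r < r0" "r < r1" using r0(1) r1(1) by (auto simp: r_def)
    have "norm (f y) \<le> norm (mollify r 0 0 \<Omega> f y) + norm (mollify r 0 0 \<Omega> f y - f y)"
      using norm_triangle_ineq2[of "f y" "mollify r 0 0 \<Omega> f y"] by (simp add: norm_minus_commute)
    then show "norm (f y) \<le> sobolev_const \<Omega> d \<delta> * sobolev_norm m \<Omega> f + e"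
      using r0(2)[OF r(1,2)] r1(2)[OF r(1,3)] by linarith
  qed
qed

lemma abs_comp_plane_le:
  fixes a b :: "'a::real_normed_vector" and h :: plane
  assumes "norm a \<le> A" "norm b \<le> A"
  shows "norm (h$1 *\<^sub>R a + h$2 *\<^sub>R b) \<le> 2 * A * norm h"
proof -
  have "norm (h$1 *\<^sub>R a + h$2 *\<^sub>R b) \<le> \<bar>h$1\<bar> * norm a + \<bar>h$2\<bar> * norm b"
    using norm_triangle_ineq[of "h$1 *\<^sub>R a" "h$2 *\<^sub>R b"] by simp
  also have "\<dots> \<le> norm h * A + norm h * A"
    by (intro add_mono mult_mono component_le_norm_cart assms) auto
  finally show ?thesis by simp
qed

lemma mollify_Lipschitz:
  fixes f :: "plane \<Rightarrow> 'a::euclidean_space"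
  assumes f: "set_integrable lebesgue \<Omega> f" and S: "convex S"
    and A: "\<And>z. z \<in> S \<Longrightarrow> norm (mollify r (Suc k) l \<Omega> f z) \<le> A" "\<And>z. z \<in> S \<Longrightarrow> norm (mollify r k (Suc l) \<Omega> f z) \<le> A"
    and xy: "x \<in> S" "y \<in> S"
  shows "norm (mollify r k l \<Omega> f x - mollify r k l \<Omega> f y) \<le> 2 * A * norm (x - y)"
proof (rule differentiable_bound[OF S _ _ xy])
  fix z assume z: "z \<in> S"
  show "(mollify r k l \<Omega> f has_derivative (\<lambda>h. h$1 *\<^sub>R mollify r (Suc k) l \<Omega> f z + h$2 *\<^sub>R mollify r k (Suc l) \<Omega> f z)) (at z within S)"
    by (rule has_derivative_at_withinI[OF mollify_has_derivative[OF f]])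
  show "onorm (\<lambda>h::plane. h$1 *\<^sub>R mollify r (Suc k) l \<Omega> f z + h$2 *\<^sub>R mollify r k (Suc l) \<Omega> f z) \<le> 2 * A"
  proof (rule onorm_bound)
    show "0 \<le> 2 * A" using A(1)[OF z] norm_ge_zero[of "mollify r (Suc k) l \<Omega> f z"] by linarith
  qed (rule abs_comp_plane_le[OF A(1)[OF z] A(2)[OF z]])
qed

text \<open>Convexity keeps the segment between two points of \<Omega> inside \<Omega>, and on this
  compact set the gradient of the mollified function is bounded for all small r. The estimate passes
  to f as r tends to 0 and then to the closure.\<close>

lemma sobolev_Lipschitz:
  fixes f :: "plane \<Rightarrow> 'a::euclidean_space"
  assumes O: "open \<Omega>" "bounded \<Omega>" "convex \<Omega>" and pc: "parallelogram_condition \<Omega> d \<delta>"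
    and f: "f \<in> sobolev m \<Omega>" "3 \<le> m" and c: "continuous_on (closure \<Omega>) f"
    and xy: "x \<in> closure \<Omega>" "y \<in> closure \<Omega>"
  shows "norm (f x - f y) \<le> 2 * (sobolev_const \<Omega> d \<delta> * sobolev_norm m \<Omega> f) * norm (x - y)"
proof -
  let ?A = "sobolev_const \<Omega> d \<delta> * sobolev_norm m \<Omega> f"
  have A0: "0 \<le> ?A"
    by (intro mult_nonneg_nonneg sobolev_norm_nonneg less_imp_le[OF sobolev_const_pos[OF pc]])
  note fi = sobolev_imp_L1(1)[OF O(1,2) f(1)]
  have int: "norm (f a - f b) \<le> 2 * ?A * norm (a - b)" if ab: "a \<in> \<Omega>" "b \<in> \<Omega>" for a b
  proof (rule field_le_epsilon)
    fix e :: real assume "e > 0"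
    then have e: "e / 2 > 0" by simp
    note co = continuous_on_subset[OF c closure_subset]
    obtain r1 where r1: "r1 > 0" "\<And>r. 0 < r \<Longrightarrow> r < r1 \<Longrightarrow> norm (mollify r 0 0 \<Omega> f a - f a) \<le> e / 2"
      using mollify_tendsto_at[OF O(1) fi co ab(1) e] by blast
    obtain r2 where r2: "r2 > 0" "\<And>r. 0 < r \<Longrightarrow> r < r2 \<Longrightarrow> norm (mollify r 0 0 \<Omega> f b - f b) \<le> e / 2"
      using mollify_tendsto_at[OF O(1) fi co ab(2) e] by blast
    have S: "compact (closed_segment a b)" "closed_segment a b \<subseteq> \<Omega>"
      using closed_segment_subset[OF ab O(3)] by auto
    obtain r0 where r0: "r0 > 0" "\<forall>r x. 0 < r \<and> r < r0 \<and> x \<in> closed_segment a b \<longrightarrow> cbox (x - diag r) (x + diag r) \<subseteq> \<Omega> \<and>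
     (\<forall>m k l. \<forall>f :: plane \<Rightarrow> 'a. f \<in> sobolev m \<Omega> \<and> k + l + 2 \<le> m \<longrightarrow>
       norm (mollify r k l \<Omega> f x) \<le> sobolev_const \<Omega> d \<delta> * sobolev_norm m \<Omega> f)"
      using mollify_le_sobolev[OF O(1,2) pc S, where 'a = 'a] by blast
    define r where "r = min r0 (min r1 r2) / 2"
    have r: "0 < r" "r < r0" "r < r1" "r < r2" using r0(1) r1(1) r2(1) by (auto simp: r_def)
    have "norm (mollify r 0 0 \<Omega> f a - mollify r 0 0 \<Omega> f b) \<le> 2 * ?A * norm (a - b)"
      by (rule mollify_Lipschitz[OF fi, of "closed_segment a b"]) (use r0(2) r f in auto)
    moreover have "norm (f a - f b) \<le> norm (mollify r 0 0 \<Omega> f a - mollify r 0 0 \<Omega> f b)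
        + norm (mollify r 0 0 \<Omega> f a - f a) + norm (mollify r 0 0 \<Omega> f b - f b)"
    proof -
      have "f a - f b = (mollify r 0 0 \<Omega> f a - mollify r 0 0 \<Omega> f b) - (mollify r 0 0 \<Omega> f a - f a) + (mollify r 0 0 \<Omega> f b - f b)"
        by simp
      then show ?thesis using norm_triangle_ineq norm_triangle_ineq4 by (smt (verit))
    qed
    ultimately show "norm (f a - f b) \<le> 2 * ?A * norm (a - b) + e"
      using r1(2)[OF r(1,3)] r2(2)[OF r(1,4)] by linarith
  qed
  have "(2 * ?A)-lipschitz_on \<Omega> f"
    by (rule lipschitz_onI) (use int A0 in \<open>auto simp: dist_norm\<close>)
  then have "(2 * ?A)-lipschitz_on (closure \<Omega>) f" by (rule lipschitz_on_closure[OF _ c])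
  from lipschitz_onD[OF this xy] show ?thesis by (simp add: dist_norm)
qed

lemma mollify_approx_Lipschitz:
  fixes f :: "plane \<Rightarrow> 'a::euclidean_space"
  assumes r: "r > 0" and sub: "cbox (x - diag r) (x + diag r) \<subseteq> \<Omega>" and f: "set_integrable lebesgue \<Omega> f"
    and L: "\<And>y. y \<in> \<Omega> \<Longrightarrow> norm (f y - f x) \<le> L * norm (y - x)" and L0: "L \<ge> 0"
  shows "norm (mollify r 0 0 \<Omega> f x - f x) \<le> L * (2 * r)"
proof (rule mollify_approx[OF r sub f])
  fix y assume y: "y \<in> cbox (x - diag r) (x + diag r)"
  then have "norm (y - x) \<le> 2 * r" using cbox_diag_subset_cball[of x r] by (auto simp: dist_norm norm_minus_commute)
  then show "norm (f y - f x) \<le> L * (2 * r)"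
    using L[of y] subsetD[OF sub y] mult_left_mono[OF _ L0, of "norm (y - x)" "2 * r"] by linarith
qed

section \<open>Taylor expansion and time derivative of the mollified solution\<close>

lemma has_vector_derivative_scaleR_const:
  "(f has_vector_derivative f') F \<Longrightarrow> ((\<lambda>x. c *\<^sub>R f x) has_vector_derivative c *\<^sub>R f') F"
  by (rule bounded_linear.has_vector_derivative[OF bounded_linear_scaleR_right])

lemma vector_derivative_bound_from_0:
  fixes g :: "real \<Rightarrow> 'a::real_normed_vector"
  assumes g: "\<And>s. s \<in> {0..1} \<Longrightarrow> (g has_vector_derivative g' s) (at s)"
    and K: "\<And>s. s \<in> {0..1} \<Longrightarrow> norm (g' s) \<le> K" and t: "t \<in> {0..1}"
  shows "norm (g t - g 0) \<le> K"
proof -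
  have "norm (g t - g 0) \<le> K * norm (t - 0)"
  proof (rule differentiable_bound[of "{0..1}"])
    fix s :: real assume s: "s \<in> {0..1}"
    show "(g has_derivative (\<lambda>h. h *\<^sub>R g' s)) (at s within {0..1})"
      using g[OF s] by (simp add: has_vector_derivative_def has_derivative_at_withinI)
    show "onorm (\<lambda>h. h *\<^sub>R g' s) \<le> K"
    proof (rule onorm_bound)
      show "0 \<le> K" using K[OF s] norm_ge_zero[of "g' s"] by linarith
      fix h :: real
      have "\<bar>h\<bar> * norm (g' s) \<le> \<bar>h\<bar> * K" by (rule mult_left_mono[OF K[OF s]]) simp
      then show "norm (h *\<^sub>R g' s) \<le> K * norm h" by (simp add: mult.commute)
    qed
  qed (use t in auto)
  also have "\<dots> \<le> K * 1"
    using t order_trans[OF norm_ge_zero K[of 0]] by (intro mult_left_mono) auto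
  finally show ?thesis by simp
qed

text \<open>The value h^T H h for the symmetric matrix H with diagonal entries a, c and off-diagonal
  entry b.\<close>

definition quad_form :: "'a \<Rightarrow> 'a \<Rightarrow> 'a \<Rightarrow> plane \<Rightarrow> 'a::real_vector" where
  "quad_form a b c h = (h$1)\<^sup>2 *\<^sub>R a + (2 * h$1 * h$2) *\<^sub>R b + (h$2)\<^sup>2 *\<^sub>R c"

text \<open>Three mean value inequalities along the segment. The 8 is the sum of the binomial
  coefficients in the third directional derivative; the factor 1/6 of the sharp remainder is given
  away.\<close>

lemma mollify_Taylor:
  fixes f :: "plane \<Rightarrow> 'a::euclidean_space"
  assumes f: "set_integrable lebesgue \<Omega> f" and S: "convex S" and xy: "x \<in> S" "y \<in> S"
    and A: "\<And>z k l. z \<in> S \<Longrightarrow> k + l = 3 \<Longrightarrow> norm (mollify r k l \<Omega> f z) \<le> A"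
  defines "F \<equiv> \<lambda>k l. mollify r k l \<Omega> f" and "h \<equiv> y - x"
  shows "norm (F 0 0 y - F 0 0 x - (h$1 *\<^sub>R F 1 0 x + h$2 *\<^sub>R F 0 1 x)
      - (1/2) *\<^sub>R quad_form (F 2 0 x) (F 1 1 x) (F 0 2 x) h) \<le> 8 * A * norm h ^ 3"
proof -
  let ?p = "\<lambda>s. x + s *\<^sub>R h"
  have pS: "?p s \<in> S" if "s \<in> {0..1}" for s
  proof -
    have "?p s = (1 - s) *\<^sub>R x + s *\<^sub>R y" by (simp add: h_def algebra_simps)
    then show ?thesis using convexD_alt[OF S xy, of s] that by auto
  qed
  have d: "((\<lambda>s. F k l (?p s)) has_vector_derivative (h$1 *\<^sub>R F (Suc k) l (?p s) + h$2 *\<^sub>R F k (Suc l) (?p s))) (at s)" for k l s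
  proof -
    have "((\<lambda>s. x + s *\<^sub>R h) has_derivative (\<lambda>t. t *\<^sub>R h)) (at s)"
      by (auto intro!: derivative_eq_intros)
    from has_derivative_compose[OF this mollify_has_derivative[OF f]]
    show ?thesis unfolding has_vector_derivative_def F_def
      by (rule has_derivative_eq_rhs) (auto simp: fun_eq_iff algebra_simps)
  qed
  \<comment> \<open>\<open>a1\<close>, \<open>a2\<close> and \<open>a3\<close> are the successive
    derivatives of \<open>a0\<close> along the segment from x to y.\<close>
  define a0 where "a0 s = F 0 0 (?p s)" for s
  define a1 where "a1 s = h$1 *\<^sub>R F 1 0 (?p s) + h$2 *\<^sub>R F 0 1 (?p s)" for s
  define a2 where "a2 s = quad_form (F 2 0 (?p s)) (F 1 1 (?p s)) (F 0 2 (?p s)) h" for s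
  define a3 where "a3 s = (h$1)^3 *\<^sub>R F 3 0 (?p s) + (3 * (h$1)\<^sup>2 * h$2) *\<^sub>R F 2 1 (?p s) + (3 * h$1 * (h$2)\<^sup>2) *\<^sub>R F 1 2 (?p s) + (h$2)^3 *\<^sub>R F 0 3 (?p s)" for s
  have d0: "(a0 has_vector_derivative a1 s) (at s)" for s
    unfolding a0_def[abs_def] a1_def using d[of 0 0 s] by simp
  have d1: "(a1 has_vector_derivative a2 s) (at s)" for s
  proof -
    have "(a1 has_vector_derivative (h$1 *\<^sub>R (h$1 *\<^sub>R F 2 0 (?p s) + h$2 *\<^sub>R F 1 1 (?p s)) + h$2 *\<^sub>R (h$1 *\<^sub>R F 1 1 (?p s) + h$2 *\<^sub>R F 0 2 (?p s)))) (at s)"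
      unfolding a1_def[abs_def]
      using d[of 1 0 s] d[of 0 1 s]
      by (intro has_vector_derivative_add has_vector_derivative_scaleR_const)
        (simp_all add: numeral_2_eq_2)
    moreover have "h$1 *\<^sub>R (h$1 *\<^sub>R F 2 0 (?p s) + h$2 *\<^sub>R F 1 1 (?p s)) + h$2 *\<^sub>R (h$1 *\<^sub>R F 1 1 (?p s) + h$2 *\<^sub>R F 0 2 (?p s)) = a2 s"
      by (simp add: a2_def quad_form_def algebra_simps power2_eq_square flip: scaleR_2)
    ultimately show ?thesis by simp
  qed
  have d2: "(a2 has_vector_derivative a3 s) (at s)" for s
  proof -
    have "(a2 has_vector_derivative ((h$1)\<^sup>2 *\<^sub>R (h$1 *\<^sub>R F 3 0 (?p s) + h$2 *\<^sub>R F 2 1 (?p s))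
       + (2 * h$1 * h$2) *\<^sub>R (h$1 *\<^sub>R F 2 1 (?p s) + h$2 *\<^sub>R F 1 2 (?p s))
       + (h$2)\<^sup>2 *\<^sub>R (h$1 *\<^sub>R F 1 2 (?p s) + h$2 *\<^sub>R F 0 3 (?p s)))) (at s)"
      unfolding a2_def[abs_def] quad_form_def
      using d[of 2 0 s] d[of 1 1 s] d[of 0 2 s]
      by (intro has_vector_derivative_add has_vector_derivative_scaleR_const)
        (simp_all add: numeral_2_eq_2 numeral_3_eq_3)
    moreover have "(h$1)\<^sup>2 *\<^sub>R (h$1 *\<^sub>R F 3 0 (?p s) + h$2 *\<^sub>R F 2 1 (?p s))
       + (2 * h$1 * h$2) *\<^sub>R (h$1 *\<^sub>R F 2 1 (?p s) + h$2 *\<^sub>R F 1 2 (?p s))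
       + (h$2)\<^sup>2 *\<^sub>R (h$1 *\<^sub>R F 1 2 (?p s) + h$2 *\<^sub>R F 0 3 (?p s)) = a3 s"
    proof -
      have "(h$1)\<^sup>2 *\<^sub>R (h$1 *\<^sub>R a + h$2 *\<^sub>R b) + (2 * h$1 * h$2) *\<^sub>R (h$1 *\<^sub>R b + h$2 *\<^sub>R c) + (h$2)\<^sup>2 *\<^sub>R (h$1 *\<^sub>R c + h$2 *\<^sub>R e)
        = (h$1)^3 *\<^sub>R a + (3 * (h$1)\<^sup>2 * h$2) *\<^sub>R b + (3 * h$1 * (h$2)\<^sup>2) *\<^sub>R c + (h$2)^3 *\<^sub>R e" for a b c e :: 'a
      proof -
        have "(h$1)\<^sup>2 *\<^sub>R (h$1 *\<^sub>R a + h$2 *\<^sub>R b) + (2 * h$1 * h$2) *\<^sub>R (h$1 *\<^sub>R b + h$2 *\<^sub>R c) + (h$2)\<^sup>2 *\<^sub>R (h$1 *\<^sub>R c + h$2 *\<^sub>R e)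
          = ((h$1)\<^sup>2 * h$1) *\<^sub>R a + ((h$1)\<^sup>2 * h$2 + 2 * h$1 * h$2 * h$1) *\<^sub>R b + (2 * h$1 * h$2 * h$2 + (h$2)\<^sup>2 * h$1) *\<^sub>R c + ((h$2)\<^sup>2 * h$2) *\<^sub>R e"
          by (simp add: scaleR_add_right scaleR_add_left)
        also have "((h$1)\<^sup>2 * h$2 + 2 * h$1 * h$2 * h$1) = 3 * (h$1)\<^sup>2 * h$2" by (simp add: power2_eq_square)
        also have "(2 * h$1 * h$2 * h$2 + (h$2)\<^sup>2 * h$1) = 3 * h$1 * (h$2)\<^sup>2" by (simp add: power2_eq_square)
        finally show ?thesis by (simp add: power3_eq_cube power2_eq_square)
      qed
      then show ?thesis by (simp only: a3_def)
    qed
    ultimately show ?thesis by simp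
  qed
  have h: "\<bar>h$1\<bar> \<le> norm h" "\<bar>h$2\<bar> \<le> norm h" by (rule component_le_norm_cart)+
  let ?K = "8 * A * norm h ^ 3"
  have b3: "norm (a3 s) \<le> ?K" if s: "s \<in> {0..1}" for s
  proof -
    have AF: "norm (F k l (?p s)) \<le> A" if "k + l = 3" for k l
      unfolding F_def by (rule A[OF pS[OF s] that])
    have m: "\<bar>a\<bar> * norm (F k l (?p s)) \<le> c * norm h ^ 3 * A" if "\<bar>a\<bar> \<le> c * norm h ^ 3" "k + l = 3" "c \<ge> 0" for a c k l
      using that AF[OF that(2)] by (intro mult_mono) auto
    have c1: "\<bar>(h$1)^3\<bar> \<le> 1 * norm h ^ 3" "\<bar>(h$2)^3\<bar> \<le> 1 * norm h ^ 3"
      using h by (auto simp: power_abs intro!: power_mono)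
    have "\<bar>h$1\<bar>\<^sup>2 * \<bar>h$2\<bar> \<le> (norm h)\<^sup>2 * norm h" "\<bar>h$1\<bar> * \<bar>h$2\<bar>\<^sup>2 \<le> norm h * (norm h)\<^sup>2"
      by (rule mult_mono[OF power_mono[OF h(1)] h(2)]; simp) (rule mult_mono[OF h(1) power_mono[OF h(2)]]; simp)
    then have c2: "\<bar>3 * (h$1)\<^sup>2 * h$2\<bar> \<le> 3 * norm h ^ 3" "\<bar>3 * h$1 * (h$2)\<^sup>2\<bar> \<le> 3 * norm h ^ 3"
      by (auto simp: abs_mult power2_eq_square power3_eq_cube algebra_simps)
    have "norm (a3 s) \<le> \<bar>(h$1)^3\<bar> * norm (F 3 0 (?p s)) + \<bar>3 * (h$1)\<^sup>2 * h$2\<bar> * norm (F 2 1 (?p s)) + \<bar>3 * h$1 * (h$2)\<^sup>2\<bar> * norm (F 1 2 (?p s)) + \<bar>(h$2)^3\<bar> * norm (F 0 3 (?p s))"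
      unfolding a3_def norm_scaleR[symmetric] by (intro norm_triangle_le add_mono order_refl)
    also have "\<dots> \<le> 1 * norm h ^ 3 * A + 3 * norm h ^ 3 * A + 3 * norm h ^ 3 * A + 1 * norm h ^ 3 * A"
      by (rule add_mono[OF add_mono[OF add_mono]]) (rule m; use c1 c2 in simp)+
    also have "\<dots> = ?K" by simp
    finally show ?thesis .
  qed
  have b2: "norm (a2 s - a2 0) \<le> ?K" if "s \<in> {0..1}" for s
    by (rule vector_derivative_bound_from_0[OF d2 b3 that])
  have b1: "norm ((a1 s - s *\<^sub>R a2 0) - (a1 0 - 0 *\<^sub>R a2 0)) \<le> ?K" if "s \<in> {0..1}" for s
  proof (rule vector_derivative_bound_from_0[OF _ b2 that])
    fix s :: real
    show "((\<lambda>s. a1 s - s *\<^sub>R a2 0) has_vector_derivative a2 s - a2 0) (at s)"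
      by (rule has_vector_derivative_diff[OF d1]) (auto intro!: derivative_eq_intros)
  qed
  have b0: "norm ((a0 1 - 1 *\<^sub>R a1 0 - (1\<^sup>2 / 2) *\<^sub>R a2 0) - (a0 0 - 0 *\<^sub>R a1 0 - (0\<^sup>2 / 2) *\<^sub>R a2 0)) \<le> ?K"
  proof (rule vector_derivative_bound_from_0[where g' = "\<lambda>s. (a1 s - s *\<^sub>R a2 0) - (a1 0 - 0 *\<^sub>R a2 0)"])
    fix s :: real
    have "((\<lambda>s. s *\<^sub>R a1 0) has_vector_derivative a1 0) (at s)" by (auto intro!: derivative_eq_intros)
    moreover have "((\<lambda>s. (s\<^sup>2 / 2) *\<^sub>R a2 0) has_vector_derivative s *\<^sub>R a2 0) (at s)"
      by (rule has_vector_derivative_scaleR[of _ s s UNIV "\<lambda>_. a2 0" 0, simplified]) (auto intro!: derivative_eq_intros)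
    ultimately have "((\<lambda>s. a0 s - s *\<^sub>R a1 0 - (s\<^sup>2 / 2) *\<^sub>R a2 0) has_vector_derivative a1 s - a1 0 - s *\<^sub>R a2 0) (at s)"
      by (intro has_vector_derivative_diff d0)
    then show "((\<lambda>s. a0 s - s *\<^sub>R a1 0 - (s\<^sup>2 / 2) *\<^sub>R a2 0) has_vector_derivative (a1 s - s *\<^sub>R a2 0) - (a1 0 - 0 *\<^sub>R a2 0)) (at s)"
      by (simp add: algebra_simps)
  qed (use b1 in auto)
  have e: "a0 1 = F 0 0 y" "a0 0 = F 0 0 x" "a1 0 = h$1 *\<^sub>R F 1 0 x + h$2 *\<^sub>R F 0 1 x"
    "a2 0 = quad_form (F 2 0 x) (F 1 1 x) (F 0 2 x) h"
    by (simp_all add: a0_def a1_def a2_def h_def)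
  have eqn: "(a0 1 - 1 *\<^sub>R a1 0 - (1\<^sup>2 / 2) *\<^sub>R a2 0) - (a0 0 - 0 *\<^sub>R a1 0 - (0\<^sup>2 / 2) *\<^sub>R a2 0)
     = a0 1 - a0 0 - a1 0 - (1/2) *\<^sub>R a2 0" by simp
  have "norm (a0 1 - a0 0 - a1 0 - (1/2) *\<^sub>R a2 0) \<le> ?K" using b0 by (simp only: eqn)
  then show ?thesis by (simp only: e)
qed

lemma mollify_diff:
  fixes f g :: "plane \<Rightarrow> 'a::euclidean_space"
  assumes "set_integrable lebesgue \<Omega> f" "set_integrable lebesgue \<Omega> g"
  shows "mollify r k l \<Omega> (\<lambda>x. f x - g x) x = mollify r k l \<Omega> f x - mollify r k l \<Omega> g x"
  unfolding mollify_def
  using set_integral_diff(2)[OF mollify_integrable[OF assms(1)] mollify_integrable[OF assms(2)], of r k l x r k l x]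
  by (simp add: scaleR_diff_right)

lemma mollify_add:
  fixes f g :: "plane \<Rightarrow> 'a::euclidean_space"
  assumes "set_integrable lebesgue \<Omega> f" "set_integrable lebesgue \<Omega> g"
  shows "mollify r k l \<Omega> (\<lambda>x. f x + g x) x = mollify r k l \<Omega> f x + mollify r k l \<Omega> g x"
  unfolding mollify_def
  using set_integral_add(2)[OF mollify_integrable[OF assms(1)] mollify_integrable[OF assms(2)], of r k l x r k l x]
  by (simp add: scaleR_add_right)

lemma mollify_scaleR: "mollify r k l \<Omega> (\<lambda>x. c *\<^sub>R f x) x = c *\<^sub>R mollify r k l \<Omega> f x"
  unfolding mollify_def by (simp flip: set_integral_scaleR_right add: mult.commute)

lemma mollify_cmult: "mollify r k l \<Omega> (\<lambda>x. c * f x) x = c * mollify r k l \<Omega> f x" for c :: complex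
  unfolding mollify_def set_lebesgue_integral_def
  by (subst integral_mult_right_zero[symmetric]) (simp add: scaleR_conv_of_real mult_ac)

text \<open>Used at fixed r, to see that a point value of the mollified function is a continuous
  functional in the Sobolev norm. The factor M may grow as r shrinks, so this bound does not enter
  the constants.\<close>

lemma mollify_norm_le:
  fixes f :: "plane \<Rightarrow> 'a::euclidean_space"
  assumes O: "open \<Omega>" "bounded \<Omega>" and M: "\<And>y. \<bar>mollifier_jet r k l y\<bar> \<le> M" and f: "f \<in> sobolev m \<Omega>"
  shows "norm (mollify r k l \<Omega> f x) \<le> M * ((measure lebesgue \<Omega> + 1) * sobolev_norm m \<Omega> f)"
proof -
  note fi = sobolev_imp_L1[OF O f]
  note i = mollify_integrable[OF fi(1), of r k l x]
  have M0: "0 \<le> M" using M[of 0] by linarith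
  have "norm (mollify r k l \<Omega> f x) \<le> (LINT y:\<Omega>|lebesgue. norm (mollifier_jet r k l (x - y) *\<^sub>R f y))"
    unfolding mollify_def by (rule set_integral_norm_bound[OF i])
  also have "\<dots> \<le> (LINT y:\<Omega>|lebesgue. M * norm (f y))"
  proof (rule set_integral_mono[OF set_integrable_norm[OF i]])
    show "set_integrable lebesgue \<Omega> (\<lambda>y. M * norm (f y))"
      using set_integrable_norm[OF fi(1)] by (rule set_integrable_mult_right)
    show "norm (mollifier_jet r k l (x - y) *\<^sub>R f y) \<le> M * norm (f y)" for y
      using M[of "x - y"] by (simp add: mult_right_mono)
  qed
  also have "\<dots> = M * (LINT y:\<Omega>|lebesgue. norm (f y))" by simp
  also have "\<dots> \<le> M * ((measure lebesgue \<Omega> + 1) * sobolev_norm m \<Omega> f)"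
    by (rule mult_left_mono[OF fi(2) M0])
  finally show ?thesis .
qed

lemma sobolev_diff:
  fixes f g :: "plane \<Rightarrow> 'a::euclidean_space"
  assumes O: "open \<Omega>" and f: "f \<in> sobolev m \<Omega>" and g: "g \<in> sobolev m \<Omega>"
  shows "(\<lambda>x. f x - g x) \<in> sobolev m \<Omega>"
  unfolding sobolev_def
proof (intro CollectI allI impI)
  fix \<alpha> :: "nat \<times> nat" assume a: "fst \<alpha> + snd \<alpha> \<le> m"
  let ?f = "weak_derivative \<Omega> \<alpha> f" and ?g = "weak_derivative \<Omega> \<alpha> g"
  note F = sobolev_weak_derivative[OF O f a] and G = sobolev_weak_derivative[OF O g a]
  have m: "set_borel_measurable lebesgue \<Omega> (\<lambda>x. ?f x - ?g x)"
    using F(2) G(2) unfolding square_integrable_def set_borel_measurable_def scaleR_diff_right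
    by (elim conjE) (rule borel_measurable_diff)
  have "set_borel_measurable lebesgue \<Omega> (\<lambda>x. (norm (?f x - ?g x))\<^sup>2)"
  proof -
    have "(\<lambda>x. indicator \<Omega> x *\<^sub>R (norm (?f x - ?g x))\<^sup>2) = (\<lambda>x. (norm (indicator \<Omega> x *\<^sub>R (?f x - ?g x)))\<^sup>2)"
      by (auto simp: indicator_def fun_eq_iff)
    then show ?thesis
      using m measurable_compose[of "\<lambda>x. indicator \<Omega> x *\<^sub>R (?f x - ?g x)" lebesgue borel "\<lambda>v. (norm v)\<^sup>2" borel]
      unfolding set_borel_measurable_def by simp
  qed
  moreover have "set_integrable lebesgue \<Omega> (\<lambda>x. 2 * (norm (?f x))\<^sup>2 + 2 * (norm (?g x))\<^sup>2)"
    using F(2) G(2) unfolding square_integrable_def by (intro set_integral_add set_integrable_mult_right) auto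
  moreover have "(norm (p - q))\<^sup>2 \<le> 2 * (norm p)\<^sup>2 + 2 * (norm q)\<^sup>2" for p q :: 'a
  proof -
    have "(norm (p - q))\<^sup>2 \<le> (norm p + norm q)\<^sup>2" using norm_triangle_ineq4[of p q] by (intro power_mono) auto
    also have "\<dots> \<le> 2 * (norm p)\<^sup>2 + 2 * (norm q)\<^sup>2" using sum_squares_bound[of "norm p" "norm q"] by (simp add: power2_sum)
    finally show ?thesis .
  qed
  ultimately have "set_integrable lebesgue \<Omega> (\<lambda>x. (norm (?f x - ?g x))\<^sup>2)"
    by (elim set_integrable_bound[rotated]) (auto intro!: AE_I2 order_trans[OF _ abs_ge_self])
  with m have "square_integrable \<Omega> (\<lambda>x. ?f x - ?g x)" by (simp add: square_integrable_def)
  with has_weak_derivative_diff[OF F(1) G(1)]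
  show "\<exists>g'. has_weak_derivative \<Omega> \<alpha> (\<lambda>x. f x - g x) g' \<and> square_integrable \<Omega> g'" by blast
qed

lemma sobolev_scaleR:
  fixes f :: "plane \<Rightarrow> 'a::euclidean_space"
  assumes f: "f \<in> sobolev m \<Omega>"
  shows "(\<lambda>x. c *\<^sub>R f x) \<in> sobolev m \<Omega>"
  unfolding sobolev_def
proof (intro CollectI allI impI)
  fix \<alpha> :: "nat \<times> nat" assume "fst \<alpha> + snd \<alpha> \<le> m"
  then obtain g where g: "has_weak_derivative \<Omega> \<alpha> f g" "square_integrable \<Omega> g"
    using f unfolding sobolev_def by blast
  have li: "locally_integrable \<Omega> (\<lambda>x. c *\<^sub>R h x)" if "locally_integrable \<Omega> h" for h :: "plane \<Rightarrow> 'a"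
    using that unfolding locally_integrable_def by (blast intro: set_integrable_scaleR_right)
  have sw: "a *\<^sub>R (c *\<^sub>R v) = c *\<^sub>R (a *\<^sub>R v)" for a and v :: 'a by (simp add: mult.commute)
  have "has_weak_derivative \<Omega> \<alpha> (\<lambda>x. c *\<^sub>R f x) (\<lambda>x. c *\<^sub>R g x)"
    using g(1) li unfolding has_weak_derivative_def sw set_integral_scaleR_right by simp
  moreover have "square_integrable \<Omega> (\<lambda>x. c *\<^sub>R g x)"
  proof -
    have eq: "(\<lambda>x. (norm (c *\<^sub>R g x))\<^sup>2) = (\<lambda>x. c\<^sup>2 * (norm (g x))\<^sup>2)"
      by (auto simp: power_mult_distrib)
    have "set_integrable lebesgue \<Omega> (\<lambda>x. c\<^sup>2 * (norm (g x))\<^sup>2)"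
      using g(2) unfolding square_integrable_def by (intro set_integrable_mult_right) auto
    moreover have "set_borel_measurable lebesgue \<Omega> (\<lambda>x. c *\<^sub>R g x)"
      using g(2) unfolding square_integrable_def set_borel_measurable_def sw
      by (elim conjE) (rule borel_measurable_const_scaleR)
    ultimately show ?thesis unfolding square_integrable_def eq by simp
  qed
  ultimately show "\<exists>g. has_weak_derivative \<Omega> \<alpha> (\<lambda>x. c *\<^sub>R f x) g \<and> square_integrable \<Omega> g" by blast
qed

lemma mollify_continuous_time:
  fixes f :: "real \<Rightarrow> plane \<Rightarrow> 'a::euclidean_space"
  assumes O: "open \<Omega>" "bounded \<Omega>" and f: "sobolev_continuous m \<Omega> T f"
  shows "continuous_on {0..T} (\<lambda>t. mollify r k l \<Omega> (f t) x)"
  unfolding continuous_on_def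
proof
  fix t assume t: "t \<in> {0..T}"
  obtain M where M: "M > 0" "\<forall>y. \<bar>mollifier_jet r k l y\<bar> \<le> M" using mollifier_jet_bounded[of r k l] by blast
  have fs: "f s \<in> sobolev m \<Omega>" if "s \<in> {0..T}" for s using f that by (simp add: sobolev_continuous_def)
  let ?N = "\<lambda>s. sobolev_norm m \<Omega> (\<lambda>x. f s x - f t x)"
  have "(?N \<longlongrightarrow> 0) (at t within {0..T})" using f t by (simp add: sobolev_continuous_def)
  then have "((\<lambda>s. M * ((measure lebesgue \<Omega> + 1) * ?N s)) \<longlongrightarrow> M * ((measure lebesgue \<Omega> + 1) * 0)) (at t within {0..T})"
    by (intro tendsto_mult tendsto_const)
  then have lim: "((\<lambda>s. M * ((measure lebesgue \<Omega> + 1) * ?N s)) \<longlongrightarrow> 0) (at t within {0..T})" by simp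
  have bd: "norm (mollify r k l \<Omega> (f s) x - mollify r k l \<Omega> (f t) x) \<le> M * ((measure lebesgue \<Omega> + 1) * ?N s)"
    if s: "s \<in> {0..T}" for s
    using mollify_norm_le[OF O _ sobolev_diff[OF O(1) fs[OF s] fs[OF t]], of r k l M x] M(2)
    by (simp add: mollify_diff sobolev_imp_L1(1)[OF O fs[OF s]] sobolev_imp_L1(1)[OF O fs[OF t]])
  have "((\<lambda>s. mollify r k l \<Omega> (f s) x - mollify r k l \<Omega> (f t) x) \<longlongrightarrow> 0) (at t within {0..T})"
    by (rule Lim_null_comparison[OF _ lim]) (use bd in \<open>auto simp: eventually_at_filter\<close>)
  then show "((\<lambda>s. mollify r k l \<Omega> (f s) x) \<longlongrightarrow> mollify r k l \<Omega> (f t) x) (at t within {0..T})"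
    by (simp add: LIM_zero_iff)
qed

text \<open>For fixed r and x, mollification is a bounded linear functional in the Sobolev norm, so
  convergence of the difference quotients in that norm carries over to point values.\<close>

lemma mollify_time_derivative:
  fixes f :: "real \<Rightarrow> plane \<Rightarrow> 'a::euclidean_space"
  assumes O: "open \<Omega>" "bounded \<Omega>" and f: "has_sobolev_time_derivative m \<Omega> T f t g" and t: "0 < t" "t < T"
  shows "((\<lambda>s. mollify r k l \<Omega> (f s) x) has_vector_derivative mollify r k l \<Omega> g x) (at t)"
proof -
  obtain M where M: "M > 0" "\<forall>y. \<bar>mollifier_jet r k l y\<bar> \<le> M" using mollifier_jet_bounded[of r k l] by blast
  have fs: "f s \<in> sobolev m \<Omega>" if "s \<in> {0..T}" for s using f that by (simp add: has_sobolev_time_derivative_def)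
  have g: "g \<in> sobolev m \<Omega>" using f by (simp add: has_sobolev_time_derivative_def)
  have tT: "t \<in> {0..T}" using t by simp
  note i = sobolev_imp_L1(1)[OF O]
  let ?q = "\<lambda>s x. (f s x - f t x) /\<^sub>R (s - t)"
  let ?N = "\<lambda>s. sobolev_norm m \<Omega> (\<lambda>x. ?q s x - g x)"
  let ?\<phi> = "\<lambda>s. mollify r k l \<Omega> (f s) x" and ?\<phi>' = "mollify r k l \<Omega> g x"
  have "(?N \<longlongrightarrow> 0) (at t within {0..T})" using f by (simp add: has_sobolev_time_derivative_def)
  then have "((\<lambda>s. M * ((measure lebesgue \<Omega> + 1) * ?N s)) \<longlongrightarrow> M * ((measure lebesgue \<Omega> + 1) * 0)) (at t within {0..T})"
    by (intro tendsto_mult tendsto_const)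
  then have lim: "((\<lambda>s. M * ((measure lebesgue \<Omega> + 1) * ?N s)) \<longlongrightarrow> 0) (at t within {0..T})" by simp
  have bd: "norm ((1 / norm (s - t)) *\<^sub>R (?\<phi> s - (?\<phi> t + (s - t) *\<^sub>R ?\<phi>'))) \<le> M * ((measure lebesgue \<Omega> + 1) * ?N s)"
    if s: "s \<in> {0..T}" "s \<noteq> t" for s
  proof -
    have fd: "(\<lambda>x. f s x - f t x) \<in> sobolev m \<Omega>" by (rule sobolev_diff[OF O(1) fs[OF s(1)] fs[OF tT]])
    have qs: "?q s \<in> sobolev m \<Omega>" using sobolev_scaleR[OF fd, of "inverse (s - t)"] by simp
    have "mollify r k l \<Omega> (\<lambda>x. ?q s x - g x) x = inverse (s - t) *\<^sub>R (?\<phi> s - ?\<phi> t) - ?\<phi>'"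
      by (simp add: mollify_diff[OF i[OF qs] i[OF g]] mollify_scaleR mollify_diff[OF i[OF fs[OF s(1)]] i[OF fs[OF tT]]])
    moreover have "norm (mollify r k l \<Omega> (\<lambda>x. ?q s x - g x) x) \<le> M * ((measure lebesgue \<Omega> + 1) * ?N s)"
      by (rule mollify_norm_le[OF O _ sobolev_diff[OF O(1) qs g]]) (use M(2) in blast)
    moreover have "norm ((1 / norm (s - t)) *\<^sub>R (?\<phi> s - (?\<phi> t + (s - t) *\<^sub>R ?\<phi>'))) = norm (inverse (s - t) *\<^sub>R (?\<phi> s - ?\<phi> t) - ?\<phi>')"
    proof -
      have "?\<phi> s - (?\<phi> t + (s - t) *\<^sub>R ?\<phi>') = (s - t) *\<^sub>R (inverse (s - t) *\<^sub>R (?\<phi> s - ?\<phi> t) - ?\<phi>')"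
        using s(2) by (simp add: scaleR_diff_right)
      then show ?thesis using s(2) by simp
    qed
    ultimately show ?thesis by simp
  qed
  have "((\<lambda>s. (1 / norm (s - t)) *\<^sub>R (?\<phi> s - (?\<phi> t + (s - t) *\<^sub>R ?\<phi>'))) \<longlongrightarrow> 0) (at t within {0..T})"
    by (rule Lim_null_comparison[OF _ lim]) (use bd in \<open>auto simp: eventually_at_filter simp del: norm_scaleR\<close>)
  then have "(?\<phi> has_vector_derivative ?\<phi>') (at t within {0..T})"
    unfolding has_vector_derivative_def has_derivative_within by (simp add: bounded_linear_scaleR_left)
  moreover have "at t within {0..T} = at t" by (rule at_within_interior) (use t in simp)
  ultimately show ?thesis by simp
qed

lemma sobolev_sup_bounds:
  fixes f :: "real \<Rightarrow> plane \<Rightarrow> 'a::euclidean_space"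
  assumes O: "open \<Omega>" "bounded \<Omega>" "convex \<Omega>" and pc: "parallelogram_condition \<Omega> d \<delta>"
    and f: "sobolev_continuous m \<Omega> T f" "3 \<le> m" and c: "continuous_on (closure \<Omega>) (f t)" and t: "t \<in> {0..T}"
    and xy: "x \<in> closure \<Omega>" "y \<in> closure \<Omega>"
  shows "norm (f t x) \<le> sobolev_const \<Omega> d \<delta> * sobolev_sup_norm m \<Omega> T f"
    and "norm (f t x - f t y) \<le> 2 * (sobolev_const \<Omega> d \<delta> * sobolev_sup_norm m \<Omega> T f) * norm (x - y)"
proof -
  have ft: "f t \<in> sobolev m \<Omega>" using f t by (simp add: sobolev_continuous_def)
  have le: "sobolev_const \<Omega> d \<delta> * sobolev_norm m \<Omega> (f t) \<le> sobolev_const \<Omega> d \<delta> * sobolev_sup_norm m \<Omega> T f"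
    using sobolev_const_pos[OF pc] by (intro mult_left_mono sobolev_sup_norm_upper[OF O(1) f(1) t]) auto
  show "norm (f t x) \<le> sobolev_const \<Omega> d \<delta> * sobolev_sup_norm m \<Omega> T f"
    by (rule order_trans[OF sobolev_pointwise_bound[OF O(1,2) pc ft _ c xy(1)] le]) (use f in simp)
  show "norm (f t x - f t y) \<le> 2 * (sobolev_const \<Omega> d \<delta> * sobolev_sup_norm m \<Omega> T f) * norm (x - y)"
    by (rule order_trans[OF sobolev_Lipschitz[OF O pc ft f(2) c xy]]) (intro mult_right_mono mult_left_mono le; simp)
qed

section \<open>The nonlinearity and the mollified equation\<close>

lemma cubic_Lipschitz:
  fixes a b :: complex
  assumes "norm a \<le> A" "norm b \<le> A"
  shows "norm (of_real ((norm a)\<^sup>2) * a - of_real ((norm b)\<^sup>2) * b) \<le> 3 * A\<^sup>2 * norm (a - b)"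
proof -
  have A0: "0 \<le> A" using assms norm_ge_zero order_trans by blast
  have "of_real ((norm a)\<^sup>2) * a - of_real ((norm b)\<^sup>2) * b
      = of_real ((norm a)\<^sup>2) * (a - b) + of_real ((norm a)\<^sup>2 - (norm b)\<^sup>2) * b"
    by (simp add: algebra_simps)
  then have "norm (of_real ((norm a)\<^sup>2) * a - of_real ((norm b)\<^sup>2) * b)
      \<le> (norm a)\<^sup>2 * norm (a - b) + \<bar>(norm a)\<^sup>2 - (norm b)\<^sup>2\<bar> * norm b"
    using norm_triangle_ineq[of "of_real ((norm a)\<^sup>2) * (a - b)" "of_real ((norm a)\<^sup>2 - (norm b)\<^sup>2) * b"]
    by (simp only: norm_mult norm_of_real) simp
  also have "\<bar>(norm a)\<^sup>2 - (norm b)\<^sup>2\<bar> = \<bar>norm a - norm b\<bar> * (norm a + norm b)"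
    by (simp add: power2_eq_square square_diff_square_factored abs_mult)
  also have "(norm a)\<^sup>2 * norm (a - b) + \<bar>norm a - norm b\<bar> * (norm a + norm b) * norm b
      \<le> A\<^sup>2 * norm (a - b) + norm (a - b) * (A + A) * A"
    using assms A0 norm_triangle_ineq3[of a b]
    by (intro add_mono mult_mono power_mono mult_nonneg_nonneg) auto
  also have "\<dots> = 3 * A\<^sup>2 * norm (a - b)" by (simp add: power2_eq_square algebra_simps)
  finally show ?thesis .
qed

definition gp_rhs :: "real \<Rightarrow> (plane \<Rightarrow> real) \<Rightarrow> (plane \<Rightarrow> complex) \<Rightarrow> plane \<Rightarrow> complex" where
  "gp_rhs \<gamma> V u x = of_real (\<gamma> * (norm (u x))\<^sup>2) * u x + of_real (V x) * u x"

text \<open>The cubic term gives 6 \<gamma> A^3, and the two parts of the difference of the products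
  V u give 2 A B each, as both factors have a Lipschitz constant twice their bound.\<close>

lemma gp_rhs_Lipschitz:
  assumes "\<gamma> \<ge> 0" "norm (u x) \<le> A" "norm (u y) \<le> A" "norm (u y - u x) \<le> 2 * A * e"
    and "\<bar>V x\<bar> \<le> B" "\<bar>V y\<bar> \<le> B" "\<bar>V y - V x\<bar> \<le> 2 * B * e"
  shows "norm (gp_rhs \<gamma> V u y - gp_rhs \<gamma> V u x) \<le> (6 * \<gamma> * A ^ 3 + 4 * A * B) * e"
proof -
  have A0: "0 \<le> A" using assms(2) norm_ge_zero order_trans by blast
  have B0: "0 \<le> B" using assms(5) abs_ge_zero order_trans by blast
  have "gp_rhs \<gamma> V u y - gp_rhs \<gamma> V u x
      = of_real \<gamma> * (of_real ((norm (u y))\<^sup>2) * u y - of_real ((norm (u x))\<^sup>2) * u x)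
        + (of_real (V y) * (u y - u x) + of_real (V y - V x) * u x)"
    by (simp add: gp_rhs_def algebra_simps)
  also have "norm \<dots> \<le> norm (of_real \<gamma> * (of_real ((norm (u y))\<^sup>2) * u y - of_real ((norm (u x))\<^sup>2) * u x))
        + (norm (of_real (V y) * (u y - u x)) + norm (of_real (V y - V x) * u x))"
    by (intro norm_triangle_le add_mono order_refl norm_triangle_ineq)
  also have "\<dots> \<le> \<gamma> * (3 * A\<^sup>2 * (2 * A * e)) + (B * (2 * A * e) + 2 * B * e * A)"
  proof (intro add_mono)
    have "norm (of_real ((norm (u y))\<^sup>2) * u y - of_real ((norm (u x))\<^sup>2) * u x) \<le> 3 * A\<^sup>2 * norm (u y - u x)"
      by (rule cubic_Lipschitz) (use assms in auto)
    also have "\<dots> \<le> 3 * A\<^sup>2 * (2 * A * e)" using assms(4) by (intro mult_left_mono) auto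
    finally show "norm (of_real \<gamma> * (of_real ((norm (u y))\<^sup>2) * u y - of_real ((norm (u x))\<^sup>2) * u x)) \<le> \<gamma> * (3 * A\<^sup>2 * (2 * A * e))"
      using assms(1) by (simp only: norm_mult norm_of_real) (simp add: mult_left_mono)
    show "norm (of_real (V y) * (u y - u x)) \<le> B * (2 * A * e)"
      using assms B0 by (simp only: norm_mult norm_of_real) (intro mult_mono; simp)
    have "0 \<le> 2 * B * e" using assms(7) by linarith
    then show "norm (of_real (V y - V x) * u x) \<le> 2 * B * e * A"
      using assms by (simp only: norm_mult norm_of_real) (intro mult_mono; simp)
  qed
  also have "\<dots> = (6 * \<gamma> * A ^ 3 + 4 * A * B) * e"
    by (simp add: power2_eq_square power3_eq_cube algebra_simps)
  finally show ?thesis .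
qed

lemma quad_form_diff_bound:
  fixes a b c :: "'a::real_normed_vector"
  assumes "norm a \<le> A" "norm b \<le> A" "norm c \<le> A" and h: "norm h \<le> D" "norm h' \<le> D"
  shows "norm (quad_form a b c h - quad_form a b c h') \<le> 8 * A * D * norm (h - h')"
proof -
  let ?e = "norm (h - h')"
  have A0: "0 \<le> A" using assms(1) norm_ge_zero order_trans by blast
  have D0: "0 \<le> D" using h(1) norm_ge_zero order_trans by blast
  have c: "\<bar>h$i\<bar> \<le> D" "\<bar>h'$i\<bar> \<le> D" "\<bar>h$i - h'$i\<bar> \<le> ?e" for i
    using component_le_norm_cart[of h i] component_le_norm_cart[of h' i] component_le_norm_cart[of "h - h'" i] h by auto
  have pr: "\<bar>h$i * h$j - h'$i * h'$j\<bar> \<le> 2 * D * ?e" for i j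
  proof -
    have "h$i * h$j - h'$i * h'$j = (h$i - h'$i) * h$j + h'$i * (h$j - h'$j)" by (simp add: algebra_simps)
    then have "\<bar>h$i * h$j - h'$i * h'$j\<bar> \<le> \<bar>h$i - h'$i\<bar> * \<bar>h$j\<bar> + \<bar>h'$i\<bar> * \<bar>h$j - h'$j\<bar>"
      using abs_triangle_ineq[of "(h$i - h'$i) * h$j" "h'$i * (h$j - h'$j)"] by (simp add: abs_mult)
    also have "\<dots> \<le> ?e * D + D * ?e" using c D0 by (intro add_mono mult_mono) auto
    finally show ?thesis by (simp add: algebra_simps)
  qed
  have "quad_form a b c h - quad_form a b c h' = (h$1 * h$1 - h'$1 * h'$1) *\<^sub>R a
      + (2 * (h$1 * h$2 - h'$1 * h'$2)) *\<^sub>R b + (h$2 * h$2 - h'$2 * h'$2) *\<^sub>R c"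
    by (simp add: quad_form_def power2_eq_square algebra_simps)
  also have "norm \<dots> \<le> \<bar>h$1 * h$1 - h'$1 * h'$1\<bar> * norm a + \<bar>2 * (h$1 * h$2 - h'$1 * h'$2)\<bar> * norm b + \<bar>h$2 * h$2 - h'$2 * h'$2\<bar> * norm c"
    unfolding norm_scaleR[symmetric] by (intro norm_triangle_le add_mono order_refl norm_triangle_ineq)
  also have "\<dots> \<le> (2 * D * ?e) * A + (4 * D * ?e) * A + (2 * D * ?e) * A"
    using pr[of 1 1] pr[of 1 2] pr[of 2 2] assms(1-3) D0
    by (intro add_mono mult_mono) (auto simp: abs_mult)
  finally show ?thesis by (simp add: algebra_simps)
qed

lemma power3_diff_bound:
  fixes a b D :: real
  assumes "0 \<le> a" "a \<le> D" "0 \<le> b" "b \<le> D" "a - b \<le> e" "0 \<le> e"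
  shows "a ^ 3 \<le> b ^ 3 + 3 * D\<^sup>2 * e"
proof (cases "a \<le> b")
  case True
  then have "a ^ 3 \<le> b ^ 3" using assms by (intro power_mono) auto
  then show ?thesis using assms by (smt (verit) mult_nonneg_nonneg zero_le_power2)
next
  case False
  have "a ^ 3 - b ^ 3 = (a - b) * (a * a + a * b + b * b)" by (simp add: power3_eq_cube algebra_simps)
  also have "\<dots> \<le> e * (D * D + D * D + D * D)"
    using assms False by (intro mult_mono add_mono) auto
  finally show ?thesis by (simp add: power2_eq_square algebra_simps)
qed

text \<open>An equation valid almost everywhere can be mollified. The weak space derivatives return
  to the kernel, and the only error is that of mollifying the Lipschitz right-hand side.\<close>

lemma mollify_gp_equation:
  assumes O: "open \<Omega>" "bounded \<Omega>" and r: "0 < r" and sub: "cbox (x - diag r) (x + diag r) \<subseteq> \<Omega>"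
    and v: "v \<in> sobolev 5 \<Omega>" and vt: "vt \<in> sobolev 0 \<Omega>"
    and xx: "has_weak_derivative \<Omega> (2, 0) v vxx" and yy: "has_weak_derivative \<Omega> (0, 2) v vyy"
    and eq: "AE x in lebesgue. x \<in> \<Omega> \<longrightarrow> \<i> * vt x + (vxx x + vyy x) = g x"
    and g: "\<And>y. y \<in> \<Omega> \<Longrightarrow> norm (g y - g x) \<le> L * norm (y - x)" "0 \<le> L"
  shows "norm (\<i> * mollify r 0 0 \<Omega> vt x + (mollify r 2 0 \<Omega> v x + mollify r 0 2 \<Omega> v x) - g x) \<le> L * (2 * r)"
proof -
  let ?xx = "weak_derivative \<Omega> (2, 0) v" and ?yy = "weak_derivative \<Omega> (0, 2) v"
  have l: "fst (2::nat, 0::nat) + snd (2::nat, 0::nat) \<le> 5" "fst (0::nat, 2::nat) + snd (0::nat, 2::nat) \<le> 5" by auto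
  note X = sobolev_weak_derivative(1)[OF O(1) v l(1)] and Y = sobolev_weak_derivative(1)[OF O(1) v l(2)]
  note Xi = weak_derivative_L1(1)[OF O v l(1)] and Yi = weak_derivative_L1(1)[OF O v l(2)]
  have ti: "set_integrable lebesgue \<Omega> (\<lambda>x. \<i> * vt x)"
    using sobolev_imp_L1(1)[OF O vt] by (rule set_integrable_mult_right)
  let ?s = "\<lambda>x. \<i> * vt x + (?xx x + ?yy x)"
  have si: "set_integrable lebesgue \<Omega> ?s" by (intro set_integral_add(1) ti Xi Yi)
  \<comment> \<open>Agreement almost everywhere with the left-hand side is what makes g measurable
    and integrable on \<Omega>.\<close>
  have ae: "AE y in lebesgue. indicator \<Omega> y *\<^sub>R ?s y = indicator \<Omega> y *\<^sub>R g y"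
    using eq weak_derivative_unique[OF O(1) X xx] weak_derivative_unique[OF O(1) Y yy]
    by eventually_elim (auto simp: indicator_def)
  have sint: "integrable lebesgue (\<lambda>y. indicator \<Omega> y *\<^sub>R ?s y)" using si by (simp add: set_integrable_def)
  have gm: "(\<lambda>y. indicator \<Omega> y *\<^sub>R g y) \<in> borel_measurable lebesgue"
    by (rule borel_measurable_AE[OF borel_measurable_integrable[OF sint] ae])
  have gi: "set_integrable lebesgue \<Omega> g"
    unfolding set_integrable_def by (rule integrable_cong_AE_imp[OF sint gm]) (use ae in \<open>eventually_elim, simp\<close>)
  have "mollify r 0 0 \<Omega> g x = mollify r 0 0 \<Omega> ?s x"
    unfolding mollify_def set_lebesgue_integral_def
  proof (rule integral_cong_AE)
    show "(\<lambda>y. indicator \<Omega> y *\<^sub>R (mollifier_jet r 0 0 (x - y) *\<^sub>R g y)) \<in> borel_measurable lebesgue"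
      using mollify_integrable[OF gi, of r 0 0 x] unfolding set_integrable_def by (rule borel_measurable_integrable)
    show "(\<lambda>y. indicator \<Omega> y *\<^sub>R (mollifier_jet r 0 0 (x - y) *\<^sub>R ?s y)) \<in> borel_measurable lebesgue"
      using mollify_integrable[OF si, of r 0 0 x] unfolding set_integrable_def by (rule borel_measurable_integrable)
    show "AE y in lebesgue. indicator \<Omega> y *\<^sub>R (mollifier_jet r 0 0 (x - y) *\<^sub>R g y) = indicator \<Omega> y *\<^sub>R (mollifier_jet r 0 0 (x - y) *\<^sub>R ?s y)"
      using ae by eventually_elim (auto simp: indicator_def split: if_splits)
  qed
  also have "\<dots> = \<i> * mollify r 0 0 \<Omega> vt x + (mollify r 0 0 \<Omega> ?xx x + mollify r 0 0 \<Omega> ?yy x)"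
    by (simp add: mollify_add[OF ti set_integral_add(1)[OF Xi Yi]] mollify_add[OF Xi Yi] mollify_cmult)
  also have "mollify r 0 0 \<Omega> ?xx x = mollify r 2 0 \<Omega> v x" by (rule mollify_weak_derivative[OF X sub, symmetric])
  also have "mollify r 0 0 \<Omega> ?yy x = mollify r 0 2 \<Omega> v x" by (rule mollify_weak_derivative[OF Y sub, symmetric])
  finally show ?thesis
    using mollify_approx_Lipschitz[OF r sub gi g] by simp
qed

text \<open>The functions \<open>F k l\<close> below are mollifications of the derivatives of \<open>u\<close>; they stand in
  for the classical derivatives, up to an arbitrarily small error \<open>\<eta>\<close> that is uniform in time.\<close>

lemma gp_approximation:
  assumes O: "open \<Omega>" "bounded \<Omega>" "convex \<Omega>" and pc: "parallelogram_condition \<Omega> d \<delta>"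
    and g0: "\<gamma> \<ge> 0" and V: "admissible_potential \<Omega> T V" and u: "gp_solution \<Omega> T \<gamma> V u0 u"
    and S: "finite S" "S \<subseteq> \<Omega>" and Z: "finite Z" "Z \<subseteq> closure \<Omega>" and eta: "\<eta> > 0"
  defines "A \<equiv> sobolev_const \<Omega> d \<delta> * sobolev_sup_norm 5 \<Omega> T u"
  shows "\<exists>F :: nat \<Rightarrow> nat \<Rightarrow> real \<Rightarrow> plane \<Rightarrow> complex.
    (\<forall>x\<in>S. continuous_on {0..T} (\<lambda>t. F 0 0 t x)) \<and>
    (\<forall>t\<in>{0..T}. \<forall>x\<in>S. norm (F 0 0 t x - u t x) \<le> \<eta> \<and> (\<forall>k l. k + l \<le> 3 \<longrightarrow> norm (F k l t x) \<le> A)) \<and>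
    (\<forall>t\<in>{0..T}. \<forall>x\<in>S. \<forall>z\<in>Z. norm (u t z - F 0 0 t x
        - ((z - x)$1 *\<^sub>R F 1 0 t x + (z - x)$2 *\<^sub>R F 0 1 t x)
        - (1/2) *\<^sub>R quad_form (F 2 0 t x) (F 1 1 t x) (F 0 2 t x) (z - x)) \<le> 8 * A * norm (z - x) ^ 3 + \<eta>) \<and>
    (\<forall>t\<in>{0..T}. \<forall>x\<in>S. \<forall>y\<in>S. \<forall>k l. k + l = 2 \<longrightarrow> norm (F k l t x - F k l t y) \<le> 2 * A * norm (x - y)) \<and>
    (\<forall>t\<in>{0<..<T}. \<forall>x\<in>S. \<exists>F'. ((\<lambda>s. F 0 0 s x) has_vector_derivative F') (at t) \<and>
        norm (\<i> * F' + (F 2 0 t x + F 0 2 t x) - gp_rhs \<gamma> (V t) (u t) x) \<le> \<eta>)"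
proof (cases "S = {} \<or> T < 0")
  case True
  then show ?thesis by (intro exI[of _ "\<lambda>k l t x. 0"]) auto
next
  case False
  then obtain c where c: "c \<in> \<Omega>" using S by blast
  have T0: "0 \<in> {0..T}" using False by auto
  define B where "B = sobolev_const \<Omega> d \<delta> * sobolev_sup_norm 3 \<Omega> T V"
  have uc: "sobolev_continuous 5 \<Omega> T u" "\<And>t. t \<in> {0..T} \<Longrightarrow> continuous_on (closure \<Omega>) (u t)"
    using u by (auto simp: gp_solution_def)
  have Vc: "sobolev_continuous 3 \<Omega> T V" "\<And>t. t \<in> {0..T} \<Longrightarrow> continuous_on (closure \<Omega>) (V t)"
    using V by (auto simp: admissible_potential_def)
  have us: "u t \<in> sobolev 5 \<Omega>" if "t \<in> {0..T}" for t using uc(1) that by (simp add: sobolev_continuous_def)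
  have cl: "x \<in> \<Omega> \<Longrightarrow> x \<in> closure \<Omega>" for x using closure_subset[of \<Omega>] by blast
  have ub: "norm (u t x) \<le> A" "norm (u t x - u t y) \<le> 2 * A * norm (x - y)"
    if "t \<in> {0..T}" "x \<in> closure \<Omega>" "y \<in> closure \<Omega>" for t x y
    unfolding A_def using sobolev_sup_bounds[OF O pc uc(1) _ uc(2)[OF that(1)] that] by auto
  have Vb: "\<bar>V t x\<bar> \<le> B" "\<bar>V t x - V t y\<bar> \<le> 2 * B * norm (x - y)"
    if "t \<in> {0..T}" "x \<in> closure \<Omega>" "y \<in> closure \<Omega>" for t x y
    unfolding B_def using sobolev_sup_bounds[OF O pc Vc(1) _ Vc(2)[OF that(1)] that] by auto
  have A0: "0 \<le> A" using order_trans[OF norm_ge_zero ub(1)[OF T0 cl[OF c] cl[OF c]]] .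
  have B0: "0 \<le> B" using order_trans[OF abs_ge_zero Vb(1)[OF T0 cl[OF c] cl[OF c]]] .
  define L where "L = 6 * \<gamma> * A ^ 3 + 4 * A * B"
  have L0: "0 \<le> L" using A0 B0 g0 by (simp add: L_def)
  define D where "D = diameter (closure \<Omega>)"
  have bc: "bounded (closure \<Omega>)" using O(2) by (rule bounded_closure)
  have D: "norm (x - y) \<le> D" if "x \<in> closure \<Omega>" "y \<in> closure \<Omega>" for x y
    using diameter_bounded_bound[OF bc that] by (simp add: D_def dist_norm)
  have D0: "0 \<le> D" using D[OF cl[OF c] cl[OF c]] by simp
  \<comment> \<open>K collects, per unit of A e, the cost of replacing z by the shifted point
    \<open>p z\<close>: 4 D from value and linear term, 4 D^2 from the quadratic term, 24 D^3 from
    the remainder.\<close>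
  define K where "K = 4 * D + 4 * D\<^sup>2 + 24 * D ^ 3"
  have K0: "0 \<le> K" using D0 by (simp add: K_def)
  define e where "e = min 1 (\<eta> / (2 * (A * K + 1)))"
  have e: "0 < e" "e \<le> 1" "A * K * e \<le> \<eta> / 2"
  proof -
    have AK: "0 \<le> A * K" using A0 K0 by simp
    show "0 < e" "e \<le> 1" using eta AK by (auto simp: e_def)
    have "A * K * e \<le> A * K * (\<eta> / (2 * (A * K + 1)))" using AK by (intro mult_left_mono) (auto simp: e_def)
    also have "\<dots> \<le> (A * K + 1) * (\<eta> / (2 * (A * K + 1)))" using AK eta by (intro mult_right_mono) auto
    also have "\<dots> = \<eta> / 2" using AK by (simp add: field_simps)
    finally show "A * K * e \<le> \<eta> / 2" .
  qed
  \<comment> \<open>The bounds on the mollified function hold inside \<Omega>, while z may lie on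
    the boundary. It is pulled slightly towards the interior point c, and the Lipschitz bound of u
    controls the shift.\<close>
  define p where "p z = z - e *\<^sub>R (z - c)" for z
  have p: "p z \<in> \<Omega>" if "z \<in> closure \<Omega>" for z
    using mem_interior_closure_convex_shrink[OF O(3) _ that e(1,2), of c] c O(1)
    by (simp add: p_def interior_open)
  \<comment> \<open>Taylor expansion asks for a convex set on which the mollified derivatives are
    bounded, and the Sobolev bound asks for a compact subset of \<Omega>.\<close>
  define Q where "Q = convex hull (S \<union> p ` Z)"
  have Qc: "compact Q" unfolding Q_def using S(1) Z(1) by (intro compact_convex_hull finite_imp_compact) auto
  have QO: "Q \<subseteq> \<Omega>" unfolding Q_def by (rule hull_minimal) (use S Z p O in auto)
  have Qconv: "convex Q" by (simp add: Q_def)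
  have SQ: "x \<in> Q" if "x \<in> S" for x using that unfolding Q_def by (intro hull_inc) auto
  have ZQ: "p z \<in> Q" if "z \<in> Z" for z using that unfolding Q_def by (intro hull_inc) auto
  obtain r0 where r0: "r0 > 0" "\<forall>r x. 0 < r \<and> r < r0 \<and> x \<in> Q \<longrightarrow> cbox (x - diag r) (x + diag r) \<subseteq> \<Omega> \<and>
     (\<forall>m k l. \<forall>f :: plane \<Rightarrow> complex. f \<in> sobolev m \<Omega> \<and> k + l + 2 \<le> m \<longrightarrow>
       norm (mollify r k l \<Omega> f x) \<le> sobolev_const \<Omega> d \<delta> * sobolev_norm m \<Omega> f)"
    using mollify_le_sobolev[OF O(1,2) pc Qc QO, where 'a = complex] by blast
  \<comment> \<open>One radius serves all times, because A and L come from suprema over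
    [0,T].\<close>
  define r where "r = min (r0 / 2) (min (\<eta> / (8 * A + 1)) (\<eta> / (2 * L + 1)))"
  have r: "0 < r" "r < r0" "4 * A * r \<le> \<eta> / 2" "L * (2 * r) \<le> \<eta>"
  proof -
    show "0 < r" "r < r0" using r0(1) eta A0 L0 by (auto simp: r_def)
    have "4 * A * r \<le> 4 * A * (\<eta> / (8 * A + 1))" using A0 by (intro mult_left_mono) (auto simp: r_def)
    also have "\<dots> \<le> \<eta> / 2" using A0 eta by (simp add: field_simps)
    finally show "4 * A * r \<le> \<eta> / 2" .
    have "L * (2 * r) \<le> L * (2 * (\<eta> / (2 * L + 1)))" using L0 by (intro mult_left_mono) (auto simp: r_def)
    also have "\<dots> \<le> \<eta>" using L0 eta by (simp add: field_simps)
    finally show "L * (2 * r) \<le> \<eta>" .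
  qed
  have sub: "cbox (x - diag r) (x + diag r) \<subseteq> \<Omega>" if "x \<in> Q" for x using r0(2) r that by blast
  have bd: "norm (mollify r k l \<Omega> (u t) x) \<le> A" if "x \<in> Q" "t \<in> {0..T}" "k + l \<le> 3" for x t k l
  proof -
    have "norm (mollify r k l \<Omega> (u t) x) \<le> sobolev_const \<Omega> d \<delta> * sobolev_norm 5 \<Omega> (u t)"
      using r0(2) r(1,2) that us[OF that(2)] by simp
    also have "\<dots> \<le> A" unfolding A_def using sobolev_const_pos[OF pc]
      by (intro mult_left_mono sobolev_sup_norm_upper[OF O(1) uc(1) that(2)]) auto
    finally show ?thesis .
  qed
  have ui: "set_integrable lebesgue \<Omega> (u t)" if "t \<in> {0..T}" for t by (rule sobolev_imp_L1(1)[OF O(1,2) us[OF that]])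
  have ap: "norm (mollify r 0 0 \<Omega> (u t) x - u t x) \<le> 4 * A * r" if "x \<in> Q" "t \<in> {0..T}" for x t
  proof -
    have "norm (mollify r 0 0 \<Omega> (u t) x - u t x) \<le> (2 * A) * (2 * r)"
      by (rule mollify_approx_Lipschitz[OF r(1) sub[OF that(1)] ui[OF that(2)]])
        (use ub(2)[OF that(2)] cl A0 QO that in auto)
    then show ?thesis by simp
  qed
  define F where "F k l t x = mollify r k l \<Omega> (u t) x" for k l t x
  have Taylor: "norm (u t z - F 0 0 t x
        - ((z - x)$1 *\<^sub>R F 1 0 t x + (z - x)$2 *\<^sub>R F 0 1 t x)
        - (1/2) *\<^sub>R quad_form (F 2 0 t x) (F 1 1 t x) (F 0 2 t x) (z - x)) \<le> 8 * A * norm (z - x) ^ 3 + \<eta>"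
    if t: "t \<in> {0..T}" and x: "x \<in> S" and z: "z \<in> Z" for t x z
  proof -
    define h where "h = z - x"
    define h' where "h' = p z - x"
    have zc: "z \<in> closure \<Omega>" and xc: "x \<in> closure \<Omega>" and pc': "p z \<in> closure \<Omega>" using z Z x S cl p by auto
    have hh: "norm (h - h') \<le> e * D"
      using D[OF zc cl[OF c]] e by (simp add: h_def h'_def p_def mult_left_mono)
    have hD: "norm h \<le> D" "norm h' \<le> D" using D zc xc pc' by (auto simp: h_def h'_def)
    let ?l = "\<lambda>h. h$1 *\<^sub>R F 1 0 t x + h$2 *\<^sub>R F 0 1 t x"
    let ?q = "quad_form (F 2 0 t x) (F 1 1 t x) (F 0 2 t x)"
    have bF: "norm (F k l t x) \<le> A" if "k + l \<le> 3" for k l unfolding F_def by (rule bd[OF SQ[OF x] t that])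
    have 1: "norm (F 0 0 t (p z) - F 0 0 t x - ?l h' - (1/2) *\<^sub>R ?q h') \<le> 8 * A * norm h' ^ 3"
      unfolding F_def h'_def by (rule mollify_Taylor[OF ui[OF t] Qconv SQ[OF x] ZQ[OF z]]) (rule bd[OF _ t], auto)
    have 2: "norm (u t z - u t (p z)) \<le> 2 * A * (e * D)"
    proof -
      have "norm (u t z - u t (p z)) \<le> 2 * A * norm (z - p z)" by (rule ub(2)[OF t zc pc'])
      also have "\<dots> \<le> 2 * A * (e * D)" using hh A0 by (intro mult_left_mono) (auto simp: h_def h'_def)
      finally show ?thesis .
    qed
    have 3: "norm (u t (p z) - F 0 0 t (p z)) \<le> 4 * A * r"
      using ap[OF ZQ[OF z] t] by (simp add: F_def norm_minus_commute)
    have 4: "norm (?l (h' - h)) \<le> 2 * A * (e * D)"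
    proof -
      have "norm (?l (h' - h)) \<le> 2 * A * norm (h' - h)" by (rule abs_comp_plane_le) (rule bF, simp)+
      also have "\<dots> \<le> 2 * A * (e * D)" using hh A0 by (intro mult_left_mono) (auto simp: norm_minus_commute)
      finally show ?thesis .
    qed
    have 5: "norm (?q h' - ?q h) \<le> 8 * A * D * (e * D)"
    proof -
      have "norm (?q h' - ?q h) \<le> 8 * A * D * norm (h' - h)"
        by (rule quad_form_diff_bound[OF bF bF bF hD(2,1)]) auto
      also have "\<dots> \<le> 8 * A * D * (e * D)" using hh A0 D0 by (intro mult_left_mono) (auto simp: norm_minus_commute)
      finally show ?thesis .
    qed
    have h5: "norm ((1/2) *\<^sub>R (?q h' - ?q h)) \<le> (1/2) * (8 * A * D * (e * D))"
      unfolding norm_scaleR using mult_left_mono[OF 5, of "1/2"] by simp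
    have 6: "norm h' ^ 3 \<le> norm h ^ 3 + 3 * D\<^sup>2 * (e * D)"
      by (rule power3_diff_bound) (use hD hh e D0 norm_triangle_ineq2[of h' h] in \<open>auto simp: norm_minus_commute\<close>)
    have "u t z - F 0 0 t x - ?l h - (1/2) *\<^sub>R ?q h
      = (F 0 0 t (p z) - F 0 0 t x - ?l h' - (1/2) *\<^sub>R ?q h') + ((u t z - u t (p z)) + ((u t (p z) - F 0 0 t (p z)) + (?l (h' - h) + (1/2) *\<^sub>R (?q h' - ?q h))))"
      by (simp add: algebra_simps)
    also have "norm \<dots> \<le> 8 * A * norm h' ^ 3 + (2 * A * (e * D) + (4 * A * r + (2 * A * (e * D) + (1/2) * (8 * A * D * (e * D)))))"
      by (rule norm_triangle_le[OF add_mono[OF 1 norm_triangle_le[OF add_mono[OF 2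
              norm_triangle_le[OF add_mono[OF 3 norm_triangle_le[OF add_mono[OF 4 h5]]]]]]]])
    also have "\<dots> \<le> 8 * A * (norm h ^ 3 + 3 * D\<^sup>2 * (e * D)) + (2 * A * (e * D) + (4 * A * r + (2 * A * (e * D) + (1/2) * (8 * A * D * (e * D)))))"
      using 6 A0 by (intro add_right_mono mult_left_mono) auto
    also have "\<dots> = 8 * A * norm h ^ 3 + A * K * e + 4 * A * r"
      by (simp add: K_def power2_eq_square power3_eq_cube algebra_simps)
    also have "\<dots> \<le> 8 * A * norm h ^ 3 + \<eta>" using e(3) r(3) by linarith
    finally show ?thesis unfolding h_def .
  qed
  have pde: "\<exists>F'. ((\<lambda>s. F 0 0 s x) has_vector_derivative F') (at t) \<and>
        norm (\<i> * F' + (F 2 0 t x + F 0 2 t x) - gp_rhs \<gamma> (V t) (u t) x) \<le> \<eta>"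
    if t: "t \<in> {0<..<T}" and x: "x \<in> S" for t x
  proof -
    have tT: "t \<in> {0..T}" using t by auto
    obtain ut uxx uyy where E: "has_sobolev_time_derivative 0 \<Omega> T u t ut"
      "has_weak_derivative \<Omega> (2, 0) (u t) uxx" "has_weak_derivative \<Omega> (0, 2) (u t) uyy"
      "AE x in lebesgue. x \<in> \<Omega> \<longrightarrow> \<i> * ut x + (uxx x + uyy x) =
             of_real (\<gamma> * (norm (u t x))\<^sup>2) * u t x + of_real (V t x) * u t x"
      using u t unfolding gp_solution_def by blast
    have ut: "ut \<in> sobolev 0 \<Omega>" using E(1) by (simp add: has_sobolev_time_derivative_def)
    have "norm (\<i> * mollify r 0 0 \<Omega> ut x + (mollify r 2 0 \<Omega> (u t) x + mollify r 0 2 \<Omega> (u t) x) - gp_rhs \<gamma> (V t) (u t) x) \<le> L * (2 * r)"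
    proof (rule mollify_gp_equation[OF O(1,2) r(1) sub[OF SQ[OF x]] us[OF tT] ut E(2,3)])
      show "AE x in lebesgue. x \<in> \<Omega> \<longrightarrow> \<i> * ut x + (uxx x + uyy x) = gp_rhs \<gamma> (V t) (u t) x"
        using E(4) by (simp add: gp_rhs_def)
      fix y assume "y \<in> \<Omega>"
      then have yc: "y \<in> closure \<Omega>" and xc: "x \<in> closure \<Omega>" using cl x S by auto
      show "norm (gp_rhs \<gamma> (V t) (u t) y - gp_rhs \<gamma> (V t) (u t) x) \<le> L * norm (y - x)"
        unfolding L_def by (rule gp_rhs_Lipschitz[OF g0]) (use ub[OF tT] Vb[OF tT] xc yc in auto)
    qed (rule L0)
    moreover have "((\<lambda>s. F 0 0 s x) has_vector_derivative mollify r 0 0 \<Omega> ut x) (at t)"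
      unfolding F_def by (rule mollify_time_derivative[OF O(1,2) E(1)]) (use t in auto)
    ultimately show ?thesis unfolding F_def using r(4) by (intro exI[of _ "mollify r 0 0 \<Omega> ut x"]) auto
  qed
  have Lip: "norm (F k l t x - F k l t y) \<le> 2 * A * norm (x - y)"
    if "t \<in> {0..T}" "x \<in> S" "y \<in> S" "k + l = 2" for t x y k l
    unfolding F_def by (rule mollify_Lipschitz[OF ui[OF that(1)] Qconv]) (use bd that SQ in auto)
  have cont: "continuous_on {0..T} (\<lambda>t. F 0 0 t x)" for x
    unfolding F_def by (rule mollify_continuous_time[OF O(1,2) uc(1)])
  have near: "norm (F 0 0 t x - u t x) \<le> \<eta>" "\<And>k l. k + l \<le> 3 \<Longrightarrow> norm (F k l t x) \<le> A" if "t \<in> {0..T}" "x \<in> S" for t x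
    using ap[OF SQ[OF that(2)] that(1)] bd[OF SQ[OF that(2)] that(1)] r(3) eta unfolding F_def by auto
  show ?thesis
    by (rule exI[of _ F]) (use cont near Taylor Lip pde in blast)
qed

section \<open>Geometry of Voronoi meshes\<close>

locale voronoi_mesh =
  fixes \<Omega> :: "plane set" and \<V> :: mesh
  assumes domain: "open \<Omega>" "bounded \<Omega>" "convex \<Omega>" "\<Omega> \<noteq> {}"
    and admissible: "admissible_mesh \<Omega> \<V>" and voronoi: "voronoi \<Omega> \<V>"
    and boundary: "boundary_property \<Omega> \<V>"
begin

abbreviation "ctr \<equiv> center \<V>"
abbreviation "nb \<equiv> neighbours \<V>"

lemma admissibleD:
  shows finite_cells: "finite (cells \<V>)"
    and cell_basic: "\<forall>K\<in>cells \<V>. K \<noteq> {} \<and> open K \<and> convex K \<and> polytope (closure K) \<and> K \<subseteq> \<Omega>"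
    and cells_disjoint0: "\<forall>K\<in>cells \<V>. \<forall>L\<in>cells \<V>. K \<noteq> L \<longrightarrow> K \<inter> L = {}"
    and closure_domain: "closure \<Omega> = (\<Union>K\<in>cells \<V>. closure K)"
    and finite_edges: "finite (edges \<V>)"
    and edge_segment0: "\<forall>\<sigma>\<in>edges \<V>. \<exists>a b. a \<noteq> b \<and> \<sigma> = closed_segment a b"
    and edges_disjoint: "\<forall>\<sigma>\<in>edges \<V>. \<forall>\<tau>\<in>edges \<V>. \<sigma> \<noteq> \<tau> \<longrightarrow> rel_interior \<sigma> \<inter> rel_interior \<tau> = {}"
    and cell_frontier: "\<forall>K\<in>cells \<V>. frontier K = \<Union>(cell_edges \<V> K)"
    and interface_edge: "\<forall>K\<in>cells \<V>. \<forall>L\<in>cells \<V>. K \<noteq> L \<longrightarrow>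
        edge_length (interface K L) = 0 \<or> interface K L \<in> edges \<V>"
    and ctr_closure: "\<forall>K\<in>cells \<V>. center \<V> K \<in> closure K"
  by (insert admissible[unfolded admissible_mesh_def], elim conjE, assumption)+

lemma cellD:
  assumes "K \<in> cells \<V>"
  shows "K \<noteq> {}" "open K" "convex K" "K \<subseteq> \<Omega>" "ctr K \<in> closure K" "frontier K = \<Union>(cell_edges \<V> K)" "bounded K"
proof -
  show "K \<noteq> {}" "open K" "convex K" and KO: "K \<subseteq> \<Omega>"
    using bspec[OF cell_basic assms] by auto
  show "ctr K \<in> closure K" "frontier K = \<Union>(cell_edges \<V> K)"
    using bspec[OF ctr_closure assms] bspec[OF cell_frontier assms] by auto
  show "bounded K" using bounded_subset[OF domain(2) KO] .
qed

lemma cells_disjoint: "K \<in> cells \<V> \<Longrightarrow> L \<in> cells \<V> \<Longrightarrow> K \<noteq> L \<Longrightarrow> K \<inter> L = {}"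
  using cells_disjoint0 by blast

lemma interior_closure_cell: "K \<in> cells \<V> \<Longrightarrow> interior (closure K) = K"
  using convex_interior_closure[OF cellD(3)] interior_open[OF cellD(2)] by simp

lemma cell_eq: "K \<in> cells \<V> \<Longrightarrow> K = {x \<in> \<Omega>. \<forall>L\<in>cells \<V>. ctr L \<noteq> ctr K \<longrightarrow> dist x (ctr K) < dist x (ctr L)}"
  using voronoi[unfolded voronoi_def] by (rule bspec)

text \<open>The Voronoi description of a cell involves the cell only through its center.\<close>

lemma ctr_inj:
  assumes "K \<in> cells \<V>" "L \<in> cells \<V>" "ctr K = ctr L"
  shows "K = L"
proof -
  have "K = {x \<in> \<Omega>. \<forall>M\<in>cells \<V>. ctr M \<noteq> ctr L \<longrightarrow> dist x (ctr L) < dist x (ctr M)}"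
    using cell_eq[OF assms(1)] unfolding assms(3) .
  also have "\<dots> = L" by (rule cell_eq[OF assms(2), symmetric])
  finally show ?thesis .
qed

lemma cell_iff:
  assumes "K \<in> cells \<V>"
  shows "y \<in> K \<longleftrightarrow> y \<in> \<Omega> \<and> (\<forall>L\<in>cells \<V>. L \<noteq> K \<longrightarrow> dist y (ctr K) < dist y (ctr L))"
proof -
  have "y \<in> K \<longleftrightarrow> y \<in> \<Omega> \<and> (\<forall>L\<in>cells \<V>. ctr L \<noteq> ctr K \<longrightarrow> dist y (ctr K) < dist y (ctr L))"
    by (subst cell_eq[OF assms]) simp
  also have "\<dots> \<longleftrightarrow> y \<in> \<Omega> \<and> (\<forall>L\<in>cells \<V>. L \<noteq> K \<longrightarrow> dist y (ctr K) < dist y (ctr L))"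
    using ctr_inj[OF _ assms] by (intro conj_cong refl ball_cong) auto
  finally show ?thesis .
qed

text \<open>For distinct centers, an affine function that vanishes on their perpendicular bisector
  and is negative on the side of \<open>ctr K\<close>. Its sign and slope replace normals and angles
  in the geometric arguments.\<close>

definition bis :: "plane set \<Rightarrow> plane set \<Rightarrow> plane \<Rightarrow> real" where
  "bis K L y = (y - ctr K) \<bullet> (ctr L - ctr K) - ((ctr L - ctr K) \<bullet> (ctr L - ctr K)) / 2"

lemma bis_alt: "bis K L y = ((dist y (ctr K))\<^sup>2 - (dist y (ctr L))\<^sup>2) / 2"
  by (simp add: bis_def dist_norm power2_norm_eq_inner inner_diff_left inner_diff_right inner_commute field_simps)

lemma bis_commute: "bis L K y = - bis K L y"
  by (simp add: bis_alt diff_divide_distrib)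

lemma bis_neg_iff: "bis K L y < 0 \<longleftrightarrow> dist y (ctr K) < dist y (ctr L)"
proof -
  have "bis K L y < 0 \<longleftrightarrow> (dist y (ctr K))\<^sup>2 < (dist y (ctr L))\<^sup>2" by (simp add: bis_alt)
  also have "\<dots> \<longleftrightarrow> dist y (ctr K) < dist y (ctr L)"
    using power_mono_iff[of "dist y (ctr L)" "dist y (ctr K)" 2] by (simp add: not_le[symmetric])
  finally show ?thesis .
qed

lemma bis_affine: "bis K L (y + t *\<^sub>R v) = bis K L y + t * (v \<bullet> (ctr L - ctr K))"
  by (simp add: bis_def inner_add_left inner_diff_left algebra_simps)

lemma bis_neg: "K \<in> cells \<V> \<Longrightarrow> L \<in> cells \<V> \<Longrightarrow> K \<noteq> L \<Longrightarrow> y \<in> K \<Longrightarrow> bis K L y < 0"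
  using cell_iff bis_neg_iff by blast

lemma bis_nonpos:
  assumes "K \<in> cells \<V>" "L \<in> cells \<V>" "K \<noteq> L" "y \<in> closure K"
  shows "bis K L y \<le> 0"
proof -
  have cont: "continuous_on (closure K) (bis K L)"
    unfolding bis_def by (intro continuous_intros)
  show ?thesis
    using continuous_le_on_closure[OF cont assms(4), of 0] bis_neg[OF assms(1-3)] by (simp add: less_imp_le)
qed

lemma nbD:
  assumes "nb K L"
  shows "K \<in> cells \<V>" "L \<in> cells \<V>" "K \<noteq> L" "interface K L \<in> edges \<V>" "ctr K \<noteq> ctr L"
  using assms ctr_inj unfolding neighbours_def by auto

lemma interface_commute: "interface K L = interface L K"
  by (simp add: interface_def Int_commute)

lemma nb_commute: "nb K L \<longleftrightarrow> nb L K"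
  by (auto simp: neighbours_def interface_commute)

text \<open>A point in both closed cells satisfies the two one-sided bounds, which are
  opposite.\<close>

lemma bis_interface:
  assumes "nb K L" "y \<in> interface K L"
  shows "bis K L y = 0"
  using bis_nonpos[of K L y] bis_nonpos[of L K y] nbD[OF assms(1)] assms(2) bis_commute[of L K y]
  by (auto simp: interface_def)

lemma edge_segment: "\<sigma> \<in> edges \<V> \<Longrightarrow> \<exists>a b. a \<noteq> b \<and> \<sigma> = closed_segment a b"
  using edge_segment0 by (rule bspec)

lemma segment_midpoint_open:
  fixes a b p q :: "'a::real_vector"
  assumes "p \<in> closed_segment a b" "q \<in> closed_segment a b" "p \<noteq> q"
  shows "midpoint p q \<in> open_segment a b"
proof -
  obtain s where s: "0 \<le> s" "s \<le> 1" "p = (1 - s) *\<^sub>R a + s *\<^sub>R b" using assms(1) by (auto simp: in_segment)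
  obtain t where t: "0 \<le> t" "t \<le> 1" "q = (1 - t) *\<^sub>R a + t *\<^sub>R b" using assms(2) by (auto simp: in_segment)
  have "s \<noteq> t" using assms(3) s t by auto
  then have st: "0 < (s + t) / 2" "(s + t) / 2 < 1" using s t by auto
  have "a \<noteq> b" using assms by auto
  moreover have "midpoint p q = (1 - (s + t) / 2) *\<^sub>R a + ((s + t) / 2) *\<^sub>R b"
    unfolding s t midpoint_def
    by (simp add: algebra_simps add_divide_distrib) (simp flip: scaleR_left_distrib)
  ultimately show ?thesis using st unfolding in_segment by blast
qed

text \<open>The midpoint of two common points belongs to both relative interiors, and these are
  disjoint for different edges.\<close>

lemma edges_eqI:
  assumes "\<sigma> \<in> edges \<V>" "\<tau> \<in> edges \<V>" "p \<in> \<sigma>" "p \<in> \<tau>" "q \<in> \<sigma>" "q \<in> \<tau>" "p \<noteq> q"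
  shows "\<sigma> = \<tau>"
proof (rule ccontr)
  assume ne: "\<sigma> \<noteq> \<tau>"
  have mid: "midpoint p q \<in> rel_interior \<rho>" if r: "\<rho> \<in> edges \<V>" "p \<in> \<rho>" "q \<in> \<rho>" for \<rho>
  proof -
    obtain a b where ab: "a \<noteq> b" "\<rho> = closed_segment a b" using edge_segment[OF r(1)] by blast
    then show ?thesis using segment_midpoint_open[of p a b q] r assms(7) by (simp add: rel_interior_closed_segment)
  qed
  have "rel_interior \<sigma> \<inter> rel_interior \<tau> = {}"
    using edges_disjoint assms(1,2) ne by blast
  then show False using mid assms by blast
qed

text \<open>If an inner point p of the segment were outside \<Omega>, a supporting linear functional
  would be maximal at p. Being affine on the segment it would be constant there, and the entire
  segment would lie on the boundary.\<close>

lemma open_segment_in_domain: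
  assumes ab: "closed_segment a b \<subseteq> closure \<Omega>" and nf: "\<not> closed_segment a b \<subseteq> frontier \<Omega>" and p: "p \<in> open_segment a b"
  shows "p \<in> \<Omega>"
proof (rule ccontr)
  assume pn: "p \<notin> \<Omega>"
  obtain w c where w: "w \<noteq> 0" "\<forall>x\<in>\<Omega>. w \<bullet> x \<le> c" "\<forall>x\<in>{p}. c \<le> w \<bullet> x"
    using separating_hyperplane_sets[of \<Omega> "{p}"] domain pn by auto
  have strict: "w \<bullet> y < w \<bullet> p" if y: "y \<in> \<Omega>" for y
  proof -
    obtain e where e: "e > 0" "cball y e \<subseteq> \<Omega>" using domain(1) y open_contains_cball by blast
    have "y + (e / norm w) *\<^sub>R w \<in> \<Omega>" using e w(1) by (intro subsetD[OF e(2)]) (auto simp: dist_norm)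
    then have "w \<bullet> (y + (e / norm w) *\<^sub>R w) \<le> w \<bullet> p" using w by force
    moreover have "0 < (e / norm w) * (w \<bullet> w)" using e w(1) by simp
    ultimately show ?thesis by (simp add: inner_add_right)
  qed
  have le: "w \<bullet> y \<le> w \<bullet> p" if "y \<in> closure \<Omega>" for y
    by (rule continuous_le_on_closure[of \<Omega> "\<lambda>y. w \<bullet> y" y "w \<bullet> p"])
      (use that less_imp_le[OF strict] in \<open>auto intro!: continuous_intros\<close>)
  obtain s where s: "0 < s" "s < 1" "p = (1 - s) *\<^sub>R a + s *\<^sub>R b" using p by (auto simp: in_segment)
  have la: "w \<bullet> a \<le> w \<bullet> p" "w \<bullet> b \<le> w \<bullet> p" using le ab by auto
  have wp: "w \<bullet> p = (1 - s) * (w \<bullet> a) + s * (w \<bullet> b)" using s(3) by (simp add: inner_add_right)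
  have eq: "w \<bullet> a = w \<bullet> p" "w \<bullet> b = w \<bullet> p"
  proof -
    have "(1 - s) * (w \<bullet> p - w \<bullet> a) + s * (w \<bullet> p - w \<bullet> b) = 0" using wp by (simp add: algebra_simps)
    moreover have "0 \<le> (1 - s) * (w \<bullet> p - w \<bullet> a)" "0 \<le> s * (w \<bullet> p - w \<bullet> b)" using la s by auto
    ultimately have "(1 - s) * (w \<bullet> p - w \<bullet> a) = 0" "s * (w \<bullet> p - w \<bullet> b) = 0" by linarith+
    then show "w \<bullet> a = w \<bullet> p" "w \<bullet> b = w \<bullet> p" using s by auto
  qed
  have "y \<in> frontier \<Omega>" if y: "y \<in> closed_segment a b" for y
  proof -
    obtain t where t: "y = (1 - t) *\<^sub>R a + t *\<^sub>R b" using y by (auto simp: in_segment)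
    have "w \<bullet> y = w \<bullet> p" using eq unfolding t by (simp add: inner_add_right algebra_simps)
    then have "y \<notin> \<Omega>" using strict by fastforce
    then show ?thesis using ab y domain(1) by (auto simp: frontier_def interior_open)
  qed
  then show False using nf by blast
qed

lemma closed_cell_subset: "K \<in> cells \<V> \<Longrightarrow> closure K \<subseteq> closure \<Omega>"
  using cellD(4) by (simp add: closure_mono)

text \<open>Arbitrarily close to p there are points of \<Omega> outside the closure of K. The other
  closed cells cover them, and their finite union is closed.\<close>

lemma frontier_point_other_cell:
  assumes K: "K \<in> cells \<V>" and p: "p \<in> frontier K" "p \<in> \<Omega>"
  shows "\<exists>L\<in>cells \<V>. L \<noteq> K \<and> p \<in> closure L"
proof -
  let ?U = "\<Union>L\<in>cells \<V> - {K}. closure L"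
  have "closed ?U" using finite_cells by (intro closed_UN) auto
  moreover have "p \<in> closure (\<Omega> - closure K)"
    unfolding closure_approachable
  proof (intro allI impI)
    fix e :: real assume e: "e > 0"
    obtain d where d: "d > 0" "ball p d \<subseteq> \<Omega>" using domain(1) p(2) openE by blast
    have "p \<notin> interior (closure K)"
      using p(1) cellD(2)[OF K] by (simp add: interior_closure_cell[OF K] frontier_def interior_open)
    then have "\<not> ball p (min d e) \<subseteq> closure K" using d e mem_interior by (metis min_less_iff_conj)
    then obtain y where "y \<in> ball p (min d e)" "y \<notin> closure K" by blast
    then show "\<exists>y\<in>\<Omega> - closure K. dist y p < e" using d by (auto simp: dist_commute intro!: bexI[of _ y])
  qed
  moreover have "\<Omega> - closure K \<subseteq> ?U" using closure_domain closure_subset[of \<Omega>] by blast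
  ultimately have "p \<in> ?U" using closure_minimal by blast
  then show ?thesis by blast
qed

text \<open>By pigeonhole, one of the finitely many other closed cells contains infinitely many
  points of the open segment. The interface with it has positive length, hence is an edge, and it
  shares two points with \<sigma>.\<close>

lemma interior_edge_interface:
  assumes K: "K \<in> cells \<V>" and s: "\<sigma> \<in> cell_edges \<V> K" and ne: "\<not> \<sigma> \<subseteq> frontier \<Omega>"
  shows "\<exists>L. nb K L \<and> \<sigma> = interface K L"
proof -
  have se: "\<sigma> \<in> edges \<V>" "\<sigma> \<subseteq> frontier K" using s by (auto simp: cell_edges_def)
  obtain a b where ab: "a \<noteq> b" "\<sigma> = closed_segment a b" using edge_segment[OF se(1)] by blast
  have fK: "frontier K \<subseteq> closure K" by (simp add: frontier_def)
  have sub: "closed_segment a b \<subseteq> closure \<Omega>" using se(2) ab fK closed_cell_subset[OF K] by blast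
  have "open_segment a b \<subseteq> (\<Union>L\<in>cells \<V> - {K}. closure L \<inter> open_segment a b)"
  proof
    fix p assume p: "p \<in> open_segment a b"
    have "p \<in> \<Omega>" using open_segment_in_domain[OF sub _ p] ne ab by blast
    moreover have "p \<in> frontier K" using p se(2) ab segment_open_subset_closed by blast
    ultimately show "p \<in> (\<Union>L\<in>cells \<V> - {K}. closure L \<inter> open_segment a b)"
      using frontier_point_other_cell[OF K] p by blast
  qed
  moreover have "infinite (open_segment a b)" using ab(1) by (simp add: finite_open_segment)
  ultimately have "infinite (\<Union>L\<in>cells \<V> - {K}. closure L \<inter> open_segment a b)" using finite_subset by blast
  then have "\<not> (\<forall>L\<in>cells \<V> - {K}. finite (closure L \<inter> open_segment a b))"
    using finite_UN_I[of "cells \<V> - {K}" "\<lambda>L. closure L \<inter> open_segment a b"] finite_cells by blast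
  then obtain L where L: "L \<in> cells \<V>" "L \<noteq> K" "infinite (closure L \<inter> open_segment a b)" by blast
  obtain p where p: "p \<in> closure L \<inter> open_segment a b" using L(3) infinite_imp_nonempty by blast
  have "infinite (closure L \<inter> open_segment a b - {p})" using L(3) by simp
  then obtain q where q: "q \<in> closure L \<inter> open_segment a b" "q \<noteq> p" using infinite_imp_nonempty by blast
  have s1: "x \<in> \<sigma>" "x \<in> closure K" if "x \<in> open_segment a b" for x
    using that se(2) ab fK segment_open_subset_closed by blast+
  have pq: "p \<in> interface K L" "q \<in> interface K L" using p q s1 by (auto simp: interface_def)
  have "bounded (interface K L)" using bounded_closure[OF cellD(7)[OF K]] unfolding interface_def by blast
  then have "dist p q \<le> edge_length (interface K L)" unfolding edge_length_def using pq by (rule diameter_bounded_bound)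
  moreover have "0 < dist p q" using q(2) by simp
  ultimately have "edge_length (interface K L) \<noteq> 0" by linarith
  then have ie: "interface K L \<in> edges \<V>" using interface_edge K L(1,2) by blast
  then have "nb K L" using K L by (simp add: neighbours_def)
  moreover have "\<sigma> = interface K L" by (rule edges_eqI[OF se(1) ie _ pq(1) _ pq(2)]) (use s1 p q in auto)
  ultimately show ?thesis by blast
qed

lemma int_cellD:
  assumes "K \<in> int_cells \<Omega> \<V>"
  shows "K \<in> cells \<V>" "\<And>\<sigma>. \<sigma> \<in> cell_edges \<V> K \<Longrightarrow> \<exists>L. nb K L \<and> \<sigma> = interface K L"
proof -
  show K: "K \<in> cells \<V>" using assms by (simp add: int_cells_def)
  show "\<exists>L. nb K L \<and> \<sigma> = interface K L" if "\<sigma> \<in> cell_edges \<V> K" for \<sigma>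
    by (rule interior_edge_interface[OF K that])
      (use assms that in \<open>auto simp: int_cells_def ext_edges_def cell_edges_def\<close>)
qed

lemma bis_ctr: "nb K L \<Longrightarrow> bis K L (ctr K) < 0"
  using nbD(5)[of K L] by (auto simp: bis_def)

text \<open>A center on the frontier of its cell would lie on an interface and so have distance 0 to
  a second center as well.\<close>

lemma int_cell_ctr:
  assumes "K \<in> int_cells \<Omega> \<V>"
  shows "ctr K \<in> K"
proof (rule ccontr)
  assume "ctr K \<notin> K"
  note K = int_cellD(1)[OF assms]
  have "ctr K \<in> frontier K" using \<open>ctr K \<notin> K\<close> cellD(5)[OF K] cellD(2)[OF K] by (simp add: frontier_def interior_open)
  then obtain \<sigma> where "\<sigma> \<in> cell_edges \<V> K" "ctr K \<in> \<sigma>" using cellD(6)[OF K] by blast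
  then obtain L where L: "nb K L" "ctr K \<in> interface K L" using int_cellD(2)[OF assms] by blast
  show False using bis_interface[OF L] bis_ctr[OF L(1)] by simp
qed

lemma ext_cell_ctr:
  assumes "K \<in> ext_cells \<Omega> \<V>"
  shows "K \<in> cells \<V>" "ctr K \<in> frontier \<Omega>"
proof -
  have "K \<in> cells \<V> \<and> cell_edges \<V> K \<inter> ext_edges \<Omega> \<V> \<noteq> {}"
    using assms by (simp add: ext_cells_def int_cells_def)
  then show "K \<in> cells \<V>" "ctr K \<in> frontier \<Omega>"
    using boundary[unfolded boundary_property_def] by simp_all
qed

text \<open>In the plane the orthogonal complement of a nonzero vector is a line.\<close>

lemma orthogonal_plane:
  fixes u v w :: plane
  assumes "w \<noteq> 0" "u \<bullet> w = 0" "v \<bullet> w = 0"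
  shows "u$1 * v$2 = u$2 * v$1"
proof -
  have 1: "u$1 * w$1 + u$2 * w$2 = 0" "v$1 * w$1 + v$2 * w$2 = 0"
    using assms by (simp_all add: inner_vec_def sum_2)
  have "(u$1 * v$2 - u$2 * v$1) * w$1 = v$2 * (u$1 * w$1 + u$2 * w$2) - u$2 * (v$1 * w$1 + v$2 * w$2)"
    by (simp add: algebra_simps)
  moreover have "(u$1 * v$2 - u$2 * v$1) * w$2 = u$1 * (v$1 * w$1 + v$2 * w$2) - v$1 * (u$1 * w$1 + u$2 * w$2)"
    by (simp add: algebra_simps)
  moreover have "w$1 \<noteq> 0 \<or> w$2 \<noteq> 0" using assms(1) by (auto simp: vec_eq_iff forall_2)
  ultimately show ?thesis using 1 by auto
qed

text \<open>The center of the neighbour is the mirror image of \<open>ctr K\<close> in the line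
  through the edge. Algebraically, u and v are both orthogonal to the edge, so v = m u, and the two
  bisector equations at a common point leave m = 1.\<close>

lemma interface_determines_neighbour:
  assumes L: "nb K L" and M: "nb K M" and eq: "interface K L = interface K M"
  shows "L = M"
proof -
  obtain a b where ab: "a \<noteq> b" "interface K L = closed_segment a b" using edge_segment[OF nbD(4)[OF L]] by blast
  define u where "u = ctr L - ctr K"
  define v where "v = ctr M - ctr K"
  have uv: "u \<noteq> 0" "v \<noteq> 0" using nbD(5)[OF L] nbD(5)[OF M] by (auto simp: u_def v_def)
  have A: "(y - ctr K) \<bullet> u = (u \<bullet> u) / 2" "(y - ctr K) \<bullet> v = (v \<bullet> v) / 2" if "y \<in> interface K L" for y
    using bis_interface[OF L that] bis_interface[OF M] that eq
    by (auto simp: bis_def u_def v_def)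
  have aI: "a \<in> interface K L" "b \<in> interface K L" using ab by auto
  have "u \<bullet> (b - a) = 0" "v \<bullet> (b - a) = 0"
    using A(1)[OF aI(1)] A(1)[OF aI(2)] A(2)[OF aI(1)] A(2)[OF aI(2)]
    by (simp_all add: inner_diff_left inner_diff_right inner_commute)
  then have cr: "u$1 * v$2 = u$2 * v$1" using orthogonal_plane[of "b - a" u v] ab(1) by simp
  define y where "y = a - ctr K"
  have y: "y$1 * u$1 + y$2 * u$2 = (u$1 * u$1 + u$2 * u$2) / 2" "y$1 * v$1 + y$2 * v$2 = (v$1 * v$1 + v$2 * v$2) / 2"
    using A[OF aI(1)] by (simp_all add: y_def inner_vec_def sum_2)
  have "(u \<bullet> u) *\<^sub>R v = (u \<bullet> v) *\<^sub>R u" using cr by (auto simp: inner_vec_def sum_2 vec_eq_iff forall_2 algebra_simps)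
  then have vu: "v = ((u \<bullet> v) / (u \<bullet> u)) *\<^sub>R u"
    using uv(1) by (metis (no_types) divide_inverse_commute inner_eq_zero_iff right_inverse scaleR_one scaleR_scaleR mult.commute)
  define m where "m = (u \<bullet> v) / (u \<bullet> u)"
  have vm: "v = m *\<^sub>R u" using vu by (simp add: m_def)
  have "m * (y \<bullet> u) = m\<^sup>2 * (u \<bullet> u) / 2" using A(2)[OF aI(1)] unfolding vm y_def by (simp add: power2_eq_square mult.assoc)
  then have "m * ((u \<bullet> u) / 2) = m\<^sup>2 * (u \<bullet> u) / 2" using A(1)[OF aI(1)] by (simp add: y_def)
  then have "m * (u \<bullet> u) * (1 - m) = 0" by (simp add: power2_eq_square algebra_simps)
  moreover have "m \<noteq> 0" using vm uv(2) by auto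
  ultimately have "m = 1" using uv(1) by simp
  then have "ctr L = ctr M" using vm by (simp add: u_def v_def)
  then show ?thesis using ctr_inj nbD(2)[OF L] nbD(2)[OF M] by blast
qed

end

section \<open>Area and centroid of triangles\<close>

lemma absolutely_integrable_continuous_compact:
  fixes f :: "plane \<Rightarrow> 'a::euclidean_space"
  assumes "compact S" "continuous_on UNIV f"
  shows "f absolutely_integrable_on S"
proof -
  obtain a b where ab: "S \<subseteq> cbox a b" using bounded_subset_cbox_symmetric[OF compact_imp_bounded[OF assms(1)]] by blast
  have "f absolutely_integrable_on cbox a b"
    by (rule absolutely_integrable_continuous[OF continuous_on_subset[OF assms(2)]]) simp
  then show ?thesis
    by (rule set_integrable_subset[OF _ _ ab]) (use assms(1) lmeasurable_compact in blast)
qed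

lemma plane_coords:
  fixes u v y :: plane
  assumes "u$1 * v$2 - u$2 * v$1 \<noteq> 0"
  shows "y = ((y$1 * v$2 - y$2 * v$1) / (u$1 * v$2 - u$2 * v$1)) *\<^sub>R u + ((u$1 * y$2 - u$2 * y$1) / (u$1 * v$2 - u$2 * v$1)) *\<^sub>R v"
  using assms by (simp add: vec_eq_iff forall_2 add_divide_distrib[symmetric] nonzero_eq_divide_eq) (simp add: algebra_simps)

lemma plane_coords_unique:
  fixes u v :: plane
  assumes "u$1 * v$2 - u$2 * v$1 \<noteq> 0" "\<alpha> *\<^sub>R u + \<beta> *\<^sub>R v = 0"
  shows "\<alpha> = 0" "\<beta> = 0"
proof -
  have e: "\<alpha> * u$1 + \<beta> * v$1 = 0" "\<alpha> * u$2 + \<beta> * v$2 = 0"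
    using assms(2) by (simp_all add: vec_eq_iff forall_2)
  have "\<alpha> * (u$1 * v$2 - u$2 * v$1) = (\<alpha> * u$1 + \<beta> * v$1) * v$2 - (\<alpha> * u$2 + \<beta> * v$2) * v$1"
    "\<beta> * (u$1 * v$2 - u$2 * v$1) = (\<alpha> * u$2 + \<beta> * v$2) * u$1 - (\<alpha> * u$1 + \<beta> * v$1) * u$2"
    by (simp_all add: algebra_simps)
  then show "\<alpha> = 0" "\<beta> = 0" using e assms(1) by auto
qed

text \<open>The centroid formula follows from the invariance of the triangle under the affine map
  that permutes its vertices cyclically, whose only fixed point is the centroid.\<close>

lemma triangle_centroid:
  fixes p a b :: plane
  defines "T \<equiv> convex hull {p, a, b}"
  shows "((\<lambda>x. x) has_integral measure lebesgue T *\<^sub>R ((1/3) *\<^sub>R (p + a + b))) T"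
proof -
  define u where "u = a - p"
  define v where "v = b - p"
  define \<delta> where "\<delta> = u$1 * v$2 - u$2 * v$1"
  have Tc: "compact T" unfolding T_def by (intro compact_convex_hull finite_imp_compact) auto
  have TL: "T \<in> lmeasurable" by (rule lmeasurable_compact[OF Tc])
  have ct: "measure lebesgue T = \<bar>\<delta>\<bar> / 2"
    using content_triangle[of p a b] unfolding T_def \<delta>_def u_def v_def
    by (simp add: measure_completion borel_compact Tc[unfolded T_def] abs_minus_commute mult.commute)
  have xi: "(\<lambda>x::plane. x) absolutely_integrable_on T"
    by (rule absolutely_integrable_continuous_compact[OF Tc]) (rule continuous_on_id)
  show ?thesis
  proof (cases "\<delta> = 0")
    case True
    then have "negligible T" using ct TL by (simp add: negligible_iff_measure)
    then show ?thesis using True ct by (simp add: has_integral_iff integrable_negligible integral_negligible)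
  next
    case False
    then have d: "u$1 * v$2 - u$2 * v$1 \<noteq> 0" by (simp add: \<delta>_def)
    define \<alpha> where "\<alpha> x = (x$1 * v$2 - x$2 * v$1) / \<delta>" for x :: plane
    define \<beta> where "\<beta> x = (u$1 * x$2 - u$2 * x$1) / \<delta>" for x :: plane
    have xy: "x = \<alpha> x *\<^sub>R u + \<beta> x *\<^sub>R v" for x
      unfolding \<alpha>_def \<beta>_def \<delta>_def by (rule plane_coords[OF d])
    \<comment> \<open>The linear part of the cyclic map: it sends u = a - p to b - a and v = b - p
      to p - a.\<close>
    define G where "G x = \<alpha> x *\<^sub>R (v - u) + \<beta> x *\<^sub>R (- u)" for x
    have Glin: "linear G"
      unfolding G_def \<alpha>_def \<beta>_def
      by (rule linearI) (simp_all add: algebra_simps add_divide_distrib diff_divide_distrib)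
    have ab: "\<alpha> u = 1" "\<beta> u = 0" "\<alpha> v = 0" "\<beta> v = 1"
      using False by (simp_all add: \<alpha>_def \<beta>_def \<delta>_def mult.commute)
    have Gu: "G u = v - u" "G v = - u" by (simp_all add: G_def ab)
    have Gfix: "x = 0" if "G x = x" for x
    proof -
      have "\<alpha> x *\<^sub>R u + \<beta> x *\<^sub>R v - (\<alpha> x *\<^sub>R (v - u) + \<beta> x *\<^sub>R (- u)) = 0"
        using that xy[of x] unfolding G_def by simp
      then have "(2 * \<alpha> x + \<beta> x) *\<^sub>R u + (\<beta> x - \<alpha> x) *\<^sub>R v = 0" by (simp add: vec_eq_iff algebra_simps)
      from plane_coords_unique[OF d this] have "\<alpha> x = 0" "\<beta> x = 0" by auto
      then show ?thesis using xy[of x] by simp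
    qed
    have Ginj: "x = 0" if "G x = 0" for x
    proof -
      have "(- \<alpha> x - \<beta> x) *\<^sub>R u + \<alpha> x *\<^sub>R v = 0" using that by (simp add: G_def algebra_simps)
      from plane_coords_unique[OF d this] have "\<alpha> x = 0" "\<beta> x = 0" by auto
      then show ?thesis using xy[of x] by simp
    qed
    define A where "A x = (a - G p) + G x" for x
    have Ap: "A p = a" "A a = b" "A b = p"
    proof -
      have "G a = G p + G u" "G b = G p + G v"
        by (simp_all add: linear_add[OF Glin, symmetric] u_def v_def)
      then show "A p = a" "A a = b" "A b = p" unfolding A_def Gu by (simp_all add: u_def v_def)
    qed
    have AT: "A ` T = T"
    proof -
      have "A ` T = (+) (a - G p) ` (G ` (convex hull {p, a, b}))" by (simp add: A_def[abs_def] T_def image_image)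
      also have "\<dots> = convex hull ((+) (a - G p) ` (G ` {p, a, b}))"
        by (simp only: convex_hull_linear_image[OF Glin] convex_hull_translation)
      also have "(+) (a - G p) ` (G ` {p, a, b}) = {a, b, p}" using Ap by (simp add: A_def)
      also have "convex hull {a, b, p} = T" by (simp add: T_def insert_commute)
      finally show ?thesis .
    qed
    have Aint: "(\<lambda>x. \<bar>det (matrix G)\<bar> *\<^sub>R f (A x)) absolutely_integrable_on T \<and>
           integral T (\<lambda>x. \<bar>det (matrix G)\<bar> *\<^sub>R f (A x)) = c
      \<longleftrightarrow> f absolutely_integrable_on (A ` T) \<and> integral (A ` T) f = c" for f :: "plane \<Rightarrow> plane" and c
    proof (rule has_absolute_integral_change_of_variables)
      show "T \<in> sets lebesgue" using TL by blast
      show "(A has_derivative G) (at x within T)" for x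
        unfolding A_def[abs_def] using linear_imp_has_derivative[OF Glin] by (auto intro!: derivative_eq_intros)
      show "inj_on A T"
      proof (rule inj_onI)
        fix x y assume "A x = A y"
        then have "G (x - y) = 0" by (simp add: A_def linear_diff[OF Glin])
        then show "x = y" using Ginj by force
      qed
    qed
    define m where "m = measure lebesgue T"
    have m0: "m \<noteq> 0" using ct False by (simp add: m_def)
    have ci: "integral T (\<lambda>x. c) = m *\<^sub>R c" for c :: plane
    proof -
      have "((\<lambda>x. (1::real)) has_integral m) T"
        using TL by (simp add: m_def has_integral_iff lmeasurable_iff_integrable_on lmeasure_integral)
      from has_integral_scaleR_left[OF this, of c] show ?thesis by (simp add: integral_unique)
    qed
    \<comment> \<open>The map takes the triangle onto itself. Changing variables in the integral of
      a constant therefore gives the determinant without computing it.\<close>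
    have det1: "\<bar>det (matrix G)\<bar> = 1"
    proof -
      have "integral T (\<lambda>x. \<bar>det (matrix G)\<bar> *\<^sub>R (axis 1 1 :: plane)) = integral T (\<lambda>x. axis 1 1)"
        using Aint[of "\<lambda>x. axis 1 1" "integral T (\<lambda>x. axis 1 1)"] absolutely_integrable_continuous_compact[OF Tc, of "\<lambda>x. axis 1 1 :: plane"]
        unfolding AT by simp
      then have "m *\<^sub>R (\<bar>det (matrix G)\<bar> *\<^sub>R (axis 1 1 :: plane)) = m *\<^sub>R axis 1 1" unfolding ci .
      then have "(m * \<bar>det (matrix G)\<bar> - m) *\<^sub>R (axis 1 1 :: plane) = 0" by (simp add: algebra_simps)
      then have "m * \<bar>det (matrix G)\<bar> - m = 0" by (simp add: axis_eq_0_iff)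
      then show ?thesis using m0 by simp
    qed
    define c where "c = integral T (\<lambda>x. x)"
    have xint: "(\<lambda>x. x) integrable_on T" using xi by (simp add: absolutely_integrable_on_def)
    have "c = integral T (\<lambda>x. A x)"
      using Aint[of "\<lambda>x. x" c] xi unfolding AT det1 c_def by simp
    also have "\<dots> = integral T (\<lambda>x. a - G p) + integral T (\<lambda>x. G x)"
      unfolding A_def
      by (rule integral_add)
        (use absolutely_integrable_continuous_compact[OF Tc, of "\<lambda>x. a - G p"] absolutely_integrable_continuous_compact[OF Tc, of G]
          linear_continuous_on[of G UNIV] Glin in \<open>auto simp: absolutely_integrable_on_def linear_conv_bounded_linear\<close>)
    also have "integral T (\<lambda>x. G x) = G c"
      using integral_linear[OF xint, of G] Glin by (simp add: c_def o_def linear_conv_bounded_linear)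
    finally have cG: "c = m *\<^sub>R (a - G p) + G c" unfolding ci .
    define g where "g = (1/3) *\<^sub>R (p + a + b)"
    have gG: "g = (a - G p) + G g"
    proof -
      have "A g = a - G p + (1/3) *\<^sub>R (G p + G a + G b)"
        by (simp add: A_def g_def linear_add[OF Glin] linear_scale[OF Glin])
      also have "\<dots> = (1/3) *\<^sub>R (A p + A a + A b)"
        by (simp add: A_def vec_eq_iff field_simps)
      also have "\<dots> = g" unfolding Ap by (simp add: g_def add_ac)
      finally show ?thesis by (simp add: A_def)
    qed
    \<comment> \<open>The first moment and m times the centroid satisfy the same affine equation, so
      their difference is fixed by G and has to vanish.\<close>
    have "G (c - m *\<^sub>R g) = c - m *\<^sub>R g"
    proof -
      have "G (c - m *\<^sub>R g) = (c - m *\<^sub>R (a - G p)) - m *\<^sub>R (g - (a - G p))"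
      proof -
        have "G (c - m *\<^sub>R g) = G c - m *\<^sub>R G g" by (simp add: linear_diff[OF Glin] linear_scale[OF Glin])
        moreover have "G c = c - m *\<^sub>R (a - G p)" using cG by (metis add_diff_cancel_left')
        moreover have "G g = g - (a - G p)" using gG by (metis add_diff_cancel_left')
        ultimately show ?thesis by simp
      qed
      then show ?thesis by (simp add: algebra_simps)
    qed
    then have "c = m *\<^sub>R g" using Gfix[of "c - m *\<^sub>R g"] by simp
    then show ?thesis using xint unfolding c_def m_def g_def by (simp add: has_integral_iff)
  qed
qed

text \<open>Half of base times height, the height being measured along the normal z of the base. The
  determinant in the area formula is matched with this product by comparing squares.\<close>

lemma triangle_area:
  fixes p a b z :: plane
  assumes z: "z \<noteq> 0" "z \<bullet> (b - a) = 0"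
  shows "measure lebesgue (convex hull {p, a, b}) = dist a b * \<bar>(a - p) \<bullet> z\<bar> / (2 * norm z)"
proof -
  define u where "u = a - p"
  define e where "e = b - a"
  have Tc: "compact (convex hull {p, a, b})" by (intro compact_convex_hull finite_imp_compact) auto
  have "measure lebesgue (convex hull {p, a, b}) = \<bar>(b $ 1 - p $ 1) * (a $ 2 - p $ 2) - (a $ 1 - p $ 1) * (b $ 2 - p $ 2)\<bar> / 2"
    using content_triangle[of p a b] by (simp add: measure_completion borel_compact Tc)
  also have "(b $ 1 - p $ 1) * (a $ 2 - p $ 2) - (a $ 1 - p $ 1) * (b $ 2 - p $ 2) = - (u$1 * e$2 - u$2 * e$1)"
    by (simp add: u_def e_def algebra_simps)
  finally have M: "measure lebesgue (convex hull {p, a, b}) = \<bar>u$1 * e$2 - u$2 * e$1\<bar> / 2" by simp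
  have ze: "z$1 * e$1 + z$2 * e$2 = 0" using z(2) by (simp add: e_def inner_vec_def sum_2)
  have nz: "norm x = sqrt ((x$1)\<^sup>2 + (x$2)\<^sup>2)" for x :: plane by (simp add: norm_vec_def L2_set_def sum_2)
  have "((u$1 * e$2 - u$2 * e$1) * norm z)\<^sup>2 = (norm e * (u \<bullet> z))\<^sup>2"
  proof -
    have n2: "(norm x)\<^sup>2 = (x$1)\<^sup>2 + (x$2)\<^sup>2" for x :: plane by (simp add: nz)
    have "((u$1 * e$2 - u$2 * e$1) * norm z)\<^sup>2 - (norm e * (u \<bullet> z))\<^sup>2
      = (u$1 * e$2 - u$2 * e$1)\<^sup>2 * ((z$1)\<^sup>2 + (z$2)\<^sup>2) - ((e$1)\<^sup>2 + (e$2)\<^sup>2) * (u$1 * z$1 + u$2 * z$2)\<^sup>2"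
      by (simp add: power_mult_distrib n2 inner_vec_def sum_2)
    also have "\<dots> = 0"
    proof (cases "e = 0")
      case False
      then have ne: "(e$1)\<^sup>2 + (e$2)\<^sup>2 \<noteq> 0" by (auto simp: vec_eq_iff forall_2 sum_power2_eq_zero_iff)
      define l where "l = (z$2 * e$1 - z$1 * e$2) / ((e$1)\<^sup>2 + (e$2)\<^sup>2)"
      have zz: "z$1 * ((e$1)\<^sup>2 + (e$2)\<^sup>2) = - (z$2 * e$1 - z$1 * e$2) * e$2 + (z$1 * e$1 + z$2 * e$2) * e$1"
        "z$2 * ((e$1)\<^sup>2 + (e$2)\<^sup>2) = (z$2 * e$1 - z$1 * e$2) * e$1 + (z$1 * e$1 + z$2 * e$2) * e$2"
        by (simp_all add: power2_eq_square algebra_simps)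
      then have "z$1 = - (z$2 * e$1 - z$1 * e$2) * e$2 / ((e$1)\<^sup>2 + (e$2)\<^sup>2)" "z$2 = (z$2 * e$1 - z$1 * e$2) * e$1 / ((e$1)\<^sup>2 + (e$2)\<^sup>2)"
      proof -
        have div: "x = y / n" if "x * n = y" "n \<noteq> 0" for x y n :: real using that by auto
        show "z$1 = - (z$2 * e$1 - z$1 * e$2) * e$2 / ((e$1)\<^sup>2 + (e$2)\<^sup>2)" "z$2 = (z$2 * e$1 - z$1 * e$2) * e$1 / ((e$1)\<^sup>2 + (e$2)\<^sup>2)"
          by (rule div[OF _ ne], use zz ze in simp)+
      qed
      then have zl: "z$1 = - l * e$2" "z$2 = l * e$1"
        unfolding l_def by (simp_all only: times_divide_eq_left minus_divide_left)
      show ?thesis unfolding zl by (simp add: power2_eq_square algebra_simps)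
    qed simp
    finally show ?thesis by simp
  qed
  then have "\<bar>(u$1 * e$2 - u$2 * e$1) * norm z\<bar> = \<bar>norm e * (u \<bullet> z)\<bar>" by (simp only: power2_eq_iff abs_eq_iff)
  then have "\<bar>u$1 * e$2 - u$2 * e$1\<bar> * norm z = norm e * \<bar>u \<bullet> z\<bar>" by (simp add: abs_mult)
  then have "\<bar>u$1 * e$2 - u$2 * e$1\<bar> = norm e * \<bar>u \<bullet> z\<bar> / norm z" using z(1) by (simp add: field_simps)
  then show ?thesis unfolding M u_def e_def by (simp add: dist_norm norm_minus_commute)
qed

lemma diameter_closed_segment: "diameter (closed_segment a b) = dist a (b::plane)"
proof (rule antisym)
  show "diameter (closed_segment a b) \<le> dist a b"
  proof (rule diameter_le)
    fix x y assume "x \<in> closed_segment a b" "y \<in> closed_segment a b"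
    then obtain s t where s: "0 \<le> s" "s \<le> 1" "x = (1 - s) *\<^sub>R a + s *\<^sub>R b" and t: "0 \<le> t" "t \<le> 1" "y = (1 - t) *\<^sub>R a + t *\<^sub>R b"
      by (auto simp: in_segment)
    have "x - y = (s - t) *\<^sub>R (b - a)" unfolding s t by (simp add: algebra_simps)
    then have "norm (x - y) = \<bar>s - t\<bar> * dist a b" by (simp add: dist_norm norm_minus_commute)
    also have "\<dots> \<le> 1 * dist a b" using s t by (intro mult_right_mono) auto
    finally show "norm (x - y) \<le> dist a b" by simp
  qed simp
  show "dist a b \<le> diameter (closed_segment a b)"
    by (rule diameter_bounded_bound) (auto simp: bounded_closed_segment)
qed

lemma convex_hull_triangle:
  fixes x p a b :: plane
  assumes "x \<in> convex hull {p, a, b}"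
  shows "\<exists>s\<in>{0..1}. \<exists>y\<in>closed_segment a b. x = p + s *\<^sub>R (y - p)"
proof -
  obtain y u v where uv: "y \<in> convex hull {a, b}" "0 \<le> u" "0 \<le> v" "u + v = 1" "x = u *\<^sub>R p + v *\<^sub>R y"
    using assms convex_hull_insert[of "{a, b}" p] by auto
  have "u = 1 - v" using uv(4) by simp
  have "x = p + v *\<^sub>R (y - p)" unfolding uv(5) \<open>u = 1 - v\<close> by (simp add: algebra_simps)
  moreover have "v \<in> {0..1}" using uv by simp
  ultimately show ?thesis using uv(1) by (auto simp: segment_convex_hull)
qed

lemma negligible_closed_segment: "negligible (closed_segment a (b::plane))"
  using negligible_convex_interior[of "closed_segment a b"] interior_closed_segment_ge2[of a b] by simp

section \<open>Decomposition of a cell into the triangles over its edges\<close>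

context voronoi_mesh
begin

definition nbs :: "plane set \<Rightarrow> plane set set" where "nbs K = {L. nb K L}"
definition len :: "plane set \<Rightarrow> plane set \<Rightarrow> real" where "len K L = edge_length (interface K L)"
definition dst :: "plane set \<Rightarrow> plane set \<Rightarrow> real" where "dst K L = dist (ctr K) (ctr L)"
text \<open>The transmissibility of the edge, that is, the weight of the two-point flux.\<close>

definition wt :: "plane set \<Rightarrow> plane set \<Rightarrow> real" where "wt K L = len K L / dst K L"
text \<open>The end points are chosen as functions of the edge alone, so that the data of K|L and
  L|K coincide.\<close>

definition end1 :: "plane set \<Rightarrow> plane" where
  "end1 \<sigma> = fst (SOME e. fst e \<noteq> snd e \<and> \<sigma> = closed_segment (fst e) (snd e))"
definition end2 :: "plane set \<Rightarrow> plane" where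
  "end2 \<sigma> = snd (SOME e. fst e \<noteq> snd e \<and> \<sigma> = closed_segment (fst e) (snd e))"
definition emid :: "plane set \<Rightarrow> plane set \<Rightarrow> plane" where
  "emid K L = midpoint (end1 (interface K L)) (end2 (interface K L))"
definition tri :: "plane \<Rightarrow> plane set \<Rightarrow> plane set \<Rightarrow> plane set" where
  "tri p K L = convex hull {p, end1 (interface K L), end2 (interface K L)}"

lemma finite_nbs: "finite (nbs K)"
  by (rule finite_subset[OF _ finite_cells]) (auto simp: nbs_def neighbours_def)

lemma symmetric_data: "len K L = len L K" "dst K L = dst L K" "wt K L = wt L K" "emid K L = emid L K"
  by (simp_all add: len_def dst_def wt_def emid_def interface_commute[of K L] dist_commute[of "ctr K"])

lemma edge_ends:
  assumes "\<sigma> \<in> edges \<V>"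
  shows "end1 \<sigma> \<noteq> end2 \<sigma>" "\<sigma> = closed_segment (end1 \<sigma>) (end2 \<sigma>)"
proof -
  define P where "P e \<longleftrightarrow> fst e \<noteq> snd e \<and> \<sigma> = closed_segment (fst e) (snd e)" for e
  obtain a b where "a \<noteq> b \<and> \<sigma> = closed_segment a b" using edge_segment[OF assms] by blast
  then have "P (a, b)" by (simp add: P_def)
  then have "P (SOME e. P e)" by (rule someI)
  moreover have "end1 \<sigma> = fst (SOME e. P e)" "end2 \<sigma> = snd (SOME e. P e)"
    by (simp_all add: end1_def end2_def P_def)
  ultimately show "end1 \<sigma> \<noteq> end2 \<sigma>" "\<sigma> = closed_segment (end1 \<sigma>) (end2 \<sigma>)"
    by (simp_all add: P_def)
qed

lemma interface_ends:
  assumes "nb K L"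
  shows "end1 (interface K L) \<noteq> end2 (interface K L)"
    "interface K L = closed_segment (end1 (interface K L)) (end2 (interface K L))"
    "end1 (interface K L) \<in> interface K L" "end2 (interface K L) \<in> interface K L" "emid K L \<in> interface K L"
proof -
  note e = edge_ends[OF nbD(4)[OF assms]]
  show "end1 (interface K L) \<noteq> end2 (interface K L)" by (rule e(1))
  show s: "interface K L = closed_segment (end1 (interface K L)) (end2 (interface K L))" by (rule e(2))
  have "a \<in> \<sigma>" "b \<in> \<sigma>" "midpoint a b \<in> \<sigma>" if "\<sigma> = closed_segment a b" for a b :: plane and \<sigma>
    using that by auto
  from this[OF s] show "end1 (interface K L) \<in> interface K L" "end2 (interface K L) \<in> interface K L" "emid K L \<in> interface K L"
    unfolding emid_def by blast+
qed

lemma len_eq: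
  assumes "nb K L"
  shows "len K L = dist (end1 (interface K L)) (end2 (interface K L))"
proof -
  have "diameter \<sigma> = dist a b" if "\<sigma> = closed_segment a b" for a b :: plane and \<sigma>
    using that by (simp add: diameter_closed_segment)
  from this[OF interface_ends(2)[OF assms]] show ?thesis by (simp add: len_def edge_length_def)
qed

lemma len_pos: "nb K L \<Longrightarrow> 0 < len K L"
  using interface_ends(1)[of K L] by (simp add: len_eq)

lemma dst_pos: "nb K L \<Longrightarrow> 0 < dst K L"
  using nbD(5)[of K L] by (simp add: dst_def)

lemma wt_pos: "nb K L \<Longrightarrow> 0 < wt K L"
  by (simp add: wt_def len_pos dst_pos)

lemma wt_dst: "nb K L \<Longrightarrow> wt K L * dst K L = len K L"
  using dst_pos[of K L] by (simp add: wt_def)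

text \<open>The distance from p to the line through the edge is
  \<open>- bis K L p / dst K L\<close>.\<close>

lemma tri_area:
  assumes n: "nb K L" and p: "bis K L p \<le> 0"
  shows "measure lebesgue (tri p K L) = wt K L * (- bis K L p) / 2"
proof -
  let ?a = "end1 (interface K L)" and ?b = "end2 (interface K L)" and ?z = "ctr L - ctr K"
  have ba: "bis K L ?a = 0" "bis K L ?b = 0" using bis_interface[OF n] interface_ends[OF n] by auto
  have z: "?z \<noteq> 0" using nbD(5)[OF n] by auto
  have "?z \<bullet> (?b - ?a) = bis K L ?b - bis K L ?a"
    by (simp add: bis_def inner_diff_left inner_diff_right inner_commute)
  then have z2: "?z \<bullet> (?b - ?a) = 0" using ba by simp
  have "(?a - p) \<bullet> ?z = bis K L ?a - bis K L p"
    by (simp add: bis_def inner_diff_left inner_diff_right)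
  then have az: "\<bar>(?a - p) \<bullet> ?z\<bar> = - bis K L p" using ba p by simp
  show ?thesis
    unfolding tri_def triangle_area[OF z z2] az
    by (simp add: wt_def len_eq[OF n] dst_def dist_norm norm_minus_commute)
qed

lemma tri_compact: "compact (tri p K L)"
  unfolding tri_def by (intro compact_convex_hull finite_imp_compact) auto

lemma tri_lmeasurable: "tri p K L \<in> lmeasurable"
  by (rule lmeasurable_compact[OF tri_compact])

lemma tri_subset:
  assumes n: "nb K L" and p: "p \<in> closure K"
  shows "tri p K L \<subseteq> closure K"
  unfolding tri_def
proof (rule hull_minimal)
  show "convex (closure K)" using cellD(3)[OF nbD(1)[OF n]] by (rule convex_closure)
  show "{p, end1 (interface K L), end2 (interface K L)} \<subseteq> closure K"
    using p interface_ends(3,4)[OF n] by (auto simp: interface_def)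
qed

text \<open>The ray from the apex through a common point meets one edge in y and the other in y'.
  Comparing both functions \<open>bis\<close> along it forces y = y', and two different edges share
  at most one point; so the intersection lies in a segment.\<close>

lemma tri_null:
  assumes L: "nb K L" and M: "nb K M" and ne: "L \<noteq> M" and p: "p \<in> closure K" "bis K L p < 0" "bis K M p < 0"
  shows "negligible (tri p K L \<inter> tri p K M)"
proof -
  have ie: "interface K L \<noteq> interface K M" using interface_determines_neighbour[OF L M] ne by blast
  have one: "y = y'" if "y \<in> interface K L \<inter> interface K M" "y' \<in> interface K L \<inter> interface K M" for y y'
    using edges_eqI[OF nbD(4)[OF L] nbD(4)[OF M]] that ie by blast
  have key: "x = p \<or> (\<exists>y\<in>interface K L \<inter> interface K M. x \<in> closed_segment p y)"
    if x: "x \<in> tri p K L" "x \<in> tri p K M" for x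
  proof -
    obtain s y where s: "s \<in> {0..1}" "y \<in> interface K L" "x = p + s *\<^sub>R (y - p)"
      using convex_hull_triangle[OF x(1)[unfolded tri_def]] interface_ends(2)[OF L] by blast
    obtain t y' where t: "t \<in> {0..1}" "y' \<in> interface K M" "x = p + t *\<^sub>R (y' - p)"
      using convex_hull_triangle[OF x(2)[unfolded tri_def]] interface_ends(2)[OF M] by blast
    show ?thesis
    proof (cases "x = p")
      case False
      then have st: "s > 0" "t > 0" using s t by (auto simp: less_le)
      have eq: "s *\<^sub>R (y - p) = t *\<^sub>R (y' - p)" using s(3) t(3) by simp
      have lin: "bis K N (p + r *\<^sub>R (q - p)) = bis K N p + r * (bis K N q - bis K N p)" for N r q
        by (simp add: bis_affine) (simp add: bis_def inner_diff_left algebra_simps)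
      have y0: "bis K L y = 0" "bis K M y' = 0" using bis_interface[OF L s(2)] bis_interface[OF M t(2)] by auto
      have cK: "y \<in> closure K" "y' \<in> closure K" using s(2) t(2) by (auto simp: interface_def)
      have yn: "bis K L y' \<le> 0" "bis K M y \<le> 0"
        using bis_nonpos[OF nbD(1-3)[OF L] cK(2)] bis_nonpos[OF nbD(1-3)[OF M] cK(1)] by auto
      have "s * (- bis K L p) = t * (bis K L y' - bis K L p)"
        using lin[of L s y] lin[of L t y'] s(3) t(3) y0 by simp
      also have "\<dots> \<le> t * (- bis K L p)" using yn st by (intro mult_left_mono) auto
      finally have 1: "s \<le> t" using p(2) by simp
      have "t * (- bis K M p) = s * (bis K M y - bis K M p)"
        using lin[of M s y] lin[of M t y'] s(3) t(3) y0 by simp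
      also have "\<dots> \<le> s * (- bis K M p)" using yn st by (intro mult_left_mono) auto
      finally have 2: "t \<le> s" using p(3) by simp
      have "s = t" using 1 2 by simp
      then have "y = y'" using eq st by simp
      moreover have "x \<in> closed_segment p y"
        using s by (auto simp: in_segment algebra_simps intro!: exI[of _ s])
      ultimately show ?thesis using s(2) t(2) by blast
    qed simp
  qed
  show ?thesis
  proof (cases "\<exists>y. y \<in> interface K L \<inter> interface K M")
    case True
    then obtain y where y: "y \<in> interface K L \<inter> interface K M" by blast
    have "tri p K L \<inter> tri p K M \<subseteq> closed_segment p y"
    proof
      fix x assume "x \<in> tri p K L \<inter> tri p K M"
      then have "x = p \<or> (\<exists>y\<in>interface K L \<inter> interface K M. x \<in> closed_segment p y)" using key[of x] by blast
      then show "x \<in> closed_segment p y" using one[OF y] by auto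
    qed
    then show ?thesis by (rule negligible_subset[OF negligible_closed_segment])
  next
    case False
    then have "tri p K L \<inter> tri p K M \<subseteq> closed_segment p p" using key by auto
    then show ?thesis by (rule negligible_subset[OF negligible_closed_segment])
  qed
qed

lemma tri_pairwise:
  assumes "p \<in> closure K" "\<And>L. L \<in> nbs K \<Longrightarrow> bis K L p < 0"
  shows "pairwise (\<lambda>L M. negligible (tri p K L \<inter> tri p K M)) (nbs K)"
  unfolding pairwise_def
proof (intro ballI impI)
  fix L M assume LM: "L \<in> nbs K" "M \<in> nbs K" "L \<noteq> M"
  then have "nb K L" "nb K M" by (simp_all add: nbs_def)
  then show "negligible (tri p K L \<inter> tri p K M)"
    by (rule tri_null[OF _ _ LM(3) assms(1) assms(2)[OF LM(1)] assms(2)[OF LM(2)]])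
qed

text \<open>The ray from p through y leaves the bounded cell beyond y at a point of the frontier,
  which for an interior cell lies on an interface.\<close>

lemma tri_cover:
  assumes K: "K \<in> int_cells \<Omega> \<V>" and p: "p \<in> K"
  shows "K \<subseteq> (\<Union>L\<in>nbs K. tri p K L)"
proof
  note Kc = int_cellD(1)[OF K]
  fix y assume y: "y \<in> K"
  obtain v :: plane where v: "v \<noteq> 0" "y \<noteq> p \<Longrightarrow> v = y - p"
  proof (cases "y = p")
    case True
    then show ?thesis using that[of "axis 1 1"] by (simp add: axis_eq_0_iff)
  next
    case False
    then show ?thesis using that[of "y - p"] by simp
  qed
  have iK: "interior K = K" using cellD(2)[OF Kc] by (rule interior_open)
  obtain d where d: "d > 0" "p + d *\<^sub>R v \<in> frontier K"
    using ray_to_frontier[OF cellD(7)[OF Kc], of p v] p v(1) iK by blast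
  define z where "z = p + d *\<^sub>R v"
  obtain \<sigma> where s: "\<sigma> \<in> cell_edges \<V> K" "z \<in> \<sigma>" using d(2) cellD(6)[OF Kc] unfolding z_def by blast
  obtain L where L: "nb K L" "\<sigma> = interface K L" using int_cellD(2)[OF K s(1)] by blast
  have "closed_segment p z \<subseteq> tri p K L"
    unfolding tri_def
  proof (rule closed_segment_subset)
    show "p \<in> convex hull {p, end1 (interface K L), end2 (interface K L)}" by (rule hull_inc) simp
    have "z \<in> convex hull {end1 (interface K L), end2 (interface K L)}"
      using s(2) L(2) interface_ends(2)[OF L(1)] by (simp add: segment_convex_hull)
    moreover have "convex hull {end1 (interface K L), end2 (interface K L)} \<subseteq> convex hull {p, end1 (interface K L), end2 (interface K L)}"
      by (rule hull_mono) auto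
    ultimately show "z \<in> convex hull {p, end1 (interface K L), end2 (interface K L)}" by blast
  qed (rule convex_convex_hull)
  moreover have "y \<in> closed_segment p z"
  proof (cases "y = p")
    case False
    then have v2: "v = y - p" by (rule v(2))
    have "\<not> d \<le> 1"
    proof
      assume d1: "d \<le> 1"
      have "z = (1 - d) *\<^sub>R p + d *\<^sub>R y" by (simp add: z_def v2 algebra_simps)
      then have "z \<in> K" using convexD_alt[OF cellD(3)[OF Kc] p y, of d] d(1) d1 by simp
      moreover have "z \<notin> K" using d(2) iK by (simp add: z_def frontier_def)
      ultimately show False by simp
    qed
    then have "1 < d" by simp
    then show ?thesis unfolding in_segment
      by (intro exI[of _ "1 / d"]) (simp add: z_def v2 algebra_simps)
  qed simp
  ultimately show "y \<in> (\<Union>L\<in>nbs K. tri p K L)" using L(1) by (auto simp: nbs_def)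
qed

lemma cell_lmeasurable: "K \<in> cells \<V> \<Longrightarrow> K \<in> lmeasurable"
  using cellD(2,7) by (simp add: lmeasurable_open)

text \<open>The frontier of a convex set is a null set.\<close>

lemma measure_closure_cell:
  assumes K: "K \<in> cells \<V>"
  shows "closure K \<in> lmeasurable" "measure lebesgue (closure K) = area K"
proof -
  show cl: "closure K \<in> lmeasurable" using cellD(7)[OF K] by (simp add: lmeasurable_compact)
  have n: "negligible (closure K - K)"
    using negligible_convex_frontier[OF cellD(3)[OF K]] cellD(2)[OF K] by (simp add: frontier_def interior_open)
  have "sym_diff K (closure K) = closure K - K" using closure_subset[of K] by blast
  then have "measure lebesgue (closure K) = measure lebesgue K"
    using measure_negligible_symdiff[OF cell_lmeasurable[OF K], of "closure K"] n by simp
  then show "measure lebesgue (closure K) = area K" by (simp add: area_def)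
qed

text \<open>With apex \<open>ctr K\<close> every triangle has area
  \<open>len K L * dst K L / 4\<close>, and these triangles overlap only in null sets inside the
  closed cell. The estimate converts sums over edges into areas.\<close>

lemma sum_len_dst_le:
  assumes K: "K \<in> cells \<V>"
  shows "(\<Sum>L\<in>nbs K. len K L * dst K L) \<le> 4 * area K"
proof -
  have neg: "bis K L (ctr K) < 0" if "L \<in> nbs K" for L using that bis_ctr by (simp add: nbs_def)
  have "(\<Sum>L\<in>nbs K. len K L * dst K L / 4) = (\<Sum>L\<in>nbs K. measure lebesgue (tri (ctr K) K L))"
  proof (rule sum.cong[OF refl])
    fix L assume L: "L \<in> nbs K"
    then have n: "nb K L" by (simp add: nbs_def)
    have b: "bis K L (ctr K) = - (dst K L * dst K L / 2)"
      by (simp add: bis_alt dst_def power2_eq_square)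
    then show "len K L * dst K L / 4 = measure lebesgue (tri (ctr K) K L)"
      using tri_area[OF n, of "ctr K"] dst_pos[OF n] unfolding b by (simp add: wt_def)
  qed
  also have "\<dots> = measure lebesgue (\<Union>(tri (ctr K) K ` nbs K))"
    by (rule measure_negligible_finite_Union_image[symmetric, OF finite_nbs tri_lmeasurable tri_pairwise[OF cellD(5)[OF K] neg]])
  also have "\<dots> \<le> measure lebesgue (closure K)"
  proof (rule measure_mono_fmeasurable)
    show "\<Union>(tri (ctr K) K ` nbs K) \<subseteq> closure K" using tri_subset[OF _ cellD(5)[OF K]] by (auto simp: nbs_def)
    show "\<Union>(tri (ctr K) K ` nbs K) \<in> sets lebesgue"
      using finite_nbs tri_lmeasurable by (intro sets.finite_UN) auto
  qed (rule measure_closure_cell(1)[OF K])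
  also have "\<dots> = area K" by (rule measure_closure_cell(2)[OF K])
  finally show ?thesis by (simp add: sum_divide_distrib[symmetric])
qed

text \<open>The right-hand sides do not involve the apex p, and this freedom is exploited below. The
  vector in the second sum is the centroid of a triangle, written with the midpoint of its
  edge.\<close>

lemma cone_decomposition:
  assumes K: "K \<in> int_cells \<Omega> \<V>" and p: "p \<in> K"
  shows "(\<Sum>L\<in>nbs K. wt K L * (- bis K L p) / 2) = area K"
    and "(\<Sum>L\<in>nbs K. (wt K L * (- bis K L p) / 2) *\<^sub>R ((1/3) *\<^sub>R (p + 2 *\<^sub>R emid K L))) = integral (closure K) (\<lambda>x. x)"
proof -
  note Kc = int_cellD(1)[OF K]
  have pc: "p \<in> closure K" using p closure_subset by blast
  have neg: "bis K L p < 0" if "L \<in> nbs K" for L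
    using that bis_neg[OF Kc _ _ p, of L] nbD(2,3)[of K L] by (auto simp: nbs_def)
  let ?U = "\<Union>L\<in>nbs K. tri p K L"
  have sub: "?U \<subseteq> closure K" using tri_subset[OF _ pc] by (auto simp: nbs_def)
  have negU: "negligible (closure K - ?U)"
  proof (rule negligible_subset[OF negligible_convex_frontier[OF cellD(3)[OF Kc]]])
    show "closure K - ?U \<subseteq> frontier K"
      using tri_cover[OF K p] cellD(2)[OF Kc] by (auto simp: frontier_def interior_open)
  qed
  have n1: "negligible {x \<in> ?U - closure K. f x \<noteq> 0}" for f :: "plane \<Rightarrow> 'b::zero"
    by (rule negligible_subset[of "{}"]) (use sub in auto)
  have n2: "negligible {x \<in> closure K - ?U. f x \<noteq> 0}" for f :: "plane \<Rightarrow> 'b::zero"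
    by (rule negligible_subset[OF negU]) auto
  have ta: "measure lebesgue (tri p K L) = wt K L * (- bis K L p) / 2" if "L \<in> nbs K" for L
    using tri_area[of K L p] neg[OF that] that by (simp add: nbs_def)
  have "((\<lambda>x. 1::real) has_integral (\<Sum>L\<in>nbs K. measure lebesgue (tri p K L))) ?U"
    by (rule has_integral_UN[OF finite_nbs _ tri_pairwise[OF pc neg]])
      (use tri_lmeasurable in \<open>auto simp: has_integral_iff lmeasurable_iff_integrable_on lmeasure_integral\<close>)
  from has_integral_spike_set_eq[OF n1 n2, THEN iffD1, OF this]
  have "(\<Sum>L\<in>nbs K. measure lebesgue (tri p K L)) = measure lebesgue (closure K)"
    using lmeasure_integral[OF measure_closure_cell(1)[OF Kc]] by (simp add: integral_unique)
  then show "(\<Sum>L\<in>nbs K. wt K L * (- bis K L p) / 2) = area K"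
    using ta measure_closure_cell(2)[OF Kc] by (simp cong: sum.cong)
  have "((\<lambda>x. x) has_integral (\<Sum>L\<in>nbs K. (wt K L * (- bis K L p) / 2) *\<^sub>R ((1/3) *\<^sub>R (p + 2 *\<^sub>R emid K L)))) ?U"
  proof (rule has_integral_UN[OF finite_nbs _ tri_pairwise[OF pc neg]])
    fix L assume L: "L \<in> nbs K"
    have "p + 2 *\<^sub>R emid K L = p + end1 (interface K L) + end2 (interface K L)"
      by (simp add: emid_def midpoint_def algebra_simps)
    then show "((\<lambda>x. x) has_integral (wt K L * (- bis K L p) / 2) *\<^sub>R ((1/3) *\<^sub>R (p + 2 *\<^sub>R emid K L))) (tri p K L)"
      using triangle_centroid[of p "end1 (interface K L)" "end2 (interface K L)"] ta[OF L]
      by (simp only: tri_def)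
  qed
  from has_integral_spike_set_eq[OF n1 n2, THEN iffD1, OF this]
  show "(\<Sum>L\<in>nbs K. (wt K L * (- bis K L p) / 2) *\<^sub>R ((1/3) *\<^sub>R (p + 2 *\<^sub>R emid K L))) = integral (closure K) (\<lambda>x. x)"
    by (simp add: integral_unique)
qed

end

section \<open>Consistency of the two-point flux\<close>

text \<open>The value z^T H t for the same symmetric matrix as in \<open>quad_form\<close>.\<close>

definition bil_form :: "'a \<Rightarrow> 'a \<Rightarrow> 'a \<Rightarrow> plane \<Rightarrow> plane \<Rightarrow> 'a::real_vector" where
  "bil_form a b c z t = (z$1 * t$1) *\<^sub>R a + (z$1 * t$2 + z$2 * t$1) *\<^sub>R b + (z$2 * t$2) *\<^sub>R c"

lemma bil_form_diff_right: "bil_form a b c z (s - t) = bil_form a b c z s - bil_form a b c z t"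
  by (simp add: bil_form_def algebra_simps)

lemma bil_form_half: "bil_form a b c z ((1/2) *\<^sub>R z) = (1/2) *\<^sub>R quad_form a b c z"
  by (simp add: bil_form_def quad_form_def power2_eq_square scaleR_add_right mult.commute)

lemma bil_form_minus_left: "bil_form a b c (- z) t = - bil_form a b c z t"
  by (simp add: bil_form_def algebra_simps)

lemma bil_form_diff: "bil_form a b c z t - bil_form a' b' c' z t = bil_form (a - a') (b - b') (c - c') z t"
  by (simp add: bil_form_def algebra_simps)

lemma bil_form_bound:
  fixes a b c :: "'a::real_normed_vector"
  assumes "norm a \<le> A" "norm b \<le> A" "norm c \<le> A"
  shows "norm (bil_form a b c z t) \<le> 4 * A * norm z * norm t"
proof -
  have A0: "0 \<le> A" using assms(1) norm_ge_zero order_trans by blast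
  have p: "\<bar>z$i * t$j\<bar> \<le> norm z * norm t" for i j
    unfolding abs_mult by (intro mult_mono component_le_norm_cart) auto
  have "norm (bil_form a b c z t) \<le> \<bar>z$1 * t$1\<bar> * norm a + \<bar>z$1 * t$2 + z$2 * t$1\<bar> * norm b + \<bar>z$2 * t$2\<bar> * norm c"
    unfolding bil_form_def norm_scaleR[symmetric] by (intro norm_triangle_le add_mono order_refl norm_triangle_ineq)
  also have "\<dots> \<le> (norm z * norm t) * A + (2 * (norm z * norm t)) * A + (norm z * norm t) * A"
    using p[of 1 1] p[of 1 2] p[of 2 1] p[of 2 2] assms A0
    by (intro add_mono mult_mono) auto
  finally show ?thesis by (simp add: algebra_simps)
qed

context voronoi_mesh
begin

text \<open>Moving the apex in the cone identities from \<open>ctr K\<close> to a nearby point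
  changes neither the area nor the first moment, so the terms with the displacement cancel. The
  results are the divergence theorem on the cell for constant and for linear fields.\<close>

lemma sum_wt_ctr:
  assumes K: "K \<in> int_cells \<Omega> \<V>"
  shows "(\<Sum>L\<in>nbs K. wt K L *\<^sub>R (ctr L - ctr K)) = 0"
    and "(\<Sum>L\<in>nbs K. (wt K L * (w \<bullet> (ctr L - ctr K))) *\<^sub>R (emid K L - ctr K)) = area K *\<^sub>R w"
proof -
  note cK = int_cell_ctr[OF K] and Kc = int_cellD(1)[OF K]
  let ?z = "\<lambda>L. ctr L - ctr K"
  have small: "\<exists>e>0. ctr K + e *\<^sub>R w \<in> K" for w
  proof -
    obtain e where e: "e > 0" "cball (ctr K) e \<subseteq> K" using cellD(2)[OF Kc] cK open_contains_cball by blast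
    have w1: "0 < norm w + 1" by (simp add: add_nonneg_pos)
    have "norm ((e / (norm w + 1)) *\<^sub>R w) \<le> e" using w1 e(1) by (simp add: divide_le_eq)
    then have "ctr K + (e / (norm w + 1)) *\<^sub>R w \<in> cball (ctr K) e" by (simp add: dist_norm)
    moreover have "e / (norm w + 1) > 0" using e(1) w1 by simp
    ultimately show ?thesis using e(2) by blast
  qed
  have bs: "bis K L (ctr K + e *\<^sub>R w) = bis K L (ctr K) + e * (w \<bullet> ?z L)" for L e w
    by (rule bis_affine)
  have S1: "(\<Sum>L\<in>nbs K. wt K L * (w \<bullet> ?z L)) = 0" for w
  proof -
    obtain e where e: "e > 0" "ctr K + e *\<^sub>R w \<in> K" using small by blast
    have "(\<Sum>L\<in>nbs K. wt K L * (- bis K L (ctr K + e *\<^sub>R w)) / 2) - (\<Sum>L\<in>nbs K. wt K L * (- bis K L (ctr K)) / 2) = 0"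
      using cone_decomposition(1)[OF K e(2)] cone_decomposition(1)[OF K cK] by simp
    also have "(\<Sum>L\<in>nbs K. wt K L * (- bis K L (ctr K + e *\<^sub>R w)) / 2) - (\<Sum>L\<in>nbs K. wt K L * (- bis K L (ctr K)) / 2)
      = (\<Sum>L\<in>nbs K. (- e / 2) * (wt K L * (w \<bullet> ?z L)))"
      unfolding bs sum_subtractf[symmetric] by (intro sum.cong refl) (simp add: field_simps)
    also have "\<dots> = (- e / 2) * (\<Sum>L\<in>nbs K. wt K L * (w \<bullet> ?z L))" by (simp add: sum_distrib_left)
    finally show ?thesis using e(1) by simp
  qed
  show "(\<Sum>L\<in>nbs K. wt K L *\<^sub>R ?z L) = 0" (is "?S = 0")
  proof -
    have "v \<bullet> ?S = (\<Sum>L\<in>nbs K. wt K L * (v \<bullet> ?z L))" for v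
      by (simp add: inner_sum_right)
    from this[of ?S] have "?S \<bullet> ?S = 0" using S1[of ?S] by simp
    then show ?thesis by simp
  qed
  obtain e where e: "e > 0" "ctr K + e *\<^sub>R w \<in> K" using small by blast
  \<comment> \<open>The contributions of the apex to the centroids carry weights that sum to the
    cell area, so this form of the moment is affine in p.\<close>
  have mom: "integral (closure K) (\<lambda>x. x) = (1/3 * area K) *\<^sub>R p + (1/3) *\<^sub>R (\<Sum>L\<in>nbs K. (wt K L * (- bis K L p)) *\<^sub>R emid K L)"
    if p: "p \<in> K" for p
  proof -
    have "integral (closure K) (\<lambda>x. x) = (\<Sum>L\<in>nbs K. (1/3 * (wt K L * (- bis K L p) / 2)) *\<^sub>R p + (1/3) *\<^sub>R ((wt K L * (- bis K L p)) *\<^sub>R emid K L))"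
      unfolding cone_decomposition(2)[OF K p, symmetric] by (intro sum.cong refl) (simp add: scaleR_add_right)
    also have "\<dots> = (1/3 * (\<Sum>L\<in>nbs K. wt K L * (- bis K L p) / 2)) *\<^sub>R p + (1/3) *\<^sub>R (\<Sum>L\<in>nbs K. (wt K L * (- bis K L p)) *\<^sub>R emid K L)"
      by (simp only: sum.distrib scaleR_sum_right scaleR_sum_left sum_distrib_left)
    finally show ?thesis unfolding cone_decomposition(1)[OF K p] .
  qed
  have "0 = ((1/3 * area K) *\<^sub>R (ctr K + e *\<^sub>R w) + (1/3) *\<^sub>R (\<Sum>L\<in>nbs K. (wt K L * (- bis K L (ctr K + e *\<^sub>R w))) *\<^sub>R emid K L))
    - ((1/3 * area K) *\<^sub>R ctr K + (1/3) *\<^sub>R (\<Sum>L\<in>nbs K. (wt K L * (- bis K L (ctr K))) *\<^sub>R emid K L))"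
    using mom[OF e(2)] mom[OF cK] by simp
  also have "\<dots> = (1/3 * area K * e) *\<^sub>R w + (1/3) *\<^sub>R ((\<Sum>L\<in>nbs K. (wt K L * (- bis K L (ctr K + e *\<^sub>R w))) *\<^sub>R emid K L) - (\<Sum>L\<in>nbs K. (wt K L * (- bis K L (ctr K))) *\<^sub>R emid K L))"
    by (simp add: scaleR_add_right scaleR_diff_right)
  also have "(\<Sum>L\<in>nbs K. (wt K L * (- bis K L (ctr K + e *\<^sub>R w))) *\<^sub>R emid K L) - (\<Sum>L\<in>nbs K. (wt K L * (- bis K L (ctr K))) *\<^sub>R emid K L)
     = (- e) *\<^sub>R (\<Sum>L\<in>nbs K. (wt K L * (w \<bullet> ?z L)) *\<^sub>R emid K L)"
    unfolding bs sum_subtractf[symmetric] scaleR_sum_right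
    by (intro sum.cong refl) (simp add: algebra_simps)
  finally have "(e / 3) *\<^sub>R (area K *\<^sub>R w - (\<Sum>L\<in>nbs K. (wt K L * (w \<bullet> ?z L)) *\<^sub>R emid K L)) = 0"
    by (simp add: scaleR_diff_right mult.commute)
  then have S2: "(\<Sum>L\<in>nbs K. (wt K L * (w \<bullet> ?z L)) *\<^sub>R emid K L) = area K *\<^sub>R w" using e(1) by simp
  have "(\<Sum>L\<in>nbs K. (wt K L * (w \<bullet> ?z L)) *\<^sub>R (emid K L - ctr K))
    = (\<Sum>L\<in>nbs K. (wt K L * (w \<bullet> ?z L)) *\<^sub>R emid K L) - (\<Sum>L\<in>nbs K. wt K L * (w \<bullet> ?z L)) *\<^sub>R ctr K"
    by (simp add: scaleR_diff_right sum_subtractf scaleR_sum_left)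
  then show "(\<Sum>L\<in>nbs K. (wt K L * (w \<bullet> ?z L)) *\<^sub>R (emid K L - ctr K)) = area K *\<^sub>R w"
    using S2 S1[of w] by simp
qed

definition offset :: "plane set \<Rightarrow> plane set \<Rightarrow> plane" where
  "offset K L = emid K L - midpoint (ctr K) (ctr L)"

lemma offset_commute: "offset K L = offset L K"
  by (simp add: offset_def symmetric_data(4)[of K L] midpoint_sym)

lemma emid_ctr: "emid K L - ctr K = offset K L + (1/2) *\<^sub>R (ctr L - ctr K)"
  by (simp add: offset_def midpoint_def vec_eq_iff field_simps)

text \<open>The two moment identities make the two-point flux exact on quadratic polynomials up to
  an edge term that is antisymmetric in the two cells, because the midpoint of an edge need not
  lie on the segment joining the two centers.\<close>

lemma quadratic_consistency:
  fixes g1 g2 a b c :: "'a::real_vector"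
  assumes K: "K \<in> int_cells \<Omega> \<V>"
  shows "(\<Sum>L\<in>nbs K. wt K L *\<^sub>R (((ctr L - ctr K)$1 *\<^sub>R g1 + (ctr L - ctr K)$2 *\<^sub>R g2) + (1/2) *\<^sub>R quad_form a b c (ctr L - ctr K)))
    = area K *\<^sub>R (a + c) - (\<Sum>L\<in>nbs K. wt K L *\<^sub>R bil_form a b c (ctr L - ctr K) (offset K L))"
proof -
  let ?z = "\<lambda>L. ctr L - ctr K" and ?m = "\<lambda>L. emid K L - ctr K"
  have z: "(\<Sum>L\<in>nbs K. wt K L * ?z L $ i) = 0" for i
    using arg_cong[OF sum_wt_ctr(1)[OF K], of "\<lambda>v. v $ i"] by simp
  have ax: "axis i 1 \<bullet> (v::plane) = v $ i" for i v by (simp add: inner_axis' )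
  have m: "(\<Sum>L\<in>nbs K. wt K L * ?z L $ i * ?m L $ j) = area K * (axis i 1 :: plane) $ j" for i j
    using arg_cong[OF sum_wt_ctr(2)[OF K, of "axis i 1"], of "\<lambda>v. v $ j"] by (simp add: ax)
  have "(\<Sum>L\<in>nbs K. wt K L *\<^sub>R (?z L $ 1 *\<^sub>R g1 + ?z L $ 2 *\<^sub>R g2))
      = (\<Sum>L\<in>nbs K. wt K L * ?z L $ 1) *\<^sub>R g1 + (\<Sum>L\<in>nbs K. wt K L * ?z L $ 2) *\<^sub>R g2"
    by (simp only: scaleR_add_right scaleR_scaleR sum.distrib scaleR_sum_left)
  then have lin: "(\<Sum>L\<in>nbs K. wt K L *\<^sub>R (?z L $ 1 *\<^sub>R g1 + ?z L $ 2 *\<^sub>R g2)) = 0"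
    unfolding z by simp
  have "(\<Sum>L\<in>nbs K. wt K L *\<^sub>R bil_form a b c (?z L) (?m L))
    = (\<Sum>L\<in>nbs K. wt K L * ?z L $ 1 * ?m L $ 1) *\<^sub>R a
      + ((\<Sum>L\<in>nbs K. wt K L * ?z L $ 1 * ?m L $ 2) + (\<Sum>L\<in>nbs K. wt K L * ?z L $ 2 * ?m L $ 1)) *\<^sub>R b
      + (\<Sum>L\<in>nbs K. wt K L * ?z L $ 2 * ?m L $ 2) *\<^sub>R c"
    unfolding bil_form_def
    by (simp only: scaleR_add_right scaleR_add_left scaleR_scaleR distrib_left sum.distrib scaleR_sum_left mult.assoc)
  also have "\<dots> = area K *\<^sub>R (a + c)" unfolding m by (simp add: axis_def scaleR_add_right)
  finally have B: "(\<Sum>L\<in>nbs K. wt K L *\<^sub>R bil_form a b c (?z L) (?m L)) = area K *\<^sub>R (a + c)" .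
  \<comment> \<open>Half of the vector between the centers differs by the offset from the vector to
    the edge midpoint, which is the one in the moment identity.\<close>
  have half: "(1/2) *\<^sub>R quad_form a b c (?z L) = bil_form a b c (?z L) (?m L) - bil_form a b c (?z L) (offset K L)" for L
  proof -
    have "?m L - offset K L = (1/2) *\<^sub>R ?z L" using emid_ctr[of K L] by simp
    then show ?thesis by (simp only: bil_form_diff_right[symmetric] bil_form_half)
  qed
  have "(\<Sum>L\<in>nbs K. wt K L *\<^sub>R ((?z L $ 1 *\<^sub>R g1 + ?z L $ 2 *\<^sub>R g2) + (1/2) *\<^sub>R quad_form a b c (?z L)))
    = (\<Sum>L\<in>nbs K. wt K L *\<^sub>R (?z L $ 1 *\<^sub>R g1 + ?z L $ 2 *\<^sub>R g2))
      + ((\<Sum>L\<in>nbs K. wt K L *\<^sub>R bil_form a b c (?z L) (?m L)) - (\<Sum>L\<in>nbs K. wt K L *\<^sub>R bil_form a b c (?z L) (offset K L)))"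
    unfolding half by (simp only: scaleR_add_right scaleR_diff_right sum.distrib sum_subtractf)
  then show ?thesis unfolding lin B by simp
qed

section \<open>Bounds in terms of the mesh size\<close>

lemma diameter_le_mesh_size: "K \<in> cells \<V> \<Longrightarrow> diameter K \<le> mesh_size \<V>"
  unfolding mesh_size_def by (rule cSUP_upper) (auto simp: finite_cells bdd_above_finite)

lemma dist_closure_cell:
  assumes "K \<in> cells \<V>" "x \<in> closure K" "y \<in> closure K"
  shows "dist x y \<le> mesh_size \<V>"
proof -
  have "dist x y \<le> diameter (closure K)"
    by (rule diameter_bounded_bound[OF bounded_closure[OF cellD(7)[OF assms(1)]] assms(2,3)])
  also have "\<dots> = diameter K" by (rule diameter_closure[OF cellD(7)[OF assms(1)]])
  finally show ?thesis using diameter_le_mesh_size[OF assms(1)] by simp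
qed

lemma emid_near:
  assumes "nb K L"
  shows "dist (emid K L) (ctr K) \<le> mesh_size \<V>" "dist (emid K L) (ctr L) \<le> mesh_size \<V>"
  using interface_ends(5)[OF assms] nbD(1,2)[OF assms] cellD(5) dist_closure_cell
  by (auto simp: interface_def)

lemma dst_le: "nb K L \<Longrightarrow> dst K L \<le> 2 * mesh_size \<V>"
  using emid_near[of K L] dist_triangle2[of "ctr K" "ctr L" "emid K L"] by (simp add: dst_def dist_commute)

lemma offset_le:
  assumes "nb K L"
  shows "norm (offset K L) \<le> mesh_size \<V>"
proof -
  have "offset K L = (1/2) *\<^sub>R ((emid K L - ctr K) + (emid K L - ctr L))"
    by (simp add: offset_def midpoint_def vec_eq_iff field_simps)
  then have "norm (offset K L) = norm ((emid K L - ctr K) + (emid K L - ctr L)) / 2" by simp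
  also have "\<dots> \<le> (norm (emid K L - ctr K) + norm (emid K L - ctr L)) / 2"
    by (intro divide_right_mono norm_triangle_ineq) simp
  also have "\<dots> \<le> mesh_size \<V>" using emid_near[OF assms] by (simp add: dist_norm)
  finally show ?thesis .
qed

lemma area_pos: "K \<in> cells \<V> \<Longrightarrow> 0 < area K"
  unfolding area_def
  using cellD(1,2)[of K] cell_lmeasurable[of K] open_not_negligible[of K]
  by (auto simp: less_le negligible_iff_measure)

lemma mesh_size_pos: "0 < mesh_size \<V>"
proof -
  have "cells \<V> \<noteq> {}" using closure_domain domain(4) by auto
  then obtain K where K: "K \<in> cells \<V>" by blast
  have "infinite K" using cellD(1,2)[OF K] finite_imp_not_open by blast
  then obtain x where x: "x \<in> K" using infinite_imp_nonempty by blast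
  have "infinite (K - {x})" using \<open>infinite K\<close> by simp
  then obtain y where y: "y \<in> K" "y \<noteq> x" using infinite_imp_nonempty by blast
  have "0 < dist x y" using y by simp
  also have "\<dots> \<le> mesh_size \<V>" using dist_closure_cell[OF K] x y closure_subset by blast
  finally show ?thesis .
qed

lemma laplacian_sum:
  assumes "K \<in> int_cells \<Omega> \<V>"
  shows "area K *\<^sub>R discrete_laplacian \<Omega> \<V> v K = (\<Sum>L\<in>nbs K. wt K L *\<^sub>R (v L - v K))"
  using assms area_pos[OF int_cellD(1)[OF assms]]
  by (simp add: discrete_laplacian_def nbs_def wt_def len_def dst_def)

lemma sum_area: "(\<Sum>K\<in>cells \<V>. area K) \<le> measure lebesgue \<Omega>"
proof -
  have "(\<Sum>K\<in>cells \<V>. area K) = measure lebesgue (\<Union>K\<in>cells \<V>. K)"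
    unfolding area_def
    by (rule measure_negligible_finite_Union_image[symmetric, OF finite_cells cell_lmeasurable])
      (auto simp: pairwise_def cells_disjoint)
  also have "\<dots> \<le> measure lebesgue \<Omega>"
    by (rule measure_mono_fmeasurable)
      (use cellD(2,4) domain in \<open>auto simp: lmeasurable_open intro!: sets.finite_UN finite_cells\<close>)
  finally show ?thesis .
qed

end

section \<open>Discrete functional inequalities\<close>

text \<open>Follow the steps from K along which s increases until f vanishes, and telescope. Since s
  increases strictly, no pair is used twice, and induction on the number of elements with larger s
  applies.\<close>

lemma chain_bound:
  fixes f :: "'a \<Rightarrow> real" and s :: "'a \<Rightarrow> real"
  assumes fin: "finite A" "finite P" and f: "\<And>K. 0 \<le> f K" and K: "K \<in> A"
    and step: "\<And>K. K \<in> A \<Longrightarrow> f K = 0 \<or> (\<exists>L\<in>A. (K, L) \<in> P \<and> s K < s L)"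
  shows "f K \<le> (\<Sum>(K, L)\<in>P. \<bar>f K - f L\<bar>)"
proof -
  let ?d = "\<lambda>(K, L). \<bar>f K - f L\<bar>"
  have "f K \<le> (\<Sum>q | q \<in> P \<and> s K \<le> s (fst q). ?d q)"
    using K
  proof (induction "card {M \<in> A. s K < s M}" arbitrary: K rule: less_induct)
    case less
    have pos: "0 \<le> (\<Sum>q | q \<in> P \<and> s K \<le> s (fst q). ?d q)" by (intro sum_nonneg) auto
    show ?case
    proof (cases "f K = 0")
      case False
      then obtain L where L: "L \<in> A" "(K, L) \<in> P" "s K < s L" using step[OF less.prems] by blast
      have "{M \<in> A. s L < s M} \<subset> {M \<in> A. s K < s M}" using L by auto
      then have "card {M \<in> A. s L < s M} < card {M \<in> A. s K < s M}" using fin by (intro psubset_card_mono) auto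
      then have IH: "f L \<le> (\<Sum>q | q \<in> P \<and> s L \<le> s (fst q). ?d q)" using less.hyps L(1) by blast
      have "f K \<le> ?d (K, L) + f L" by simp
      also have "\<dots> \<le> ?d (K, L) + (\<Sum>q | q \<in> P \<and> s L \<le> s (fst q). ?d q)" using IH by simp
      also have "\<dots> = (\<Sum>q\<in>insert (K, L) {q \<in> P. s L \<le> s (fst q)}. ?d q)"
        using fin L by (subst sum.insert) auto
      also have "\<dots> \<le> (\<Sum>q | q \<in> P \<and> s K \<le> s (fst q). ?d q)"
        using fin L by (intro sum_mono2) auto
      finally show ?thesis .
    qed (use pos in simp)
  qed
  also have "\<dots> \<le> (\<Sum>q\<in>P. ?d q)" using fin by (intro sum_mono2) auto
  finally show ?thesis by simp
qed

lemma negligible_Union_image: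
  "finite A \<Longrightarrow> (\<And>a. a \<in> A \<Longrightarrow> negligible (f a)) \<Longrightarrow> negligible (\<Union>(f ` A))"
  by (intro negligible_Union) auto

lemma negligible_coordinate_line: "negligible {x::plane. x $ j = c}"
  using negligible_standard_hyperplane[of "axis j 1 :: plane" c] by (auto simp: inner_axis Basis_vec_def)

section \<open>A discrete Sobolev inequality by slicing along coordinate lines\<close>

context voronoi_mesh
begin

text \<open>Ordered pairs: each interface is listed twice, which is why factors 1/2 appear in the
  summation formulas.\<close>

definition pairs :: "(plane set \<times> plane set) set" where "pairs = (SIGMA K:cells \<V>. nbs K)"

lemma finite_pairs: "finite pairs"
  unfolding pairs_def using finite_cells finite_nbs by (rule finite_SigmaI)

lemma pairs_iff: "(K, L) \<in> pairs \<longleftrightarrow> nb K L"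
  using nbD(1) by (auto simp: pairs_def nbs_def)

lemma sum_pairs: "(\<Sum>(K, L)\<in>pairs. g K L) = (\<Sum>K\<in>cells \<V>. \<Sum>L\<in>nbs K. g K L)"
  unfolding pairs_def using finite_cells finite_nbs by (subst sum.Sigma) auto

lemma sum_pairs_swap: "(\<Sum>(K, L)\<in>pairs. g K L) = (\<Sum>(K, L)\<in>pairs. g L K)"
  by (rule sum.reindex_bij_witness[where i = prod.swap and j = prod.swap]) (auto simp: pairs_iff nb_commute)

text \<open>Moving along a coordinate line one leaves a Voronoi cell through an interface into a cell
  whose center lies further in the direction of motion. Hence the walk never returns and ends in
  an exterior cell, where the discrete functions vanish.\<close>

lemma line_step:
  fixes i j :: 2
  assumes ij: "i \<noteq> j" and K: "K \<in> cells \<V>" and p: "p \<in> K" "p $ j = c"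
    and good: "\<And>\<sigma>. \<sigma> \<in> edges \<V> \<Longrightarrow> end1 \<sigma> $ j \<noteq> c \<and> end2 \<sigma> $ j \<noteq> c"
  shows "K \<in> ext_cells \<Omega> \<V> \<or> (\<exists>L. nb K L \<and> (\<exists>q\<in>L. q $ j = c) \<and> (\<exists>z\<in>interface K L. z $ j = c)
     \<and> ctr K $ i < ctr L $ i)"
proof -
  define e :: plane where "e = axis i 1"
  have e: "e \<noteq> 0" "e $ j = 0" "e \<bullet> v = v $ i" for v
    using ij by (simp_all add: e_def axis_eq_0_iff inner_axis') (simp add: axis_def)
  have iK: "interior K = K" using cellD(2)[OF K] by (rule interior_open)
  obtain d where d: "d > 0" "p + d *\<^sub>R e \<in> frontier K"
    using ray_to_frontier[OF cellD(7)[OF K], of p e] p(1) e(1) iK by blast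
  define z where "z = p + d *\<^sub>R e"
  have zj: "z $ j = c" using p(2) e(2) by (simp add: z_def)
  obtain \<sigma> where s: "\<sigma> \<in> cell_edges \<V> K" "z \<in> \<sigma>" using d(2) cellD(6)[OF K] unfolding z_def by blast
  have se: "\<sigma> \<in> edges \<V>" using s(1) by (simp add: cell_edges_def)
  show ?thesis
  proof (cases "\<sigma> \<subseteq> frontier \<Omega>")
    case True
    then have "\<sigma> \<in> cell_edges \<V> K \<inter> ext_edges \<Omega> \<V>" using s(1) se by (simp add: ext_edges_def)
    then show ?thesis using K by (auto simp: ext_cells_def int_cells_def)
  next
    case False
    then obtain L where L: "nb K L" "\<sigma> = interface K L" using interior_edge_interface[OF K s(1)] by blast
    note nL = nbD[OF L(1)]
    \<comment> \<open>Along the direction of motion \<open>bis\<close> rises from a negative value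
      at p to 0 at z, so its slope, the difference of the centers in coordinate i, is
      positive.\<close>
    have "bis K L z = 0" using bis_interface[OF L(1)] s(2) L(2) by blast
    moreover have "bis K L z = bis K L p + d * (ctr L $ i - ctr K $ i)"
      unfolding z_def bis_affine e(3) by simp
    moreover have "bis K L p < 0" using bis_neg[OF K nL(2,3) p(1)] .
    ultimately have "0 < d * (ctr L $ i - ctr K $ i)" by simp
    then have lt: "ctr K $ i < ctr L $ i" using d(1) by (simp add: zero_less_mult_iff)
    define a b where "a = end1 \<sigma>" and "b = end2 \<sigma>"
    have ab: "a \<noteq> b" "\<sigma> = closed_segment a b" using edge_ends[OF se] by (auto simp: a_def b_def)
    have abc: "a $ j \<noteq> c" "b $ j \<noteq> c" using good[OF se] by (auto simp: a_def b_def)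
    obtain t where t: "0 \<le> t" "t \<le> 1" "z = (1 - t) *\<^sub>R a + t *\<^sub>R b" using s(2) ab(2) by (auto simp: in_segment)
    have tz: "(1 - t) * (a $ j - c) + t * (b $ j - c) = 0" using zj unfolding t(3) by (simp add: algebra_simps)
    \<comment> \<open>The line avoids the end points of the edge, so these lie strictly on both
      sides of it. Both are limits of points of L, and convexity of L then yields a point of L on
      the line.\<close>
    have sides: "(a $ j < c \<and> c < b $ j) \<or> (b $ j < c \<and> c < a $ j)"
    proof (rule ccontr)
      assume "\<not> ?thesis"
      then have "(a $ j < c \<and> b $ j < c) \<or> (c < a $ j \<and> c < b $ j)" using abc by linarith
      then show False
      proof
        assume A: "a $ j < c \<and> b $ j < c"
        have "(1 - t) * (a $ j - c) + t * (b $ j - c) < 0"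
          using A t convex_bound_lt[of "a $ j - c" 0 "b $ j - c" "1 - t" t] by simp
        then show False using tz by simp
      next
        assume A: "c < a $ j \<and> c < b $ j"
        have "(1 - t) * (c - a $ j) + t * (c - b $ j) < 0"
          using A t convex_bound_lt[of "c - a $ j" 0 "c - b $ j" "1 - t" t] by simp
        then show False using tz by (simp add: algebra_simps)
      qed
    qed
    have cl: "a \<in> closure L" "b \<in> closure L" using L(2) ab(2) by (auto simp: interface_def)
    have near: "\<exists>x\<in>L. \<bar>x $ j - y $ j\<bar> < r" if "y \<in> closure L" "0 < r" for y r
    proof -
      have "\<exists>x\<in>L. dist x y < r" using that by (simp add: closure_approachable)
      then obtain x where x: "x \<in> L" "dist x y < r" by blast
      have "\<bar>(x - y) $ j\<bar> \<le> norm (x - y)" by (rule component_le_norm_cart)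
      then show ?thesis using x by (auto simp: dist_norm intro!: bexI[of _ x])
    qed
    obtain a' where a': "a' \<in> L" "\<bar>a' $ j - a $ j\<bar> < \<bar>a $ j - c\<bar>" using near[OF cl(1), of "\<bar>a $ j - c\<bar>"] abc by auto
    obtain b' where b': "b' \<in> L" "\<bar>b' $ j - b $ j\<bar> < \<bar>b $ j - c\<bar>" using near[OF cl(2), of "\<bar>b $ j - c\<bar>"] abc by auto
    have sides': "(a' $ j < c \<and> c < b' $ j) \<or> (b' $ j < c \<and> c < a' $ j)" using sides a'(2) b'(2) by linarith
    define r where "r = (c - a' $ j) / (b' $ j - a' $ j)"
    have r: "0 \<le> r" "r \<le> 1" "r * (b' $ j - a' $ j) = c - a' $ j"
      using sides' by (auto simp: r_def divide_simps)
    have "(1 - r) *\<^sub>R a' + r *\<^sub>R b' \<in> L" using convexD_alt[OF cellD(3)[OF nL(2)] a'(1) b'(1) r(1,2)] .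
    moreover have "((1 - r) *\<^sub>R a' + r *\<^sub>R b') $ j = c" using r(3) by (simp add: algebra_simps)
    ultimately show ?thesis using L s(2) zj lt by blast
  qed
qed

text \<open>The orthogonal projection of an interface to a coordinate axis.\<close>

definition shadow :: "2 \<Rightarrow> plane set \<times> plane set \<Rightarrow> real set" where
  "shadow j q = (let \<sigma> = interface (fst q) (snd q) in
     {min (end1 \<sigma> $ j) (end2 \<sigma> $ j) .. max (end1 \<sigma> $ j) (end2 \<sigma> $ j)})"

lemma interface_shadow:
  assumes "nb K L" "z \<in> interface K L"
  shows "z $ j \<in> shadow j (K, L)"
proof -
  let ?a = "end1 (interface K L)" and ?b = "end2 (interface K L)"
  have "z \<in> closed_segment ?a ?b" using interface_ends(2)[OF assms(1)] assms(2) by simp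
  then obtain t where t: "0 \<le> t" "t \<le> 1" "z = (1 - t) *\<^sub>R ?a + t *\<^sub>R ?b" by (auto simp: in_segment)
  have zj: "z $ j = (1 - t) * ?a $ j + t * ?b $ j" unfolding t(3) by simp
  have "z $ j \<le> max (?a $ j) (?b $ j)"
    unfolding zj using t by (intro convex_bound_le) auto
  moreover have "(1 - t) * (- ?a $ j) + t * (- ?b $ j) \<le> - min (?a $ j) (?b $ j)"
    using t by (intro convex_bound_le) auto
  ultimately show ?thesis unfolding zj shadow_def Let_def by simp
qed

text \<open>A walk from p in direction i crosses only interfaces whose projection to coordinate j
  contains \<open>p $ j\<close>; telescoping the jumps up to an exterior cell bounds f. The
  right-hand side depends on p through that single coordinate.\<close>

lemma slice_bound:
  fixes i j :: 2 and f :: "plane set \<Rightarrow> real"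
  assumes ij: "i \<noteq> j" and f: "\<And>K. 0 \<le> f K" "\<And>K. K \<in> ext_cells \<Omega> \<V> \<Longrightarrow> f K = 0"
    and K: "K \<in> cells \<V>" and p: "p \<in> K"
    and good: "\<And>\<sigma>. \<sigma> \<in> edges \<V> \<Longrightarrow> end1 \<sigma> $ j \<noteq> p $ j \<and> end2 \<sigma> $ j \<noteq> p $ j"
  shows "f K \<le> (\<Sum>q\<in>pairs. \<bar>f (fst q) - f (snd q)\<bar> * indicator (shadow j q) (p $ j))"
proof -
  let ?c = "p $ j"
  let ?A = "{M \<in> cells \<V>. \<exists>q\<in>M. q $ j = ?c}" and ?P = "{q \<in> pairs. ?c \<in> shadow j q}"
  have "f K \<le> (\<Sum>(K, L)\<in>?P. \<bar>f K - f L\<bar>)"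
  proof (rule chain_bound[where A = ?A and s = "\<lambda>M. ctr M $ i"])
    fix M assume "M \<in> ?A"
    then obtain q where M: "M \<in> cells \<V>" "q \<in> M" "q $ j = ?c" by blast
    show "f M = 0 \<or> (\<exists>L\<in>?A. (M, L) \<in> ?P \<and> ctr M $ i < ctr L $ i)"
    proof (cases "M \<in> ext_cells \<Omega> \<V>")
      case False
      then obtain L where L: "nb M L" "\<exists>q\<in>L. q $ j = ?c" "\<exists>z\<in>interface M L. z $ j = ?c" "ctr M $ i < ctr L $ i"
        using line_step[OF ij M good] by blast
      then have "?c \<in> shadow j (M, L)" using interface_shadow[OF L(1)] by metis
      then show ?thesis using L nbD(2)[OF L(1)] by (intro disjI2 bexI[of _ L]) (auto simp: pairs_iff)
    qed (simp add: f(2))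
  qed (use finite_cells finite_pairs f K p in auto)
  also have "\<dots> = (\<Sum>q\<in>?P. \<bar>f (fst q) - f (snd q)\<bar>)" by (simp add: case_prod_beta)
  also have "\<dots> = (\<Sum>q\<in>pairs. \<bar>f (fst q) - f (snd q)\<bar> * indicator (shadow j q) ?c)"
    by (subst sum.inter_filter[OF finite_pairs]) (auto intro!: sum.cong simp: indicator_def)
  finally show ?thesis .
qed

text \<open>The set is a rectangle. Each side is a coordinate difference of the end points of an
  edge and so at most its length.\<close>

lemma shadow_measure:
  assumes "q \<in> pairs" "q' \<in> pairs"
  shows "{x::plane. x $ 1 \<in> shadow 1 q \<and> x $ 2 \<in> shadow 2 q'} \<in> lmeasurable"
    and "measure lebesgue {x::plane. x $ 1 \<in> shadow 1 q \<and> x $ 2 \<in> shadow 2 q'} \<le> len (fst q) (snd q) * len (fst q') (snd q')"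
proof -
  let ?a = "\<lambda>q. end1 (interface (fst q) (snd q))" and ?b = "\<lambda>q. end2 (interface (fst q) (snd q))"
  let ?l = "pt (min (?a q $ 1) (?b q $ 1)) (min (?a q' $ 2) (?b q' $ 2))"
  let ?u = "pt (max (?a q $ 1) (?b q $ 1)) (max (?a q' $ 2) (?b q' $ 2))"
  have eq: "{x::plane. x $ 1 \<in> shadow 1 q \<and> x $ 2 \<in> shadow 2 q'} = cbox ?l ?u"
    by (auto simp: mem_cbox_plane shadow_def Let_def pt_nth)
  show "{x::plane. x $ 1 \<in> shadow 1 q \<and> x $ 2 \<in> shadow 2 q'} \<in> lmeasurable" unfolding eq by simp
  have l: "\<bar>?a q $ j - ?b q $ j\<bar> \<le> len (fst q) (snd q)" if "q \<in> pairs" for q j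
  proof -
    have "nb (fst q) (snd q)" using that pairs_iff[of "fst q" "snd q"] by simp
    then show ?thesis using component_le_norm_cart[of "?a q - ?b q" j] by (simp add: len_eq dist_norm)
  qed
  have ne: "cbox ?l ?u \<noteq> {}"
    unfolding interval_ne_empty_cart by (auto simp: forall_2 pt_nth)
  have "measure lebesgue (cbox ?l ?u) = (max (?a q $ 1) (?b q $ 1) - min (?a q $ 1) (?b q $ 1)) * (max (?a q' $ 2) (?b q' $ 2) - min (?a q' $ 2) (?b q' $ 2))"
    using content_cbox_cart[OF ne] by (simp add: UNIV_2 pt_nth)
  also have "\<dots> = \<bar>?a q $ 1 - ?b q $ 1\<bar> * \<bar>?a q' $ 2 - ?b q' $ 2\<bar>"
    by (simp add: max_def min_def abs_if)
  also have "\<dots> \<le> len (fst q) (snd q) * len (fst q') (snd q')"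
    using l[OF assms(1), of 1] l[OF assms(2), of 2] by (intro mult_mono) auto
  finally show "measure lebesgue {x::plane. x $ 1 \<in> shadow 1 q \<and> x $ 2 \<in> shadow 2 q'} \<le> len (fst q) (snd q) * len (fst q') (snd q')"
    unfolding eq .
qed

text \<open>Almost everywhere the function is bounded by a function of \<open>x$1\<close> alone and by a function
  of \<open>x$2\<close> alone; the integral of the product of the two bounds factorizes.\<close>

lemma discrete_Sobolev:
  fixes f :: "plane set \<Rightarrow> real"
  assumes f: "\<And>K. 0 \<le> f K" "\<And>K. K \<in> ext_cells \<Omega> \<V> \<Longrightarrow> f K = 0"
  shows "(\<Sum>K\<in>cells \<V>. area K * (f K)\<^sup>2) \<le> (\<Sum>(K, L)\<in>pairs. len K L * \<bar>f K - f L\<bar>)\<^sup>2"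
proof -
  let ?d = "\<lambda>q. \<bar>f (fst q) - f (snd q)\<bar>"
  let ?B = "\<lambda>q q'. {x::plane. x $ 1 \<in> shadow 1 q \<and> x $ 2 \<in> shadow 2 q'}"
  let ?g = "\<lambda>x. \<Sum>K\<in>cells \<V>. (f K)\<^sup>2 * indicator K x"
  let ?G = "\<lambda>x. \<Sum>q\<in>pairs. \<Sum>q'\<in>pairs. (?d q * ?d q') * indicator (?B q q') x"
  \<comment> \<open>Coordinate lines through end points of edges are avoided; there are finitely
    many of them, so they form a null set.\<close>
  define N where "N = (\<Union>\<sigma>\<in>edges \<V>. \<Union>j\<in>UNIV. {x::plane. x $ j = end1 \<sigma> $ j} \<union> {x. x $ j = end2 \<sigma> $ j})"
  have "negligible N" unfolding N_def
    using finite_edges by (intro negligible_Union_image negligible_Un negligible_coordinate_line) auto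
  then have "AE x in lebesgue. x \<notin> N" using AE_not_in negligible_iff_null_sets by blast
  then have ae: "AE x in lebesgue. ?g x \<le> ?G x"
  proof eventually_elim
    case (elim x)
    have G0: "0 \<le> ?G x" by (intro sum_nonneg mult_nonneg_nonneg) auto
    show ?case
    proof (cases "\<exists>K\<in>cells \<V>. x \<in> K")
      case True
      then obtain K where K: "K \<in> cells \<V>" "x \<in> K" by blast
      have "?g x = (\<Sum>M\<in>cells \<V>. if M = K then (f K)\<^sup>2 else 0)"
        using cells_disjoint[OF K(1)] K(2) by (intro sum.cong refl) (auto simp: indicator_def)
      then have g: "?g x = f K * f K" using K finite_cells by (simp add: power2_eq_square)
      have good: "end1 \<sigma> $ j \<noteq> x $ j \<and> end2 \<sigma> $ j \<noteq> x $ j" if "\<sigma> \<in> edges \<V>" for \<sigma> j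
      proof -
      have "x \<notin> {x. x $ j = end1 \<sigma> $ j} \<union> {x. x $ j = end2 \<sigma> $ j}"
        using elim that unfolding N_def by blast
      then show ?thesis by auto
    qed
      have "?g x \<le> (\<Sum>q\<in>pairs. ?d q * indicator (shadow 1 q) (x $ 1)) * (\<Sum>q\<in>pairs. ?d q * indicator (shadow 2 q) (x $ 2))"
        unfolding g
      proof (rule mult_mono)
        show "f K \<le> (\<Sum>q\<in>pairs. ?d q * indicator (shadow 1 q) (x $ 1))"
          by (rule slice_bound[of 2 1 f, OF _ f K good]) simp_all
        show "f K \<le> (\<Sum>q\<in>pairs. ?d q * indicator (shadow 2 q) (x $ 2))"
          by (rule slice_bound[of 1 2 f, OF _ f K good]) simp_all
      qed (auto intro!: f sum_nonneg)
      also have "\<dots> = ?G x"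
        unfolding sum_product by (intro sum.cong refl) (auto simp: indicator_def)
      finally show ?thesis .
    next
      case False
      then have "?g x = 0" by (intro sum.neutral) auto
      then show ?thesis using G0 by simp
    qed
  qed
  have ind: "integrable lebesgue (indicator S :: plane \<Rightarrow> real)" "integral\<^sup>L lebesgue (indicator S) = measure lebesgue S"
    if "S \<in> lmeasurable" for S :: "plane set"
    using that by (auto simp: fmeasurable_def)
  have Bm: "?B q q' \<in> lmeasurable" if "q \<in> pairs" "q' \<in> pairs" for q q' using shadow_measure(1)[OF that] .
  have "(\<Sum>K\<in>cells \<V>. area K * (f K)\<^sup>2) = integral\<^sup>L lebesgue ?g"
    by (subst Bochner_Integration.integral_sum)
      (auto simp: ind cell_lmeasurable area_def mult.commute intro!: sum.cong)
  also have "\<dots> \<le> integral\<^sup>L lebesgue ?G"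
    by (rule integral_mono_AE[OF _ _ ae]) (intro Bochner_Integration.integrable_sum integrable_mult_right ind cell_lmeasurable Bm; assumption)+
  also have "\<dots> = (\<Sum>q\<in>pairs. \<Sum>q'\<in>pairs. (?d q * ?d q') * measure lebesgue (?B q q'))"
    by (subst Bochner_Integration.integral_sum; (intro Bochner_Integration.integrable_sum integrable_mult_right ind Bm sum.cong refl; assumption)?)
       (auto intro!: sum.cong simp: ind Bm)
  also have "\<dots> \<le> (\<Sum>q\<in>pairs. \<Sum>q'\<in>pairs. (?d q * ?d q') * (len (fst q) (snd q) * len (fst q') (snd q')))"
    by (intro sum_mono mult_left_mono shadow_measure(2)) auto
  also have "\<dots> = (\<Sum>q\<in>pairs. len (fst q) (snd q) * ?d q)\<^sup>2"
    unfolding power2_eq_square sum_product by (intro sum.cong refl) (simp add: algebra_simps)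
  finally show ?thesis by (simp add: case_prod_beta)
qed

text \<open>Each interface contributes twice, so this is twice the square of the usual discrete H1
  seminorm.\<close>

definition energy :: "(plane set \<Rightarrow> complex) \<Rightarrow> real" where
  "energy v = (\<Sum>(K, L)\<in>pairs. wt K L * (norm (v K - v L))\<^sup>2)"

lemma energy_nonneg: "0 \<le> energy v"
  unfolding energy_def by (intro sum_nonneg) (auto simp: pairs_iff wt_pos less_imp_le)

definition mass :: "(plane set \<Rightarrow> complex) \<Rightarrow> real" where
  "mass v = (\<Sum>K\<in>cells \<V>. area K * (norm (v K))\<^sup>2)"

lemma mass_nonneg: "0 \<le> mass v"
  unfolding mass_def by (intro sum_nonneg) (auto simp: area_def)

lemma sum_len_dst_mass: "(\<Sum>(K, L)\<in>pairs. len K L * dst K L * (norm (v K))\<^sup>2) \<le> 4 * mass v"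
proof -
  have "(\<Sum>(K, L)\<in>pairs. len K L * dst K L * (norm (v K))\<^sup>2) = (\<Sum>K\<in>cells \<V>. (\<Sum>L\<in>nbs K. len K L * dst K L) * (norm (v K))\<^sup>2)"
    by (simp add: sum_pairs sum_distrib_right)
  also have "\<dots> \<le> (\<Sum>K\<in>cells \<V>. (4 * area K) * (norm (v K))\<^sup>2)"
    by (intro sum_mono mult_right_mono sum_len_dst_le) auto
  finally show ?thesis by (simp add: mass_def sum_distrib_left mult.assoc)
qed

text \<open>Cauchy-Schwarz after writing \<open>len K L\<close> as the product of the roots of
  \<open>wt K L\<close> and of \<open>len K L * dst K L\<close>; the second root is controlled by
  the cell areas.\<close>

lemma sum_len_norm_sq:
  "(\<Sum>(K, L)\<in>pairs. len K L * (norm (v K - v L) * norm (v K)))\<^sup>2 \<le> 4 * (energy v * mass v)" (is "?X\<^sup>2 \<le> _")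
proof -
  have "?X = (\<Sum>q\<in>pairs. (sqrt (wt (fst q) (snd q)) * norm (v (fst q) - v (snd q))) * (sqrt (len (fst q) (snd q) * dst (fst q) (snd q)) * norm (v (fst q))))"
    unfolding case_prod_beta
  proof (rule sum.cong[OF refl])
    fix q assume "q \<in> pairs"
    then have n: "nb (fst q) (snd q)" using pairs_iff[of "fst q" "snd q"] by simp
    have "sqrt (wt (fst q) (snd q)) * sqrt (len (fst q) (snd q) * dst (fst q) (snd q)) = len (fst q) (snd q)"
      using dst_pos[OF n] len_pos[OF n] by (simp add: wt_def real_sqrt_mult[symmetric])
    then have "len (fst q) (snd q) * (norm (v (fst q) - v (snd q)) * norm (v (fst q))) =
      (sqrt (wt (fst q) (snd q)) * sqrt (len (fst q) (snd q) * dst (fst q) (snd q))) * (norm (v (fst q) - v (snd q)) * norm (v (fst q)))"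
      by (simp only:)
    also have "\<dots> = (sqrt (wt (fst q) (snd q)) * norm (v (fst q) - v (snd q))) * (sqrt (len (fst q) (snd q) * dst (fst q) (snd q)) * norm (v (fst q)))"
      by (simp only: mult_ac)
    finally show "len (fst q) (snd q) * (norm (v (fst q) - v (snd q)) * norm (v (fst q))) = \<dots>" .
  qed
  then have "?X\<^sup>2 \<le> (\<Sum>q\<in>pairs. (sqrt (wt (fst q) (snd q)) * norm (v (fst q) - v (snd q)))\<^sup>2) * (\<Sum>q\<in>pairs. (sqrt (len (fst q) (snd q) * dst (fst q) (snd q)) * norm (v (fst q)))\<^sup>2)"
    by (simp only: Cauchy_Schwarz_ineq_sum)
  also have "(\<Sum>q\<in>pairs. (sqrt (wt (fst q) (snd q)) * norm (v (fst q) - v (snd q)))\<^sup>2) = energy v"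
    unfolding energy_def by (intro sum.cong refl) (auto simp: pairs_iff wt_pos less_imp_le power_mult_distrib)
  also have "(\<Sum>q\<in>pairs. (sqrt (len (fst q) (snd q) * dst (fst q) (snd q)) * norm (v (fst q)))\<^sup>2) = (\<Sum>(K, L)\<in>pairs. len K L * dst K L * (norm (v K))\<^sup>2)"
    by (intro sum.cong refl) (auto simp: pairs_iff len_pos dst_pos less_imp_le power_mult_distrib)
  also have "energy v * \<dots> \<le> energy v * (4 * mass v)"
    by (intro mult_left_mono sum_len_dst_mass energy_nonneg)
  finally show ?thesis by simp
qed

text \<open>The discrete Sobolev inequality is applied to |v|^2, whose jumps are at most |v K - v L|
  times |v K| + |v L|. With X the resulting sum, the bound is the square of 2 X, and X^2 is at most
  4 times energy times mass, whence 16.\<close>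

lemma discrete_Ladyzhenskaya:
  assumes v: "\<And>K. K \<in> ext_cells \<Omega> \<V> \<Longrightarrow> v K = 0"
  shows "(\<Sum>K\<in>cells \<V>. area K * (norm (v K)) ^ 4) \<le> 16 * energy v * mass v"
proof -
  let ?X = "\<Sum>(K, L)\<in>pairs. len K L * (norm (v K - v L) * norm (v K))"
  have "(\<Sum>(K, L)\<in>pairs. len K L * \<bar>(norm (v K))\<^sup>2 - (norm (v L))\<^sup>2\<bar>)
    \<le> (\<Sum>(K, L)\<in>pairs. len K L * (norm (v K - v L) * norm (v K)) + len K L * (norm (v K - v L) * norm (v L)))"
  proof (rule sum_mono, clarify)
    fix K L assume "(K, L) \<in> pairs"
    then have "0 \<le> len K L" using len_pos by (simp add: pairs_iff less_imp_le)
    moreover have "\<bar>(norm (v K))\<^sup>2 - (norm (v L))\<^sup>2\<bar> \<le> norm (v K - v L) * (norm (v K) + norm (v L))"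
    proof -
      have "\<bar>(norm (v K))\<^sup>2 - (norm (v L))\<^sup>2\<bar> = \<bar>norm (v K) - norm (v L)\<bar> * (norm (v K) + norm (v L))"
        by (simp add: power2_eq_square square_diff_square_factored abs_mult)
      also have "\<dots> \<le> norm (v K - v L) * (norm (v K) + norm (v L))"
        by (intro mult_right_mono norm_triangle_ineq3) auto
      finally show ?thesis .
    qed
    ultimately have "len K L * \<bar>(norm (v K))\<^sup>2 - (norm (v L))\<^sup>2\<bar> \<le> len K L * (norm (v K - v L) * (norm (v K) + norm (v L)))"
      by (rule mult_left_mono[rotated])
    then show "len K L * \<bar>(norm (v K))\<^sup>2 - (norm (v L))\<^sup>2\<bar>
      \<le> len K L * (norm (v K - v L) * norm (v K)) + len K L * (norm (v K - v L) * norm (v L))"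
      by (simp add: algebra_simps)
  qed
  also have "\<dots> = ?X + (\<Sum>(K, L)\<in>pairs. len K L * (norm (v K - v L) * norm (v L)))"
    by (simp add: case_prod_beta sum.distrib)
  also have "(\<Sum>(K, L)\<in>pairs. len K L * (norm (v K - v L) * norm (v L))) = ?X"
    by (subst sum_pairs_swap) (simp add: symmetric_data(1)[of L K for L K] norm_minus_commute case_prod_beta symmetric_data(1))
  finally have 1: "(\<Sum>(K, L)\<in>pairs. len K L * \<bar>(norm (v K))\<^sup>2 - (norm (v L))\<^sup>2\<bar>) \<le> 2 * ?X" by simp
  have 2: "?X\<^sup>2 \<le> 4 * (energy v * mass v)" by (rule sum_len_norm_sq)
  have "(\<Sum>K\<in>cells \<V>. area K * (norm (v K)) ^ 4) = (\<Sum>K\<in>cells \<V>. area K * ((norm (v K))\<^sup>2)\<^sup>2)" by simp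
  also have "\<dots> \<le> (\<Sum>(K, L)\<in>pairs. len K L * \<bar>(norm (v K))\<^sup>2 - (norm (v L))\<^sup>2\<bar>)\<^sup>2"
    by (rule discrete_Sobolev) (use v in auto)
  also have "\<dots> \<le> (2 * ?X)\<^sup>2"
    by (rule power_mono[OF 1]) (auto intro!: sum_nonneg simp: pairs_iff len_pos less_imp_le)
  also have "\<dots> \<le> 16 * energy v * mass v" using 2 by (simp add: power_mult_distrib)
  finally show ?thesis .
qed

text \<open>Cauchy-Schwarz between fourth and second powers. The mass enters linearly, as Gronwall
  requires, at the price of the root of the energy.\<close>

lemma discrete_cubic_bound:
  assumes v: "\<And>K. K \<in> ext_cells \<Omega> \<V> \<Longrightarrow> v K = 0"
  shows "(\<Sum>K\<in>cells \<V>. area K * (norm (v K)) ^ 3) \<le> 4 * sqrt (energy v) * mass v"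
proof -
  have a: "0 \<le> area K" for K by (simp add: area_def)
  let ?Y = "\<Sum>K\<in>cells \<V>. area K * (norm (v K)) ^ 3"
  have "?Y = (\<Sum>K\<in>cells \<V>. (sqrt (area K) * (norm (v K))\<^sup>2) * (sqrt (area K) * norm (v K)))"
    by (intro sum.cong refl) (use a in \<open>simp add: algebra_simps power2_eq_square power3_eq_cube\<close>)
  then have "?Y\<^sup>2 \<le> (\<Sum>K\<in>cells \<V>. (sqrt (area K) * (norm (v K))\<^sup>2)\<^sup>2) * (\<Sum>K\<in>cells \<V>. (sqrt (area K) * norm (v K))\<^sup>2)"
    by (simp only: Cauchy_Schwarz_ineq_sum)
  also have "\<dots> = (\<Sum>K\<in>cells \<V>. area K * (norm (v K)) ^ 4) * mass v"
    unfolding mass_def using a by (simp add: power_mult_distrib)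
  also have "\<dots> \<le> (16 * energy v * mass v) * mass v"
    by (intro mult_right_mono discrete_Ladyzhenskaya mass_nonneg v)
  also have "\<dots> = (4 * sqrt (energy v) * mass v)\<^sup>2"
    by (simp add: power_mult_distrib energy_nonneg) (simp add: power2_eq_square)
  finally show ?thesis by (rule power2_le_imp_le) (simp add: energy_nonneg mass_nonneg)
qed

end

section \<open>Energy bounds for the scheme and the error estimate\<close>

text \<open>The shift by b/a absorbs the source: (y + b/a) exp (- a t) is decreasing.\<close>

lemma Gronwall:
  fixes y :: "real \<Rightarrow> real"
  assumes a: "0 < a" and cont: "continuous_on {0..T} y"
    and der: "\<And>t. t \<in> {0<..<T} \<Longrightarrow> \<exists>y'. (y has_real_derivative y') (at t) \<and> y' \<le> a * y t + b"
    and t: "t \<in> {0..T}"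
  shows "y t + b / a \<le> (y 0 + b / a) * exp (a * t)"
proof -
  define g where "g s = (y s + b / a) * exp (- (a * s))" for s
  have "g t \<le> g 0"
  proof (rule DERIV_nonpos_imp_decreasing_open[of 0 t g])
    show "0 \<le> t" using t by simp
    show "\<exists>d. (g has_real_derivative d) (at s) \<and> d \<le> 0" if st: "0 < s" "s < t" for s
    proof -
      obtain y' where y': "(y has_real_derivative y') (at s)" "y' \<le> a * y s + b" using der[of s] t st by auto
      have "(g has_real_derivative (y' * exp (- (a * s)) + (y s + b / a) * (exp (- (a * s)) * (- a)))) (at s)"
        unfolding g_def by (auto intro!: derivative_eq_intros y'(1))
      moreover have "y' * exp (- (a * s)) + (y s + b / a) * (exp (- (a * s)) * (- a)) = (y' - (a * y s + b)) * exp (- (a * s))"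
        using a by (simp add: field_simps)
      moreover have "\<dots> \<le> 0" using y'(2) by (intro mult_nonpos_nonneg) auto
      ultimately show ?thesis by metis
    qed
    show "continuous_on {0..t} g" unfolding g_def
      by (intro continuous_intros continuous_on_subset[OF cont]) (use t in auto)
  qed
  then have "(y t + b / a) * exp (- (a * t)) * exp (a * t) \<le> (y 0 + b / a) * exp (a * t)"
    by (intro mult_right_mono) (auto simp: g_def)
  then show ?thesis by (simp add: mult.assoc flip: exp_add)
qed

lemma has_derivative_norm_sq:
  fixes f :: "real \<Rightarrow> complex"
  assumes "(f has_vector_derivative f') (at t within S)"
  shows "((\<lambda>s. (norm (f s))\<^sup>2) has_real_derivative 2 * (f t \<bullet> f')) (at t within S)"
  using bounded_bilinear.has_vector_derivative[OF bounded_bilinear_inner assms assms]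
  by (simp add: power2_norm_eq_inner has_real_derivative_iff_has_vector_derivative inner_commute)

text \<open>For the real inner product on the complex plane, multiplication by the imaginary unit is
  a skew isometry.\<close>

lemma inner_i:
  fixes x y :: complex
  shows "(\<i> * x) \<bullet> (\<i> * y) = x \<bullet> y" "x \<bullet> (\<i> * y) = - ((\<i> * x) \<bullet> y)" "(\<i> * x) \<bullet> x = 0"
    "(of_real r * x) \<bullet> y = r * (x \<bullet> y)" "x \<bullet> (of_real r * y) = r * (x \<bullet> y)"
  by (simp_all add: inner_complex_def algebra_simps)

context voronoi_mesh
begin

lemma area_nonneg: "0 \<le> area K"
  by (simp add: area_def)

lemma cells_split: "K \<in> cells \<V> \<Longrightarrow> K \<in> int_cells \<Omega> \<V> \<or> K \<in> ext_cells \<Omega> \<V>"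
  by (simp add: ext_cells_def)

text \<open>v vanishes on the cells where the discrete Laplacian is zero by definition, so the sum
  may run over all cells. The factor 1/2 comes from ordered pairs.\<close>

lemma summation_by_parts:
  fixes v z :: "plane set \<Rightarrow> complex"
  assumes v: "\<And>K. K \<in> ext_cells \<Omega> \<V> \<Longrightarrow> v K = 0"
  shows "(\<Sum>K\<in>cells \<V>. area K * (v K \<bullet> discrete_laplacian \<Omega> \<V> z K))
    = - (1/2) * (\<Sum>(K, L)\<in>pairs. wt K L * ((v K - v L) \<bullet> (z K - z L)))"
proof -
  have "area K * (v K \<bullet> discrete_laplacian \<Omega> \<V> z K) = (\<Sum>L\<in>nbs K. wt K L * (v K \<bullet> (z L - z K)))"
    if K: "K \<in> cells \<V>" for K
  proof (cases "K \<in> int_cells \<Omega> \<V>")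
    case True
    have "area K * (v K \<bullet> discrete_laplacian \<Omega> \<V> z K) = v K \<bullet> (\<Sum>L\<in>nbs K. wt K L *\<^sub>R (z L - z K))"
      using laplacian_sum[OF True, of z] by (metis inner_scaleR_right)
    then show ?thesis by (simp add: inner_sum_right)
  qed (use v[of K] cells_split[OF K] in auto)
  then have 1: "(\<Sum>K\<in>cells \<V>. area K * (v K \<bullet> discrete_laplacian \<Omega> \<V> z K)) = (\<Sum>(K, L)\<in>pairs. wt K L * (v K \<bullet> (z L - z K)))"
    by (simp add: sum_pairs)
  have 2: "\<dots> = (\<Sum>(K, L)\<in>pairs. wt K L * (v L \<bullet> (z K - z L)))"
    by (subst sum_pairs_swap) (simp add: symmetric_data(3) case_prod_beta)
  have "(\<Sum>(K, L)\<in>pairs. wt K L * ((v K - v L) \<bullet> (z K - z L)))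
    = - (\<Sum>(K, L)\<in>pairs. wt K L * (v K \<bullet> (z L - z K))) - (\<Sum>(K, L)\<in>pairs. wt K L * (v L \<bullet> (z K - z L)))"
    unfolding case_prod_beta sum_negf[symmetric] sum_subtractf[symmetric]
    by (intro sum.cong refl) (simp add: inner_diff_left inner_diff_right algebra_simps)
  then show ?thesis using 1 2 by simp
qed

text \<open>As i z is orthogonal to z, only the differences of W across edges survive. For constant
  W the sum is zero, which gives conservation of mass.\<close>

lemma weighted_laplacian_flux:
  fixes v :: "plane set \<Rightarrow> complex" and W :: "plane set \<Rightarrow> real"
  assumes v: "\<And>K. K \<in> ext_cells \<Omega> \<V> \<Longrightarrow> v K = 0"
  shows "(\<Sum>K\<in>cells \<V>. area K * (W K * (v K \<bullet> (\<i> * discrete_laplacian \<Omega> \<V> v K))))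
    = (1/2) * (\<Sum>(K, L)\<in>pairs. wt K L * ((W K - W L) * ((\<i> * v L) \<bullet> (v K - v L))))"
proof -
  have "(\<Sum>K\<in>cells \<V>. area K * (W K * (v K \<bullet> (\<i> * discrete_laplacian \<Omega> \<V> v K))))
    = - (\<Sum>K\<in>cells \<V>. area K * ((of_real (W K) * (\<i> * v K)) \<bullet> discrete_laplacian \<Omega> \<V> v K))"
    by (simp add: inner_i sum_negf)
  also have "\<dots> = (1/2) * (\<Sum>(K, L)\<in>pairs. wt K L * ((of_real (W K) * (\<i> * v K) - of_real (W L) * (\<i> * v L)) \<bullet> (v K - v L)))"
    by (subst summation_by_parts) (use v in auto)
  finally have 1: "(\<Sum>K\<in>cells \<V>. area K * (W K * (v K \<bullet> (\<i> * discrete_laplacian \<Omega> \<V> v K))))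
    = (1/2) * (\<Sum>(K, L)\<in>pairs. wt K L * ((of_real (W K) * (\<i> * v K) - of_real (W L) * (\<i> * v L)) \<bullet> (v K - v L)))" .
  have 2: "(of_real (W K) * (\<i> * v K) - of_real (W L) * (\<i> * v L)) \<bullet> (v K - v L) = (W K - W L) * ((\<i> * v L) \<bullet> (v K - v L))" for K L
  proof -
    have "of_real (W K) * (\<i> * v K) - of_real (W L) * (\<i> * v L) = of_real (W K) * (\<i> * (v K - v L)) + of_real (W K - W L) * (\<i> * v L)"
      by (simp add: algebra_simps)
    then show ?thesis by (simp only: inner_add_left inner_i mult_zero_right add_0_left)
  qed
  show ?thesis unfolding 1 2 ..
qed

section \<open>The semi-discrete flow: conservation of mass and bound on the energy\<close>

definition flow :: "real \<Rightarrow> (plane \<Rightarrow> real) \<Rightarrow> (plane set \<Rightarrow> complex) \<Rightarrow> plane set \<Rightarrow> complex" where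
  "flow \<gamma> W v K = \<i> * (discrete_laplacian \<Omega> \<V> v K - of_real (\<gamma> * (norm (v K))\<^sup>2 + W (ctr K)) * v K)"

lemma flow_ext: "v K = 0 \<Longrightarrow> K \<in> ext_cells \<Omega> \<V> \<Longrightarrow> flow \<gamma> W v K = 0"
  by (simp add: flow_def discrete_laplacian_def ext_cells_def)

lemma semidiscreteD:
  assumes w: "semidiscrete_solution \<Omega> \<V> T \<gamma> V u0 w" and t: "t \<in> {0..T}"
  shows "\<And>K. K \<in> ext_cells \<Omega> \<V> \<Longrightarrow> w t K = 0"
    and "\<And>K. K \<in> cells \<V> \<Longrightarrow> ((\<lambda>s. w s K) has_vector_derivative flow \<gamma> (V t) (w t) K) (at t within {0..T})"
    and "\<And>K. K \<in> cells \<V> \<Longrightarrow> w 0 K = u0 (ctr K)"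
proof -
  show "w t K = 0" if "K \<in> ext_cells \<Omega> \<V>" for K
    using w t that by (auto simp: semidiscrete_solution_def discrete_space_def)
  show "w 0 K = u0 (ctr K)" if "K \<in> cells \<V>" for K
    using w that by (auto simp: semidiscrete_solution_def cell_projection_def)
  show "((\<lambda>s. w s K) has_vector_derivative flow \<gamma> (V t) (w t) K) (at t within {0..T})" if K: "K \<in> cells \<V>" for K
  proof -
    obtain w' where w': "((\<lambda>s. w s K) has_vector_derivative w') (at t within {0..T})"
      "\<i> * w' + discrete_laplacian \<Omega> \<V> (w t) K = of_real (\<gamma> * (norm (w t K))\<^sup>2) * w t K + of_real (V t (ctr K)) * w t K"
      using w t K unfolding semidiscrete_solution_def cell_projection_def by blast
    have "flow \<gamma> (V t) (w t) K = - \<i> * (of_real (\<gamma> * (norm (w t K))\<^sup>2) * w t K + of_real (V t (ctr K)) * w t K - discrete_laplacian \<Omega> \<V> (w t) K)"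
      by (simp add: flow_def algebra_simps)
    also have "\<dots> = - \<i> * (\<i> * w')" unfolding w'(2)[symmetric] by simp
    finally have "w' = flow \<gamma> (V t) (w t) K" by (simp flip: mult.assoc)
    then show ?thesis using w'(1) by simp
  qed
qed

lemma semidiscrete_at:
  assumes w: "semidiscrete_solution \<Omega> \<V> T \<gamma> V u0 w" and t: "t \<in> {0<..<T}" and K: "K \<in> cells \<V>"
  shows "((\<lambda>s. w s K) has_vector_derivative flow \<gamma> (V t) (w t) K) (at t)"
  using semidiscreteD(2)[OF w _ K, of t] t by (simp add: at_within_Icc_at)

lemma semidiscrete_continuous:
  assumes w: "semidiscrete_solution \<Omega> \<V> T \<gamma> V u0 w" and K: "K \<in> cells \<V>"
  shows "continuous_on {0..T} (\<lambda>t. w t K)"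
  unfolding continuous_on_eq_continuous_within
  using has_vector_derivative_continuous[OF semidiscreteD(2)[OF w _ K]] by blast

lemma mass_conserved:
  assumes w: "semidiscrete_solution \<Omega> \<V> T \<gamma> V u0 w" and t: "t \<in> {0..T}"
  shows "mass (w t) = mass (w 0)"
proof -
  have "((\<lambda>t. mass (w t)) has_real_derivative 0) (at s within {0..T})" if s: "s \<in> {0..T}" for s
  proof -
    have "((\<lambda>t. mass (w t)) has_real_derivative (\<Sum>K\<in>cells \<V>. area K * (2 * (w s K \<bullet> flow \<gamma> (V s) (w s) K)))) (at s within {0..T})"
      unfolding mass_def
      by (intro DERIV_sum DERIV_cmult has_derivative_norm_sq semidiscreteD(2)[OF w s])
    \<comment> \<open>The nonlinearity and the potential are real multiples of the solution, and i
      times such a multiple is orthogonal to it.\<close>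
    moreover have "w s K \<bullet> flow \<gamma> (V s) (w s) K = 1 * (w s K \<bullet> (\<i> * discrete_laplacian \<Omega> \<V> (w s) K))" for K
      unfolding flow_def right_diff_distrib inner_diff_right mult.left_commute[of \<i>] inner_i(5)
      by (simp add: inner_commute[of _ "\<i> * w s K"] inner_i(3))
    then have "(\<Sum>K\<in>cells \<V>. area K * (w s K \<bullet> flow \<gamma> (V s) (w s) K)) = 0"
      using weighted_laplacian_flux[of "w s" "\<lambda>_. 1"] semidiscreteD(1)[OF w s] by simp
    then have "(\<Sum>K\<in>cells \<V>. area K * (2 * (w s K \<bullet> flow \<gamma> (V s) (w s) K))) = 0"
      by (simp add: mult.left_commute[of _ 2] sum_distrib_left[symmetric])
    ultimately show ?thesis by simp
  qed
  then have "\<exists>c. \<forall>s\<in>{0..T}. mass (w s) = c"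
    by (intro has_field_derivative_zero_constant) auto
  then show ?thesis using t by auto
qed

text \<open>The potential is left out of the energy, so that its time derivative does not enter; what
  remains is a flux controlled by the Lipschitz constant of the potential in space.\<close>

lemma energy_flux_bound:
  fixes v :: "plane set \<Rightarrow> complex"
  assumes v: "\<And>K. K \<in> ext_cells \<Omega> \<V> \<Longrightarrow> v K = 0"
    and W: "\<And>K L. nb K L \<Longrightarrow> \<bar>W (ctr K) - W (ctr L)\<bar> \<le> \<Lambda> * dst K L"
  shows "(\<Sum>(K, L)\<in>pairs. wt K L * (2 * ((v K - v L) \<bullet> (flow \<gamma> W v K - flow \<gamma> W v L))))
     + \<gamma> * (\<Sum>K\<in>cells \<V>. area K * (4 * (norm (v K))\<^sup>2 * (v K \<bullet> flow \<gamma> W v K))) \<le> 2 * \<bar>\<Lambda>\<bar> * (energy v + mass v)"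
proof -
  let ?D = "flow \<gamma> W v" and ?A = "discrete_laplacian \<Omega> \<V> v"
  let ?X = "\<Sum>(K, L)\<in>pairs. len K L * (norm (v K - v L) * norm (v K))"
  have D0: "?D K = 0" if "K \<in> ext_cells \<Omega> \<V>" for K using flow_ext v that by blast
  \<comment> \<open>The scheme expresses the Laplacian through v and the time derivative D, and its
    part i D is orthogonal to D.\<close>
  have DA: "?D K \<bullet> ?A K = (\<gamma> * (norm (v K))\<^sup>2 + W (ctr K)) * (v K \<bullet> ?D K)" for K
  proof -
    have "?A K = of_real (\<gamma> * (norm (v K))\<^sup>2 + W (ctr K)) * v K - \<i> * ?D K"
      by (simp add: flow_def flip: mult.assoc)
    then have "?D K \<bullet> ?A K = ?D K \<bullet> (of_real (\<gamma> * (norm (v K))\<^sup>2 + W (ctr K)) * v K - \<i> * ?D K)"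
      by (rule arg_cong)
    then have "?D K \<bullet> ?A K = ?D K \<bullet> (of_real (\<gamma> * (norm (v K))\<^sup>2 + W (ctr K)) * v K) - ?D K \<bullet> (\<i> * ?D K)"
      by (simp only: inner_diff_right)
    also have "\<dots> = (\<gamma> * (norm (v K))\<^sup>2 + W (ctr K)) * (v K \<bullet> ?D K)"
      by (simp only: inner_i inner_commute[of "?D K" "v K"] minus_zero diff_zero)
    finally show ?thesis .
  qed
  have vD: "v K \<bullet> ?D K = v K \<bullet> (\<i> * ?A K)" for K
    unfolding flow_def right_diff_distrib inner_diff_right mult.left_commute[of \<i>] inner_i(5)
    by (simp add: inner_commute[of _ "\<i> * v K"] inner_i(3))
  have "(\<Sum>(K, L)\<in>pairs. wt K L * (2 * ((v K - v L) \<bullet> (?D K - ?D L))))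
    = - 4 * (- (1/2) * (\<Sum>(K, L)\<in>pairs. wt K L * ((?D K - ?D L) \<bullet> (v K - v L))))"
    by (simp add: inner_commute sum_distrib_left mult.left_commute case_prod_beta)
  also have "\<dots> = - 4 * (\<Sum>K\<in>cells \<V>. area K * (?D K \<bullet> ?A K))"
    by (subst summation_by_parts) (use D0 in auto)
  \<comment> \<open>The cubic contributions cancel against the derivative of the quartic energy, and
    only the potential is left.\<close>
  also have "\<dots> + \<gamma> * (\<Sum>K\<in>cells \<V>. area K * (4 * (norm (v K))\<^sup>2 * (v K \<bullet> ?D K)))
    = - 4 * (\<Sum>K\<in>cells \<V>. area K * (W (ctr K) * (v K \<bullet> ?D K)))"
    unfolding DA sum_distrib_left sum.distrib[symmetric] by (intro sum.cong refl) (simp add: algebra_simps)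
  also have "\<dots> = - 2 * (\<Sum>(K, L)\<in>pairs. wt K L * ((W (ctr K) - W (ctr L)) * ((\<i> * v L) \<bullet> (v K - v L))))"
    unfolding vD by (subst weighted_laplacian_flux[OF v]) auto
  also have "\<dots> = (\<Sum>(K, L)\<in>pairs. - 2 * (wt K L * ((W (ctr K) - W (ctr L)) * ((\<i> * v L) \<bullet> (v K - v L)))))"
    by (simp add: sum_distrib_left case_prod_beta)
  \<comment> \<open>The Lipschitz bound on W supplies the factor \<open>dst K L\<close> that turns
    the weight into an edge length, the form controlled by energy and mass.\<close>
  also have "\<dots> \<le> (\<Sum>(K, L)\<in>pairs. (2 * \<bar>\<Lambda>\<bar>) * (len K L * (norm (v K - v L) * norm (v L))))"
  proof (rule sum_mono, clarify)
    fix K L assume "(K, L) \<in> pairs"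
    then have n: "nb K L" by (simp add: pairs_iff)
    have "\<bar>wt K L * ((W (ctr K) - W (ctr L)) * ((\<i> * v L) \<bullet> (v K - v L)))\<bar>
      = wt K L * (\<bar>W (ctr K) - W (ctr L)\<bar> * \<bar>(\<i> * v L) \<bullet> (v K - v L)\<bar>)"
      using wt_pos[OF n] by (simp add: abs_mult)
    also have "\<dots> \<le> wt K L * ((\<bar>\<Lambda>\<bar> * dst K L) * (norm (v L) * norm (v K - v L)))"
    proof (intro mult_left_mono mult_mono)
      have "\<Lambda> * dst K L \<le> \<bar>\<Lambda>\<bar> * dst K L" using dst_pos[OF n] by (intro mult_right_mono) auto
      then show "\<bar>W (ctr K) - W (ctr L)\<bar> \<le> \<bar>\<Lambda>\<bar> * dst K L" using W[OF n] by linarith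
      show "\<bar>(\<i> * v L) \<bullet> (v K - v L)\<bar> \<le> norm (v L) * norm (v K - v L)"
        using Cauchy_Schwarz_ineq2[of "\<i> * v L" "v K - v L"] by (simp add: norm_mult)
    qed (use dst_pos[OF n] wt_pos[OF n] in auto)
    also have "\<dots> = \<bar>\<Lambda>\<bar> * ((wt K L * dst K L) * (norm (v K - v L) * norm (v L)))" by (simp add: algebra_simps)
    finally show "- 2 * (wt K L * ((W (ctr K) - W (ctr L)) * ((\<i> * v L) \<bullet> (v K - v L)))) \<le> (2 * \<bar>\<Lambda>\<bar>) * (len K L * (norm (v K - v L) * norm (v L)))"
      unfolding wt_dst[OF n] by linarith
  qed
  also have "\<dots> = (2 * \<bar>\<Lambda>\<bar>) * (\<Sum>(K, L)\<in>pairs. len K L * (norm (v K - v L) * norm (v L)))"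
    by (simp add: sum_distrib_left case_prod_beta)
  also have "(\<Sum>(K, L)\<in>pairs. len K L * (norm (v K - v L) * norm (v L))) = ?X"
    by (subst sum_pairs_swap) (simp add: norm_minus_commute case_prod_beta symmetric_data(1))
  also have "(2 * \<bar>\<Lambda>\<bar>) * ?X \<le> (2 * \<bar>\<Lambda>\<bar>) * (energy v + mass v)"
  proof (intro mult_left_mono)
    have "4 * (energy v * mass v) \<le> (energy v + mass v)\<^sup>2"
      using zero_le_power2[of "energy v - mass v"] by (simp add: power2_eq_square algebra_simps)
    then have "?X\<^sup>2 \<le> (energy v + mass v)\<^sup>2" using sum_len_norm_sq[of v] by linarith
    then show "?X \<le> energy v + mass v"
      by (rule power2_le_imp_le) (simp add: energy_nonneg mass_nonneg)
  qed simp
  finally show ?thesis .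
qed

lemma sum_len_dst_total: "(\<Sum>(K, L)\<in>pairs. len K L * dst K L) \<le> 4 * measure lebesgue \<Omega>"
proof -
  have "(\<Sum>(K, L)\<in>pairs. len K L * dst K L) \<le> (\<Sum>K\<in>cells \<V>. 4 * area K)"
    unfolding sum_pairs by (intro sum_mono sum_len_dst_le)
  also have "\<dots> \<le> 4 * measure lebesgue \<Omega>" using sum_area by (simp add: sum_distrib_left[symmetric])
  finally show ?thesis .
qed

lemma energy_le:
  assumes M: "0 \<le> M" and "\<And>K L. nb K L \<Longrightarrow> norm (v K - v L) \<le> M * dst K L"
  shows "energy v \<le> 4 * M\<^sup>2 * measure lebesgue \<Omega>"
proof -
  have "energy v \<le> (\<Sum>(K, L)\<in>pairs. M\<^sup>2 * (len K L * dst K L))"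
    unfolding energy_def
  proof (rule sum_mono, clarify)
    fix K L assume "(K, L) \<in> pairs"
    then have n: "nb K L" by (simp add: pairs_iff)
    have "wt K L * (norm (v K - v L))\<^sup>2 \<le> wt K L * (M * dst K L)\<^sup>2"
      using assms(2)[OF n] wt_pos[OF n] by (intro mult_left_mono power_mono) auto
    also have "\<dots> = M\<^sup>2 * (wt K L * dst K L * dst K L)" by (simp add: power2_eq_square algebra_simps)
    finally show "wt K L * (norm (v K - v L))\<^sup>2 \<le> M\<^sup>2 * (len K L * dst K L)" by (simp add: wt_dst[OF n])
  qed
  also have "\<dots> = M\<^sup>2 * (\<Sum>(K, L)\<in>pairs. len K L * dst K L)" by (simp add: sum_distrib_left case_prod_beta)
  also have "\<dots> \<le> M\<^sup>2 * (4 * measure lebesgue \<Omega>)" by (intro mult_left_mono sum_len_dst_total) auto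
  finally show ?thesis by (simp add: algebra_simps)
qed

lemma sum_area_le:
  assumes "\<And>K. K \<in> cells \<V> \<Longrightarrow> g K \<le> B" "0 \<le> B"
  shows "(\<Sum>K\<in>cells \<V>. area K * g K) \<le> measure lebesgue \<Omega> * B"
proof -
  have "(\<Sum>K\<in>cells \<V>. area K * g K) \<le> (\<Sum>K\<in>cells \<V>. area K * B)"
    using assms(1) area_nonneg by (intro sum_mono mult_left_mono)
  also have "\<dots> \<le> measure lebesgue \<Omega> * B"
    unfolding sum_distrib_right[symmetric] by (intro mult_right_mono sum_area assms(2))
  finally show ?thesis .
qed

text \<open>Gronwall for the energy plus \<gamma> times the sum of fourth powers. In the constant, 4
  M^2 bounds the initial energy and one more M^2 the mass, which is conserved and acts as the
  source.\<close>

lemma energy_bound: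
  assumes w: "semidiscrete_solution \<Omega> \<V> T \<gamma> V u0 w" and t: "t \<in> {0..T}" and g: "0 \<le> \<gamma>" and \<Lambda>: "0 < \<Lambda>"
    and V: "\<And>t K L. t \<in> {0..T} \<Longrightarrow> nb K L \<Longrightarrow> \<bar>V t (ctr K) - V t (ctr L)\<bar> \<le> \<Lambda> * dst K L"
    and M: "0 \<le> M" "\<And>K L. nb K L \<Longrightarrow> norm (w 0 K - w 0 L) \<le> M * dst K L" "\<And>K. K \<in> cells \<V> \<Longrightarrow> norm (w 0 K) \<le> M"
  shows "energy (w t) \<le> measure lebesgue \<Omega> * (5 * M\<^sup>2 + \<gamma> * M ^ 4) * exp (2 * \<Lambda> * T)"
proof -
  let ?\<mu> = "measure lebesgue \<Omega>"
  let ?q = "\<lambda>v. \<Sum>K\<in>cells \<V>. area K * ((norm (v K))\<^sup>2)\<^sup>2"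
  define G where "G s = energy (w s) + \<gamma> * ?q (w s)" for s
  have q0: "0 \<le> ?q v" for v :: "plane set \<Rightarrow> complex" by (intro sum_nonneg) (auto simp: area_nonneg)
  have m: "mass (w s) = mass (w 0)" if "s \<in> {0..T}" for s by (rule mass_conserved[OF w that])
  have m0: "mass (w 0) \<le> ?\<mu> * M\<^sup>2"
    unfolding mass_def by (rule sum_area_le) (auto intro!: power_mono M)
  have cw: "continuous_on {0..T} (\<lambda>t. w t K)" if "K \<in> cells \<V>" for K by (rule semidiscrete_continuous[OF w that])
  have cG: "continuous_on {0..T} G"
    unfolding G_def energy_def case_prod_beta
    by (intro continuous_intros cw) (auto simp: pairs_def nbs_def dest: nbD)
  have "G t + (2 * \<Lambda> * mass (w 0)) / (2 * \<Lambda>) \<le> (G 0 + (2 * \<Lambda> * mass (w 0)) / (2 * \<Lambda>)) * exp (2 * \<Lambda> * t)"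
  proof (rule Gronwall[OF _ cG _ t])
    fix s assume s: "s \<in> {0<..<T}"
    then have s': "s \<in> {0..T}" by simp
    let ?D = "flow \<gamma> (V s) (w s)"
    note d = semidiscrete_at[OF w s]
    have 1: "((\<lambda>s. energy (w s)) has_real_derivative (\<Sum>q\<in>pairs. wt (fst q) (snd q) * (2 * ((w s (fst q) - w s (snd q)) \<bullet> (?D (fst q) - ?D (snd q)))))) (at s)"
      unfolding energy_def case_prod_beta
      by (intro DERIV_sum DERIV_cmult has_derivative_norm_sq has_vector_derivative_diff d) (auto simp: pairs_def nbs_def dest: nbD)
    have 2: "((\<lambda>s. ?q (w s)) has_real_derivative (\<Sum>K\<in>cells \<V>. area K * (4 * (norm (w s K))\<^sup>2 * (w s K \<bullet> ?D K)))) (at s)"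
    proof (intro DERIV_sum DERIV_cmult)
      fix K assume K: "K \<in> cells \<V>"
      show "((\<lambda>s. ((norm (w s K))\<^sup>2)\<^sup>2) has_real_derivative 4 * (norm (w s K))\<^sup>2 * (w s K \<bullet> ?D K)) (at s)"
        using DERIV_power[OF has_derivative_norm_sq[OF d[OF K]], of 2] by (simp add: algebra_simps)
    qed
    have "(G has_real_derivative ((\<Sum>q\<in>pairs. wt (fst q) (snd q) * (2 * ((w s (fst q) - w s (snd q)) \<bullet> (?D (fst q) - ?D (snd q)))))
        + \<gamma> * (\<Sum>K\<in>cells \<V>. area K * (4 * (norm (w s K))\<^sup>2 * (w s K \<bullet> ?D K))))) (at s)"
      unfolding G_def by (intro DERIV_add DERIV_cmult 1 2)
    moreover have "(\<Sum>q\<in>pairs. wt (fst q) (snd q) * (2 * ((w s (fst q) - w s (snd q)) \<bullet> (?D (fst q) - ?D (snd q)))))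
        + \<gamma> * (\<Sum>K\<in>cells \<V>. area K * (4 * (norm (w s K))\<^sup>2 * (w s K \<bullet> ?D K))) \<le> 2 * \<bar>\<Lambda>\<bar> * (energy (w s) + mass (w s))"
      using energy_flux_bound[of "w s" "V s" \<Lambda> \<gamma>] semidiscreteD(1)[OF w s'] V[OF s'] by (simp add: case_prod_beta)
    moreover have "2 * \<bar>\<Lambda>\<bar> * (energy (w s) + mass (w s)) \<le> 2 * \<Lambda> * G s + 2 * \<Lambda> * mass (w 0)"
      using \<Lambda> g q0[of "w s"] by (simp add: G_def m[OF s'] algebra_simps)
    ultimately show "\<exists>y'. (G has_real_derivative y') (at s) \<and> y' \<le> 2 * \<Lambda> * G s + 2 * \<Lambda> * mass (w 0)"
      by (meson order_trans)
  qed (use \<Lambda> in simp)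
  then have Gt: "G t + mass (w 0) \<le> (G 0 + mass (w 0)) * exp (2 * \<Lambda> * t)" using \<Lambda> by simp
  have qw: "?q (w 0) \<le> ?\<mu> * M ^ 4"
  proof (rule sum_area_le)
    fix K assume "K \<in> cells \<V>"
    then have "(norm (w 0 K)) ^ 4 \<le> M ^ 4" by (intro power_mono M) auto
    then show "((norm (w 0 K))\<^sup>2)\<^sup>2 \<le> M ^ 4" by simp
  qed simp
  have G0: "G 0 + mass (w 0) \<le> ?\<mu> * (5 * M\<^sup>2 + \<gamma> * M ^ 4)"
    using energy_le[OF M(1,2)] mult_left_mono[OF qw g] m0 by (simp add: G_def algebra_simps)
  have Gn: "0 \<le> G 0 + mass (w 0)" using energy_nonneg mass_nonneg q0[of "w 0"] g by (simp add: G_def)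
  have "energy (w t) \<le> G t + mass (w 0)" using q0[of "w t"] g mass_nonneg by (simp add: G_def)
  also note Gt
  also have "(G 0 + mass (w 0)) * exp (2 * \<Lambda> * t) \<le> ?\<mu> * (5 * M\<^sup>2 + \<gamma> * M ^ 4) * exp (2 * \<Lambda> * T)"
    using t \<Lambda> G0 Gn by (intro mult_mono) auto
  finally show ?thesis .
qed

end

text \<open>The part of the difference that is a real multiple of \<open>p - w\<close> is not seen by the inner product;
  the remaining cubic term is what makes an energy bound for the error necessary.\<close>

lemma cubic_difference_bound:
  fixes p w :: complex
  assumes g: "0 \<le> \<gamma>" and p: "norm p \<le> A"
  shows "\<bar>(p - w) \<bullet> (\<i> * (of_real (\<gamma> * (norm p)\<^sup>2 + r) * p - of_real (\<gamma> * (norm w)\<^sup>2 + r) * w))\<bar>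
    \<le> \<gamma> * (2 * A\<^sup>2 * (norm (p - w))\<^sup>2 + A * norm (p - w) ^ 3)"
proof -
  let ?e = "p - w"
  have A0: "0 \<le> A" using p norm_ge_zero order_trans by blast
  have "of_real (\<gamma> * (norm p)\<^sup>2 + r) * p - of_real (\<gamma> * (norm w)\<^sup>2 + r) * w
    = of_real (\<gamma> * (norm w)\<^sup>2 + r) * ?e + of_real (\<gamma> * ((norm p)\<^sup>2 - (norm w)\<^sup>2)) * p"
    by (simp add: algebra_simps)
  then have eq: "\<i> * (of_real (\<gamma> * (norm p)\<^sup>2 + r) * p - of_real (\<gamma> * (norm w)\<^sup>2 + r) * w)
    = of_real (\<gamma> * (norm w)\<^sup>2 + r) * (\<i> * ?e) + of_real (\<gamma> * ((norm p)\<^sup>2 - (norm w)\<^sup>2)) * (\<i> * p)"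
    by (simp add: algebra_simps)
  have "?e \<bullet> (\<i> * ?e) = 0" using inner_i(3)[of ?e] by (simp add: inner_commute)
  then have "\<bar>?e \<bullet> (\<i> * (of_real (\<gamma> * (norm p)\<^sup>2 + r) * p - of_real (\<gamma> * (norm w)\<^sup>2 + r) * w))\<bar>
    = \<gamma> * (\<bar>(norm p)\<^sup>2 - (norm w)\<^sup>2\<bar> * \<bar>?e \<bullet> (\<i> * p)\<bar>)"
    unfolding eq inner_add_right inner_i(5) using g by (simp add: abs_mult)
  also have "\<dots> \<le> \<gamma> * ((norm ?e * (2 * A + norm ?e)) * (norm ?e * A))"
  proof (intro mult_left_mono mult_mono g)
    have "norm w \<le> norm p + norm ?e" using norm_triangle_ineq[of p "- ?e"] by (simp add: norm_minus_commute)
    moreover have "\<bar>norm p - norm w\<bar> \<le> norm ?e" by (rule norm_triangle_ineq3)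
    ultimately have "\<bar>norm p - norm w\<bar> * (norm p + norm w) \<le> norm ?e * (2 * A + norm ?e)"
      using p by (intro mult_mono) auto
    then show "\<bar>(norm p)\<^sup>2 - (norm w)\<^sup>2\<bar> \<le> norm ?e * (2 * A + norm ?e)"
      by (simp add: power2_eq_square square_diff_square_factored abs_mult mult.commute)
    have "\<bar>?e \<bullet> (\<i> * p)\<bar> \<le> norm ?e * norm p" using Cauchy_Schwarz_ineq2[of ?e "\<i> * p"] by (simp add: norm_mult)
    also have "\<dots> \<le> norm ?e * A" using p by (intro mult_left_mono) auto
    finally show "\<bar>?e \<bullet> (\<i> * p)\<bar> \<le> norm ?e * A" .
  qed (use A0 in auto)
  also have "\<dots> = \<gamma> * (2 * A\<^sup>2 * (norm ?e)\<^sup>2 + A * norm ?e ^ 3)"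
    by (simp add: power2_eq_square power3_eq_cube algebra_simps)
  finally show ?thesis .
qed

section \<open>Consistency error and growth of the error\<close>

context voronoi_mesh
begin

text \<open>The Taylor expansion at \<open>ctr K\<close> is inserted into
  \<open>quadratic_consistency\<close>. Its edge term is replaced by an exactly antisymmetric Q and
  the change is put into s. Of the 20 in the bound on s, 16 come from the cubic remainder with
  \<open>dst K L\<close> at most twice the mesh size, and 4 from the replacement.\<close>

lemma consistency:
  fixes p g1 g2 a b c :: "plane set \<Rightarrow> complex"
  assumes A: "0 \<le> A" and eta: "0 \<le> \<eta>"
    and taylor: "\<And>K L. K \<in> int_cells \<Omega> \<V> \<Longrightarrow> nb K L \<Longrightarrow>
      norm (p L - p K - ((ctr L - ctr K)$1 *\<^sub>R g1 K + (ctr L - ctr K)$2 *\<^sub>R g2 K)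
        - (1/2) *\<^sub>R quad_form (a K) (b K) (c K) (ctr L - ctr K)) \<le> 8 * A * dst K L ^ 3 + 2 * \<eta>"
    and bound: "\<And>K. K \<in> int_cells \<Omega> \<V> \<Longrightarrow> norm (a K) \<le> A \<and> norm (b K) \<le> A \<and> norm (c K) \<le> A"
    and lip: "\<And>K L. K \<in> int_cells \<Omega> \<V> \<Longrightarrow> L \<in> int_cells \<Omega> \<V> \<Longrightarrow>
      norm (a K - a L) \<le> 2 * A * dst K L \<and> norm (b K - b L) \<le> 2 * A * dst K L \<and> norm (c K - c L) \<le> 2 * A * dst K L"
  shows "\<exists>Q s. (\<forall>K L. Q K L = - Q L K) \<and> (\<forall>K L. nb K L \<longrightarrow> norm (Q K L) \<le> 4 * A * dst K L * mesh_size \<V>) \<and>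
     (\<forall>K L. K \<in> int_cells \<Omega> \<V> \<longrightarrow> nb K L \<longrightarrow> norm (s K L) \<le> 20 * A * mesh_size \<V> * (dst K L)\<^sup>2 + 2 * \<eta>) \<and>
     (\<forall>K. K \<in> int_cells \<Omega> \<V> \<longrightarrow>
       area K *\<^sub>R (discrete_laplacian \<Omega> \<V> p K - (a K + c K)) = (\<Sum>L\<in>nbs K. wt K L *\<^sub>R (s K L - Q K L)))"
proof -
  let ?I = "int_cells \<Omega> \<V>" and ?h = "mesh_size \<V>"
  let ?z = "\<lambda>K L. ctr L - ctr K"
  define B where "B K L = bil_form (a K) (b K) (c K) (?z K L) (offset K L)" for K L
  define \<beta> where "\<beta> K L = (if K \<in> ?I then B K L else 0)" for K L
  \<comment> \<open>Between interior cells the antisymmetric part of \<beta> is close to \<beta>, as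
    the second derivatives are Lipschitz. If one cell is exterior, its own \<beta> is 0, and the
    factor 1 makes Q equal to \<beta> on the interior side.\<close>
  define Q where "Q K L = (if K \<in> ?I \<and> L \<in> ?I then 1/2 else 1) *\<^sub>R (\<beta> K L - \<beta> L K)" for K L
  define r where "r K L = p L - p K - (?z K L$1 *\<^sub>R g1 K + ?z K L$2 *\<^sub>R g2 K)
        - (1/2) *\<^sub>R quad_form (a K) (b K) (c K) (?z K L)" for K L
  define s where "s K L = r K L + (Q K L - \<beta> K L)" for K L
  have nz: "norm (?z K L) = dst K L" for K L by (simp add: dst_def dist_norm norm_minus_commute)
  have Bb: "norm (B K L) \<le> 4 * A * dst K L * ?h" if "K \<in> ?I" "nb K L" for K L
  proof -
    have "norm (B K L) \<le> 4 * A * norm (?z K L) * norm (offset K L)"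
      unfolding B_def using bound[OF that(1)] by (intro bil_form_bound) auto
    also have "\<dots> \<le> 4 * A * norm (?z K L) * ?h" using offset_le[OF that(2)] A by (intro mult_left_mono) auto
    finally show ?thesis unfolding nz .
  qed
  have b0: "0 \<le> 4 * A * dst K L * ?h" if "nb K L" for K L
    using A dst_pos[OF that] mesh_size_pos by (intro mult_nonneg_nonneg) auto
  have \<beta>b: "norm (\<beta> K L) \<le> 4 * A * dst K L * ?h" if "nb K L" for K L
    using Bb[of K L] b0[OF that] that by (auto simp: \<beta>_def)
  have anti: "Q K L = - Q L K" for K L by (simp add: Q_def conj_commute flip: scaleR_minus_right)
  have Qb: "norm (Q K L) \<le> 4 * A * dst K L * ?h" if n: "nb K L" for K L
  proof (cases "K \<in> ?I \<and> L \<in> ?I")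
    case True
    have "norm (\<beta> K L - \<beta> L K) \<le> norm (\<beta> K L) + norm (\<beta> L K)" by (rule norm_triangle_ineq4)
    then show ?thesis using True \<beta>b[OF n] \<beta>b[of L K] n by (simp add: Q_def nb_commute[of L K] symmetric_data(2)[of L K])
  next
    case False
    then have "\<beta> K L = 0 \<or> \<beta> L K = 0" by (auto simp: \<beta>_def)
    then show ?thesis using False \<beta>b[OF n] \<beta>b[of L K] n by (auto simp: Q_def nb_commute[of L K] symmetric_data(2)[of L K])
  qed
  have d: "norm (Q K L - \<beta> K L) \<le> 4 * A * ?h * (dst K L)\<^sup>2" if K: "K \<in> ?I" and n: "nb K L" for K L
  proof (cases "L \<in> ?I")
    case True
    have "B L K = - bil_form (a L) (b L) (c L) (?z K L) (offset K L)"
      unfolding B_def offset_commute[of L K] bil_form_minus_left[symmetric] by simp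
    then have "Q K L - \<beta> K L = - (1/2) *\<^sub>R (B K L - bil_form (a L) (b L) (c L) (?z K L) (offset K L))"
      using K True by (simp add: Q_def \<beta>_def scaleR_conv_of_real field_simps)
    then have "norm (Q K L - \<beta> K L) = norm (bil_form (a K - a L) (b K - b L) (c K - c L) (?z K L) (offset K L)) / 2"
      by (simp add: B_def bil_form_diff)
    also have "\<dots> \<le> (4 * (2 * A * dst K L) * norm (?z K L) * norm (offset K L)) / 2"
      using lip[OF K True] by (intro divide_right_mono bil_form_bound) auto
    also have "\<dots> \<le> (4 * (2 * A * dst K L) * norm (?z K L) * ?h) / 2"
      using offset_le[OF n] A dst_pos[OF n] by (intro divide_right_mono mult_left_mono) auto
    finally show ?thesis unfolding nz by (simp add: power2_eq_square algebra_simps)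
  next
    case False
    then show ?thesis using K A mesh_size_pos by (simp add: Q_def \<beta>_def)
  qed
  have sb: "norm (s K L) \<le> 20 * A * ?h * (dst K L)\<^sup>2 + 2 * \<eta>" if K: "K \<in> ?I" and n: "nb K L" for K L
  proof -
    have "8 * A * dst K L ^ 3 = (8 * A * (dst K L)\<^sup>2) * dst K L" by (simp add: power2_eq_square power3_eq_cube)
    also have "\<dots> \<le> (8 * A * (dst K L)\<^sup>2) * (2 * ?h)" using dst_le[OF n] A by (intro mult_left_mono) auto
    finally have "8 * A * dst K L ^ 3 \<le> 16 * A * ?h * (dst K L)\<^sup>2" by (simp add: algebra_simps)
    moreover have "norm (s K L) \<le> norm (r K L) + norm (Q K L - \<beta> K L)" unfolding s_def by (rule norm_triangle_ineq)
    moreover have "norm (r K L) \<le> 8 * A * dst K L ^ 3 + 2 * \<eta>" unfolding r_def by (rule taylor[OF K n])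
    ultimately show ?thesis using d[OF K n] by (simp add: algebra_simps)
  qed
  have eq: "area K *\<^sub>R (discrete_laplacian \<Omega> \<V> p K - (a K + c K)) = (\<Sum>L\<in>nbs K. wt K L *\<^sub>R (s K L - Q K L))"
    if K: "K \<in> ?I" for K
  proof -
    have "area K *\<^sub>R discrete_laplacian \<Omega> \<V> p K = (\<Sum>L\<in>nbs K. wt K L *\<^sub>R (p L - p K))"
      by (rule laplacian_sum[OF K])
    also have "\<dots> = (\<Sum>L\<in>nbs K. wt K L *\<^sub>R ((?z K L$1 *\<^sub>R g1 K + ?z K L$2 *\<^sub>R g2 K) + (1/2) *\<^sub>R quad_form (a K) (b K) (c K) (?z K L)) + wt K L *\<^sub>R r K L)"
      by (intro sum.cong refl) (simp add: r_def flip: scaleR_add_right)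
    also have "\<dots> = area K *\<^sub>R (a K + c K) - (\<Sum>L\<in>nbs K. wt K L *\<^sub>R B K L) + (\<Sum>L\<in>nbs K. wt K L *\<^sub>R r K L)"
      unfolding sum.distrib quadratic_consistency[OF K] B_def ..
    finally have "area K *\<^sub>R (discrete_laplacian \<Omega> \<V> p K - (a K + c K)) = (\<Sum>L\<in>nbs K. wt K L *\<^sub>R r K L) - (\<Sum>L\<in>nbs K. wt K L *\<^sub>R B K L)"
      by (simp add: scaleR_diff_right)
    also have "\<dots> = (\<Sum>L\<in>nbs K. wt K L *\<^sub>R (s K L - Q K L))"
      unfolding sum_subtractf[symmetric] using K by (intro sum.cong refl) (simp add: s_def \<beta>_def flip: scaleR_diff_right)
    finally show ?thesis .
  qed
  show ?thesis using anti Qb sb eq by blast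
qed

text \<open>By antisymmetry the sum can be written with differences of e. Young's inequality splits
  it into the energy and the sum of \<open>len K L * dst K L\<close>, which is at most four times
  the area of the domain.\<close>

lemma flux_test:
  assumes anti: "\<And>K L. Q K L = - Q L K" and Qb: "\<And>K L. nb K L \<Longrightarrow> norm (Q K L) \<le> 4 * A * dst K L * h"
    and A: "0 \<le> A * h"
  shows "\<bar>\<Sum>(K, L)\<in>pairs. wt K L * (e K \<bullet> (\<i> * Q K L))\<bar> \<le> A * h * (energy e + 4 * measure lebesgue \<Omega>)"
proof -
  let ?S = "\<Sum>(K, L)\<in>pairs. wt K L * (e K \<bullet> (\<i> * Q K L))"
  have "?S = (\<Sum>(K, L)\<in>pairs. wt L K * (e L \<bullet> (\<i> * Q L K)))" by (rule sum_pairs_swap)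
  also have "\<dots> = (\<Sum>(K, L)\<in>pairs. - (wt K L * (e L \<bullet> (\<i> * Q K L))))"
  proof (rule sum.cong[OF refl], clarify)
    fix K L
    show "wt L K * (e L \<bullet> (\<i> * Q L K)) = - (wt K L * (e L \<bullet> (\<i> * Q K L)))"
      unfolding symmetric_data(3)[of L K] anti[of L K] by simp
  qed
  finally have "2 * ?S = (\<Sum>(K, L)\<in>pairs. wt K L * ((e K - e L) \<bullet> (\<i> * Q K L)))"
    by (simp add: sum.distrib[symmetric] case_prod_beta inner_diff_left right_diff_distrib sum_subtractf sum_negf)
  then have "2 * \<bar>?S\<bar> = \<bar>\<Sum>(K, L)\<in>pairs. wt K L * ((e K - e L) \<bullet> (\<i> * Q K L))\<bar>" by linarith
  also have "\<dots> \<le> (\<Sum>(K, L)\<in>pairs. \<bar>wt K L * ((e K - e L) \<bullet> (\<i> * Q K L))\<bar>)"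
    unfolding case_prod_beta by (rule sum_abs)
  also have "\<dots> \<le> (\<Sum>(K, L)\<in>pairs. 2 * (A * h) * (wt K L * (norm (e K - e L))\<^sup>2 + len K L * dst K L))"
  proof (rule sum_mono, clarify)
    fix K L assume "(K, L) \<in> pairs"
    then have n: "nb K L" by (simp add: pairs_iff)
    let ?x = "norm (e K - e L)"
    have "\<bar>wt K L * ((e K - e L) \<bullet> (\<i> * Q K L))\<bar> \<le> wt K L * (?x * norm (Q K L))"
      using Cauchy_Schwarz_ineq2[of "e K - e L" "\<i> * Q K L"] wt_pos[OF n]
      by (simp add: abs_mult norm_mult)
    also have "\<dots> \<le> wt K L * (?x * (4 * A * dst K L * h))"
      using Qb[OF n] wt_pos[OF n] by (intro mult_left_mono) auto
    also have "\<dots> = 2 * (A * h) * (wt K L * (2 * ?x * dst K L))" by (simp add: algebra_simps)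
    also have "\<dots> \<le> 2 * (A * h) * (wt K L * (?x\<^sup>2 + (dst K L)\<^sup>2))"
    proof (intro mult_left_mono)
      show "2 * ?x * dst K L \<le> ?x\<^sup>2 + (dst K L)\<^sup>2"
        using zero_le_power2[of "?x - dst K L"] by (simp add: power2_eq_square algebra_simps)
    qed (use A wt_pos[OF n] in auto)
    also have "wt K L * (?x\<^sup>2 + (dst K L)\<^sup>2) = wt K L * ?x\<^sup>2 + len K L * dst K L"
      unfolding wt_dst[OF n, symmetric] by (simp add: power2_eq_square algebra_simps)
    finally show "\<bar>wt K L * ((e K - e L) \<bullet> (\<i> * Q K L))\<bar> \<le> 2 * (A * h) * (wt K L * ?x\<^sup>2 + len K L * dst K L)" .
  qed
  also have "\<dots> = 2 * (A * h) * (energy e + (\<Sum>(K, L)\<in>pairs. len K L * dst K L))"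
    unfolding case_prod_beta energy_def sum.distrib[symmetric] by (rule sum_distrib_left[symmetric])
  also have "\<dots> \<le> 2 * (A * h) * (energy e + 4 * measure lebesgue \<Omega>)"
    using A sum_len_dst_total by (intro mult_left_mono) auto
  finally show ?thesis by linarith
qed

text \<open>When \<open>p'\<close> is the time derivative of p and w follows the scheme, the sum is
  the time derivative of the squared error. The hypothesis \<open>small\<close> limits the effect of
  \<eta>, amplified by the weights of a cell, to h per unit area.\<close>

lemma error_growth:
  fixes p p' w g1 g2 a b c :: "plane set \<Rightarrow> complex"
  defines "h \<equiv> mesh_size \<V>" and "\<mu> \<equiv> measure lebesgue \<Omega>"
  assumes A: "0 \<le> A" and eta: "0 \<le> \<eta>" and g: "0 \<le> \<gamma>"
    and taylor: "\<And>K L. K \<in> int_cells \<Omega> \<V> \<Longrightarrow> nb K L \<Longrightarrow>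
      norm (p L - p K - ((ctr L - ctr K)$1 *\<^sub>R g1 K + (ctr L - ctr K)$2 *\<^sub>R g2 K)
        - (1/2) *\<^sub>R quad_form (a K) (b K) (c K) (ctr L - ctr K)) \<le> 8 * A * dst K L ^ 3 + 2 * \<eta>"
    and bound: "\<And>K. K \<in> int_cells \<Omega> \<V> \<Longrightarrow> norm (a K) \<le> A \<and> norm (b K) \<le> A \<and> norm (c K) \<le> A"
    and lip: "\<And>K L. K \<in> int_cells \<Omega> \<V> \<Longrightarrow> L \<in> int_cells \<Omega> \<V> \<Longrightarrow>
      norm (a K - a L) \<le> 2 * A * dst K L \<and> norm (b K - b L) \<le> 2 * A * dst K L \<and> norm (c K - c L) \<le> 2 * A * dst K L"
    and pA: "\<And>K. K \<in> int_cells \<Omega> \<V> \<Longrightarrow> norm (p K) \<le> A"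
    and pde: "\<And>K. K \<in> int_cells \<Omega> \<V> \<Longrightarrow>
      norm (\<i> * p' K + (a K + c K) - of_real (\<gamma> * (norm (p K))\<^sup>2 + W (ctr K)) * p K) \<le> h"
    and ext: "\<And>K. K \<in> ext_cells \<Omega> \<V> \<Longrightarrow> p K = 0 \<and> w K = 0 \<and> p' K = 0"
    and small: "\<And>K. K \<in> cells \<V> \<Longrightarrow> 2 * \<eta> * (\<Sum>L\<in>nbs K. wt K L) \<le> h * area K"
    and E: "energy (\<lambda>K. p K - w K) \<le> E"
  shows "(\<Sum>K\<in>cells \<V>. area K * (2 * ((p K - w K) \<bullet> (p' K - flow \<gamma> W w K))))
    \<le> (4 * \<gamma> * A\<^sup>2 + 8 * \<gamma> * A * sqrt E + (80 * A + 2) * h) * mass (\<lambda>K. p K - w K)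
      + (2 * A * (E + 4 * \<mu>) + (80 * A + 2) * \<mu>) * h"
proof -
  let ?I = "int_cells \<Omega> \<V>"
  define e where "e K = p K - w K" for K
  have h0: "0 < h" unfolding h_def by (rule mesh_size_pos)
  obtain Q s where anti: "\<And>K L. Q K L = - Q L K"
    and Qb: "\<And>K L. nb K L \<Longrightarrow> norm (Q K L) \<le> 4 * A * dst K L * h"
    and sb: "\<And>K L. K \<in> ?I \<Longrightarrow> nb K L \<Longrightarrow> norm (s K L) \<le> 20 * A * h * (dst K L)\<^sup>2 + 2 * \<eta>"
    and cons: "\<And>K. K \<in> ?I \<Longrightarrow> area K *\<^sub>R (discrete_laplacian \<Omega> \<V> p K - (a K + c K)) = (\<Sum>L\<in>nbs K. wt K L *\<^sub>R (s K L - Q K L))"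
    using consistency[OF A eta taylor bound lip] unfolding h_def by blast
  have e0: "e K = 0" if "K \<in> ext_cells \<Omega> \<V>" for K using ext[OF that] by (simp add: e_def)
  define N where "N v K = of_real (\<gamma> * (norm (v K))\<^sup>2 + W (ctr K)) * v K" for v :: "plane set \<Rightarrow> complex" and K
  define \<tau> where "\<tau> K = \<i> * p' K + (a K + c K) - N p K" for K
  have lap_e: "discrete_laplacian \<Omega> \<V> e K = discrete_laplacian \<Omega> \<V> p K - discrete_laplacian \<Omega> \<V> w K" if "K \<in> ?I" for K
  proof -
    have "area K *\<^sub>R discrete_laplacian \<Omega> \<V> e K = area K *\<^sub>R (discrete_laplacian \<Omega> \<V> p K - discrete_laplacian \<Omega> \<V> w K)"
      unfolding scaleR_diff_right laplacian_sum[OF that] sum_subtractf[symmetric]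
      by (intro sum.cong refl) (simp add: e_def algebra_simps)
    then show ?thesis using area_pos[OF int_cellD(1)[OF that]] by simp
  qed
  let ?T1 = "\<lambda>K. area K * (e K \<bullet> (\<i> * discrete_laplacian \<Omega> \<V> e K))"
  let ?T2 = "\<lambda>K. area K * (\<gamma> * (2 * A\<^sup>2 * (norm (e K))\<^sup>2 + A * norm (e K) ^ 3))"
  let ?T3 = "\<lambda>K. \<Sum>L\<in>nbs K. wt K L * (e K \<bullet> (\<i> * Q K L))"
  \<comment> \<open>Here 80 A is 4 times 20 A, the Taylor part of s summed over the edges, and the 2
    counts the contribution of \<eta> and the residual of the equation.\<close>
  let ?T4 = "\<lambda>K. h * (80 * A + 2) * (area K * norm (e K))"
  have per_cell: "area K * (e K \<bullet> (p' K - flow \<gamma> W w K)) \<le> ?T1 K + ?T2 K + ?T3 K + ?T4 K" if K: "K \<in> cells \<V>" for K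
  proof (cases "K \<in> ?I")
    case True
    let ?\<Delta> = "discrete_laplacian \<Omega> \<V>"
    have "p' K = - \<i> * (\<tau> K - (a K + c K) + N p K)" by (simp add: \<tau>_def algebra_simps)
    moreover have "flow \<gamma> W w K = \<i> * (?\<Delta> w K - N w K)" by (simp add: flow_def N_def)
    ultimately have "p' K - flow \<gamma> W w K = \<i> * (?\<Delta> e K - (?\<Delta> p K - (a K + c K)) - (N p K - N w K) - \<tau> K)"
      unfolding lap_e[OF True] by (simp add: algebra_simps)
    then have "area K * (e K \<bullet> (p' K - flow \<gamma> W w K))
      = ?T1 K - e K \<bullet> (\<i> * (area K *\<^sub>R (?\<Delta> p K - (a K + c K)))) - area K * (e K \<bullet> (\<i> * (N p K - N w K))) - area K * (e K \<bullet> (\<i> * \<tau> K))"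
      by (simp add: right_diff_distrib inner_diff_right)
    also have "e K \<bullet> (\<i> * (area K *\<^sub>R (?\<Delta> p K - (a K + c K)))) = (\<Sum>L\<in>nbs K. wt K L * (e K \<bullet> (\<i> * s K L))) - ?T3 K"
      unfolding cons[OF True] sum_distrib_left inner_sum_right sum_subtractf[symmetric]
      by (intro sum.cong refl) (simp add: right_diff_distrib inner_diff_right)
    finally have 1: "area K * (e K \<bullet> (p' K - flow \<gamma> W w K))
      = ?T1 K + ?T3 K - (\<Sum>L\<in>nbs K. wt K L * (e K \<bullet> (\<i> * s K L))) - area K * (e K \<bullet> (\<i> * (N p K - N w K))) - area K * (e K \<bullet> (\<i> * \<tau> K))"
      by simp
    have "\<bar>area K * (e K \<bullet> (\<i> * (N p K - N w K)))\<bar> \<le> ?T2 K"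
      unfolding abs_mult using cubic_difference_bound[OF g pA[OF True], of "w K" "W (ctr K)"] area_nonneg[of K]
      by (simp add: N_def e_def mult_left_mono)
    moreover have "\<bar>area K * (e K \<bullet> (\<i> * \<tau> K))\<bar> \<le> h * (area K * norm (e K))"
    proof -
      have "\<bar>e K \<bullet> (\<i> * \<tau> K)\<bar> \<le> norm (e K) * norm (\<tau> K)" using Cauchy_Schwarz_ineq2[of "e K" "\<i> * \<tau> K"] by (simp add: norm_mult)
      also have "\<dots> \<le> norm (e K) * h" unfolding \<tau>_def N_def by (intro mult_left_mono pde[OF True]) auto
      finally have "area K * \<bar>e K \<bullet> (\<i> * \<tau> K)\<bar> \<le> area K * (norm (e K) * h)" by (intro mult_left_mono area_nonneg)
      then show ?thesis using area_nonneg[of K] by (simp add: abs_mult mult_ac)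
    qed
    moreover have "\<bar>\<Sum>L\<in>nbs K. wt K L * (e K \<bullet> (\<i> * s K L))\<bar> \<le> h * (80 * A + 1) * (area K * norm (e K))"
    proof -
      have "\<bar>\<Sum>L\<in>nbs K. wt K L * (e K \<bullet> (\<i> * s K L))\<bar> \<le> (\<Sum>L\<in>nbs K. \<bar>wt K L * (e K \<bullet> (\<i> * s K L))\<bar>)" by (rule sum_abs)
      also have "\<dots> \<le> (\<Sum>L\<in>nbs K. norm (e K) * (20 * A * h * (len K L * dst K L) + 2 * \<eta> * wt K L))"
      proof (rule sum_mono)
        fix L assume "L \<in> nbs K"
        then have n: "nb K L" by (simp add: nbs_def)
        have "\<bar>wt K L * (e K \<bullet> (\<i> * s K L))\<bar> \<le> wt K L * (norm (e K) * norm (s K L))"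
          using Cauchy_Schwarz_ineq2[of "e K" "\<i> * s K L"] wt_pos[OF n] by (simp add: abs_mult norm_mult)
        also have "\<dots> \<le> wt K L * (norm (e K) * (20 * A * h * (dst K L)\<^sup>2 + 2 * \<eta>))"
          using sb[OF True n] wt_pos[OF n] by (intro mult_left_mono) auto
        also have "\<dots> = norm (e K) * (20 * A * h * (len K L * dst K L) + 2 * \<eta> * wt K L)"
          unfolding wt_dst[OF n, symmetric] by (simp add: power2_eq_square algebra_simps)
        finally show "\<bar>wt K L * (e K \<bullet> (\<i> * s K L))\<bar> \<le> norm (e K) * (20 * A * h * (len K L * dst K L) + 2 * \<eta> * wt K L)" .
      qed
      also have "\<dots> = norm (e K) * (20 * A * h * (\<Sum>L\<in>nbs K. len K L * dst K L) + 2 * \<eta> * (\<Sum>L\<in>nbs K. wt K L))"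
        by (simp add: sum_distrib_left sum.distrib distrib_left)
      also have "\<dots> \<le> norm (e K) * (20 * A * h * (4 * area K) + h * area K)"
        using A h0 by (intro mult_left_mono add_mono small[OF K] sum_len_dst_le[OF K]) auto
      also have "\<dots> = h * (80 * A + 1) * (area K * norm (e K))" by (simp add: algebra_simps)
      finally show ?thesis .
    qed
    moreover have "?T4 K = h * (area K * norm (e K)) + h * (80 * A + 1) * (area K * norm (e K))" by (simp add: algebra_simps)
    ultimately show ?thesis using 1 by linarith
  next
    case False
    then have "K \<in> ext_cells \<Omega> \<V>" using K by (simp add: ext_cells_def)
    then show ?thesis using e0[of K] by simp
  qed
  have m: "mass (\<lambda>K. p K - w K) = mass e" "energy (\<lambda>K. p K - w K) = energy e" by (simp_all add: e_def mass_def energy_def)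
  have "(\<Sum>K\<in>cells \<V>. area K * (e K \<bullet> (p' K - flow \<gamma> W w K))) \<le> (\<Sum>K\<in>cells \<V>. ?T1 K + ?T2 K + ?T3 K + ?T4 K)"
    by (rule sum_mono[OF per_cell])
  also have "\<dots> = (\<Sum>K\<in>cells \<V>. ?T1 K) + (\<Sum>K\<in>cells \<V>. ?T2 K) + (\<Sum>K\<in>cells \<V>. ?T3 K) + (\<Sum>K\<in>cells \<V>. ?T4 K)"
    by (simp only: sum.distrib)
  also have "(\<Sum>K\<in>cells \<V>. ?T1 K) = 0" using weighted_laplacian_flux[of e "\<lambda>_. 1"] e0 by simp
  also have "(\<Sum>K\<in>cells \<V>. ?T2 K) \<le> (2 * \<gamma> * A\<^sup>2 + 4 * \<gamma> * A * sqrt E) * mass e"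
  proof -
    have "(\<Sum>K\<in>cells \<V>. ?T2 K) = 2 * \<gamma> * A\<^sup>2 * mass e + \<gamma> * A * (\<Sum>K\<in>cells \<V>. area K * norm (e K) ^ 3)"
      unfolding mass_def sum_distrib_left sum.distrib[symmetric] by (intro sum.cong refl) (simp add: algebra_simps)
    also have "\<dots> \<le> 2 * \<gamma> * A\<^sup>2 * mass e + \<gamma> * A * (4 * sqrt E * mass e)"
    proof (intro add_left_mono mult_left_mono)
      have "(\<Sum>K\<in>cells \<V>. area K * norm (e K) ^ 3) \<le> 4 * sqrt (energy e) * mass e" by (rule discrete_cubic_bound[OF e0])
      also have "\<dots> \<le> 4 * sqrt E * mass e" using E m by (intro mult_right_mono mult_left_mono) (auto simp: mass_nonneg)
      finally show "(\<Sum>K\<in>cells \<V>. area K * norm (e K) ^ 3) \<le> 4 * sqrt E * mass e" .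
    qed (use g A in auto)
    finally show ?thesis by (simp add: algebra_simps)
  qed
  also have "(\<Sum>K\<in>cells \<V>. ?T3 K) \<le> A * h * (E + 4 * \<mu>)"
  proof -
    have "(\<Sum>K\<in>cells \<V>. ?T3 K) \<le> A * h * (energy e + 4 * \<mu>)"
      using flux_test[OF anti Qb, of e] A h0 unfolding sum_pairs \<mu>_def by (auto simp: abs_le_iff)
    also have "\<dots> \<le> A * h * (E + 4 * \<mu>)" using E m A h0 by (intro mult_left_mono) auto
    finally show ?thesis .
  qed
  also have "(\<Sum>K\<in>cells \<V>. ?T4 K) \<le> h * (80 * A + 2) * ((\<mu> + mass e) / 2)"
  proof -
    have "(\<Sum>K\<in>cells \<V>. area K * norm (e K)) \<le> (\<Sum>K\<in>cells \<V>. area K * ((1 + (norm (e K))\<^sup>2) / 2))"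
    proof (intro sum_mono mult_left_mono area_nonneg)
      fix K show "norm (e K) \<le> (1 + (norm (e K))\<^sup>2) / 2"
        using zero_le_power2[of "norm (e K) - 1"] by (simp add: power2_eq_square algebra_simps)
    qed
    also have "\<dots> = ((\<Sum>K\<in>cells \<V>. area K) + mass e) / 2"
      unfolding mass_def sum.distrib[symmetric] sum_divide_distrib by (intro sum.cong refl) (simp add: algebra_simps)
    also have "\<dots> \<le> (\<mu> + mass e) / 2" using sum_area by (simp add: \<mu>_def)
    finally have "(\<Sum>K\<in>cells \<V>. area K * norm (e K)) \<le> (\<mu> + mass e) / 2" .
    then show ?thesis unfolding sum_distrib_left[symmetric] using A h0 by (intro mult_left_mono) auto
  qed
  finally have le: "(\<Sum>K\<in>cells \<V>. area K * (e K \<bullet> (p' K - flow \<gamma> W w K)))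
    \<le> (2 * \<gamma> * A\<^sup>2 + 4 * \<gamma> * A * sqrt E) * mass e + A * h * (E + 4 * \<mu>) + h * (80 * A + 2) * ((\<mu> + mass e) / 2)"
    by simp
  have "(\<Sum>K\<in>cells \<V>. area K * (2 * ((p K - w K) \<bullet> (p' K - flow \<gamma> W w K)))) = 2 * (\<Sum>K\<in>cells \<V>. area K * (e K \<bullet> (p' K - flow \<gamma> W w K)))"
    by (simp add: sum_distrib_left e_def mult.left_commute)
  also have "\<dots> \<le> 2 * ((2 * \<gamma> * A\<^sup>2 + 4 * \<gamma> * A * sqrt E) * mass e + A * h * (E + 4 * \<mu>) + h * (80 * A + 2) * ((\<mu> + mass e) / 2))"
    by (rule mult_left_mono[OF le]) simp
  also have "\<dots> = (4 * \<gamma> * A\<^sup>2 + 8 * \<gamma> * A * sqrt E + (80 * A + 2) * h) * mass e + (2 * A * (E + 4 * \<mu>) + (80 * A + 2) * \<mu>) * h"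
    by (simp add: field_simps)
  finally show ?thesis unfolding m .
qed

end

text \<open>The summands bound the energies of the mollified solution and of the scheme. The
  approximation error raises the Lipschitz constant 2 A to 2 A + 2, and 2 B + 1 instead of 2 B keeps
  the rate for the potential positive.\<close>

definition energy_const :: "real \<Rightarrow> real \<Rightarrow> real \<Rightarrow> real \<Rightarrow> real \<Rightarrow> real" where
  "energy_const \<gamma> T \<mu> A B =
     2 * (4 * (2 * A + 2)\<^sup>2 * \<mu>) + 2 * (\<mu> * (5 * (2 * A)\<^sup>2 + \<gamma> * (2 * A) ^ 4) * exp (2 * (2 * B + 1) * T))"

definition growth_const :: "real \<Rightarrow> real \<Rightarrow> real \<Rightarrow> real \<Rightarrow> real" where
  "growth_const \<gamma> D A E = 4 * \<gamma> * A\<^sup>2 + 8 * \<gamma> * A * sqrt E + (80 * A + 2) * D"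

definition source_const :: "real \<Rightarrow> real \<Rightarrow> real \<Rightarrow> real" where
  "source_const \<mu> A E = 2 * A * (E + 4 * \<mu>) + (80 * A + 2) * \<mu>"

text \<open>Gronwall's bound at time T for an initial mass of at most \<mu> h, divided by h. The
  factor 2 and the summand 2 \<mu> pay for returning from the mollified solution to u.\<close>

definition error_const :: "real \<Rightarrow> real \<Rightarrow> real \<Rightarrow> real \<Rightarrow> real \<Rightarrow> real \<Rightarrow> real" where
  "error_const \<gamma> T D \<mu> A B =
     (let E = energy_const \<gamma> T \<mu> A B; a = growth_const \<gamma> D A E; b = source_const \<mu> A E
      in 2 * \<mu> + 2 * ((\<mu> + b / a) * exp (a * T)))"

lemma finite_positive_lower_bound:
  fixes R :: "real set"
  assumes "finite R" "\<And>r. r \<in> R \<Longrightarrow> 0 < r"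
  shows "\<exists>\<eta>>0. \<forall>r\<in>R. \<eta> \<le> r"
proof (intro exI[of _ "Min (insert 1 R)"] conjI ballI)
  show "0 < Min (insert 1 R)" using assms by (subst Min_gr_iff) auto
  show "Min (insert 1 R) \<le> r" if "r \<in> R" for r using assms that by (intro Min_le) auto
qed

lemma norm_add_sq_le: "(norm (x + y))\<^sup>2 \<le> 2 * (norm x)\<^sup>2 + 2 * (norm (y::'a::real_normed_vector))\<^sup>2"
proof -
  have "(norm (x + y))\<^sup>2 \<le> (norm x + norm y)\<^sup>2" by (intro power_mono norm_triangle_ineq) simp
  also have "\<dots> \<le> 2 * (norm x)\<^sup>2 + 2 * (norm y)\<^sup>2"
    using zero_le_power2[of "norm x - norm y"] by (simp add: power2_eq_square algebra_simps)
  finally show ?thesis .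
qed

section \<open>The error estimate\<close>

context voronoi_mesh
begin

lemma mesh_size_le_diameter: "mesh_size \<V> \<le> diameter \<Omega>"
proof -
  have "cells \<V> \<noteq> {}" using closure_domain domain(4) by auto
  then show ?thesis unfolding mesh_size_def
    by (rule cSUP_least) (intro diameter_subset cellD(4) domain(2))
qed

lemma energy_diff: "energy (\<lambda>K. p K - w K) \<le> 2 * energy p + 2 * energy w"
proof -
  have "energy (\<lambda>K. p K - w K) \<le> (\<Sum>(K, L)\<in>pairs. 2 * (wt K L * (norm (p K - p L))\<^sup>2) + 2 * (wt K L * (norm (w K - w L))\<^sup>2))"
    unfolding energy_def
  proof (rule sum_mono, clarify)
    fix K L assume "(K, L) \<in> pairs"
    then have n: "nb K L" by (simp add: pairs_iff)
    have "(norm ((p K - w K) - (p L - w L)))\<^sup>2 \<le> 2 * (norm (p K - p L))\<^sup>2 + 2 * (norm (w K - w L))\<^sup>2"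
      using norm_add_sq_le[of "p K - p L" "w L - w K"] by (simp add: norm_minus_commute algebra_simps)
    then have "wt K L * (norm ((p K - w K) - (p L - w L)))\<^sup>2 \<le> wt K L * (2 * (norm (p K - p L))\<^sup>2 + 2 * (norm (w K - w L))\<^sup>2)"
      using wt_pos[OF n] by (intro mult_left_mono) auto
    then show "wt K L * (norm ((p K - w K) - (p L - w L)))\<^sup>2 \<le> 2 * (wt K L * (norm (p K - p L))\<^sup>2) + 2 * (wt K L * (norm (w K - w L))\<^sup>2)"
      by (simp add: algebra_simps)
  qed
  also have "\<dots> = 2 * energy p + 2 * energy w"
    by (simp add: energy_def case_prod_beta sum.distrib sum_distrib_left)
  finally show ?thesis .
qed

text \<open>Gronwall is applied to p - w, with p the mollified solution, which is differentiable in
  time at every center. For the given mesh \<eta> is so small that all approximation errors are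
  swallowed by h.\<close>

lemma error_estimate:
  fixes w :: "real \<Rightarrow> plane set \<Rightarrow> complex"
  assumes pc: "parallelogram_condition \<Omega> d \<delta>" and g: "0 \<le> \<gamma>" and T: "0 < T"
    and V: "admissible_potential \<Omega> T V" and u: "gp_solution \<Omega> T \<gamma> V u0 u"
    and w: "semidiscrete_solution \<Omega> \<V> T \<gamma> V u0 w" and t: "t \<in> {0..T}"
  shows "mass (\<lambda>K. u t (ctr K) - w t K) \<le>
    error_const \<gamma> T (diameter \<Omega>) (measure lebesgue \<Omega>) (sobolev_const \<Omega> d \<delta> * sobolev_sup_norm 5 \<Omega> T u)
      (sobolev_const \<Omega> d \<delta> * sobolev_sup_norm 3 \<Omega> T V) * mesh_size \<V>"
proof -
  define A where "A = sobolev_const \<Omega> d \<delta> * sobolev_sup_norm 5 \<Omega> T u"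
  define B where "B = sobolev_const \<Omega> d \<delta> * sobolev_sup_norm 3 \<Omega> T V"
  define h \<mu> D where "h = mesh_size \<V>" and "\<mu> = measure lebesgue \<Omega>" and "D = diameter \<Omega>"
  define E where "E = energy_const \<gamma> T \<mu> A B"
  define a where "a = growth_const \<gamma> D A E"
  define b where "b = source_const \<mu> A E"
  let ?I = "int_cells \<Omega> \<V>" and ?X = "ext_cells \<Omega> \<V>"
  note O = domain(1-3)
  have h0: "0 < h" and hD: "h \<le> D" using mesh_size_pos mesh_size_le_diameter by (simp_all add: h_def D_def)
  have \<mu>0: "0 \<le> \<mu>" by (simp add: \<mu>_def)
  have cO: "ctr K \<in> closure \<Omega>" if "K \<in> cells \<V>" for K using cellD(5)[OF that] closed_cell_subset[OF that] by blast
  have iO: "ctr K \<in> \<Omega>" if "K \<in> ?I" for K using int_cell_ctr[OF that] cellD(4)[OF int_cellD(1)[OF that]] by blast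
  have uc: "sobolev_continuous 5 \<Omega> T u" "\<And>t. t \<in> {0..T} \<Longrightarrow> continuous_on (closure \<Omega>) (u t)"
    and u_bd: "\<And>t x. t \<in> {0..T} \<Longrightarrow> x \<in> frontier \<Omega> \<Longrightarrow> u t x = 0"
    and u_init: "\<And>x. x \<in> closure \<Omega> \<Longrightarrow> u 0 x = u0 x"
    using u by (auto simp: gp_solution_def)
  have Vc: "sobolev_continuous 3 \<Omega> T V" "\<And>t. t \<in> {0..T} \<Longrightarrow> continuous_on (closure \<Omega>) (V t)"
    using V by (auto simp: admissible_potential_def)
  have ub: "norm (u t x) \<le> A" "norm (u t x - u t y) \<le> 2 * A * norm (x - y)"
    if "t \<in> {0..T}" "x \<in> closure \<Omega>" "y \<in> closure \<Omega>" for t x y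
    unfolding A_def using sobolev_sup_bounds[OF O pc uc(1) _ uc(2)[OF that(1)] that] by auto
  have Vb: "norm (V t x) \<le> B" "norm (V t x - V t y) \<le> 2 * B * norm (x - y)"
    if "t \<in> {0..T}" "x \<in> closure \<Omega>" "y \<in> closure \<Omega>" for t x y
    unfolding B_def using sobolev_sup_bounds[OF O pc Vc(1) _ Vc(2)[OF that(1)] that] by auto
  have T0: "0 \<in> {0..T}" using T by simp
  obtain x0 where x0: "x0 \<in> closure \<Omega>" using domain(4) closure_subset by blast
  have A0: "0 \<le> A" by (rule order_trans[OF norm_ge_zero ub(1)[OF T0 x0 x0]])
  have B0: "0 \<le> B" by (rule order_trans[OF norm_ge_zero Vb(1)[OF T0 x0 x0]])
  have E0: "0 \<le> E" unfolding E_def energy_const_def using \<mu>0 g by simp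
  have a0: "0 < a" unfolding a_def growth_const_def using A0 g E0 h0 hD by (intro add_nonneg_pos add_nonneg_nonneg mult_nonneg_nonneg mult_pos_pos) auto
  have b0: "0 \<le> b" unfolding b_def source_const_def using A0 E0 \<mu>0 by simp
  \<comment> \<open>The thresholds for \<eta>: the comparison of p with u, the residual of the
    equation, the sum of the weights of each cell, and the distances between centers.\<close>
  define R where "R = {1, h, h / (1 + 3 * \<gamma> * A\<^sup>2 + B)} \<union> (\<lambda>K. h * area K / (2 * (\<Sum>L\<in>nbs K. wt K L) + 1)) ` cells \<V> \<union> (\<lambda>q. dst (fst q) (snd q)) ` pairs"
  have wt0: "0 \<le> (\<Sum>L\<in>nbs K. wt K L)" for K by (intro sum_nonneg) (auto simp: nbs_def wt_pos less_imp_le)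
  have c1: "0 < 1 + 3 * \<gamma> * A\<^sup>2 + B" using g B0 by (intro add_pos_nonneg) auto
  have "\<exists>\<eta>>0. \<forall>r\<in>R. \<eta> \<le> r"
  proof (rule finite_positive_lower_bound)
    show "finite R" by (simp add: R_def finite_cells finite_pairs)
    fix r assume "r \<in> R"
    then show "0 < r" unfolding R_def
      using h0 c1 wt0 by (auto simp: pairs_iff dst_pos area_pos intro!: divide_pos_pos mult_pos_pos add_nonneg_pos)
  qed
  then obtain \<eta> where eta: "\<eta> > 0" and etaR: "\<And>r. r \<in> R \<Longrightarrow> \<eta> \<le> r" by blast
  have eta1: "\<eta> \<le> 1" "\<eta> \<le> h" by (rule etaR; simp add: R_def)+
  have eta2: "(1 + 3 * \<gamma> * A\<^sup>2 + B) * \<eta> \<le> h"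
  proof -
    have "\<eta> \<le> h / (1 + 3 * \<gamma> * A\<^sup>2 + B)" by (rule etaR) (simp add: R_def)
    then show ?thesis using c1 by (simp add: le_divide_eq mult.commute)
  qed
  have eta3: "2 * \<eta> * (\<Sum>L\<in>nbs K. wt K L) \<le> h * area K" if "K \<in> cells \<V>" for K
  proof -
    have "\<eta> \<le> h * area K / (2 * (\<Sum>L\<in>nbs K. wt K L) + 1)" by (rule etaR) (use that in \<open>simp add: R_def\<close>)
    then have "\<eta> * (2 * (\<Sum>L\<in>nbs K. wt K L) + 1) \<le> h * area K" using wt0[of K] by (simp add: le_divide_eq)
    then show ?thesis using eta by (simp add: algebra_simps)
  qed
  have eta4: "\<eta> \<le> dst K L" if "nb K L" for K L
    by (rule etaR) (use that pairs_iff[of K L] in \<open>force simp: R_def\<close>)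
  have eta5: "\<eta>\<^sup>2 \<le> h"
  proof -
    have "\<eta>\<^sup>2 \<le> \<eta> * 1" unfolding power2_eq_square using eta eta1 by (intro mult_left_mono) auto
    then show ?thesis using eta1 by simp
  qed
  have fin: "finite (ctr ` ?I)" "ctr ` ?I \<subseteq> \<Omega>" "finite (ctr ` cells \<V>)" "ctr ` cells \<V> \<subseteq> closure \<Omega>"
    using finite_subset[OF _ finite_cells, of ?I] int_cellD(1) finite_cells iO cO by auto
  obtain F :: "nat \<Rightarrow> nat \<Rightarrow> real \<Rightarrow> plane \<Rightarrow> complex" where
    Fc: "\<forall>x\<in>ctr ` ?I. continuous_on {0..T} (\<lambda>t. F 0 0 t x)"
    and Fb: "\<forall>t\<in>{0..T}. \<forall>x\<in>ctr ` ?I. norm (F 0 0 t x - u t x) \<le> \<eta> \<and> (\<forall>k l. k + l \<le> 3 \<longrightarrow> norm (F k l t x) \<le> A)"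
    and Ft: "\<forall>t\<in>{0..T}. \<forall>x\<in>ctr ` ?I. \<forall>z\<in>ctr ` cells \<V>. norm (u t z - F 0 0 t x
        - ((z - x)$1 *\<^sub>R F 1 0 t x + (z - x)$2 *\<^sub>R F 0 1 t x)
        - (1/2) *\<^sub>R quad_form (F 2 0 t x) (F 1 1 t x) (F 0 2 t x) (z - x)) \<le> 8 * A * norm (z - x) ^ 3 + \<eta>"
    and Fl: "\<forall>t\<in>{0..T}. \<forall>x\<in>ctr ` ?I. \<forall>y\<in>ctr ` ?I. \<forall>k l. k + l = 2 \<longrightarrow> norm (F k l t x - F k l t y) \<le> 2 * A * norm (x - y)"
    and Fp: "\<forall>t\<in>{0<..<T}. \<forall>x\<in>ctr ` ?I. \<exists>F'. ((\<lambda>s. F 0 0 s x) has_vector_derivative F') (at t) \<and>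
        norm (\<i> * F' + (F 2 0 t x + F 0 2 t x) - gp_rhs \<gamma> (V t) (u t) x) \<le> \<eta>"
    using gp_approximation[OF O pc g V u fin eta, folded A_def] by (elim exE conjE) (rule that, assumption+)
  \<comment> \<open>The center of an exterior cell lies on the boundary, where u is 0.\<close>
  define p where "p t K = (if K \<in> ?I then F 0 0 t (ctr K) else 0)" for t K
  have pu: "norm (p s K - u s (ctr K)) \<le> \<eta>" if "s \<in> {0..T}" "K \<in> cells \<V>" for s K
  proof (cases "K \<in> ?I")
    case True
    then show ?thesis using Fb that by (simp add: p_def)
  next
    case False
    then have "K \<in> ?X" using that(2) by (simp add: ext_cells_def)
    then show ?thesis using False u_bd[OF that(1) ext_cell_ctr(2)] eta by (simp add: p_def)
  qed
  have w0: "w 0 K = u 0 (ctr K)" if "K \<in> cells \<V>" for K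
    using semidiscreteD(3)[OF w T0 that] u_init[OF cO[OF that]] by simp
  have nd: "norm (ctr K - ctr L) = dst K L" for K L by (simp add: dst_def dist_norm)
  \<comment> \<open>No smallness is claimed: the energies of p and w are bounded separately, the
    latter through the energy estimate for the scheme.\<close>
  have E_bound: "energy (\<lambda>K. p s K - w s K) \<le> E" if s: "s \<in> {0..T}" for s
  proof -
    have "energy (p s) \<le> 4 * (2 * A + 2)\<^sup>2 * \<mu>"
      unfolding \<mu>_def
    proof (rule energy_le)
      fix K L assume n: "nb K L"
      have "norm (p s K - p s L) \<le> norm (p s K - u s (ctr K)) + norm (u s (ctr K) - u s (ctr L)) + norm (p s L - u s (ctr L))"
        by norm
      also have "\<dots> \<le> \<eta> + 2 * A * dst K L + \<eta>"
        using ub(2)[OF s cO[OF nbD(1)[OF n]] cO[OF nbD(2)[OF n]]] unfolding nd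
        by (intro add_mono pu s nbD(1)[OF n] nbD(2)[OF n])
      also have "\<dots> \<le> (2 * A + 2) * dst K L" using eta4[OF n] by (simp add: algebra_simps)
      finally show "norm (p s K - p s L) \<le> (2 * A + 2) * dst K L" .
    qed (use A0 in simp)
    moreover have "energy (w s) \<le> \<mu> * (5 * (2 * A)\<^sup>2 + \<gamma> * (2 * A) ^ 4) * exp (2 * (2 * B + 1) * T)"
      unfolding \<mu>_def
    proof (rule energy_bound[OF w s g])
      show "0 < 2 * B + 1" using B0 by simp
      show "\<bar>V r (ctr K) - V r (ctr L)\<bar> \<le> (2 * B + 1) * dst K L" if "r \<in> {0..T}" and n: "nb K L" for r K L
        using Vb(2)[OF that(1) cO[OF nbD(1)[OF n]] cO[OF nbD(2)[OF n]]] dst_pos[OF n] unfolding nd by (simp add: algebra_simps)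
      show "norm (w 0 K - w 0 L) \<le> 2 * A * dst K L" if n: "nb K L" for K L
        using ub(2)[OF T0 cO[OF nbD(1)[OF n]] cO[OF nbD(2)[OF n]]] unfolding nd w0[OF nbD(1)[OF n]] w0[OF nbD(2)[OF n]] .
      show "norm (w 0 K) \<le> 2 * A" if "K \<in> cells \<V>" for K
        using ub(1)[OF T0 cO[OF that] cO[OF that]] A0 unfolding w0[OF that] by simp
    qed (use A0 in simp)
    ultimately show ?thesis using energy_diff[of "p s" "w s"] unfolding E_def energy_const_def by linarith
  qed
  define y where "y s = mass (\<lambda>K. p s K - w s K)" for s
  have "y t + b * h / a \<le> (y 0 + b * h / a) * exp (a * t)"
  proof (rule Gronwall[OF a0 _ _ t])
    have "continuous_on {0..T} (\<lambda>s. p s K)" if "K \<in> cells \<V>" for K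
      using Fc by (cases "K \<in> ?I") (auto simp: p_def)
    then show "continuous_on {0..T} y" unfolding y_def mass_def
      by (intro continuous_intros semidiscrete_continuous[OF w])
    fix s assume s: "s \<in> {0<..<T}"
    then have s': "s \<in> {0..T}" by simp
    have "\<exists>F'. ((\<lambda>s. F 0 0 s (ctr K)) has_vector_derivative F') (at s) \<and>
        norm (\<i> * F' + (F 2 0 s (ctr K) + F 0 2 s (ctr K)) - gp_rhs \<gamma> (V s) (u s) (ctr K)) \<le> \<eta>" if "K \<in> ?I" for K
      using Fp s that by blast
    then obtain f' where f': "\<And>K. K \<in> ?I \<Longrightarrow> ((\<lambda>s. F 0 0 s (ctr K)) has_vector_derivative f' K) (at s)"
        "\<And>K. K \<in> ?I \<Longrightarrow> norm (\<i> * f' K + (F 2 0 s (ctr K) + F 0 2 s (ctr K)) - gp_rhs \<gamma> (V s) (u s) (ctr K)) \<le> \<eta>"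
      by metis
    define p' where "p' K = (if K \<in> ?I then f' K else 0)" for K
    have dp: "((\<lambda>s. p s K) has_vector_derivative p' K) (at s)" for K
      using f'(1)[of K] by (cases "K \<in> ?I") (simp_all add: p_def p'_def)
    have dy: "(y has_real_derivative (\<Sum>K\<in>cells \<V>. area K * (2 * ((p s K - w s K) \<bullet> (p' K - flow \<gamma> (V s) (w s) K))))) (at s)"
      unfolding y_def mass_def
      by (intro DERIV_sum DERIV_cmult has_derivative_norm_sq has_vector_derivative_diff dp semidiscrete_at[OF w s])
    have "(\<Sum>K\<in>cells \<V>. area K * (2 * ((p s K - w s K) \<bullet> (p' K - flow \<gamma> (V s) (w s) K))))
      \<le> (4 * \<gamma> * A\<^sup>2 + 8 * \<gamma> * A * sqrt E + (80 * A + 2) * mesh_size \<V>) * mass (\<lambda>K. p s K - w s K)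
      + (2 * A * (E + 4 * measure lebesgue \<Omega>) + (80 * A + 2) * measure lebesgue \<Omega>) * mesh_size \<V>"
    proof (rule error_growth[where \<eta> = \<eta> and ?g1.0 = "\<lambda>K. F 1 0 s (ctr K)" and ?g2.0 = "\<lambda>K. F 0 1 s (ctr K)"
          and a = "\<lambda>K. F 2 0 s (ctr K)" and b = "\<lambda>K. F 1 1 s (ctr K)" and c = "\<lambda>K. F 0 2 s (ctr K)"])
      fix K L assume K: "K \<in> ?I" and n: "nb K L"
      let ?r = "\<lambda>v. v - p s K - ((ctr L - ctr K)$1 *\<^sub>R F 1 0 s (ctr K) + (ctr L - ctr K)$2 *\<^sub>R F 0 1 s (ctr K))
        - (1/2) *\<^sub>R quad_form (F 2 0 s (ctr K)) (F 1 1 s (ctr K)) (F 0 2 s (ctr K)) (ctr L - ctr K)"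
      have "norm (?r (u s (ctr L))) \<le> 8 * A * dst K L ^ 3 + \<eta>"
        using bspec[OF bspec[OF bspec[OF Ft s'] imageI[OF K]] imageI[OF nbD(2)[OF n]]]
        by (simp only: p_def K if_True nd symmetric_data(2)[of L K])
      moreover have "norm (p s L - u s (ctr L)) \<le> \<eta>" by (rule pu[OF s' nbD(2)[OF n]])
      \<comment> \<open>One \<eta> belongs to the expansion of u; the second comes from exchanging u
        for p at the neighbour.\<close>
      moreover have "?r (p s L) = ?r (u s (ctr L)) + (p s L - u s (ctr L))" by simp
      then have "norm (?r (p s L)) \<le> norm (?r (u s (ctr L))) + norm (p s L - u s (ctr L))"
        using norm_triangle_ineq[of "?r (u s (ctr L))" "p s L - u s (ctr L)"] by (simp only:)
      ultimately show "norm (?r (p s L)) \<le> 8 * A * dst K L ^ 3 + 2 * \<eta>" by linarith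
    next
      fix K assume K: "K \<in> ?I"
      show "norm (F 2 0 s (ctr K)) \<le> A \<and> norm (F 1 1 s (ctr K)) \<le> A \<and> norm (F 0 2 s (ctr K)) \<le> A"
        using Fb s' K by simp
      show pA: "norm (p s K) \<le> A" using Fb s' K by (simp add: p_def)
      let ?N = "\<lambda>z. of_real (\<gamma> * (norm z)\<^sup>2) * z + of_real (V s (ctr K)) * z"
      have cK: "ctr K \<in> closure \<Omega>" by (rule cO[OF int_cellD(1)[OF K]])
      have pu': "norm (u s (ctr K) - p s K) \<le> \<eta>" using pu[OF s' int_cellD(1)[OF K]] by (simp add: norm_minus_commute)
      have "?N (u s (ctr K)) - ?N (p s K) = of_real \<gamma> * (of_real ((norm (u s (ctr K)))\<^sup>2) * u s (ctr K) - of_real ((norm (p s K))\<^sup>2) * p s K)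
          + of_real (V s (ctr K)) * (u s (ctr K) - p s K)" by (simp add: algebra_simps)
      then have "norm (?N (u s (ctr K)) - ?N (p s K)) \<le> norm (of_real \<gamma> * (of_real ((norm (u s (ctr K)))\<^sup>2) * u s (ctr K) - of_real ((norm (p s K))\<^sup>2) * p s K))
          + norm (of_real (V s (ctr K)) * (u s (ctr K) - p s K))" by (simp only: norm_triangle_ineq)
      also have "\<dots> \<le> \<gamma> * (3 * A\<^sup>2 * \<eta>) + B * \<eta>"
      proof (rule add_mono)
        have "norm (of_real ((norm (u s (ctr K)))\<^sup>2) * u s (ctr K) - of_real ((norm (p s K))\<^sup>2) * p s K) \<le> 3 * A\<^sup>2 * norm (u s (ctr K) - p s K)"
          by (rule cubic_Lipschitz) (use ub(1)[OF s' cK cK] pA in auto)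
        also have "\<dots> \<le> 3 * A\<^sup>2 * \<eta>" by (intro mult_left_mono pu') simp
        finally show "norm (of_real \<gamma> * (of_real ((norm (u s (ctr K)))\<^sup>2) * u s (ctr K) - of_real ((norm (p s K))\<^sup>2) * p s K)) \<le> \<gamma> * (3 * A\<^sup>2 * \<eta>)"
          using g by (simp only: norm_mult norm_of_real) (simp add: mult_left_mono)
        show "norm (of_real (V s (ctr K)) * (u s (ctr K) - p s K)) \<le> B * \<eta>"
          using Vb(1)[OF s' cK cK] pu' B0 by (simp only: norm_mult norm_of_real) (intro mult_mono; simp)
      qed
      finally have 1: "norm (gp_rhs \<gamma> (V s) (u s) (ctr K) - of_real (\<gamma> * (norm (p s K))\<^sup>2 + V s (ctr K)) * p s K) \<le> \<gamma> * (3 * A\<^sup>2 * \<eta>) + B * \<eta>"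
        by (simp add: gp_rhs_def distrib_right)
      have 2: "norm (\<i> * p' K + (F 2 0 s (ctr K) + F 0 2 s (ctr K)) - gp_rhs \<gamma> (V s) (u s) (ctr K)) \<le> \<eta>"
        using f'(2)[OF K] K by (simp add: p'_def)
      have "norm (\<i> * p' K + (F 2 0 s (ctr K) + F 0 2 s (ctr K)) - of_real (\<gamma> * (norm (p s K))\<^sup>2 + V s (ctr K)) * p s K)
        \<le> \<eta> + (\<gamma> * (3 * A\<^sup>2 * \<eta>) + B * \<eta>)"
        using norm_diff_triangle_le[OF 2 1] .
      also have "\<dots> \<le> h" using eta2 by (simp add: algebra_simps)
      finally show "norm (\<i> * p' K + (F 2 0 s (ctr K) + F 0 2 s (ctr K)) - of_real (\<gamma> * (norm (p s K))\<^sup>2 + V s (ctr K)) * p s K) \<le> mesh_size \<V>"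
        by (simp only: h_def)
    next
      fix K L assume "K \<in> ?I" "L \<in> ?I"
      then show "norm (F 2 0 s (ctr K) - F 2 0 s (ctr L)) \<le> 2 * A * dst K L \<and> norm (F 1 1 s (ctr K) - F 1 1 s (ctr L)) \<le> 2 * A * dst K L
          \<and> norm (F 0 2 s (ctr K) - F 0 2 s (ctr L)) \<le> 2 * A * dst K L"
        using Fl s' unfolding nd[symmetric] by simp
    next
      fix K assume "K \<in> ?X"
      then show "p s K = 0 \<and> w s K = 0 \<and> p' K = 0"
        using semidiscreteD(1)[OF w s'] by (simp add: p_def p'_def ext_cells_def)
    next
      show "2 * \<eta> * sum (wt K) (nbs K) \<le> mesh_size \<V> * area K" if "K \<in> cells \<V>" for K
        using eta3[OF that] by (simp add: h_def)
    qed (use A0 eta g E_bound[OF s'] in auto)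
    also have "\<dots> = (4 * \<gamma> * A\<^sup>2 + 8 * \<gamma> * A * sqrt E + (80 * A + 2) * h) * y s + b * h"
      by (simp add: y_def b_def source_const_def h_def \<mu>_def)
    also have "\<dots> \<le> a * y s + b * h"
      unfolding a_def growth_const_def using hD A0
      by (intro add_right_mono mult_right_mono add_left_mono mult_left_mono) (auto simp: y_def mass_nonneg)
    finally show "\<exists>y'. (y has_real_derivative y') (at s) \<and> y' \<le> a * y s + b * h" using dy by blast
  qed
  \<comment> \<open>The scheme starts from the values of u at the centers, so the initial error is
    at most \<eta>, and \<eta>^2 is at most h.\<close>
  moreover have "y 0 \<le> \<mu> * h"
    unfolding y_def mass_def \<mu>_def
  proof (rule sum_area_le)
    fix K assume K: "K \<in> cells \<V>"
    have "(norm (p 0 K - w 0 K))\<^sup>2 \<le> \<eta>\<^sup>2" using pu[OF T0 K] unfolding w0[OF K] by (intro power_mono) auto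
    then show "(norm (p 0 K - w 0 K))\<^sup>2 \<le> h" using eta5 by simp
  qed (use h0 in simp)
  moreover have "0 \<le> y 0" by (simp add: y_def mass_nonneg)
  moreover have "(y 0 + b * h / a) * exp (a * t) \<le> (\<mu> * h + b * h / a) * exp (a * T)"
    using calculation(2,3) t a0 b0 h0 by (intro mult_mono) auto
  moreover have "0 \<le> b * h / a" using a0 b0 h0 by simp
  ultimately have yt: "y t \<le> (\<mu> * h + b * h / a) * exp (a * T)" by linarith
  have "mass (\<lambda>K. u t (ctr K) - w t K) \<le> (\<Sum>K\<in>cells \<V>. area K * (2 * (norm (p t K - w t K))\<^sup>2 + 2 * h))"
    unfolding mass_def
  proof (intro sum_mono mult_left_mono area_nonneg)
    fix K assume K: "K \<in> cells \<V>"
    have "(norm (u t (ctr K) - w t K))\<^sup>2 \<le> 2 * (norm (p t K - w t K))\<^sup>2 + 2 * (norm (u t (ctr K) - p t K))\<^sup>2"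
      using norm_add_sq_le[of "p t K - w t K" "u t (ctr K) - p t K"] by simp
    moreover have "(norm (u t (ctr K) - p t K))\<^sup>2 \<le> \<eta>\<^sup>2"
      using pu[OF t K] by (intro power_mono) (auto simp: norm_minus_commute)
    ultimately show "(norm (u t (ctr K) - w t K))\<^sup>2 \<le> 2 * (norm (p t K - w t K))\<^sup>2 + 2 * h" using eta5 by linarith
  qed
  also have "\<dots> = 2 * y t + 2 * h * (\<Sum>K\<in>cells \<V>. area K)"
    unfolding y_def mass_def sum_distrib_left sum.distrib[symmetric] by (intro sum.cong refl) (simp add: algebra_simps)
  also have "\<dots> \<le> 2 * ((\<mu> * h + b * h / a) * exp (a * T)) + 2 * h * \<mu>"
    using yt sum_area h0 by (intro add_mono mult_left_mono) (auto simp: \<mu>_def)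
  also have "\<dots> = error_const \<gamma> T D \<mu> A B * h"
    by (simp add: error_const_def Let_def E_def[symmetric] a_def[symmetric] b_def[symmetric] algebra_simps)
  finally show ?thesis unfolding A_def B_def D_def \<mu>_def h_def .
qed

lemma discrete_norm_mass: "discrete_norm \<V> v = sqrt (mass v)"
  by (simp add: discrete_norm_def mass_def)

end

theorem theorem1:
  fixes \<gamma> :: real
  assumes "\<gamma> > 0"
  shows "\<exists>C :: real \<Rightarrow> plane set \<Rightarrow> real \<Rightarrow> real \<Rightarrow> real \<Rightarrow> real \<Rightarrow> real.
    (\<forall>T \<Omega> M\<^sub>u M\<^sub>V \<Theta> \<epsilon>. C T \<Omega> M\<^sub>u M\<^sub>V \<Theta> \<epsilon> > 0) \<and>
    (\<forall>T \<Omega> \<V> \<T> \<Theta> V u\<^sub>0 u u\<^sub>\<M> \<epsilon>.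
      T > 0 \<and>
      polygonal_domain \<Omega> \<and>
      admissible_mesh \<Omega> \<V> \<and> voronoi \<Omega> \<V> \<and> boundary_property \<Omega> \<V> \<and>
      dual_triangulation \<Omega> \<V> \<T> \<and> regular_mesh \<Omega> \<V> \<T> \<Theta> \<and>
      admissible_potential \<Omega> T V \<and>
      u\<^sub>0 \<in> sobolev 5 \<Omega> \<inter> sobolev_H10 \<Omega> \<and> continuous_on (closure \<Omega>) u\<^sub>0 \<and>
      gp_solution \<Omega> T \<gamma> V u\<^sub>0 u \<and>
      (\<forall>w. gp_solution \<Omega> T \<gamma> V u\<^sub>0 w \<longrightarrow> (\<forall>t\<in>{0..T}. \<forall>x\<in>closure \<Omega>. w t x = u t x)) \<and>
      semidiscrete_solution \<Omega> \<V> T \<gamma> V u\<^sub>0 u\<^sub>\<M> \<and>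
      \<epsilon> > 0 \<longrightarrow>
      (\<forall>t\<in>{0..T}.
        discrete_norm \<V> (\<lambda>K. cell_projection \<V> (u t) K - u\<^sub>\<M> t K)
          \<le> C T \<Omega> (sobolev_sup_norm 5 \<Omega> T u) (sobolev_sup_norm 3 \<Omega> T V) \<Theta> \<epsilon>
              * mesh_size \<V> powr (1/2 - \<epsilon>)))"
proof -
  \<comment> \<open>The parameters of the parallelogram condition are selected as a function of
    \<Omega> alone, so that C is fixed before the mesh, the potential and the solution.\<close>
  define P where "P \<Omega> q \<longleftrightarrow> parallelogram_condition \<Omega> (fst q) (snd q)" for \<Omega> q
  define S where "S \<Omega> = sobolev_const \<Omega> (fst (SOME q. P \<Omega> q)) (snd (SOME q. P \<Omega> q))" for \<Omega>
  define c where "c T \<Omega> M N = error_const \<gamma> T (diameter \<Omega>) (measure lebesgue \<Omega>) (S \<Omega> * M) (S \<Omega> * N)" for T \<Omega> M N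
  \<comment> \<open>The maximum with 1 makes C positive for all arguments, and the power of the
    diameter absorbs \<open>mesh_size \<V> powr \<epsilon>\<close>.\<close>
  define C where "C T \<Omega> M N (\<Theta>::real) \<epsilon> = max 1 (sqrt (c T \<Omega> M N) * diameter \<Omega> powr \<epsilon>)" for T \<Omega> M N \<Theta> \<epsilon>
  have main: "discrete_norm \<V> (\<lambda>K. cell_projection \<V> (u t) K - w t K)
      \<le> C T \<Omega> (sobolev_sup_norm 5 \<Omega> T u) (sobolev_sup_norm 3 \<Omega> T V) \<Theta> \<epsilon> * mesh_size \<V> powr (1/2 - \<epsilon>)"
    if T: "T > 0" and dom: "polygonal_domain \<Omega>" and mesh: "admissible_mesh \<Omega> \<V>" "voronoi \<Omega> \<V>" "boundary_property \<Omega> \<V>"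
      and V: "admissible_potential \<Omega> T V" and u: "gp_solution \<Omega> T \<gamma> V u0 u"
      and w: "semidiscrete_solution \<Omega> \<V> T \<gamma> V u0 w" and e: "\<epsilon> > 0" and t: "t \<in> {0..T}"
    for T \<Omega> \<V> \<Theta> V u0 u w \<epsilon> t
  proof -
    have O: "open \<Omega>" "bounded \<Omega>" "convex \<Omega>" "\<Omega> \<noteq> {}" using dom by (simp_all add: polygonal_domain_def)
    interpret voronoi_mesh \<Omega> \<V> by (intro voronoi_mesh.intro O mesh)
    obtain d \<delta> where "parallelogram_condition \<Omega> d \<delta>" using parallelogram_condition_convex[OF O(1,3,2,4)] by blast
    then have "P \<Omega> (d, \<delta>)" by (simp add: P_def)
    then have "P \<Omega> (SOME q. P \<Omega> q)" by (rule someI)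
    then have pc: "parallelogram_condition \<Omega> (fst (SOME q. P \<Omega> q)) (snd (SOME q. P \<Omega> q))" by (simp only: P_def)
    let ?c = "c T \<Omega> (sobolev_sup_norm 5 \<Omega> T u) (sobolev_sup_norm 3 \<Omega> T V)" and ?h = "mesh_size \<V>"
    have "mass (\<lambda>K. cell_projection \<V> (u t) K - w t K) \<le> ?c * ?h"
      using error_estimate[OF pc less_imp_le[OF assms] T V u w t] by (simp only: c_def S_def cell_projection_def)
    then have "discrete_norm \<V> (\<lambda>K. cell_projection \<V> (u t) K - w t K) \<le> sqrt (?c * ?h)"
      by (simp add: discrete_norm_mass)
    also have "\<dots> = sqrt ?c * ?h powr (1/2)" using mesh_size_pos by (simp add: real_sqrt_mult powr_half_sqrt)
    also have "?h powr (1/2) = ?h powr \<epsilon> * ?h powr (1/2 - \<epsilon>)" by (simp flip: powr_add)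
    also have "sqrt ?c * (?h powr \<epsilon> * ?h powr (1/2 - \<epsilon>)) \<le> C T \<Omega> (sobolev_sup_norm 5 \<Omega> T u) (sobolev_sup_norm 3 \<Omega> T V) \<Theta> \<epsilon> * ?h powr (1/2 - \<epsilon>)"
    proof -
      have "0 \<le> ?c * ?h" using order_trans[OF mass_nonneg \<open>mass _ \<le> _\<close>] .
      then have "0 \<le> ?c" using mesh_size_pos by (simp add: zero_le_mult_iff)
      moreover have "?h powr \<epsilon> \<le> diameter \<Omega> powr \<epsilon>"
        using mesh_size_pos mesh_size_le_diameter e by (intro powr_mono2) auto
      ultimately have "sqrt ?c * ?h powr \<epsilon> \<le> sqrt ?c * diameter \<Omega> powr \<epsilon>" by (intro mult_left_mono) auto
      also have "\<dots> \<le> C T \<Omega> (sobolev_sup_norm 5 \<Omega> T u) (sobolev_sup_norm 3 \<Omega> T V) \<Theta> \<epsilon>" by (simp add: C_def)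
      finally have "sqrt ?c * ?h powr \<epsilon> * ?h powr (1/2 - \<epsilon>) \<le> C T \<Omega> (sobolev_sup_norm 5 \<Omega> T u) (sobolev_sup_norm 3 \<Omega> T V) \<Theta> \<epsilon> * ?h powr (1/2 - \<epsilon>)"
        by (rule mult_right_mono) simp
      then show ?thesis by (simp only: mult.assoc)
    qed
    finally show ?thesis .
  qed
  show ?thesis
  proof (intro exI[of _ C] conjI allI impI ballI)
    show "0 < C T \<Omega> M\<^sub>u M\<^sub>V \<Theta> \<epsilon>" for T \<Omega> M\<^sub>u M\<^sub>V \<Theta> \<epsilon> by (simp add: C_def less_max_iff_disj)
  qed (elim conjE, rule main)
qed

end
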